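(* Let $\varphi$ be a modal formula. If $\varphi$ is not provable in the Gödel-Löb provability logic $\mathsf{GL}$, then there exists an arithmetical evaluation $f$ such that $\mathsf{PA}\nvdash f(\varphi)$.
   Context: **The logic $\mathsf{GL}$.** Modal formulas are built from propositional variables and the constants $\top$ (truth), $\bot$ (false) using the classical propositional connectives and the unary modal connective $\Box$; $\Diamond\varphi$ abbreviates $\lnot\Box\lnot\varphi$. The logic $\mathsf{GL}$ has the Hilbert-style deductive system with axiom schemes: all axiom schemes of classical propositional calculus; $\Box(\varphi\to\psi)\to(\Box\varphi\to\Box\psi)$; $\Box(\Box\varphi\to\varphi)\to\Box\varphi$; and rules: modus ponens (from $\varphi$ and $\varphi\to\psi$ infer $\psi$) and necessitation (from $\varphi$ infer $\Box\varphi$). **Arithmetization.** Syntactical expressions are identified with binary strings. A positive integer $n$ written in binary as $1a_{k-1}\ldots a_0$ encodes the binary string $a_{k-1}\ldots a_0$; the number encoding a formula $\mathsf{F}$ is the Gödel number of $\mathsf{F}$. Efficient numerals are defined by: $\underline{0}$ is the term $0$; $\underline{1}$ is the term $1$; $\underline{2n}$ is the term $(1+1)\cdot\underline{n}$ and $\underline{2n+1}$ is the term $(1+1)\cdot\underline{n}+1$ (for $n\ge 1$). For an arithmetical formula $\mathsf{F}$ with Gödel number $n$, $\ulcorner\mathsf{F}\urcorner$ denotes $\underline{n}$. A proof of a formula in a theory $\mathsf{T}$ is a list of arithmetical formulas that ends with this formula and in which each formula is an axiom of $\mathsf{T}$, or an axiom of predicate calculus, or is obtained by inference rules from previous formulas.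 $\mathsf{PA}$ is axiomatized by the axioms of Robinson arithmetic $\mathsf{Q}$ and the induction schema. $\mathsf{Prf}(x,y)$ is the natural $\Delta_0$-formalization of "$x$ is a proof in $\mathsf{PA}$ of the formula with Gödel number $y$", and $\mathsf{Prv}(y)$ is the $\Sigma_1$-formula $\exists x\,\mathsf{Prf}(x,y)$. **Arithmetical evaluations.** An arithmetical evaluation is a function $f$ from modal formulas to sentences of the language of first-order arithmetic such that: $f(\varphi\land\psi)$ is $f(\varphi)\land f(\psi)$; $f(\varphi\lor\psi)$ is $f(\varphi)\lor f(\psi)$; $f(\lnot\varphi)$ is $\lnot f(\varphi)$; $f(\varphi\to\psi)$ is $f(\varphi)\to f(\psi)$; $f(\top)$ is $0=0$; $f(\bot)$ is $0=1$; $f(\Box\varphi)$ is $\mathsf{Prv}(\ulcorner f(\varphi)\urcorner)$. (So $f$ is uniquely determined by its values on propositional variables, which may be arbitrary arithmetical sentences.) *)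

theory Defs
  imports "HOL-Library.Sublist"
begin

section \<open>Modal formulas and the logic GL\<close>

datatype mform =
    MVar nat
  | MTop
  | MBot
  | MNeg mform
  | MAnd mform mform
  | MOr mform mform
  | MImp mform mform
  | MBox mform

abbreviation MDia :: "mform \<Rightarrow> mform" where
  "MDia A \<equiv> MNeg (MBox (MNeg A))"

inductive GL :: "mform \<Rightarrow> bool" where
  C1: "GL (MImp A (MImp B A))"
| C2: "GL (MImp (MImp A (MImp B C)) (MImp (MImp A B) (MImp A C)))"
| C3: "GL (MImp (MAnd A B) A)"
| C4: "GL (MImp (MAnd A B) B)"
| C5: "GL (MImp A (MImp B (MAnd A B)))"
| C6: "GL (MImp A (MOr A B))"
| C7: "GL (MImp B (MOr A B))"
| C8: "GL (MImp (MImp A C) (MImp (MImp B C) (MImp (MOr A B) C)))"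
| C9: "GL (MImp (MImp A B) (MImp (MImp A (MNeg B)) (MNeg A)))"
| C10: "GL (MImp (MNeg (MNeg A)) A)"
| C11: "GL MTop"
| C12: "GL (MImp MBot A)"
| K: "GL (MImp (MBox (MImp A B)) (MImp (MBox A) (MBox B)))"
| L: "GL (MImp (MBox (MImp (MBox A) A)) (MBox A))"
| MP: "GL A \<Longrightarrow> GL (MImp A B) \<Longrightarrow> GL B"
| Nec: "GL A \<Longrightarrow> GL (MBox A)"


section \<open>The language of first-order arithmetic\<close>

datatype tm = Var nat | Zero | One | Plus tm tm | Times tm tm

datatype fm = Eq tm tm | Neg fm | Imp fm fm | All nat fm

definition Con :: "fm \<Rightarrow> fm \<Rightarrow> fm" where
  "Con F G = Neg (Imp F (Neg G))"

definition Dis :: "fm \<Rightarrow> fm \<Rightarrow> fm" where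
  "Dis F G = Imp (Neg F) G"

definition Ex :: "nat \<Rightarrow> fm \<Rightarrow> fm" where
  "Ex x F = Neg (All x (Neg F))"

primrec tm_vars :: "tm \<Rightarrow> nat set" where
  "tm_vars (Var x) = {x}"
| "tm_vars Zero = {}"
| "tm_vars One = {}"
| "tm_vars (Plus s t) = tm_vars s \<union> tm_vars t"
| "tm_vars (Times s t) = tm_vars s \<union> tm_vars t"

text \<open>All variables that occur, free or bound or directly after a quantifier.\<close>

primrec fm_vars :: "fm \<Rightarrow> nat set" where
  "fm_vars (Eq s t) = tm_vars s \<union> tm_vars t"
| "fm_vars (Neg F) = fm_vars F"
| "fm_vars (Imp F G) = fm_vars F \<union> fm_vars G"
| "fm_vars (All x F) = insert x (fm_vars F)"

primrec free_vars :: "fm \<Rightarrow> nat set" where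
  "free_vars (Eq s t) = tm_vars s \<union> tm_vars t"
| "free_vars (Neg F) = free_vars F"
| "free_vars (Imp F G) = free_vars F \<union> free_vars G"
| "free_vars (All x F) = free_vars F - {x}"

definition sentence :: "fm \<Rightarrow> bool" where
  "sentence F \<longleftrightarrow> free_vars F = {}"

primrec tm_subst :: "nat \<Rightarrow> tm \<Rightarrow> tm \<Rightarrow> tm" where
  "tm_subst x t (Var y) = (if y = x then t else Var y)"
| "tm_subst x t Zero = Zero"
| "tm_subst x t One = One"
| "tm_subst x t (Plus r s) = Plus (tm_subst x t r) (tm_subst x t s)"
| "tm_subst x t (Times r s) = Times (tm_subst x t r) (tm_subst x t s)"

text \<open>Bound variables are not renamed; in all uses below no variable is captured.\<close>

primrec fm_subst :: "nat \<Rightarrow> tm \<Rightarrow> fm \<Rightarrow> fm" where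
  "fm_subst x t (Eq r s) = Eq (tm_subst x t r) (tm_subst x t s)"
| "fm_subst x t (Neg F) = Neg (fm_subst x t F)"
| "fm_subst x t (Imp F G) = Imp (fm_subst x t F) (fm_subst x t G)"
| "fm_subst x t (All y F) = (if y = x then All y F else All y (fm_subst x t F))"


section \<open>Peano arithmetic\<close>

text \<open>
  Predicate calculus with equality in the style of Tarski, Kalish--Montague and Monk: the rules are
  modus ponens and generalization, and no axiom mentions substitution, which makes the proof predicate
  below easy to write down.
\<close>

inductive logic_axiom :: "fm \<Rightarrow> bool" where
  "logic_axiom (Imp F (Imp G F))"
| "logic_axiom (Imp (Imp F (Imp G H)) (Imp (Imp F G) (Imp F H)))"
| "logic_axiom (Imp (Imp (Neg F) (Neg G)) (Imp G F))"
| "logic_axiom (Imp (All x (Imp F G)) (Imp (All x F) (All x G)))"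
| "logic_axiom (Imp (All x F) F)"
| "x \<notin> fm_vars F \<Longrightarrow> logic_axiom (Imp F (All x F))"
| "x \<notin> tm_vars t \<Longrightarrow> logic_axiom (Neg (All x (Neg (Eq (Var x) t))))"
| "logic_axiom (Eq t t)"
| "logic_axiom (Imp (Eq s t) (Imp (Eq s r) (Eq t r)))"
| "logic_axiom (Imp (Eq s t) (Imp (Eq s' t') (Eq (Plus s s') (Plus t t'))))"
| "logic_axiom (Imp (Eq s t) (Imp (Eq s' t') (Eq (Times s s') (Times t t'))))"

text \<open>Robinson arithmetic; the successor of \<open>x\<close> is \<open>x + 1\<close>.\<close>

definition Q_axioms :: "fm list" where
  "Q_axioms =
    [All 0 (Neg (Eq (Plus (Var 0) One) Zero)),
     All 0 (All 1 (Imp (Eq (Plus (Var 0) One) (Plus (Var 1) One)) (Eq (Var 0) (Var 1)))),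
     All 0 (Imp (Neg (Eq (Var 0) Zero)) (Ex 1 (Eq (Var 0) (Plus (Var 1) One)))),
     All 0 (Eq (Plus (Var 0) Zero) (Var 0)),
     All 0 (All 1 (Eq (Plus (Var 0) (Plus (Var 1) One)) (Plus (Plus (Var 0) (Var 1)) One))),
     All 0 (Eq (Times (Var 0) Zero) Zero),
     All 0 (All 1 (Eq (Times (Var 0) (Plus (Var 1) One)) (Plus (Times (Var 0) (Var 1)) (Var 0))))]"

text \<open>
  The induction axiom \<open>F(0) \<longrightarrow> \<forall>x (F(x) \<longrightarrow> F(x + 1)) \<longrightarrow> \<forall>x F(x)\<close>.  As in Smullyan's presentation
  of PA, \<open>F(0)\<close> is written \<open>\<forall>x (x = 0 \<longrightarrow> F)\<close>, and \<open>F(x + 1)\<close> is written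
  \<open>\<forall>y (y = x + 1 \<longrightarrow> \<forall>x (x = y \<longrightarrow> F))\<close> with \<open>y\<close> a variable that does not occur in \<open>F\<close>.
\<close>

definition induction_axiom :: "nat \<Rightarrow> nat \<Rightarrow> fm \<Rightarrow> fm" where
  "induction_axiom x y F =
    Imp (All x (Imp (Eq (Var x) Zero) F))
   (Imp (All x (Imp F (All y (Imp (Eq (Var y) (Plus (Var x) One))
                                  (All x (Imp (Eq (Var x) (Var y)) F))))))
        (All x F))"

definition PA_axiom :: "fm \<Rightarrow> bool" where
  "PA_axiom F \<longleftrightarrow> F \<in> set Q_axioms \<or>
     (\<exists>x y G. x \<noteq> y \<and> y \<notin> fm_vars G \<and> F = induction_axiom x y G)"

definition PA_proof :: "fm list \<Rightarrow> fm \<Rightarrow> bool" where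
  "PA_proof Fs F \<longleftrightarrow> Fs \<noteq> [] \<and> last Fs = F \<and>
     (\<forall>i < length Fs.
        logic_axiom (Fs ! i) \<or> PA_axiom (Fs ! i) \<or>
        (\<exists>j < i. \<exists>k < i. Fs ! j = Imp (Fs ! k) (Fs ! i)) \<or>
        (\<exists>j < i. \<exists>x. Fs ! i = All x (Fs ! j)))"

definition PA_provable :: "fm \<Rightarrow> bool" where
  "PA_provable F \<longleftrightarrow> (\<exists>Fs. PA_proof Fs F)"


primrec bound_vars :: "fm \<Rightarrow> nat set" where
  "bound_vars (Eq s t) = {}"
| "bound_vars (Neg F) = bound_vars F"
| "bound_vars (Imp F G) = bound_vars F \<union> bound_vars G"
| "bound_vars (All x F) = insert x (bound_vars F)"

text \<open>
  \<open>PA_induction\<close> below confirms that the axioms yield induction with genuine substitution (up to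
  renaming \<open>x\<close> where it is also bound in \<open>F\<close>).
\<close>

context
begin

lemma PA_ax: "logic_axiom F \<or> PA_axiom F \<Longrightarrow> PA_provable F"
  unfolding PA_provable_def PA_proof_def by (rule exI[of _ "[F]"]) auto

private definition ok :: "fm list \<Rightarrow> nat \<Rightarrow> bool" where
  "ok Fs i \<longleftrightarrow> logic_axiom (Fs ! i) \<or> PA_axiom (Fs ! i) \<or>
        (\<exists>j < i. \<exists>k < i. Fs ! j = Imp (Fs ! k) (Fs ! i)) \<or> (\<exists>j < i. \<exists>x. Fs ! i = All x (Fs ! j))"

private lemma ok_shift: assumes "ok Fs i" "\<And>j. j \<le> i \<Longrightarrow> Hs ! (a + j) = Fs ! j" shows "ok Hs (a + i)"
proof -
  have i: "Hs ! (a + i) = Fs ! i" using assms(2) by simp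
  from assms(1) consider "logic_axiom (Fs ! i) \<or> PA_axiom (Fs ! i)" | j k where "j < i" "k < i" "Fs ! j = Imp (Fs ! k) (Fs ! i)"
    | j x where "j < i" "Fs ! i = All x (Fs ! j)" unfolding ok_def by blast
  then show ?thesis
  proof cases
    case 1 then show ?thesis unfolding ok_def i by blast
  next
    case (2 j k)
    then have "Hs ! (a + j) = Imp (Hs ! (a + k)) (Hs ! (a + i))" "a + j < a + i" "a + k < a + i" using assms(2) by simp_all
    then show ?thesis unfolding ok_def by blast
  next
    case (3 j x)
    then have "Hs ! (a + i) = All x (Hs ! (a + j))" "a + j < a + i" using assms(2) by simp_all
    then show ?thesis unfolding ok_def by blast
  qed
qed

private lemma PA_proof_append:
  assumes F: "PA_proof Fs F" and G: "PA_proof Gs G"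
    and H: "G = Imp F H \<or> (\<exists>x. H = All x F)"
  shows "PA_proof (Fs @ Gs @ [H]) H"
proof -
  let ?Hs = "Fs @ Gs @ [H]"
  have F': "Fs \<noteq> []" "last Fs = F" "\<And>i. i < length Fs \<Longrightarrow> ok Fs i"
    and G': "Gs \<noteq> []" "last Gs = G" "\<And>i. i < length Gs \<Longrightarrow> ok Gs i"
    using F G unfolding PA_proof_def ok_def by blast+
  have "ok ?Hs i" if "i < length ?Hs" for i
  proof -
    have "i < length Fs \<or> (\<not> i < length Fs \<and> i - length Fs < length Gs) \<or> i = length Fs + length Gs"
      using that by simp linarith
    then consider "i < length Fs" | "\<not> i < length Fs" "i - length Fs < length Gs" | "i = length Fs + length Gs"
      by blast
    then show ?thesis
    proof cases
      case 1
      then show ?thesis using ok_shift[OF F'(3), of i ?Hs 0] by (simp add: nth_append)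
    next
      case 2
      then show ?thesis using ok_shift[OF G'(3), of "i - length Fs" ?Hs "length Fs"] by (simp add: nth_append)
    next
      case 3
      have l: "length Fs > 0" "length Gs > 0" using F' G' by simp_all
      have "?Hs ! i = H" using 3 by (simp add: nth_append)
      moreover have "length Fs - 1 < i" "length Fs + (length Gs - 1) < i" using 3 l by linarith+
      moreover have "?Hs ! (length Fs - 1) = F" using 3 F'(1,2) l by (simp add: nth_append last_conv_nth)
      moreover have "?Hs ! (length Fs + (length Gs - 1)) = G"
        using 3 G'(1,2) l by (simp add: nth_append last_conv_nth)
      ultimately show ?thesis using H unfolding ok_def by metis
    qed
  qed
  then show ?thesis unfolding PA_proof_def ok_def by simp
qed

lemma PA_MP: "PA_provable F \<Longrightarrow> PA_provable (Imp F G) \<Longrightarrow> PA_provable G"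
  unfolding PA_provable_def using PA_proof_append by blast
lemma PA_Gen: "PA_provable F \<Longrightarrow> PA_provable (All x F)"
  unfolding PA_provable_def using PA_proof_append by blast

private abbreviation "P \<equiv> PA_provable"
private lemma A1: "P (Imp F (Imp G F))" and A2: "P (Imp (Imp F (Imp G H)) (Imp (Imp F G) (Imp F H)))"
  and A3: "P (Imp (Imp (Neg F) (Neg G)) (Imp G F))"
  and AD: "P (Imp (All x (Imp F G)) (Imp (All x F) (All x G)))" and AS: "P (Imp (All x F) F)"
  and AV: "x \<notin> fm_vars F \<Longrightarrow> P (Imp F (All x F))"
  and ER: "P (Eq t t)" and ES: "P (Imp (Eq s t) (Imp (Eq s r) (Eq t r)))"
  and EP: "P (Imp (Eq s t) (Imp (Eq s' t') (Eq (Plus s s') (Plus t t'))))"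
  and ET: "P (Imp (Eq s t) (Imp (Eq s' t') (Eq (Times s s') (Times t t'))))"
  by (auto intro!: PA_ax logic_axiom.intros)

private lemma w: "P F \<Longrightarrow> P (Imp H F)" using A1 PA_MP by blast
private lemma m: "P (Imp H (Imp F G)) \<Longrightarrow> P (Imp H F) \<Longrightarrow> P (Imp H G)" using A2 PA_MP by blast
private lemma refl': "P (Imp F F)" using m[OF A1 A1] .
private lemma tr: "P (Imp F G) \<Longrightarrow> P (Imp G H) \<Longrightarrow> P (Imp F H)" using m w by blast
private lemma sw: "P (Imp F (Imp G H)) \<Longrightarrow> P (Imp G (Imp F H))" using tr[OF A1] A2 PA_MP by blast
private lemma tr': "P (Imp (Imp F G) (Imp (Imp G H) (Imp F H)))"
  by (rule sw) (rule tr[OF A1 A2])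
private lemma efq: "P (Imp (Neg F) (Imp F G))" by (rule tr[OF A1 A3])
private lemma dn: "P (Imp (Neg (Neg F)) F)"
proof -
  have "P (Imp (Neg (Neg F)) (Imp (Neg F) (Neg (Neg (Neg F)))))" by (rule efq)
  then have "P (Imp (Neg (Neg F)) (Imp (Neg (Neg F)) F))" using A3 tr by blast
  then show ?thesis using m refl' by blast
qed
private lemma dn': "P (Imp F (Neg (Neg F)))" using dn A3 PA_MP by blast
private lemma cp: "P (Imp (Imp F G) (Imp (Neg G) (Neg F)))"
proof -
  have 1: "P (Imp (Imp F G) (Imp (Neg (Neg F)) G))" using tr'[of "Neg (Neg F)" F G] dn PA_MP by blast
  have "P (Imp (Imp (Neg (Neg F)) G) (Imp (Neg (Neg F)) (Neg (Neg G))))"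
    using sw[OF tr'[of "Neg (Neg F)" G "Neg (Neg G)"]] dn' PA_MP by blast
  then show ?thesis using 1 A3 tr by blast
qed
private lemma mono: "P (Imp F G) \<Longrightarrow> P (Imp (All x F) (All x G))" using PA_Gen AD PA_MP by blast
private lemma intro_all: "P (Imp F G) \<Longrightarrow> x \<notin> fm_vars F \<Longrightarrow> P (Imp F (All x G))" using mono AV tr by blast
private lemma sym: "P (Imp H (Eq s t)) \<Longrightarrow> P (Imp H (Eq t s))"
  using m[OF m[OF w[OF ES[of s t s]]] w[OF ER[of s]]] .
private lemma app: "P (Imp H (Imp F G)) \<Longrightarrow> P (Imp H (Imp G K)) \<Longrightarrow> P (Imp H (Imp F K))"
  using m[OF m[OF w[OF tr']]] .

private lemma subst_tm_eq: "P (Imp (Eq (Var x) t) (Eq s (tm_subst x t s)))"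
proof (induction s)
  case (Plus r s) then show ?case using m[OF m[OF w[OF EP]]] by simp
next
  case (Times r s) then show ?case using m[OF m[OF w[OF ET]]] by simp
qed (auto intro: w ER refl')

private lemma eq_step: "P (Imp H (Eq r r')) \<Longrightarrow> P (Imp H (Eq s s')) \<Longrightarrow> P (Imp H (Imp (Eq r s) (Eq r' s')))"
proof -
  assume a: "P (Imp H (Eq r r'))" "P (Imp H (Eq s s'))"
  have 1: "P (Imp H (Imp (Eq r s) (Eq r' s)))" using m[OF w[OF ES] a(1)] .
  have sy: "P (Imp (Eq u v) (Eq v u))" for u v using sym[OF refl'] .
  have 2: "P (Imp H (Imp (Eq s r') (Eq s' r')))" using m[OF w[OF ES] a(2)] .
  show ?thesis using app[OF app[OF 1 w[OF sy]] app[OF 2 w[OF sy]]] .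
qed

private lemma subst_fm:
  assumes "bound_vars F \<inter> insert x (tm_vars t) = {}"
  shows "P (Imp (Eq (Var x) t) (Imp F (fm_subst x t F))) \<and> P (Imp (Eq (Var x) t) (Imp (fm_subst x t F) F))"
  using assms
proof (induction F)
  case (Eq r s)
  show ?case using eq_step[OF subst_tm_eq subst_tm_eq] eq_step[OF sym[OF subst_tm_eq] sym[OF subst_tm_eq]] by simp
next
  case (Neg F)
  then show ?case using m[OF w[OF cp]] by simp
next
  case (Imp F G)
  let ?H = "Eq (Var x) t"
  have go: "P (Imp ?H (Imp (Imp A B) (Imp A' B')))" if a: "P (Imp ?H (Imp A' A))" "P (Imp ?H (Imp B B'))" for A A' B B'
  proof -
    have 1: "P (Imp ?H (Imp (Imp A B) (Imp A' B)))" using m[OF w[OF tr'] a(1)] .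
    have "P (Imp (Imp B B') (Imp (Imp A' B) (Imp A' B')))" using sw[OF tr'] .
    then show ?thesis using app[OF 1 m[OF w a(2)]] by blast
  qed
  show ?case using Imp go by (simp add: Int_Un_distrib2)
next
  case (All y F)
  let ?H = "Eq (Var x) t"
  have y: "y \<noteq> x" "y \<notin> fm_vars ?H" using All.prems by auto
  have go: "P (Imp ?H (Imp (All y A) (All y B)))" if "P (Imp ?H (Imp A B))" for A B
    using tr[OF intro_all[OF that y(2)] AD] .
  show ?case using All go y by auto
qed

private lemma tm_subst_vars: "tm_vars (tm_subst x t s) \<subseteq> (tm_vars s - {x}) \<union> tm_vars t" by (induction s) auto
private lemma fm_subst_vars: "x \<notin> bound_vars F \<Longrightarrow> fm_vars (fm_subst x t F) \<subseteq> (fm_vars F - {x}) \<union> tm_vars t"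
proof (induction F)
  case (Eq r s) then show ?case using tm_subst_vars[of x t r] tm_subst_vars[of x t s] by auto
qed auto
private lemma bound_subst: "bound_vars (fm_subst x t F) = bound_vars F" by (induction F) auto
private lemma bound_sub_vars: "bound_vars F \<subseteq> fm_vars F" by (induction F) auto
private lemma tm_subst_subst: "y \<notin> tm_vars s \<Longrightarrow> tm_subst y t (tm_subst x (Var y) s) = tm_subst x t s" by (induction s) auto
private lemma tm_subst_id: "y \<notin> tm_vars s \<Longrightarrow> tm_subst y t s = s" by (induction s) auto
private lemma fm_subst_subst: "y \<notin> fm_vars F \<Longrightarrow> x \<notin> bound_vars F \<Longrightarrow> fm_subst y t (fm_subst x (Var y) F) = fm_subst x t F"
  by (induction F) (auto simp: tm_subst_subst)
private lemma finite_tm_vars: "finite (tm_vars t)" by (induction t) auto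
private lemma finite_fm_vars: "finite (fm_vars F)" by (induction F) (auto simp: finite_tm_vars)

lemma PA_induction:
  assumes x: "x \<notin> bound_vars F"
  shows "PA_provable (Imp (fm_subst x Zero F)
    (Imp (All x (Imp F (fm_subst x (Plus (Var x) One) F))) (All x F)))"
proof -
  obtain y where y: "y \<notin> insert x (fm_vars F)" using ex_new_if_finite[OF infinite_UNIV_nat] finite_fm_vars by (metis finite_insert)
  let ?F0 = "fm_subst x Zero F" and ?F1 = "fm_subst x (Plus (Var x) One) F" and ?G = "fm_subst x (Var y) F"
  let ?B = "All y (Imp (Eq (Var y) (Plus (Var x) One)) (All x (Imp (Eq (Var x) (Var y)) F)))"
  have yb: "y \<notin> bound_vars F" using y bound_sub_vars by auto
  have 0: "P (Imp ?F0 (All x (Imp (Eq (Var x) Zero) F)))"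
  proof (rule intro_all)
    show "P (Imp ?F0 (Imp (Eq (Var x) Zero) F))" using subst_fm[of F x Zero] x sw by simp
    show "x \<notin> fm_vars ?F0" using fm_subst_vars[OF x, of Zero] by auto
  qed
  have G: "P (Imp ?G (All x (Imp (Eq (Var x) (Var y)) F)))"
  proof (rule intro_all)
    show "P (Imp ?G (Imp (Eq (Var x) (Var y)) F))" using subst_fm[of F x "Var y"] x yb sw by simp
    show "x \<notin> fm_vars ?G" using fm_subst_vars[OF x, of "Var y"] y by auto
  qed
  have 1: "P (Imp ?F1 ?B)"
  proof (rule intro_all)
    have "P (Imp (Eq (Var y) (Plus (Var x) One)) (Imp (fm_subst y (Plus (Var x) One) ?G) ?G))"
      using subst_fm[of ?G y "Plus (Var x) One"] x yb by (simp add: bound_subst)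
    then have "P (Imp ?F1 (Imp (Eq (Var y) (Plus (Var x) One)) ?G))" using y x by (simp add: fm_subst_subst sw)
    then show "P (Imp ?F1 (Imp (Eq (Var y) (Plus (Var x) One)) (All x (Imp (Eq (Var x) (Var y)) F))))"
      using app w G by blast
    show "y \<notin> fm_vars ?F1" using fm_subst_vars[OF x, of "Plus (Var x) One"] y by auto
  qed
  have 2: "P (Imp (All x (Imp F ?F1)) (All x (Imp F ?B)))"
    by (rule mono) (use sw[OF tr'] 1 PA_MP in blast)
  have "PA_axiom (induction_axiom x y F)" unfolding PA_axiom_def
    by (rule disjI2, rule exI[of _ x], rule exI[of _ y], rule exI[of _ F]) (use y in simp)
  then have "P (induction_axiom x y F)" using PA_ax by blast
  then have "P (Imp ?F0 (Imp (All x (Imp F ?B)) (All x F)))" using tr[OF 0] unfolding induction_axiom_def by blast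
  then show ?thesis using app[OF w[OF 2]] by blast
qed

end


section \<open>Binary strings and Goedel numbers\<close>

text \<open>The number with binary notation \<open>1w\<close> encodes the string \<open>w\<close>.\<close>

definition code :: "bool list \<Rightarrow> nat" where
  "code w = foldl (\<lambda>n b. 2 * n + of_bool b) 1 w"

abbreviation ones :: "nat \<Rightarrow> bool list" where
  "ones k \<equiv> replicate k True"

text \<open>
  A list \<open>[w\<^sub>1, \<dots>, w\<^sub>n]\<close> of strings, each of which begins and ends with the bit 0, is identified with
  the string \<open>0 1\<^sup>k w\<^sub>1 1\<^sup>k w\<^sub>2 1\<^sup>k \<dots> 1\<^sup>k w\<^sub>n 1\<^sup>k 0\<close>, where \<open>k\<close> is least such that \<open>1\<^sup>k\<close> is a factor of
  no \<open>w\<^sub>i\<close>.  The result again begins and ends with 0.  Terms, formulas and proofs are all nested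
  lists of this kind.  The nesting can be read off locally, without counting brackets (the factor 00
  occurs only in tags), and this is what makes it easy to say in a bounded formula that a string is a
  formula.
\<close>

definition sep_length :: "bool list list \<Rightarrow> nat" where
  "sep_length ws = (LEAST k. \<forall>w \<in> set ws. \<not> sublist (ones k) w)"

definition enc :: "bool list list \<Rightarrow> bool list" where
  "enc ws = (let s = ones (sep_length ws) in
     [False] @ s @ concat (map (\<lambda>w. w @ s) ws) @ [False])"

definition tag :: "nat \<Rightarrow> bool list" where
  "tag j = replicate (j + 2) False"

definition index :: "nat \<Rightarrow> bool list" where
  "index i = [False] @ ones (Suc i) @ [False]"

primrec tm_string :: "tm \<Rightarrow> bool list" where
  "tm_string (Var i) = enc [tag 0, index i]"
| "tm_string Zero = enc [tag 1]"
| "tm_string One = enc [tag 2]"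
| "tm_string (Plus s t) = enc [tag 3, tm_string s, tm_string t]"
| "tm_string (Times s t) = enc [tag 4, tm_string s, tm_string t]"

primrec fm_string :: "fm \<Rightarrow> bool list" where
  "fm_string (Eq s t) = enc [tag 5, tm_string s, tm_string t]"
| "fm_string (Neg F) = enc [tag 6, fm_string F]"
| "fm_string (Imp F G) = enc [tag 7, fm_string F, fm_string G]"
| "fm_string (All x F) = enc [tag 8, tm_string (Var x), fm_string F]"

definition proof_string :: "fm list \<Rightarrow> bool list" where
  "proof_string Fs = enc (map fm_string Fs)"

definition goedel_number :: "fm \<Rightarrow> nat" where
  "goedel_number F = code (fm_string F)"

fun numeral_tm :: "nat \<Rightarrow> tm" where
  "numeral_tm n =
    (if n = 0 then Zero else if n = 1 then One
     else if even n then Times (Plus One One) (numeral_tm (n div 2))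
     else Plus (Times (Plus One One) (numeral_tm (n div 2))) One)"

declare numeral_tm.simps [simp del]

definition quot :: "fm \<Rightarrow> tm" where
  "quot F = numeral_tm (goedel_number F)"


section \<open>The proof predicate\<close>

text \<open>
  The formulas below are built with a counter \<open>k\<close> that exceeds all variables of the term arguments;
  a quantifier binds the variable \<open>k\<close> and passes \<open>Suc k\<close> on to its body.
  All quantifiers are bounded; \<open>s \<le> t\<close> abbreviates \<open>\<exists>z. z + s = t\<close>.
\<close>

primrec fresh :: "tm \<Rightarrow> nat" where
  "fresh (Var x) = Suc x"
| "fresh Zero = 0"
| "fresh One = 0"
| "fresh (Plus s t) = max (fresh s) (fresh t)"
| "fresh (Times s t) = max (fresh s) (fresh t)"

definition Leq :: "tm \<Rightarrow> tm \<Rightarrow> fm" where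
  "Leq s t = (let z = max (fresh s) (fresh t) in Ex z (Eq (Plus (Var z) s) t))"

definition BAll :: "nat \<Rightarrow> tm \<Rightarrow> (tm \<Rightarrow> nat \<Rightarrow> fm) \<Rightarrow> fm" where
  "BAll k t B = All k (Imp (Leq (Var k) t) (B (Var k) (Suc k)))"

definition BEx :: "nat \<Rightarrow> tm \<Rightarrow> (tm \<Rightarrow> nat \<Rightarrow> fm) \<Rightarrow> fm" where
  "BEx k t B = Neg (BAll k t (\<lambda>x k. Neg (B x k)))"

fun conjs :: "fm list \<Rightarrow> fm" where
  "conjs [] = Eq Zero Zero"
| "conjs [F] = F"
| "conjs (F # Fs) = Con F (conjs Fs)"

fun disjs :: "fm list \<Rightarrow> fm" where
  "disjs [] = Eq Zero One"
| "disjs [F] = F"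
| "disjs (F # Fs) = Dis F (disjs Fs)"

text \<open>\<open>t\<close> is a power of two: all divisors of \<open>t\<close> other than 1 are even.\<close>

definition pow2_fm :: "nat \<Rightarrow> tm \<Rightarrow> fm" where
  "pow2_fm k t = Con (Neg (Eq t Zero))
     (BAll k t (\<lambda>d k. BAll k t (\<lambda>e k. Imp (Eq (Times d e) t)
        (Dis (Eq d One) (BEx k d (\<lambda>c k. Eq d (Plus c c)))))))"

text \<open>
  The string \<open>z\<close> is the concatenation of \<open>x\<close> and \<open>y\<close>: if \<open>y = 2\<^sup>l + d\<close> with \<open>d < 2\<^sup>l\<close>, then
  \<open>z = x \<cdot> 2\<^sup>l + d\<close>.
\<close>

definition cat_fm :: "nat \<Rightarrow> tm \<Rightarrow> tm \<Rightarrow> tm \<Rightarrow> fm" where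
  "cat_fm k x y z = Con (Neg (Eq x Zero))
     (BEx k y (\<lambda>p k. BEx k p (\<lambda>d k. conjs
        [pow2_fm k p, Neg (Eq d p), Eq y (Plus p d), Eq z (Plus (Times x p) d)])))"

fun cats_fm :: "nat \<Rightarrow> tm list \<Rightarrow> tm \<Rightarrow> fm" where
  "cats_fm k [] z = Eq z One"
| "cats_fm k (t # ts) z = BEx k z (\<lambda>r k. Con (cats_fm k ts r) (cat_fm k t r z))"

definition factor_fm :: "nat \<Rightarrow> tm \<Rightarrow> tm \<Rightarrow> fm" where
  "factor_fm k u x = BEx k x (\<lambda>p k. BEx k x (\<lambda>q k. cats_fm k [p, u, q] x))"

definition const :: "bool list \<Rightarrow> tm" where
  "const w = numeral_tm (code w)"

text \<open>\<open>s\<close> is a string \<open>1\<^sup>l\<close> with \<open>l > 0\<close> and \<open>s'\<close> is \<open>1\<^sup>l\<^sup>-\<^sup>1\<close>.\<close>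

definition ones_fm :: "nat \<Rightarrow> tm \<Rightarrow> tm \<Rightarrow> fm" where
  "ones_fm k s s' = conjs
     [pow2_fm k (Plus s One), Neg (Eq s' Zero), Eq s (Plus (Plus s' s') One)]"

primrec separated :: "tm \<Rightarrow> tm list \<Rightarrow> tm list" where
  "separated s [] = [const [False]]"
| "separated s (t # ts) = t # s # separated s ts"

text \<open>\<open>z\<close> is \<open>enc\<close> of the list \<open>ts\<close> (of a fixed length).\<close>

definition enc_fm :: "nat \<Rightarrow> tm \<Rightarrow> tm list \<Rightarrow> fm" where
  "enc_fm k z ts = BEx k z (\<lambda>s k. BEx k s (\<lambda>s' k. conjs
     [ones_fm k s s',
      cats_fm k (const [False] # s # separated s ts) z,
      conjs (map (\<lambda>t. Neg (factor_fm k s t)) ts),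
      disjs (map (\<lambda>t. factor_fm k s' t) ts)]))"

definition node0_fm :: "nat \<Rightarrow> nat \<Rightarrow> tm \<Rightarrow> fm" where
  "node0_fm j k z = enc_fm k z [const (tag j)]"

definition node1_fm :: "nat \<Rightarrow> nat \<Rightarrow> tm \<Rightarrow> tm \<Rightarrow> fm" where
  "node1_fm j k z t = enc_fm k z [const (tag j), t]"

definition node2_fm :: "nat \<Rightarrow> nat \<Rightarrow> tm \<Rightarrow> tm \<Rightarrow> tm \<Rightarrow> fm" where
  "node2_fm j k z s t = enc_fm k z [const (tag j), s, t]"

definition var_fm :: "nat \<Rightarrow> tm \<Rightarrow> fm" where
  "var_fm k z = BEx k z (\<lambda>i k. BEx k i (\<lambda>s k. BEx k s (\<lambda>s' k. conjs
     [ones_fm k s s', cats_fm k [const [False], s, const [False]] i, node1_fm 0 k z i])))"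

text \<open>The outermost symbol of \<open>z\<close> is that of a term, respectively that of a formula.\<close>

definition tm_head_fm :: "nat \<Rightarrow> tm \<Rightarrow> fm" where
  "tm_head_fm k z = disjs
     [var_fm k z, node0_fm 1 k z, node0_fm 2 k z,
      BEx k z (\<lambda>a k. BEx k z (\<lambda>b k. Dis (node2_fm 3 k z a b) (node2_fm 4 k z a b)))]"

definition fm_head_fm :: "nat \<Rightarrow> tm \<Rightarrow> fm" where
  "fm_head_fm k z = disjs
     [BEx k z (\<lambda>a k. node1_fm 6 k z a),
      BEx k z (\<lambda>a k. BEx k z (\<lambda>b k. disjs
        [node2_fm 5 k z a b, node2_fm 7 k z a b, node2_fm 8 k z a b]))]"

text \<open>
  A string is a term or formula if it has the right outermost symbol and all its factors of the
  form of a compound expression have immediate constituents of the right kind.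
\<close>

definition wf_fm :: "nat \<Rightarrow> tm \<Rightarrow> fm" where
  "wf_fm k z = BAll k z (\<lambda>u k. Imp (factor_fm k u z) (BAll k u (\<lambda>a k. Con
     (Imp (node1_fm 6 k u a) (fm_head_fm k a))
     (BAll k u (\<lambda>b k. conjs
        [Imp (disjs [node2_fm 3 k u a b, node2_fm 4 k u a b, node2_fm 5 k u a b])
             (Con (tm_head_fm k a) (tm_head_fm k b)),
         Imp (node2_fm 7 k u a b) (Con (fm_head_fm k a) (fm_head_fm k b)),
         Imp (node2_fm 8 k u a b) (Con (var_fm k a) (fm_head_fm k b))])))))"

definition term_fm :: "nat \<Rightarrow> tm \<Rightarrow> fm" where
  "term_fm k z = Con (tm_head_fm k z) (wf_fm k z)"

definition form_fm :: "nat \<Rightarrow> tm \<Rightarrow> fm" where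
  "form_fm k z = Con (fm_head_fm k z) (wf_fm k z)"

text \<open>
  A pattern is the shape of an axiom scheme; the leaves \<open>PMeta\<close> are object variables that stand for
  codes of expressions.
\<close>

datatype pat = PMeta tm | PNode0 nat | PNode1 nat pat | PNode2 nat pat pat

primrec pat_fm :: "pat \<Rightarrow> nat \<Rightarrow> tm \<Rightarrow> fm" where
  "pat_fm (PMeta t) k z = Eq z t"
| "pat_fm (PNode0 j) k z = node0_fm j k z"
| "pat_fm (PNode1 j p) k z = BEx k z (\<lambda>a k. Con (node1_fm j k z a) (pat_fm p k a))"
| "pat_fm (PNode2 j p q) k z = BEx k z (\<lambda>a k. BEx k z (\<lambda>b k. conjs
     [node2_fm j k z a b, pat_fm p k a, pat_fm q k b]))"

abbreviation "PZero \<equiv> PNode0 1"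
abbreviation "POne \<equiv> PNode0 2"
abbreviation "PPlus \<equiv> PNode2 3"
abbreviation "PTimes \<equiv> PNode2 4"
abbreviation "PEq \<equiv> PNode2 5"
abbreviation "PNeg \<equiv> PNode1 6"
abbreviation "PImp \<equiv> PNode2 7"
abbreviation "PAll \<equiv> PNode2 8"

definition ex_var :: "nat \<Rightarrow> tm \<Rightarrow> (tm \<Rightarrow> nat \<Rightarrow> fm) \<Rightarrow> fm" where
  "ex_var k z B = BEx k z (\<lambda>x k. Con (var_fm k x) (B x k))"

definition ex_term :: "nat \<Rightarrow> tm \<Rightarrow> (tm \<Rightarrow> nat \<Rightarrow> fm) \<Rightarrow> fm" where
  "ex_term k z B = BEx k z (\<lambda>x k. Con (term_fm k x) (B x k))"

definition ex_form :: "nat \<Rightarrow> tm \<Rightarrow> (tm \<Rightarrow> nat \<Rightarrow> fm) \<Rightarrow> fm" where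
  "ex_form k z B = BEx k z (\<lambda>x k. Con (form_fm k x) (B x k))"

definition logic_axiom_fm :: "nat \<Rightarrow> tm \<Rightarrow> fm" where
  "logic_axiom_fm k z = disjs
    [ex_form k z (\<lambda>F k. ex_form k z (\<lambda>G k.
       pat_fm (PImp (PMeta F) (PImp (PMeta G) (PMeta F))) k z)),
     ex_form k z (\<lambda>F k. ex_form k z (\<lambda>G k. ex_form k z (\<lambda>H k.
       pat_fm (PImp (PImp (PMeta F) (PImp (PMeta G) (PMeta H)))
                    (PImp (PImp (PMeta F) (PMeta G)) (PImp (PMeta F) (PMeta H)))) k z))),
     ex_form k z (\<lambda>F k. ex_form k z (\<lambda>G k.
       pat_fm (PImp (PImp (PNeg (PMeta F)) (PNeg (PMeta G))) (PImp (PMeta G) (PMeta F))) k z)),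
     ex_var k z (\<lambda>x k. ex_form k z (\<lambda>F k. ex_form k z (\<lambda>G k.
       pat_fm (PImp (PAll (PMeta x) (PImp (PMeta F) (PMeta G)))
                    (PImp (PAll (PMeta x) (PMeta F)) (PAll (PMeta x) (PMeta G)))) k z))),
     ex_var k z (\<lambda>x k. ex_form k z (\<lambda>F k.
       pat_fm (PImp (PAll (PMeta x) (PMeta F)) (PMeta F)) k z)),
     ex_var k z (\<lambda>x k. ex_form k z (\<lambda>F k. Con (Neg (factor_fm k x F))
       (pat_fm (PImp (PMeta F) (PAll (PMeta x) (PMeta F))) k z))),
     ex_var k z (\<lambda>x k. ex_term k z (\<lambda>t k. Con (Neg (factor_fm k x t))
       (pat_fm (PNeg (PAll (PMeta x) (PNeg (PEq (PMeta x) (PMeta t))))) k z))),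
     ex_term k z (\<lambda>t k. pat_fm (PEq (PMeta t) (PMeta t)) k z),
     ex_term k z (\<lambda>s k. ex_term k z (\<lambda>t k. ex_term k z (\<lambda>r k.
       pat_fm (PImp (PEq (PMeta s) (PMeta t))
                    (PImp (PEq (PMeta s) (PMeta r)) (PEq (PMeta t) (PMeta r)))) k z))),
     ex_term k z (\<lambda>s k. ex_term k z (\<lambda>t k. ex_term k z (\<lambda>s' k. ex_term k z (\<lambda>t' k.
       pat_fm (PImp (PEq (PMeta s) (PMeta t)) (PImp (PEq (PMeta s') (PMeta t'))
                 (PEq (PPlus (PMeta s) (PMeta s')) (PPlus (PMeta t) (PMeta t'))))) k z)))),
     ex_term k z (\<lambda>s k. ex_term k z (\<lambda>t k. ex_term k z (\<lambda>s' k. ex_term k z (\<lambda>t' k.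
       pat_fm (PImp (PEq (PMeta s) (PMeta t)) (PImp (PEq (PMeta s') (PMeta t'))
                 (PEq (PTimes (PMeta s) (PMeta s')) (PTimes (PMeta t) (PMeta t'))))) k z))))]"

definition PA_axiom_fm :: "nat \<Rightarrow> tm \<Rightarrow> fm" where
  "PA_axiom_fm k z = disjs
    (map (\<lambda>F. Eq z (quot F)) Q_axioms @
     [ex_var k z (\<lambda>x k. ex_var k z (\<lambda>y k. ex_form k z (\<lambda>F k. conjs
       [Neg (Eq x y), Neg (factor_fm k y F),
        pat_fm
          (PImp (PAll (PMeta x) (PImp (PEq (PMeta x) PZero) (PMeta F)))
          (PImp (PAll (PMeta x) (PImp (PMeta F)
                   (PAll (PMeta y) (PImp (PEq (PMeta y) (PPlus (PMeta x) POne))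
                                         (PAll (PMeta x) (PImp (PEq (PMeta x) (PMeta y)) (PMeta F)))))))
                (PAll (PMeta x) (PMeta F)))) k z])))])"

text \<open>
  In a string \<open>x = 0 1\<^sup>k w\<^sub>1 1\<^sup>k \<dots> 1\<^sup>k w\<^sub>n 1\<^sup>k 0\<close> that has no factor \<open>1\<^sup>k\<^sup>+\<^sup>1\<close>, the \<open>w\<^sub>i\<close> are the strings \<open>u\<close>
  without factor \<open>1\<^sup>k\<close> such that \<open>1\<^sup>k u 1\<^sup>k\<close> is a factor of \<open>x\<close>.
\<close>

definition item_fm :: "nat \<Rightarrow> tm \<Rightarrow> tm \<Rightarrow> tm \<Rightarrow> fm" where
  "item_fm k s u x = Con (Neg (factor_fm k s u))
     (BEx k x (\<lambda>w k. Con (cats_fm k [s, u, s] w) (factor_fm k w x)))"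

text \<open>
  \<open>z\<close> is an axiom or follows by a rule from items of the initial segment \<open>r\<close> of the proof.
\<close>

definition line_fm :: "nat \<Rightarrow> tm \<Rightarrow> tm \<Rightarrow> tm \<Rightarrow> fm" where
  "line_fm k s r z = disjs
     [logic_axiom_fm k z,
      PA_axiom_fm k z,
      BEx k r (\<lambda>G k. BEx k r (\<lambda>H k. conjs
        [item_fm k s G r, item_fm k s H r, node2_fm 7 k H G z])),
      BEx k r (\<lambda>G k. ex_var k z (\<lambda>x k. Con (item_fm k s G r) (node2_fm 8 k z x G)))]"

definition prf_fm :: "nat \<Rightarrow> tm \<Rightarrow> tm \<Rightarrow> fm" where
  "prf_fm k x y = BEx k x (\<lambda>s k. BEx k s (\<lambda>s' k. conjs
     [ones_fm k s s',
      Neg (factor_fm k (Plus (Plus s s) One) x),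
      BEx k x (\<lambda>q k. cats_fm k [const [False], s, q] x),
      Neg (factor_fm k s y),
      BEx k x (\<lambda>p k. cats_fm k [p, s, y, s, const [False]] x),
      BEx k x (\<lambda>u k. Con (item_fm k s u x) (factor_fm k s' u)),
      BAll k x (\<lambda>r k. BAll k x (\<lambda>u k. Imp
        (conjs
          [BEx k r (\<lambda>p k. cats_fm k [p, s] r),
           Neg (factor_fm k s u),
           BEx k x (\<lambda>q k. cats_fm k [r, u, s, q] x)])
        (line_fm k s r u)))]))"

definition Prf :: fm where
  "Prf = prf_fm 2 (Var 0) (Var 1)"

definition Prv :: fm where
  "Prv = Ex 0 Prf"


section \<open>Arithmetical evaluations\<close>

definition arithmetical_evaluation :: "(mform \<Rightarrow> fm) \<Rightarrow> bool" where
  "arithmetical_evaluation f \<longleftrightarrow>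
     (\<forall>A. sentence (f A)) \<and>
     (\<forall>A B. f (MAnd A B) = Con (f A) (f B)) \<and>
     (\<forall>A B. f (MOr A B) = Dis (f A) (f B)) \<and>
     (\<forall>A. f (MNeg A) = Neg (f A)) \<and>
     (\<forall>A B. f (MImp A B) = Imp (f A) (f B)) \<and>
     f MTop = Eq Zero Zero \<and>
     f MBot = Eq Zero One \<and>
     (\<forall>A. f (MBox A) = fm_subst 1 (quot (f A)) Prv)"

end

theory Submission
  imports Defs "HOL-Library.Countable" "HOL-Library.Infinite_Set"
begin

abbreviation (input) Iff (infixr "<->" 25) where "A <-> B \<equiv> A = (B::bool)"

text \<open>
  By the completeness theorem, \<open>PA\<close> proves what holds in all its models.  So the steps of Solovay's proof
  that are usually carried out inside \<open>PA\<close> are carried out here in an arbitrary model, about its possibly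
  nonstandard strings and proofs, by induction for definable predicates.

  A formula that \<open>GL\<close> does not prove fails at a world of a finite frame whose relation \<open>R\<close> is transitive and
  irreflexive.  The worlds are numbered \<open>1, \<dots>, n\<close> in an order that extends \<open>R\<close>, and 0 becomes a new root.  The
  Solovay function starts at 0 and moves from \<open>i\<close> to a successor \<open>j\<close> when a proof of \<open>\<not> L\<^sub>j\<close> is found, where the
  sentence \<open>L\<^sub>i\<close> says that \<open>i\<close> is its limit.  In each model exactly one \<open>L\<^sub>i\<close> holds.  If it is \<open>L\<^sub>i\<close> and \<open>i R j\<close>, then
  \<open>\<not> L\<^sub>j\<close> is not provable, since the function does not move on.  If moreover \<open>i > 0\<close>, then the disjunction of
  the \<open>L\<^sub>j\<close> with \<open>i R j\<close> is provable: \<open>\<not> L\<^sub>i\<close> is provable because the function moved to \<open>i\<close>, and that it did so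
  is a true, hence provable, \<open>\<Sigma>\<^sub>1\<close> sentence.  Therefore \<open>L\<^sub>i\<close> decides the translation of a modal formula as the
  world \<open>i\<close> does, if a variable is translated as the disjunction of the \<open>L\<^sub>i\<close> with \<open>i\<close> forcing it.  As \<open>PA\<close> is
  sound, in the standard model the limit is 0, and no \<open>\<not> L\<^sub>i\<close> with \<open>i > 0\<close> is provable.
\<close>

section \<open>Propositional calculi\<close>

text \<open>\<open>Prv\<close> is one concrete formula, so no derivability condition comes for free:
  even closure under modus ponens must be read off from \<open>prf_fm\<close>. In a nonstandard
  model a string can be infinitely long, so its items and subformulas are out of reach of recursion
  on lists or formulas; Levi's lemma, least elements and induction on positions take their place.
  The separator of a list depends on its items, so proofs cannot be concatenated: they are copied
  with a longer separator and finally brought back to the minimal one. \<open>WF\<close> quantifies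
  over all factors, so a compound of well-formed parts might contain accidental nodes; the string
  \<open>0 1...1 00\<close>, which marks the front of a node, excludes them. Numerals of nonstandard
  elements exist only through derivations inside the model, and they are unary because induction
  goes from \<open>a\<close> to \<open>a + 1\<close>. Propositional reasoning about codes stays
  external, as Lindenbaum's argument works for a predicate on any type. Self-reference is obtained
  for all limit sentences at once, by one formula with an index variable.\<close>

locale prop_calc =
  fixes P :: "'f => bool" and imp :: "'f => 'f => 'f" and neg :: "'f => 'f"
  assumes A1: "P (imp F (imp G F))"
    and A2: "P (imp (imp F (imp G H)) (imp (imp F G) (imp F H)))"
    and A3: "P (imp (imp (neg F) (neg G)) (imp G F))"
    and MP: "P F ==> P (imp F G) ==> P G"
begin

text \<open>\<open>imp\<close> and \<open>neg\<close> need not be constructors, so a valuation is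
  any predicate that respects their truth tables; everything else counts as an atom. In this form
  the notion also fits codes of formulas in a nonstandard model.\<close>

definition val :: "('f => bool) => bool" where
  "val v <-> (\<forall>F G. v (imp F G) <-> (v F --> v G)) \<and> (\<forall>F. v (neg F) <-> \<not> v F)"

lemma val_simps: "val v ==> v (imp F G) <-> (v F --> v G)" "val v ==> v (neg F) <-> \<not> v F"
  by (simp_all add: val_def)

text \<open>Premises enter only through a provable chain of implications. Generalization and
  necessitation therefore never act on premises, and the deduction theorem holds without
  restriction.\<close>

definition der :: "'f set => 'f => bool" where
  "der T F <-> (\<exists>Gs. set Gs \<subseteq> T \<and> P (foldr imp Gs F))"

lemma imp_weaken: "P F ==> P (imp G F)"
  using A1 MP by blast

lemma imp_mp: "P (imp H (imp F G)) ==> P (imp H F) ==> P (imp H G)"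
  using A2 MP by blast

lemma imp_refl: "P (imp F F)"
  using imp_mp[OF A1 A1] .

lemma imp_trans: "P (imp F G) ==> P (imp G H) ==> P (imp F H)"
  by (rule imp_mp[OF imp_weaken])

lemma foldr_mp: "P (foldr imp Gs (imp F G)) ==> P (foldr imp Gs F) ==> P (foldr imp Gs G)"
proof -
  have "P (imp (foldr imp Gs (imp F G)) (imp (foldr imp Gs F) (foldr imp Gs G)))" for Gs
  proof (induction Gs)
    case Nil
    show ?case by (simp add: imp_refl)
  next
    case (Cons H Hs)
    let ?A = "foldr imp Hs (imp F G)" and ?B = "foldr imp Hs F" and ?C = "foldr imp Hs G"
    have "P (imp (imp H ?A) (imp H (imp ?B ?C)))"
      using MP[OF imp_weaken[OF Cons] A2] by simp
    then show ?case by (auto intro: imp_trans[OF _ A2])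
  qed
  then show "P (foldr imp Gs (imp F G)) ==> P (foldr imp Gs F) ==> P (foldr imp Gs G)"
    using MP by blast
qed

lemma foldr_weaken: "P F ==> P (foldr imp Gs F)"
  by (induction Gs) (auto intro: imp_weaken)

lemma foldr_append_weaken: "P (foldr imp Gs F) ==> P (foldr imp (Gs @ Hs) F)"
proof (induction Gs arbitrary: F)
  case (Cons G Gs)
  have "P (imp (foldr imp Gs F) (foldr imp (Gs @ Hs) F))"
  proof -
    have w: "P (imp F (foldr imp Hs F))" for F
    proof (induction Hs)
      case (Cons H Hs) then show ?case by (auto intro: imp_trans[OF _ A1])
    qed (simp add: imp_refl)
    have mono: "P (imp A B) ==> P (imp (foldr imp Gs A) (foldr imp Gs B))" for A B Gs
    proof (induction Gs)
      case (Cons G Gs) then show ?case by (auto intro: MP[OF imp_weaken A2])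
    qed simp
    show ?thesis by (simp add: mono w)
  qed
  then show ?case using Cons.prems MP[OF _ MP[OF imp_weaken A2]] by simp
qed (simp add: foldr_weaken)

lemma der_mp: "der T (imp F G) ==> der T F ==> der T G"
proof -
  have pre: "P (foldr imp (Gs @ Hs) F)" if "P (foldr imp Hs F)" for Gs Hs F
    using foldr_weaken[OF that, of Gs] by simp
  assume "der T (imp F G)" "der T F"
  then obtain Gs Hs where "set (Gs @ Hs) \<subseteq> T" "P (foldr imp Gs (imp F G))" "P (foldr imp Hs F)"
    unfolding der_def by auto
  then show "der T G" unfolding der_def by (intro exI[of _ "Gs @ Hs"] conjI foldr_mp[OF foldr_append_weaken pre])
qed

lemma der_P: "P F ==> der T F"
  unfolding der_def by (rule exI[of _ "[]"]) simp

lemma der_in: "F \<in> T ==> der T F"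
  unfolding der_def by (rule exI[of _ "[F]"]) (simp add: imp_refl)

lemma der_mono: "der T F ==> T \<subseteq> T' ==> der T' F"
  unfolding der_def by blast

lemma der_weaken: "der T F ==> der T (imp G F)"
  by (rule der_mp[OF der_P[OF A1]])

lemma deduction: "der (insert G T) F ==> der T (imp G F)"
proof -
  have "der T (imp G F)" if "set Gs \<subseteq> insert G T" "P (foldr imp Gs F)" for Gs F
    using that
  proof (induction Gs arbitrary: F rule: rev_induct)
    case Nil then show ?case by (simp add: der_P imp_weaken)
  next
    case (snoc H Hs)
    then have *: "der T (imp G (imp H F))" by simp
    have **: "der T (imp G H)"
    proof (cases "H = G")
      case False then show ?thesis using snoc.prems by (simp add: der_weaken der_in)
    qed (simp add: der_P imp_refl)
    show ?case using der_mp[OF der_mp[OF der_P[OF A2] *] **] .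
  qed
  moreover assume "der (insert G T) F"
  ultimately show "der T (imp G F)" unfolding der_def[of "insert G T"] by blast
qed

lemma der_contr: "der T (neg F) ==> der T F ==> der T G"
  by (rule der_mp[OF der_mp[OF der_P[OF A3] der_weaken]])

lemma der_clavius:
  assumes a: "der T (imp (neg F) F)"
  shows "der T F"
proof -
  let ?U = "insert (neg F) T"
  have n: "der ?U (neg F)" by (simp add: der_in)
  have "der ?U F" by (rule der_mp[OF der_mono[OF a] n]) blast
  \<comment> \<open>A contradiction is recorded as the negation of the theorem
    \<open>imp F F\<close>, since A3 contraposes only between negated formulas.\<close>
  then have "der ?U (neg (imp F F))" by (rule der_contr[OF n])
  then have "der T (imp (neg F) (neg (imp F F)))" by (rule deduction)
  then have "der T (imp (imp F F) F)" by (rule der_mp[OF der_P[OF A3]])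
  then show ?thesis by (rule der_mp[OF _ der_P[OF imp_refl]])
qed

lemma der_dn: "der T (neg (neg G)) ==> der T G"
proof (rule der_clavius)
  assume a: "der T (neg (neg G))"
  have "der (insert (neg G) T) G"
    by (rule der_contr[OF der_mono[OF a] der_in]) auto
  then show "der T (imp (neg G) G)" by (rule deduction)
qed

lemma der_cases:
  assumes a: "der T (imp G F)" "der T (imp (neg G) F)"
  shows "der T F"
proof -
  let ?U = "insert (neg F) T"
  let ?W = "insert (neg (neg G)) ?U"
  have "der ?W G" by (rule der_dn) (simp add: der_in)
  then have "der ?W F" by (rule der_mp[OF der_mono[OF a(1)], rotated]) blast
  then have "der ?W (neg (imp F F))" by (rule der_contr[rotated]) (simp add: der_in)
  then have "der ?U (imp (neg (neg G)) (neg (imp F F)))" by (rule deduction)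
  then have "der ?U (imp (imp F F) (neg G))" by (rule der_mp[OF der_P[OF A3]])
  then have "der ?U (neg G)" by (rule der_mp[OF _ der_P[OF imp_refl]])
  then have "der ?U F" by (rule der_mp[OF der_mono[OF a(2)], rotated]) blast
  then have "der T (imp (neg F) F)" by (rule deduction)
  then show ?thesis by (rule der_clavius)
qed

text \<open>Lindenbaum: a maximal theory that does not derive \<open>F\<close> is a Boolean valuation.\<close>

theorem val_exists:
  assumes "\<not> der T F"
  obtains v where "val v" "\<And>G. der T G ==> v G" "\<not> v F"
proof -
  let ?S = "{U. T \<subseteq> U \<and> \<not> der U F}"
  have "\<exists>M\<in>?S. \<forall>X\<in>?S. M \<subseteq> X --> X = M"
  proof (rule subset_Zorn_nonempty)
    show "?S ~= {}" using assms by blast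
  next
    fix \<C> assume c: "\<C> ~= {}" "subset.chain ?S \<C>"
    have "\<not> der (\<Union>\<C>) F"
    proof
      assume "der (\<Union>\<C>) F"
      then obtain Gs where Gs: "set Gs \<subseteq> \<Union>\<C>" "P (foldr imp Gs F)" unfolding der_def by blast
      have "\<exists>X\<in>\<C>. set Gs \<subseteq> X"
        using finite_subset_Union_chain[OF _ Gs(1) c(1)] c(2) unfolding subset.chain_def
        by (metis List.finite_set c(2))
      then show False using Gs(2) c(2) unfolding der_def subset.chain_def by blast
    qed
    then show "\<Union>\<C> \<in> ?S" using c unfolding subset.chain_def by blast
  qed
  then obtain U where U: "T \<subseteq> U" "\<not> der U F" "\<And>X. U \<subseteq> X ==> \<not> der X F ==> X = U"
    by (smt (verit, best) mem_Collect_eq subset_trans)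
  have max: "der U (imp G F)" if "\<not> der U G" for G
    using U(3)[of "insert G U"] that deduction der_in by blast
  define v where "v G = der U G" for G
  have neg: "v (neg G) = (\<not> v G)" for G
    unfolding v_def using der_contr[of U G F] U(2) max[of G] max[of "neg G"] der_cases[of U G F] by blast
  have imp: "v (imp G H) = (v G --> v H)" for G H
  proof
    show "v G --> v H" if "v (imp G H)" using that der_mp[of U G H] unfolding v_def by blast
    show "v (imp G H)" if "v G --> v H"
    proof (cases "v G")
      case True then show ?thesis using that der_weaken[of U H G] unfolding v_def by blast
    next
      case False
      then have "der U (neg G)" using neg[of G] unfolding v_def by simp
      then have "der (insert G U) H" by (rule der_contr[OF der_mono der_in]) auto
      then show ?thesis unfolding v_def by (rule deduction)
    qed
  qed
  show thesis
    by (rule that[of v]) (use neg imp U(2) der_mono[OF _ U(1)] in \<open>auto simp: v_def val_def\<close>)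
qed

text \<open>By Lindenbaum's argument tautologies are provable, so propositional derivations can be
  replaced by truth-table checks left to automation; \<open>taut_from\<close> adds provable
  premises.\<close>

lemma taut:
  assumes "\<And>v. val v ==> v F"
  shows "P F"
proof (rule ccontr)
  assume "\<not> P F"
  then have "\<not> der {} F" unfolding der_def by auto
  then show False using val_exists assms by metis
qed

lemma taut_from:
  assumes "\<And>G. G \<in> set Gs ==> P G" "\<And>v. val v ==> \<forall>G\<in>set Gs. v G ==> v F"
  shows "P F"
  using assms
proof (induction Gs arbitrary: F)
  case Nil
  show ?case by (rule taut) (use Nil(2) in simp)
next
  case (Cons G Gs)
  have "P (imp G F)"
    by (rule Cons.IH) (use Cons.prems in \<open>auto simp: val_def\<close>)
  then show ?case by (rule MP[rotated]) (simp add: Cons.prems(1))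
qed

end

section \<open>First-order calculi\<close>

lemma finite_tm_vars [simp]: "finite (tm_vars t)"
  by (induction t) auto

lemma finite_fm_vars [simp]: "finite (fm_vars F)"
  by (induction F) auto

lemma bound_vars_subset: "bound_vars F \<subseteq> fm_vars F"
  by (induction F) auto

lemma free_vars_subset: "free_vars F \<subseteq> fm_vars F"
  by (induction F) auto

lemma finite_free_vars [simp]: "finite (free_vars F)"
  using finite_subset[OF free_vars_subset] by simp

lemma tm_subst_id [simp]: "x \<notin> tm_vars t ==> tm_subst x s t = t"
  by (induction t) auto

lemma fm_subst_id [simp]: "x \<notin> fm_vars F ==> fm_subst x t F = F"
  by (induction F) auto

lemma tm_subst_vars: "tm_vars (tm_subst x t s) \<subseteq> (tm_vars s - {x}) \<union> tm_vars t"
  by (induction s) auto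

lemma fm_subst_vars: "x \<notin> bound_vars F ==> fm_vars (fm_subst x t F) \<subseteq> (fm_vars F - {x}) \<union> tm_vars t"
proof (induction F)
  case (Eq r s) then show ?case using tm_subst_vars[of x t r] tm_subst_vars[of x t s] by auto
qed auto

lemma bound_vars_subst [simp]: "bound_vars (fm_subst x t F) = bound_vars F"
  by (induction F) auto

lemma tm_subst_back: "y \<notin> tm_vars s ==> tm_subst y (Var x) (tm_subst x (Var y) s) = s"
  by (induction s) auto

lemma fm_subst_back:
  "y \<notin> fm_vars F ==> x \<notin> bound_vars F ==> fm_subst y (Var x) (fm_subst x (Var y) F) = F"
  by (induction F) (auto simp: tm_subst_back)

lemma fresh_var: "finite A ==> \<exists>z::nat. z \<notin> A"
  using ex_new_if_finite[OF infinite_UNIV_nat] by blast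

lemma fm_vars_eq: "fm_vars F = bound_vars F \<union> free_vars F"
  by (induction F) auto

lemma tm_subst_free: "tm_vars (tm_subst x (Var y) t) = (if x \<in> tm_vars t then insert y (tm_vars t - {x}) else tm_vars t)"
  by (induction t) auto

lemma free_vars_subst:
  "x \<notin> bound_vars F ==> y \<notin> bound_vars F ==>
    free_vars (fm_subst x (Var y) F) = (if x \<in> free_vars F then insert y (free_vars F - {x}) else free_vars F)"
  by (induction F) (auto simp: tm_subst_free)

text \<open>No quantifier lies in the scope of another one with the same variable. Substitution does
  not rename, and instantiation as well as the Henkin axioms need
  \<open>x \<notin> bound_vars F\<close> for the matrix of every \<open>All x F\<close>.\<close>

primrec nice :: "fm => bool" where
  "nice (Eq s t) <-> True"
| "nice (Neg F) <-> nice F"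
| "nice (Imp F G) <-> nice F \<and> nice G"
| "nice (All x F) <-> x \<notin> bound_vars F \<and> nice F"

lemma nice_subst [simp]: "nice (fm_subst x t F) = nice F"
  by (induction F) auto

locale hilbert = prop_calc P Imp Neg for P +
  fixes V :: "nat set"
  assumes AD: "P (Imp (All x (Imp F G)) (Imp (All x F) (All x G)))"
    and AS: "x \<in> V ==> P (Imp (All x F) F)"
    and AV: "x \<notin> fm_vars F ==> P (Imp F (All x F))"
    and AE: "x \<notin> tm_vars t ==> P (Neg (All x (Neg (Eq (Var x) t))))"
    and ER: "P (Eq t t)"
    and ES: "P (Imp (Eq s t) (Imp (Eq s r) (Eq t r)))"
    and EP: "P (Imp (Eq s t) (Imp (Eq s' t') (Eq (Plus s s') (Plus t t'))))"
    and ET: "P (Imp (Eq s t) (Imp (Eq s' t') (Eq (Times s s') (Times t t'))))"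
    and Gen: "x \<in> V ==> P F ==> P (All x F)"
begin

lemma mono: "x \<in> V ==> P (Imp F G) ==> P (Imp (All x F) (All x G))"
  using Gen[of x "Imp F G"] AD MP by blast

lemma intro_all: "x \<in> V ==> P (Imp F G) ==> x \<notin> fm_vars F ==> P (Imp F (All x G))"
  by (rule imp_trans[OF AV mono])

lemma Eq_sym: "P (Imp (Eq s t) (Eq t s))"
  by (rule taut_from[of "[Eq s s, Imp (Eq s t) (Imp (Eq s s) (Eq t s))]"])
    (auto simp: ER ES val_def)

lemma Eq_trans: "P (Imp (Eq s t) (Imp (Eq t r) (Eq s r)))"
  by (rule taut_from[of "[Imp (Eq s t) (Eq t s), Imp (Eq t s) (Imp (Eq t r) (Eq s r))]"])
    (auto simp: Eq_sym ES val_def)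

lemma subst_tm: "P (Imp (Eq (Var x) t) (Eq s (tm_subst x t s)))"
proof (induction s)
  case (Plus r s)
  let ?r = "tm_subst x t r" and ?s = "tm_subst x t s"
  have "P (Imp (Eq r ?r) (Imp (Eq s ?s) (Eq (Plus r s) (Plus ?r ?s))))" by (rule EP)
  with Plus show ?case
    by - (rule taut_from[of "[Imp (Eq (Var x) t) (Eq r ?r), Imp (Eq (Var x) t) (Eq s ?s),
    Imp (Eq r ?r) (Imp (Eq s ?s) (Eq (Plus r s) (Plus ?r ?s)))]"], auto simp: val_def)
next
  case (Times r s)
  let ?r = "tm_subst x t r" and ?s = "tm_subst x t s"
  have "P (Imp (Eq r ?r) (Imp (Eq s ?s) (Eq (Times r s) (Times ?r ?s))))" by (rule ET)
  with Times show ?case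
    by - (rule taut_from[of "[Imp (Eq (Var x) t) (Eq r ?r), Imp (Eq (Var x) t) (Eq s ?s),
    Imp (Eq r ?r) (Imp (Eq s ?s) (Eq (Times r s) (Times ?r ?s)))]"], auto simp: val_def)
qed (auto intro: imp_weaken ER imp_refl)

text \<open>Both directions are proved together because negations and premises of implications
  exchange them. At a quantifier the equation does not contain the bound variable, so generalization
  can be moved past it.\<close>

lemma subst_fm:
  assumes "bound_vars F \<subseteq> V" "bound_vars F \<inter> insert x (tm_vars t) = {}"
  shows "P (Imp (Eq (Var x) t) (Imp F (fm_subst x t F))) \<and> P (Imp (Eq (Var x) t) (Imp (fm_subst x t F) F))"
  using assms
proof (induction F)
  case (Eq r s)
  let ?r = "tm_subst x t r" and ?s = "tm_subst x t s"
  have eq: "P (Imp (Eq a a') (Imp (Eq b b') (Imp (Eq a b) (Eq a' b'))))" for a a' b b'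
    by (rule taut_from[of "[Imp (Eq a a') (Imp (Eq a b) (Eq a' b)), Imp (Eq a' b) (Imp (Eq b b') (Eq a' b'))]"])
      (auto simp: ES Eq_trans val_def)
  have sb: "P (Imp (Eq (Var x) t) (Eq r ?r))" "P (Imp (Eq (Var x) t) (Eq s ?s))"
    by (rule subst_tm)+
  have "P (Imp (Eq (Var x) t) (Imp (Eq r s) (Eq ?r ?s)))"
    by (rule taut_from[of "[Imp (Eq (Var x) t) (Eq r ?r), Imp (Eq (Var x) t) (Eq s ?s),
      Imp (Eq r ?r) (Imp (Eq s ?s) (Imp (Eq r s) (Eq ?r ?s)))]"]) (use sb eq in \<open>auto simp: val_def\<close>)
  moreover have "P (Imp (Eq (Var x) t) (Imp (Eq ?r ?s) (Eq r s)))"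
    by (rule taut_from[of "[Imp (Eq (Var x) t) (Eq r ?r), Imp (Eq (Var x) t) (Eq s ?s),
      Imp (Eq r ?r) (Eq ?r r), Imp (Eq s ?s) (Eq ?s s),
      Imp (Eq ?r r) (Imp (Eq ?s s) (Imp (Eq ?r ?s) (Eq r s)))]"]) (use sb eq Eq_sym in \<open>auto simp: val_def\<close>)
  ultimately show ?case by simp
next
  case (Neg F)
  then have IH: "P (Imp (Eq (Var x) t) (Imp F (fm_subst x t F)))"
    "P (Imp (Eq (Var x) t) (Imp (fm_subst x t F) F))" by auto
  have "P (Imp (Eq (Var x) t) (Imp (Neg F) (Neg (fm_subst x t F))))"
    by (rule taut_from[of "[Imp (Eq (Var x) t) (Imp (fm_subst x t F) F)]"]) (use IH in \<open>auto simp: val_def\<close>)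
  moreover have "P (Imp (Eq (Var x) t) (Imp (Neg (fm_subst x t F)) (Neg F)))"
    by (rule taut_from[of "[Imp (Eq (Var x) t) (Imp F (fm_subst x t F))]"]) (use IH in \<open>auto simp: val_def\<close>)
  ultimately show ?case by simp
next
  case (Imp F G)
  then have IH: "P (Imp (Eq (Var x) t) (Imp F (fm_subst x t F)))"
    "P (Imp (Eq (Var x) t) (Imp (fm_subst x t F) F))"
    "P (Imp (Eq (Var x) t) (Imp G (fm_subst x t G)))"
    "P (Imp (Eq (Var x) t) (Imp (fm_subst x t G) G))" by auto
  have "P (Imp (Eq (Var x) t) (Imp (Imp F G) (Imp (fm_subst x t F) (fm_subst x t G))))"
    by (rule taut_from[of "[Imp (Eq (Var x) t) (Imp (fm_subst x t F) F), Imp (Eq (Var x) t) (Imp G (fm_subst x t G))]"])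
      (use IH in \<open>auto simp: val_def\<close>)
  moreover have "P (Imp (Eq (Var x) t) (Imp (Imp (fm_subst x t F) (fm_subst x t G)) (Imp F G)))"
    by (rule taut_from[of "[Imp (Eq (Var x) t) (Imp F (fm_subst x t F)), Imp (Eq (Var x) t) (Imp (fm_subst x t G) G)]"])
      (use IH in \<open>auto simp: val_def\<close>)
  ultimately show ?case by simp
next
  case (All y F)
  let ?H = "Eq (Var x) t"
  have y: "y ~= x" "y \<notin> fm_vars ?H" "y \<in> V" using All.prems by auto
  have go: "P (Imp ?H (Imp (All y A) (All y B)))" if "P (Imp ?H (Imp A B))" for A B
    using imp_trans[OF intro_all[OF y(3) that y(2)] AD] .
  show ?case using All go y by auto
qed

text \<open>No axiom mentions substitution. If the instance failed, then \<open>F\<close> for all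
  \<open>x\<close> would refute \<open>x = t\<close> for every \<open>x\<close>, contrary to the
  axiom that some \<open>x\<close> equals \<open>t\<close>.\<close>

lemma all_inst:
  assumes "bound_vars F \<subseteq> V" "x \<in> V" "x \<notin> bound_vars F" "bound_vars F \<inter> tm_vars t = {}" "x \<notin> tm_vars t"
  shows "P (Imp (All x F) (fm_subst x t F))"
proof -
  let ?G = "fm_subst x t F"
  have "P (Imp (Eq (Var x) t) (Imp F ?G))"
    using subst_fm[of F x t] assms by auto
  then have "P (Imp F (Imp (Neg ?G) (Neg (Eq (Var x) t))))"
    by - (rule taut_from[of "[Imp (Eq (Var x) t) (Imp F ?G)]"], auto simp: val_def)
  then have 1: "P (Imp (All x F) (All x (Imp (Neg ?G) (Neg (Eq (Var x) t)))))"
    by (rule mono[OF assms(2)])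
  have "x \<notin> fm_vars (Neg ?G)" using fm_subst_vars[OF assms(3), of t] assms(5) by auto
  then have 2: "P (Imp (Neg ?G) (All x (Neg ?G)))" by (rule AV)
  show ?thesis
    by (rule taut_from[of "[Imp (All x F) (All x (Imp (Neg ?G) (Neg (Eq (Var x) t)))),
      Imp (All x (Imp (Neg ?G) (Neg (Eq (Var x) t)))) (Imp (All x (Neg ?G)) (All x (Neg (Eq (Var x) t)))),
      Imp (Neg ?G) (All x (Neg ?G)), Neg (All x (Neg (Eq (Var x) t)))]"])
      (use 1 AD 2 AE[OF assms(5)] in \<open>auto simp: val_def\<close>)
qed

text \<open>The comparison passes through a third variable \<open>x\<close>: some \<open>x\<close>
  equals \<open>c\<close>, hence also \<open>d\<close>, and \<open>subst_fm\<close> relates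
  \<open>F\<close> to both instances.\<close>

lemma Eq_subst:
  assumes "bound_vars F \<subseteq> V" "x \<in> V" "x \<notin> bound_vars F" "bound_vars F \<inter> {c, d} = {}" "x ~= c" "x ~= d"
  shows "P (Imp (Eq (Var c) (Var d)) (Imp (fm_subst x (Var d) F) (fm_subst x (Var c) F)))"
proof -
  let ?C = "fm_subst x (Var c) F" and ?D = "fm_subst x (Var d) F"
  let ?G = "Imp (Eq (Var c) (Var d)) (Imp ?D ?C)"
  have 1: "P (Imp (Eq (Var x) (Var c)) (Imp F ?C))" "P (Imp (Eq (Var x) (Var d)) (Imp ?D F))"
    using subst_fm[of F x "Var c"] subst_fm[of F x "Var d"] assms by auto
  have "P (Imp (Neg ?G) (Neg (Eq (Var x) (Var c))))"
    by (rule taut_from[of "[Imp (Eq (Var x) (Var c)) (Imp F ?C), Imp (Eq (Var x) (Var d)) (Imp ?D F),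
      Imp (Eq (Var x) (Var c)) (Imp (Eq (Var c) (Var d)) (Eq (Var x) (Var d)))]"])
      (use 1 Eq_trans in \<open>auto simp: val_def\<close>)
  then have 2: "P (Imp (Neg ?G) (All x (Neg (Eq (Var x) (Var c)))))"
    by (rule intro_all[OF assms(2)])
      (use fm_subst_vars[OF assms(3), of "Var c"] fm_subst_vars[OF assms(3), of "Var d"] assms(5,6) in auto)
  have "P (Neg (All x (Neg (Eq (Var x) (Var c)))))" using AE assms(5) by simp
  then show ?thesis
    by - (rule taut_from[of "[Imp (Neg ?G) (All x (Neg (Eq (Var x) (Var c)))), Neg (All x (Neg (Eq (Var x) (Var c))))]"],
      use 2 in \<open>auto simp: val_def\<close>)
qed

lemma val_foldr: "val v ==> v (foldr Imp Gs F) <-> ((\<forall>G\<in>set Gs. v G) --> v F)"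
  by (induction Gs) (auto simp: val_def)

end

interpretation PA: hilbert PA_provable UNIV
proof unfold_locales
  show "PA_provable F ==> PA_provable (Imp F G) ==> PA_provable G" for F G by (rule PA_MP)
  show "PA_provable F ==> PA_provable (All x F)" for x F by (rule PA_Gen)
qed (auto intro!: PA_ax logic_axiom.intros)

text \<open>Only with all variables available for generalization can bound variables be renamed.\<close>

locale full_hilbert = hilbert P UNIV for P
begin

lemma all_rename:
  assumes "x \<notin> bound_vars F" "y \<notin> fm_vars F"
  shows "P (Imp (All x F) (All y (fm_subst x (Var y) F)))"
proof (cases "x = y")
  case True
  then show ?thesis using assms by (simp add: AV imp_refl)
next
  case False
  have y: "y \<notin> bound_vars F" using assms(2) bound_vars_subset by blast
  show ?thesis
    by (rule intro_all[OF UNIV_I all_inst]) (use assms y False in auto)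
qed

text \<open>
  The bound variables can be taken from any infinite set \<open>E\<close>.  The finite set \<open>X\<close> to be avoided makes
  the induction go through.
\<close>

lemma rename_bound:
  assumes "infinite E" "finite X"
  shows "\<exists>F'. bound_vars F' \<subseteq> E - X \<and> nice F' \<and> free_vars F' \<subseteq> free_vars F \<and> P (Imp F F') \<and> P (Imp F' F)"
  using assms(2)
proof (induction F arbitrary: X)
  case (Eq s t)
  show ?case by (rule exI[of _ "Eq s t"]) (simp add: imp_refl)
next
  case (Neg F)
  then obtain F' where F': "bound_vars F' \<subseteq> E - X" "nice F'" "free_vars F' \<subseteq> free_vars F"
    "P (Imp F F')" "P (Imp F' F)" by meson
  have "P (Imp (Neg F) (Neg F'))"
    by (rule taut_from[of "[Imp F' F]"]) (use F' in \<open>auto simp: val_def\<close>)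
  moreover have "P (Imp (Neg F') (Neg F))"
    by (rule taut_from[of "[Imp F F']"]) (use F' in \<open>auto simp: val_def\<close>)
  ultimately show ?case using F' by (intro exI[of _ "Neg F'"]) simp
next
  case (Imp F G)
  obtain F' where F': "bound_vars F' \<subseteq> E - X" "nice F'" "free_vars F' \<subseteq> free_vars F"
    "P (Imp F F')" "P (Imp F' F)" using Imp.IH(1)[OF Imp.prems] by blast
  obtain G' where G': "bound_vars G' \<subseteq> E - X" "nice G'" "free_vars G' \<subseteq> free_vars G"
    "P (Imp G G')" "P (Imp G' G)" using Imp.IH(2)[OF Imp.prems] by blast
  have "P (Imp (Imp F G) (Imp F' G'))"
    by (rule taut_from[of "[Imp F' F, Imp G G']"]) (use F' G' in \<open>auto simp: val_def\<close>)
  moreover have "P (Imp (Imp F' G') (Imp F G))"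
    by (rule taut_from[of "[Imp F F', Imp G' G]"]) (use F' G' in \<open>auto simp: val_def\<close>)
  ultimately show ?case using F' G' by (intro exI[of _ "Imp F' G'"]) auto
next
  case (All x F)
  obtain F' where F': "bound_vars F' \<subseteq> E - insert x X" "nice F'" "free_vars F' \<subseteq> free_vars F"
    "P (Imp F F')" "P (Imp F' F)" using All.IH[of "insert x X"] All.prems by blast
  have "infinite (E - (X \<union> insert x (fm_vars F')))" using assms(1) All.prems by simp
  then obtain y where y: "y \<in> E - (X \<union> insert x (fm_vars F'))" using infinite_imp_nonempty by blast
  let ?G = "fm_subst x (Var y) F'"
  have x: "x \<notin> bound_vars F'" "y \<notin> bound_vars F'" using F'(1) y bound_vars_subset by blast+
  have "P (Imp (All x F') (All y ?G))" using all_rename x y by simp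
  then have 1: "P (Imp (All x F) (All y ?G))" using imp_trans[OF mono[OF UNIV_I F'(4)]] by blast
  have "P (Imp (All y ?G) (All x (fm_subst y (Var x) ?G)))"
    by (rule all_rename) (use x y fm_subst_vars[OF x(1), of "Var y"] in auto)
  then have "P (Imp (All y ?G) (All x F'))" using x y by (simp add: fm_subst_back)
  then have 2: "P (Imp (All y ?G) (All x F))" using imp_trans[OF _ mono[OF UNIV_I F'(5)]] by blast
  show ?case
    by (rule exI[of _ "All y ?G"]) (use 1 2 F' x y in \<open>auto simp: free_vars_subst split: if_splits\<close>)
qed

end

interpretation PA: full_hilbert PA_provable
  by unfold_locales

section \<open>Structures\<close>

locale arith_structure =
  fixes zero :: 'a ("\<zero>") and one :: 'a ("\<one>")
    and add :: "'a => 'a => 'a" (infixl "\<oplus>" 65) and mult :: "'a => 'a => 'a" (infixl "\<otimes>" 70)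
begin

primrec tval :: "(nat => 'a) => tm => 'a" where
  "tval e (Var x) = e x"
| "tval e Zero = \<zero>"
| "tval e One = \<one>"
| "tval e (Plus s t) = tval e s \<oplus> tval e t"
| "tval e (Times s t) = tval e s \<otimes> tval e t"

primrec sat :: "(nat => 'a) => fm => bool" where
  "sat e (Eq s t) <-> tval e s = tval e t"
| "sat e (Neg F) <-> \<not> sat e F"
| "sat e (Imp F G) <-> (sat e F --> sat e G)"
| "sat e (All x F) <-> (\<forall>a. sat (e(x := a)) F)"

lemma tval_cong: "(\<And>x. x \<in> tm_vars t ==> e x = e' x) ==> tval e t = tval e' t"
  by (induction t) auto

lemma sat_cong: "(\<And>x. x \<in> free_vars F ==> e x = e' x) ==> sat e F = sat e' F"
proof (induction F arbitrary: e e')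
  case (Eq s t)
  have "tval e s = tval e' s" "tval e t = tval e' t"
    by (rule tval_cong, use Eq in auto)+
  then show ?case by simp
next
  case (Neg F)
  have "sat e F = sat e' F" by (rule Neg.IH) (use Neg.prems in auto)
  then show ?case by simp
next
  case (Imp F G)
  have "sat e F = sat e' F" by (rule Imp.IH(1)) (use Imp.prems in auto)
  moreover have "sat e G = sat e' G" by (rule Imp.IH(2)) (use Imp.prems in auto)
  ultimately show ?case by simp
next
  case (All x F)
  have "sat (e(x := a)) F = sat (e'(x := a)) F" for a
    by (rule All.IH) (use All.prems in auto)
  then show ?case by simp
qed

lemma tval_upd [simp]: "x \<notin> tm_vars t ==> tval (e(x := a)) t = tval e t"
  by (rule tval_cong) auto

lemma sat_upd: "x \<notin> free_vars F ==> sat (e(x := a)) F = sat e F"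
  by (rule sat_cong) auto

lemma sat_Ex [simp]: "sat e (Ex x F) <-> (\<exists>a. sat (e(x := a)) F)"
  and sat_Con [simp]: "sat e (Con F G) <-> sat e F \<and> sat e G"
  and sat_Dis [simp]: "sat e (Dis F G) <-> sat e F \<or> sat e G"
  by (auto simp: Ex_def Con_def Dis_def)

text \<open>Treating validity as one more calculus gives soundness axiom by axiom. It also makes the
  renaming of bound variables available for a structure that is not yet known to satisfy PA.\<close>

lemma full_hilbert_valid: "full_hilbert (%F. \<forall>e. sat e F)"
proof unfold_locales
  show "\<forall>e. sat e (Imp F (All x F))" if "x \<notin> fm_vars F" for x F
    using that by (simp add: sat_upd contra_subsetD[OF free_vars_subset])
next
  have "sat e F" if "\<forall>a. sat (e(x := a)) F" for e x F
    using spec[OF that, of "e x"] by simp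
  then show "\<forall>e. sat e (Imp (All x F) F)" for x F by simp
next
  show "\<forall>e. sat e (Neg (All x (Neg (Eq (Var x) t))))" if "x \<notin> tm_vars t" for x t
    using that by simp
qed (simp_all, blast)

lemma sat_PA:
  assumes "\<And>F e. PA_axiom F ==> sat e F" "PA_provable F"
  shows "sat e F"
proof -
  interpret full_hilbert "%F. \<forall>e. sat e F" by (rule full_hilbert_valid)
  obtain Fs where Fs: "PA_proof Fs F" using assms(2) unfolding PA_provable_def by blast
  have "\<forall>e. sat e (Fs ! i)" if "i < length Fs" for i
    using that
  proof (induction i rule: less_induct)
    case (less i)
    have "logic_axiom G ==> \<forall>e. sat e G" for G
      by (induction rule: logic_axiom.induct) (rule A1 A2 A3 AD AS[OF UNIV_I] AV AE ER ES EP ET; assumption?)+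
    moreover have "sat e (Fs ! i)" if "j < i" "k < i" "Fs ! j = Imp (Fs ! k) (Fs ! i)" for e j k
      using less.IH[OF that(1)] less.IH[OF that(2)] that less.prems by auto
    moreover have "sat e (Fs ! i)" if "j < i" "Fs ! i = All x (Fs ! j)" for e j x
      using less.IH[OF that(1)] that less.prems by auto
    ultimately show ?case
      using Fs less.prems assms(1) unfolding PA_proof_def by meson
  qed
  then show ?thesis using Fs unfolding PA_proof_def
    by (metis last_conv_nth diff_less length_greater_0_conv zero_less_one)
qed

end

section \<open>Completeness\<close>

primrec tm_ren :: "(nat => nat) => tm => tm" where
  "tm_ren \<sigma> (Var x) = Var (\<sigma> x)"
| "tm_ren \<sigma> Zero = Zero"
| "tm_ren \<sigma> One = One"
| "tm_ren \<sigma> (Plus s t) = Plus (tm_ren \<sigma> s) (tm_ren \<sigma> t)"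
| "tm_ren \<sigma> (Times s t) = Times (tm_ren \<sigma> s) (tm_ren \<sigma> t)"

primrec fm_ren :: "(nat => nat) => fm => fm" where
  "fm_ren \<sigma> (Eq s t) = Eq (tm_ren \<sigma> s) (tm_ren \<sigma> t)"
| "fm_ren \<sigma> (Neg F) = Neg (fm_ren \<sigma> F)"
| "fm_ren \<sigma> (Imp F G) = Imp (fm_ren \<sigma> F) (fm_ren \<sigma> G)"
| "fm_ren \<sigma> (All x F) = All x (fm_ren (\<sigma>(x := x)) F)"

lemma tm_ren_id: "(\<And>x. x \<in> tm_vars t ==> \<sigma> x = x) ==> tm_ren \<sigma> t = t"
  by (induction t) auto

lemma fm_ren_id: "(\<And>x. x \<in> free_vars F ==> \<sigma> x = x) ==> fm_ren \<sigma> F = F"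
  by (induction F arbitrary: \<sigma>) (auto simp: tm_ren_id)

lemma bound_vars_ren [simp]: "bound_vars (fm_ren \<sigma> F) = bound_vars F"
  by (induction F arbitrary: \<sigma>) auto

lemma tm_subst_ren:
  "(\<And>z. z \<in> tm_vars t ==> z ~= x ==> \<sigma> z ~= x) ==>
    tm_subst x (Var c) (tm_ren (\<sigma>(x := x)) t) = tm_ren (\<sigma>(x := c)) t"
  by (induction t) auto

lemma fm_subst_ren:
  "x \<notin> bound_vars F ==> (\<And>z. z \<in> free_vars F ==> z ~= x ==> \<sigma> z ~= x) ==>
    fm_subst x (Var c) (fm_ren (\<sigma>(x := x)) F) = fm_ren (\<sigma>(x := c)) F"
proof (induction F arbitrary: \<sigma>)
  case (All y F)
  have 1: "\<sigma>(x := d, y := y) = \<sigma>(y := y, x := d)" for d using All.prems(1) by (auto simp: fun_upd_twist)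
  have "fm_subst x (Var c) (fm_ren ((\<sigma>(y := y))(x := x)) F) = fm_ren ((\<sigma>(y := y))(x := c)) F"
    by (rule All.IH) (use All.prems in auto)
  then show ?case using All.prems(1) unfolding fm_ren.simps 1 by simp
qed (auto simp: tm_subst_ren)

fun closure :: "nat list => fm => fm" where
  "closure [] F = F"
| "closure (x # xs) F = All x (closure xs F)"

lemma closure_free: "free_vars (closure xs F) = free_vars F - set xs"
  by (induction xs) auto

lemma closure_PA: "PA_provable (closure xs F) ==> PA_provable F"
  by (induction xs) (auto dest: PA_MP[OF _ PA.AS[OF UNIV_I]])

lemma closure_provable: "PA_provable F ==> PA_provable (closure xs F)"
  by (induction xs) (auto intro: PA_Gen)

lemma (in arith_structure) sat_closure: "(\<And>e. sat e F) ==> sat e (closure xs F)"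
  by (induction xs arbitrary: e) auto

lemma (in arith_structure) sat_closure_open: "(\<And>e. sat e (closure xs F)) ==> sat e F"
proof (induction xs arbitrary: e)
  case (Cons x xs)
  then have "sat (e(x := e x)) (closure xs F)" for e by (simp del: fun_upd_triv)
  then show ?case using Cons.IH by simp
qed simp

section \<open>Henkin axioms and their conservativity\<close>

instance tm :: countable by countable_datatype
instance fm :: countable by countable_datatype

text \<open>Henkin witnesses are taken from the odd variables, bound variables from the even ones.\<close>

definition hvar :: "nat => nat" where
  "hvar n = 2 * (\<Sum>m\<le>n. Suc (\<Sum>(fm_vars (All (fst (from_nat m :: nat \<times> fm)) (snd (from_nat m :: nat \<times> fm)))))) + 1"

text \<open>The variable \<open>hvar n\<close> is to be a counterexample to \<open>All x F\<close>
  if there is one. Pairs of the wrong shape get the harmless \<open>Imp F F\<close>, which keeps the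
  enumeration total.\<close>

definition henkin :: "nat => fm" where
  "henkin n = (case from_nat n :: nat \<times> fm of (x, F) =>
    if even x \<and> x \<notin> bound_vars F \<and> bound_vars F \<subseteq> Collect even
    then Imp (fm_subst x (Var (hvar n)) F) (All x F) else Imp F F)"

lemma hvar_odd [simp]: "odd (hvar n)"
  by (simp add: hvar_def)

lemma hvar_mono: "m < n ==> hvar m < hvar n"
proof -
  have "hvar n < hvar (Suc n)" for n by (simp add: hvar_def)
  then show "m < n ==> hvar m < hvar n" using lift_Suc_mono_less[of hvar] by blast
qed

lemma hvar_fresh:
  assumes "(x, F) = from_nat m" "m \<le> n" "y \<in> insert x (fm_vars F)"
  shows "y < hvar n"
proof -
  have "y \<le> \<Sum>(insert x (fm_vars F))" using assms(3) by (intro member_le_sum) auto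
  also have "\<dots> < Suc (\<Sum>(fm_vars (All (fst (from_nat m :: nat \<times> fm)) (snd (from_nat m :: nat \<times> fm)))))"
    by (simp flip: assms(1))
  also have "\<dots> \<le> (\<Sum>m\<le>n. Suc (\<Sum>(fm_vars (All (fst (from_nat m :: nat \<times> fm)) (snd (from_nat m :: nat \<times> fm))))))"
    using assms(2) by (intro member_le_sum) auto
  finally show ?thesis unfolding hvar_def by linarith
qed

lemma henkin_vars:
  assumes "m < n"
  shows "hvar n \<notin> fm_vars (henkin m)"
proof -
  obtain x F where xF: "(x, F) = (from_nat m :: nat \<times> fm)" by (metis surj_pair)
  have 1: "hvar n \<notin> insert x (fm_vars F)" using hvar_fresh[OF xF] assms less_imp_le by blast
  have "hvar n ~= hvar m" using hvar_mono assms by (metis nat_less_le)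
  then show ?thesis using 1 fm_subst_vars[of x F "Var (hvar m)"]
    by (auto simp: henkin_def simp flip: xF)
qed

text \<open>The axioms are discharged from the last one downwards. If the conclusion
  \<open>?A\<close> fails, so does the axiom, hence its premise holds for the witness. The witness
  does not occur in \<open>?A\<close>, so it can be generalized and renamed to \<open>x\<close>,
  which makes the axiom true after all.\<close>

lemma henkin_conservative:
  assumes "\<And>n. odd n ==> n \<notin> fm_vars H" "PA.der (range henkin) H"
  shows "PA_provable H"
proof -
  have step: "PA.der (henkin ` {..<n}) H ==> PA_provable H" for n
  proof (induction n)
    case 0
    then show ?case by (simp add: PA.der_def)
  next
    case (Suc n)
    obtain x F where xF: "(x, F) = (from_nat n :: nat \<times> fm)" by (metis surj_pair)
    have "PA.der (insert (henkin n) (henkin ` {..<n})) H" using Suc.prems by (simp add: lessThan_Suc)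
    then have d: "PA.der (henkin ` {..<n}) (Imp (henkin n) H)" by (rule PA.deduction)
    show ?case
    proof (cases "even x \<and> x \<notin> bound_vars F \<and> bound_vars F \<subseteq> Collect even")
      case False
      then have "henkin n = Imp F F" by (auto simp: henkin_def simp flip: xF)
      then have "PA.der (henkin ` {..<n}) H"
        using PA.der_mp[OF d PA.der_P] PA.imp_refl by simp
      then show ?thesis by (rule Suc.IH)
    next
      case True
      let ?c = "hvar n" let ?D = "fm_subst x (Var ?c) F"
      have h: "henkin n = Imp ?D (All x F)" using True by (auto simp: henkin_def simp flip: xF)
      have c: "?c \<notin> insert x (fm_vars F)" using hvar_fresh[OF xF order_refl] by blast
      obtain Gs where Gs: "set Gs \<subseteq> henkin ` {..<n}" "PA_provable (foldr Imp Gs (Imp (henkin n) H))"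
        using d unfolding PA.der_def by blast
      let ?A = "foldr Imp Gs H"
      have "fm_vars (foldr Imp Gs H) = fm_vars H \<union> (\<Union>G\<in>set Gs. fm_vars G)" by (induction Gs) auto
      then have cA: "?c \<notin> fm_vars ?A" using Gs(1) henkin_vars assms(1) by auto
      have "PA_provable (Imp (Neg ?A) ?D)"
        by (rule PA.taut_from[of "[foldr Imp Gs (Imp (henkin n) H)]"])
          (use Gs in \<open>auto simp: h PA.val_foldr PA.val_simps\<close>)
      then have 1: "PA_provable (Imp (Neg ?A) (All ?c ?D))"
        by (rule PA.intro_all[OF UNIV_I]) (use cA in simp)
      have cb: "?c \<notin> bound_vars F" using c bound_vars_subset by blast
      have x: "x \<notin> bound_vars F" using True by simp
      have "fm_vars ?D \<subseteq> (fm_vars F - {x}) \<union> {?c}" using fm_subst_vars[OF x, of "Var ?c"] by simp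
      then have xD: "x \<notin> fm_vars ?D" using c by blast
      have sub_back: "fm_subst ?c (Var x) ?D = F" by (rule fm_subst_back) (use c x in simp_all)
      have "PA_provable (Imp (All ?c ?D) (All x (fm_subst ?c (Var x) ?D)))"
        by (rule PA.all_rename) (use cb xD in simp_all)
      then have 2: "PA_provable (Imp (All ?c ?D) (All x F))"
        unfolding sub_back .
      have "PA_provable ?A"
      proof (rule PA.MP[OF Gs(2) PA.MP[OF 1 PA.MP[OF 2 PA.taut]]])
        fix v assume v: "PA.val v"
        show "v (Imp (Imp (All ?c ?D) (All x F)) (Imp (Imp (Neg ?A) (All ?c ?D)) (Imp (foldr Imp Gs (Imp (henkin n) H)) ?A)))"
          unfolding h PA.val_foldr[OF v] PA.val_simps[OF v] by blast
      qed
      then have "PA.der (henkin ` {..<n}) H" using Gs(1) unfolding PA.der_def by blast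
      then show ?thesis by (rule Suc.IH)
    qed
  qed
  obtain Gs where Gs: "set Gs \<subseteq> range henkin" "PA_provable (foldr Imp Gs H)"
    using assms(2) unfolding PA.der_def by blast
  obtain N where N: "finite N" "set Gs = henkin ` N" using finite_subset_image[OF _ Gs(1)] by auto
  then have "set Gs \<subseteq> henkin ` {..<Suc (Max N)}" by (auto simp: less_Suc_eq_le)
  then have "PA.der (henkin ` {..<Suc (Max N)}) H" using Gs(2) unfolding PA.der_def by blast
  then show ?thesis by (rule step)
qed

text \<open>Serves the term model below, where a formula and its renamed variant must be equivalent
  both provably and in the model, with one and the same variant.\<close>

lemma full_hilbert_conj:
  assumes "full_hilbert P" "full_hilbert Q"
  shows "full_hilbert (%F. P F \<and> Q F)"
proof -
  interpret P: full_hilbert P by fact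
  interpret Q: full_hilbert Q by fact
  show ?thesis
  proof unfold_locales
    show "P F \<and> Q F ==> P (Imp F G) \<and> Q (Imp F G) ==> P G \<and> Q G" for F G
      using P.MP Q.MP by blast
    show "P F \<and> Q F ==> P (All x F) \<and> Q (All x F)" for x F
      using P.Gen Q.Gen by blast
  qed (rule conjI; rule P.A1 Q.A1 P.A2 Q.A2 P.A3 Q.A3 P.AD Q.AD P.AS Q.AS P.AV Q.AV P.AE Q.AE P.ER Q.ER
    P.ES Q.ES P.EP Q.EP P.ET Q.ET; assumption?)+
qed

text \<open>Henkin's term model: the odd variables modulo the equations that a Lindenbaum valuation
  makes true. The carrier is \<open>nat\<close> because a statement cannot quantify over types; the
  quotient can be numbered since it is infinite, the numerals being pairwise distinct.\<close>

theorem completeness: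
  assumes valid: "\<And>(zero :: nat) one add mult.
    (\<And>F e. PA_axiom F ==> arith_structure.sat zero one add mult e F) ==>
    (\<And>e. arith_structure.sat zero one add mult e H)"
  shows "PA_provable H"
proof (rule ccontr)
  let ?odd = "Collect odd :: nat set" and ?even = "Collect even :: nat set"
  assume "\<not> PA_provable H"
  define K where "K = closure (sorted_list_of_set (free_vars H)) H"
  have K: "\<not> PA_provable K" "free_vars K = {}"
    using \<open>\<not> PA_provable H\<close> closure_PA closure_free unfolding K_def by auto
  have inf: "infinite ?even"
    by (rule infinite_super[OF _ range_inj_infinite[of "%n::nat. 2 * n"]]) (auto simp: inj_def)
  \<comment> \<open>Bound variables have to be even, as the witnesses are odd, and must not be
    nested; the truth claim below covers only such formulas.\<close>
  obtain K' where K': "bound_vars K' \<subseteq> ?even" "nice K'" "free_vars K' = {}"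
    "PA_provable (Imp K K')" "PA_provable (Imp K' K)"
    using PA.rename_bound[OF inf, of "{}" K] K(2) by auto
  have "\<not> PA_provable K'" using K'(5) K(1) PA_MP by blast
  moreover have "\<And>n. odd n ==> n \<notin> fm_vars K'" using K'(1,3) by (auto simp: fm_vars_eq)
  ultimately have "\<not> PA.der (range henkin) K'" using henkin_conservative by blast
  then obtain v where v: "PA.val v" "\<And>G. PA.der (range henkin) G ==> v G" "\<not> v K'"
    using PA.val_exists by metis
  note [simp] = PA.val_simps[OF v(1)]
  have vP: "v F" if "PA_provable F" for F using v(2) PA.der_P that by blast
  have hen: "\<exists>c. odd c \<and> (v (fm_subst x (Var c) F) --> v (All x F))"
    if "even x" "x \<notin> bound_vars F" "bound_vars F \<subseteq> ?even" for x F
  proof -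
    have "v (henkin (to_nat (x, F)))" by (rule v(2)) (simp add: PA.der_in)
    then show ?thesis using that by (intro exI[of _ "hvar (to_nat (x, F))"]) (auto simp: henkin_def)
  qed
  define eqv where "eqv s t = v (Eq s t)" for s t
  have refl: "eqv t t" for t unfolding eqv_def by (rule vP[OF PA.ER])
  have sym: "eqv s t ==> eqv t s" for s t using vP[OF PA.Eq_sym, of s t] unfolding eqv_def by simp
  have trans: "eqv s t ==> eqv t r ==> eqv s r" for s t r
    using vP[OF PA.Eq_trans, of s t r] unfolding eqv_def by simp
  have plus: "eqv s t ==> eqv s' t' ==> eqv (Plus s s') (Plus t t')" for s t s' t'
    using vP[OF PA.EP, of s t s' t'] unfolding eqv_def by simp
  have times: "eqv s t ==> eqv s' t' ==> eqv (Times s s') (Times t t')" for s t s' t'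
    using vP[OF PA.ET, of s t s' t'] unfolding eqv_def by simp
  have witness: "\<exists>c. odd c \<and> eqv (Var c) t" for t
  proof -
    have "infinite (?even - tm_vars t)" using inf by simp
    then obtain x where x: "even x" "x \<notin> tm_vars t" using infinite_imp_nonempty by blast
    obtain c where c: "odd c" "v (fm_subst x (Var c) (Neg (Eq (Var x) t))) --> v (All x (Neg (Eq (Var x) t)))"
      using hen[of x "Neg (Eq (Var x) t)"] x(1) by auto
    have "\<not> v (All x (Neg (Eq (Var x) t)))" using vP[OF PA.AE[OF x(2)]] by simp
    then have "eqv (Var c) t" using c(2) x(2) by (simp add: eqv_def)
    then show ?thesis using c(1) by blast
  qed
  \<comment> \<open>Each class is represented by its least odd variable; \<open>nm\<close> and
    \<open>el\<close> below pass between these representatives and the carrier.\<close>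
  define rep where "rep t = (LEAST c. odd c \<and> eqv (Var c) t)" for t
  have rep: "odd (rep t)" "eqv (Var (rep t)) t" for t
    using LeastI_ex[OF witness[of t]] unfolding rep_def by simp_all
  have rep_eq: "rep s = rep t <-> eqv s t" for s t
  proof
    show "eqv s t" if "rep s = rep t" using rep(2)[of s] rep(2)[of t] that sym trans by metis
    have "eqv (Var c) s <-> eqv (Var c) t" if "eqv s t" for c using that sym trans by blast
    then show "rep s = rep t" if "eqv s t" using that unfolding rep_def by simp
  qed
  define num where "num n = ((%t. Plus t One) ^^ n) Zero" for n :: nat
  have num_vars: "tm_vars (num n) = {}" for n by (induction n) (auto simp: num_def)
  have num_inj: "\<not> eqv (num m) (num n)" if "m < n" for m n
    using that
  proof (induction m arbitrary: n)
    case 0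
    then obtain k where k: "n = Suc k" by (cases n) auto
    have "PA_provable (All 0 (Neg (Eq (Plus (Var 0) One) Zero)))"
      by (rule PA_ax) (simp add: PA_axiom_def Q_axioms_def)
    moreover have "PA_provable (Imp (All 0 (Neg (Eq (Plus (Var 0) One) Zero))) (Neg (Eq (num n) Zero)))"
      using PA.all_inst[of "Neg (Eq (Plus (Var 0) One) Zero)" 0 "num k"] num_vars by (simp add: k num_def)
    ultimately have "v (Neg (Eq (num n) Zero))" using PA_MP vP by blast
    then show ?case using sym by (auto simp: eqv_def num_def)
  next
    case (Suc m)
    then obtain k where k: "n = Suc k" "m < k" by (cases n) auto
    let ?F = "Imp (Eq (Plus (Var 0) One) (Plus (Var 1) One)) (Eq (Var 0) (Var 1))"
    have "PA_provable (All 0 (All 1 ?F))" by (rule PA_ax) (simp add: PA_axiom_def Q_axioms_def)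
    moreover have "PA_provable (Imp (All 0 (All 1 ?F)) (fm_subst 0 (num m) (All 1 ?F)))"
      by (rule PA.all_inst) (use num_vars in auto)
    moreover have "PA_provable (Imp (fm_subst 0 (num m) (All 1 ?F)) (fm_subst 1 (num k) (fm_subst 0 (num m) ?F)))"
      using PA.all_inst[of "fm_subst 0 (num m) ?F" 1 "num k"] num_vars by simp
    ultimately have "v (fm_subst 1 (num k) (fm_subst 0 (num m) ?F))" using PA_MP vP by blast
    then have "eqv (num (Suc m)) n' ==> n' = num (Suc k) ==> eqv (num m) (num k)" for n'
      using num_vars by (simp add: eqv_def num_def)
    then show ?case using Suc.IH[OF k(2)] k(1) by blast
  qed
  have "inj (%n. rep (num n))"
    using num_inj sym by (intro injI) (metis linorder_neqE_nat rep_eq)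
  then have "infinite (range rep)"
    using range_inj_infinite infinite_super[of "range (%n. rep (num n))" "range rep"] by blast
  then obtain nm where nm: "bij_betw nm (UNIV :: nat set) (range rep)" using bij_enumerate by blast
  have "\<exists>n. nm n = rep t" for t using nm unfolding bij_betw_def by (metis rangeI rangeE)
  then obtain el where el: "\<And>t. nm (el t) = rep t" by metis
  have nm_inj: "nm m = nm n ==> m = n" for m n using nm unfolding bij_betw_def inj_def by blast
  have nm_rep: "nm n = rep (Var (nm n))" for n
  proof -
    obtain t where t: "nm n = rep t" using nm unfolding bij_betw_def by blast
    then show ?thesis using rep(2)[of t] rep_eq[of "Var (rep t)" t] by simp
  qed
  have nm_odd: "odd (nm n)" for n using nm_rep rep(1) by metis
  have el_eq: "el s = el t <-> eqv s t" for s t using el nm_inj rep_eq by metis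
  have el_nm: "el (Var (nm n)) = n" for n using el nm_rep nm_inj by metis
  have el_eqv: "eqv (Var (nm (el t))) t" for t using el rep(2) by metis
  define add where "add a b = el (Plus (Var (nm a)) (Var (nm b)))" for a b
  define mult where "mult a b = el (Times (Var (nm a)) (Var (nm b)))" for a b
  have add: "add (el s) (el t) = el (Plus s t)" and mult: "mult (el s) (el t) = el (Times s t)" for s t
    unfolding add_def mult_def el_eq by (intro plus times el_eqv)+
  interpret M: arith_structure "el Zero" "el One" add mult .
  have tval: "M.tval e t = el (tm_ren (%x. nm (e x)) t)" for e t
    by (induction t) (simp_all add: el_nm add mult)
  have truth: "M.sat e F <-> v (fm_ren (%x. nm (e x)) F)" if "nice F" "bound_vars F \<subseteq> ?even" for e F
    using that
  proof (induction F arbitrary: e)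
    case (Eq s t)
    then show ?case by (simp add: tval el_eq eqv_def)
  next
    case (All x F)
    let ?\<sigma> = "%x. nm (e x)"
    let ?D = "fm_ren (?\<sigma>(x := x)) F"
    have x: "even x" "x \<notin> bound_vars ?D" "bound_vars ?D \<subseteq> ?even" using All.prems by auto
    have ne: "x ~= c" "c ~= x" if "odd c" for c using that x(1) by auto
    have inst: "fm_ren (?\<sigma>(x := c)) F = fm_subst x (Var c) ?D" for c
      by (rule fm_subst_ren[symmetric]) (use All.prems(1) ne(2)[OF nm_odd] in auto)
    have upd: "(%y. nm ((e(x := a)) y)) = ?\<sigma>(x := nm a)" for a by auto
    have "M.sat e (All x F) <-> (\<forall>a. v (fm_subst x (Var (nm a)) ?D))"
    proof -
      have "M.sat (e(x := a)) F <-> v (fm_subst x (Var (nm a)) ?D)" for a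
      proof -
        have "M.sat (e(x := a)) F <-> v (fm_ren (%y. nm ((e(x := a)) y)) F)"
          by (rule All.IH) (use All.prems in auto)
        also have "fm_ren (%y. nm ((e(x := a)) y)) F = fm_subst x (Var (nm a)) ?D"
          by (subst inst[symmetric], subst upd) (rule HOL.refl)
        finally show ?thesis .
      qed
      then show ?thesis by simp
    qed
    also have "\<dots> <-> v (All x ?D)"
    proof
      assume *: "\<forall>a. v (fm_subst x (Var (nm a)) ?D)"
      \<comment> \<open>The Henkin witness \<open>c\<close> need not be a representative, so the
        assumption is used for its representative \<open>?d\<close> and carried over by substitution
        of equals.\<close>
      obtain c where c: "odd c" "v (fm_subst x (Var c) ?D) --> v (All x ?D)" using hen x by blast
      let ?d = "nm (el (Var c))"
      have "PA_provable (Imp (Eq (Var c) (Var ?d)) (Imp (fm_subst x (Var ?d) ?D) (fm_subst x (Var c) ?D)))"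
        by (rule PA.Eq_subst) (use x c(1) nm_odd ne in auto)
      then have "eqv (Var c) (Var ?d) ==> v (fm_subst x (Var ?d) ?D) ==> v (fm_subst x (Var c) ?D)"
        using vP unfolding eqv_def by fastforce
      then show "v (All x ?D)" using * c(2) el_eqv sym by blast
    next
      assume *: "v (All x ?D)"
      have "PA_provable (Imp (All x ?D) (fm_subst x (Var (nm a)) ?D))" for a
        by (rule PA.all_inst) (use x nm_odd[of a] ne in auto)
      then show "\<forall>a. v (fm_subst x (Var (nm a)) ?D)" using vP * by fastforce
    qed
    finally show ?case by simp
  qed simp_all
  have "M.sat e F" if "PA_axiom F" for e F
  proof -
    \<comment> \<open>The axioms may have odd bound variables. Their closures are renamed by an
      equivalence that is both provable and valid in the model: provability makes the variant true
      under \<open>v\<close>, and validity leads back to the axiom.\<close>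
    let ?P = "%F. PA_provable F \<and> (\<forall>e. M.sat e F)"
    interpret V: full_hilbert "%F. \<forall>e. M.sat e F" by (rule M.full_hilbert_valid)
    interpret PV: full_hilbert ?P
      by (rule full_hilbert_conj[OF PA.full_hilbert_axioms V.full_hilbert_axioms])
    define L where "L = closure (sorted_list_of_set (free_vars F)) F"
    have L: "free_vars L = {}" "PA_provable L"
      using PA_ax that closure_free unfolding L_def by (auto intro: closure_provable)
    obtain L' where L': "bound_vars L' \<subseteq> ?even" "nice L'" "free_vars L' = {}"
      "?P (Imp L L')" "?P (Imp L' L)" using PV.rename_bound[OF inf, of "{}" L] L(1) by auto
    have "v L'" using L'(4) L(2) PA_MP vP by blast
    then have "M.sat e L'" for e using truth[OF L'(2,1)] fm_ren_id[of L'] L'(3) by simp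
    then have "M.sat e L" for e using L'(5) by simp
    then show ?thesis using M.sat_closure_open unfolding L_def by blast
  qed
  note PA = this
  then have "M.sat e H" for e by (rule valid)
  then have "M.sat e K" for e using M.sat_closure unfolding K_def by blast
  then have "M.sat e K'" for e using M.sat_PA[OF PA K'(4)] by simp
  then show False using truth[OF K'(2,1)] fm_ren_id[of K'] K'(3) v(3) by simp
qed

section \<open>Models of PA and definability\<close>

text \<open>
  \<open>Dfn\<close> is a class of predicates on environments to which induction applies: the predicates that are
  definable with parameters in a model, or all predicates on the standard model.  The environment is
  a stack, with the innermost bound variable in position 0.
\<close>

named_theorems dfn

locale pa_model = arith_structure zero one add mult
  for zero :: 'a ("\<zero>") and one :: 'a ("\<one>")
    and add :: "'a => 'a => 'a" (infixl "\<oplus>" 65) and mult :: "'a => 'a => 'a" (infixl "\<otimes>" 70) +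
  fixes Dfn :: "((nat => 'a) => bool) => bool"
  assumes axioms: "PA_axiom F ==> sat e F"
    and Dfn_sat: "Dfn (%e. sat e F)"
    and Dfn_not [dfn]: "Dfn \<Phi> ==> Dfn (%e. \<not> \<Phi> e)"
    and Dfn_imp [dfn]: "Dfn \<Phi> ==> Dfn \<Psi> ==> Dfn (%e. \<Phi> e --> \<Psi> e)"
    and Dfn_all [dfn]: "Dfn (%e. \<Theta> (%n. e (Suc n)) (e 0)) ==> Dfn (%e. \<forall>a. \<Theta> e a)"
    and Dfn_param: "Dfn (%e. \<Theta> (%n. e (Suc n)) (e 0)) ==> Dfn (%e. \<Theta> e c)"
    and Dfn_ren: "Dfn \<Phi> ==> Dfn (%e. \<Phi> (%n. e (r n)))"
    and ind: "Dfn (%e. P (e 0)) ==> P \<zero> ==> (\<And>a. P a ==> P (a \<oplus> \<one>)) ==> P a"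
begin

definition dft :: "((nat => 'a) => 'a) => bool" where
  "dft t <-> Dfn (%e. e 0 = t (%n. e (Suc n)))"

lemma Dfn_conj [dfn]: "Dfn \<Phi> ==> Dfn \<Psi> ==> Dfn (%e. \<Phi> e \<and> \<Psi> e)"
  using Dfn_not[OF Dfn_imp[OF _ Dfn_not]] by fastforce

lemma Dfn_disj [dfn]: "Dfn \<Phi> ==> Dfn \<Psi> ==> Dfn (%e. \<Phi> e \<or> \<Psi> e)"
  using Dfn_imp[OF Dfn_not] by (simp flip: imp_conv_disj add: disj_imp)

lemma Dfn_iff [dfn]: "Dfn \<Phi> ==> Dfn \<Psi> ==> Dfn (%e. \<Phi> e <-> \<Psi> e)"
  using Dfn_conj[OF Dfn_imp Dfn_imp] by (simp add: iff_conv_conj_imp)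

lemma Dfn_ex [dfn]: "Dfn (%e. \<Theta> (%n. e (Suc n)) (e 0)) ==> Dfn (%e. \<exists>a. \<Theta> e a)"
  using Dfn_not[OF Dfn_all[OF Dfn_not]] by fastforce

lemma dft_ren: "dft t ==> dft (%e. t (%n. e (r n)))"
  unfolding dft_def by (drule Dfn_ren[where r = "%n. case n of 0 => 0 | Suc m => Suc (r m)"]) simp

lemma dft_var [dfn]: "dft (%e. e n)"
  unfolding dft_def using Dfn_sat[of "Eq (Var 0) (Var (Suc n))"] by simp

lemma Dfn_subst: "Dfn (%e. \<Theta> (%n. e (Suc n)) (e 0)) ==> dft t ==> Dfn (%e. \<Theta> e (t e))"
proof -
  assume "Dfn (%e. \<Theta> (%n. e (Suc n)) (e 0))" "dft t"
  then have "Dfn (%e. \<exists>a. a = t e \<and> \<Theta> e a)" unfolding dft_def by (intro Dfn_ex Dfn_conj)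
  then show ?thesis by simp
qed

lemma dft_const [dfn]: "dft (%e. c)"
  unfolding dft_def
  by (rule Dfn_param[of "%e a. e 0 = a"]) (use Dfn_sat[of "Eq (Var (Suc 0)) (Var 0)"] in simp)

lemma Dfn_const [dfn]: "Dfn (%e. b)"
  using Dfn_sat[of "Eq Zero Zero"] Dfn_not[OF Dfn_sat[of "Eq Zero Zero"]] by (cases b) simp_all

lemma Dfn1: "Dfn (%e. P (e 0)) ==> dft t ==> Dfn (%e. P (t e))"
  by (rule Dfn_subst)

lemma Dfn2: "Dfn (%e. P (e 0) (e 1)) ==> dft s ==> dft t ==> Dfn (%e. P (s e) (t e))"
proof -
  assume P: "Dfn (%e. P (e 0) (e 1))" and t: "dft s" "dft t"
  have "Dfn (%e. P (e 0) (t (%n. e (Suc n))))"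
    by (rule Dfn_subst[OF _ dft_ren[OF t(2)]])
      (use Dfn_ren[OF P, of "%n. case n of 0 => 1 | Suc _ => 0"] in simp)
  then show ?thesis by (rule Dfn_subst[OF _ t(1)])
qed

lemma Dfn3:
  "Dfn (%e. P (e 0) (e 1) (e 2)) ==> dft s ==> dft t ==> dft u ==> Dfn (%e. P (s e) (t e) (u e))"
proof -
  assume P: "Dfn (%e. P (e 0) (e 1) (e 2))" and t: "dft s" "dft t" "dft u"
  let ?r = "%n::nat. if n = 0 then 2 else if n = 1 then 1 else 0 :: nat"
  have "Dfn (%e. P (e (Suc 0)) (e 0) (u (%n. e (Suc (Suc n)))))"
    by (rule Dfn_subst[OF _ dft_ren[OF t(3)]])
      (use Dfn_ren[OF P, of ?r] in \<open>simp add: numeral_2_eq_2\<close>)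
  then have "Dfn (%e. P (e 0) (t (%n. e (Suc n))) (u (%n. e (Suc n))))"
    by (rule Dfn_subst[OF _ dft_ren[OF t(2)]])
  then show ?thesis by (rule Dfn_subst[OF _ t(1)])
qed

lemma Dfn_eq [dfn]: "dft s ==> dft t ==> Dfn (%e. s e = t e)"
  by (rule Dfn2[of "(=)"]) (use Dfn_sat[of "Eq (Var 0) (Var 1)"] in simp)

lemma dft1: "dft (%e. f (e 0)) ==> dft t ==> dft (%e. f (t e))"
  unfolding dft_def[of "%e. f (t e)"]
  by (rule Dfn2[of "%a b. a = f b"]) (auto simp: dft_def[of "%e. f (e 0)"] intro: dfn dft_ren)

lemma dft2: "dft (%e. f (e 0) (e 1)) ==> dft s ==> dft t ==> dft (%e. f (s e) (t e))"
  unfolding dft_def[of "%e. f (s e) (t e)"]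
  by (rule Dfn3[of "%a b c. a = f b c"])
    (auto simp: dft_def[of "%e. f (e 0) (e 1)"] numeral_2_eq_2 intro: dfn dft_ren)

lemma dft_add [dfn]: "dft s ==> dft t ==> dft (%e. s e \<oplus> t e)"
  by (rule dft2) (use Dfn_sat[of "Eq (Var 0) (Plus (Var 1) (Var 2))"] in \<open>simp_all add: dft_def numeral_2_eq_2\<close>)

lemma dft_mult [dfn]: "dft s ==> dft t ==> dft (%e. s e \<otimes> t e)"
  by (rule dft2) (use Dfn_sat[of "Eq (Var 0) (Times (Var 1) (Var 2))"] in \<open>simp_all add: dft_def numeral_2_eq_2\<close>)

lemma Dfn_formula2: "(\<And>e. sat e F <-> P (e 0) (e 1)) ==> dft s ==> dft t ==> Dfn (%e. P (s e) (t e))"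
  using Dfn2[of P s t] Dfn_sat[of F] by simp

section \<open>Arithmetic in a model\<close>

lemma Q_ax: "F \<in> set Q_axioms ==> sat e F"
  by (rule axioms) (simp add: PA_axiom_def)

lemma
  succ_not_zero: "a \<oplus> \<one> ~= \<zero>" and
  succ_inj: "a \<oplus> \<one> = b \<oplus> \<one> <-> a = b" and
  cases_zero: "a ~= \<zero> ==> \<exists>b. a = b \<oplus> \<one>" and
  add_zero: "a \<oplus> \<zero> = a" and
  add_succ: "a \<oplus> (b \<oplus> \<one>) = (a \<oplus> b) \<oplus> \<one>" and
  mult_zero: "a \<otimes> \<zero> = \<zero>" and
  mult_succ: "a \<otimes> (b \<oplus> \<one>) = a \<otimes> b \<oplus> a"
proof -
  have "\<forall>F\<in>set Q_axioms. sat (%_. \<zero>) F" using Q_ax by blast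
  then have Q: "(\<forall>a. a \<oplus> \<one> ~= \<zero>) \<and> (\<forall>a b. a \<oplus> \<one> = b \<oplus> \<one> --> a = b) \<and> (\<forall>a. a ~= \<zero> --> (\<exists>b. a = b \<oplus> \<one>)) \<and>
    (\<forall>a. a \<oplus> \<zero> = a) \<and> (\<forall>a b. a \<oplus> (b \<oplus> \<one>) = (a \<oplus> b) \<oplus> \<one>) \<and> (\<forall>a. a \<otimes> \<zero> = \<zero>) \<and>
    (\<forall>a b. a \<otimes> (b \<oplus> \<one>) = a \<otimes> b \<oplus> a)"
    by (simp only: Q_axioms_def list.set ball_simps sat.simps sat_Ex tval.simps fun_upd_apply if_True if_False
      zero_neq_one one_neq_zero list.simps simp_thms) blast
  show "a \<oplus> \<one> ~= \<zero>" "a \<oplus> \<one> = b \<oplus> \<one> <-> a = b" "a ~= \<zero> ==> \<exists>b. a = b \<oplus> \<one>" "a \<oplus> \<zero> = a"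
    "a \<oplus> (b \<oplus> \<one>) = (a \<oplus> b) \<oplus> \<one>" "a \<otimes> \<zero> = \<zero>" "a \<otimes> (b \<oplus> \<one>) = a \<otimes> b \<oplus> a"
    using Q by blast+
qed

lemma add_assoc': "(a \<oplus> b) \<oplus> c = a \<oplus> (b \<oplus> c)"
proof (induction c rule: ind)
  show "Dfn (%e. (a \<oplus> b) \<oplus> e 0 = a \<oplus> (b \<oplus> e 0))" by (intro dfn)
qed (simp_all add: add_zero add_succ)

lemma zero_add: "\<zero> \<oplus> a = a"
proof (induction a rule: ind)
  show "Dfn (%e. \<zero> \<oplus> e 0 = e 0)" by (intro dfn)
qed (simp_all add: add_zero add_succ)

lemma succ_add: "(a \<oplus> \<one>) \<oplus> b = (a \<oplus> b) \<oplus> \<one>"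
proof (induction b rule: ind)
  show "Dfn (%e. (a \<oplus> \<one>) \<oplus> e 0 = (a \<oplus> e 0) \<oplus> \<one>)" by (intro dfn)
qed (simp_all add: add_zero add_succ)

lemma add_comm': "a \<oplus> b = b \<oplus> a"
proof (induction b rule: ind)
  show "Dfn (%e. a \<oplus> e 0 = e 0 \<oplus> a)" by (intro dfn)
qed (simp_all add: add_zero zero_add add_succ succ_add)

lemma add_cancel: "a \<oplus> c = b \<oplus> c <-> a = b"
proof (induction c rule: ind)
  show "Dfn (%e. a \<oplus> e 0 = b \<oplus> e 0 <-> a = b)" by (intro dfn)
qed (simp_all add: add_zero add_succ succ_inj)

lemma add_left_comm': "a \<oplus> (b \<oplus> c) = b \<oplus> (a \<oplus> c)"
  by (simp only: add_assoc'[symmetric] add_comm'[of a b])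

lemma distrib_left': "a \<otimes> (b \<oplus> c) = a \<otimes> b \<oplus> a \<otimes> c"
proof (induction c rule: ind)
  show "Dfn (%e. a \<otimes> (b \<oplus> e 0) = a \<otimes> b \<oplus> a \<otimes> e 0)" by (intro dfn)
  show "a \<otimes> (b \<oplus> (c \<oplus> \<one>)) = a \<otimes> b \<oplus> a \<otimes> (c \<oplus> \<one>)" if "a \<otimes> (b \<oplus> c) = a \<otimes> b \<oplus> a \<otimes> c" for c
    by (simp only: add_succ mult_succ that) (rule add_assoc')
qed (simp add: add_zero mult_zero)

lemma mult_one: "a \<otimes> \<one> = a"
  using mult_succ[of a \<zero>] by (simp add: mult_zero zero_add)

lemma mult_assoc': "(a \<otimes> b) \<otimes> c = a \<otimes> (b \<otimes> c)"
proof (induction c rule: ind)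
  show "Dfn (%e. (a \<otimes> b) \<otimes> e 0 = a \<otimes> (b \<otimes> e 0))" by (intro dfn)
  show "(a \<otimes> b) \<otimes> (c \<oplus> \<one>) = a \<otimes> (b \<otimes> (c \<oplus> \<one>))" if "(a \<otimes> b) \<otimes> c = a \<otimes> (b \<otimes> c)" for c
  proof -
    have "(a \<otimes> b) \<otimes> (c \<oplus> \<one>) = a \<otimes> (b \<otimes> c) \<oplus> a \<otimes> b" using mult_succ that by simp
    also have "\<dots> = a \<otimes> (b \<otimes> c \<oplus> b)" by (rule distrib_left'[symmetric])
    also have "b \<otimes> c \<oplus> b = b \<otimes> (c \<oplus> \<one>)" by (rule mult_succ[symmetric])
    finally show ?thesis .
  qed
qed (simp add: mult_zero)

lemma zero_mult: "\<zero> \<otimes> a = \<zero>"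
proof (induction a rule: ind)
  show "Dfn (%e. \<zero> \<otimes> e 0 = \<zero>)" by (intro dfn)
qed (simp_all add: mult_zero mult_succ add_zero)

lemma succ_mult: "(a \<oplus> \<one>) \<otimes> b = a \<otimes> b \<oplus> b"
proof (induction b rule: ind)
  show "Dfn (%e. (a \<oplus> \<one>) \<otimes> e 0 = a \<otimes> e 0 \<oplus> e 0)" by (intro dfn)
next
  fix b assume IH: "(a \<oplus> \<one>) \<otimes> b = a \<otimes> b \<oplus> b"
  show "(a \<oplus> \<one>) \<otimes> (b \<oplus> \<one>) = a \<otimes> (b \<oplus> \<one>) \<oplus> (b \<oplus> \<one>)"
    by (simp add: mult_succ IH add_assoc' add_left_comm'[of b])
qed (simp add: mult_zero add_zero)

lemma mult_comm': "a \<otimes> b = b \<otimes> a"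
proof (induction b rule: ind)
  show "Dfn (%e. a \<otimes> e 0 = e 0 \<otimes> a)" by (intro dfn)
qed (simp_all add: mult_zero zero_mult mult_succ succ_mult)

definition le :: "'a => 'a => bool" (infix "\<sqsubseteq>" 50) where "a \<sqsubseteq> b <-> (\<exists>c. c \<oplus> a = b)"
definition less :: "'a => 'a => bool" (infix "\<sqsubset>" 50) where "a \<sqsubset> b <-> a \<sqsubseteq> b \<and> a ~= b"
definition minus :: "'a => 'a => 'a" (infixl "\<ominus>" 65) where
  "a \<ominus> b = (if b \<sqsubseteq> a then THE c. c \<oplus> b = a else \<zero>)"

lemma Dfn_le [dfn]: "dft s ==> dft t ==> Dfn (%e. s e \<sqsubseteq> t e)"
  by (rule Dfn2[of "(\<sqsubseteq>)"]) (simp_all add: le_def, intro dfn)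

lemma Dfn_less [dfn]: "dft s ==> dft t ==> Dfn (%e. s e \<sqsubset> t e)"
  unfolding less_def by (intro dfn)

lemma add_minus: "(a \<oplus> b) \<ominus> b = a"
  unfolding minus_def le_def using add_cancel by auto

lemma add_eq_zero: "a \<oplus> b = \<zero> <-> a = \<zero> \<and> b = \<zero>"
proof (cases "b = \<zero>")
  case False
  then obtain c where "b = c \<oplus> \<one>" using cases_zero by blast
  then show ?thesis by (simp add: add_succ succ_not_zero)
qed (simp add: add_zero)

lemma le_linear': "a \<sqsubseteq> b \<or> b \<sqsubseteq> a"
proof (induction b rule: ind)
  show "Dfn (%e. a \<sqsubseteq> e 0 \<or> e 0 \<sqsubseteq> a)" by (intro dfn)
  show "a \<sqsubseteq> \<zero> \<or> \<zero> \<sqsubseteq> a" by (auto simp: le_def add_zero)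
next
  fix b assume "a \<sqsubseteq> b \<or> b \<sqsubseteq> a"
  then consider c where "c \<oplus> a = b" | c where "c \<oplus> b = a" unfolding le_def by blast
  then show "a \<sqsubseteq> b \<oplus> \<one> \<or> b \<oplus> \<one> \<sqsubseteq> a"
  proof cases
    case 1
    then have "(c \<oplus> \<one>) \<oplus> a = b \<oplus> \<one>" by (simp add: succ_add)
    then show ?thesis unfolding le_def by blast
  next
    case 2
    show ?thesis
    proof (cases "c = \<zero>")
      case True
      then have "\<one> \<oplus> a = b \<oplus> \<one>" using 2 by (simp add: zero_add add_zero add_comm')
      then show ?thesis unfolding le_def by blast
    next
      case False
      then obtain d where "c = d \<oplus> \<one>" using cases_zero by blast
      then have "d \<oplus> (b \<oplus> \<one>) = a" using 2 by (simp add: add_succ succ_add)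
      then show ?thesis unfolding le_def by blast
    qed
  qed
qed

lemma le_antisym': "a \<sqsubseteq> b ==> b \<sqsubseteq> a ==> a = b"
proof -
  assume "a \<sqsubseteq> b" "b \<sqsubseteq> a"
  then obtain c d where c: "c \<oplus> a = b" "d \<oplus> b = a" unfolding le_def by blast
  then have "(d \<oplus> c) \<oplus> a = \<zero> \<oplus> a" by (simp add: add_assoc' zero_add)
  then have "d \<oplus> c = \<zero>" by (simp only: add_cancel)
  then show ?thesis using c by (simp add: add_eq_zero zero_add)
qed

lemma le_trans': "a \<sqsubseteq> b ==> b \<sqsubseteq> c ==> a \<sqsubseteq> c"
  unfolding le_def by (auto simp flip: add_assoc')

lemma mult_strict_mono': "a \<sqsubset> b ==> \<zero> \<sqsubset> c ==> c \<otimes> a \<sqsubset> c \<otimes> b"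
proof -
  assume a: "a \<sqsubset> b" and c: "\<zero> \<sqsubset> c"
  then obtain d where d: "d \<oplus> a = b" "d ~= \<zero>" unfolding less_def le_def by (metis zero_add)
  then obtain d' where d': "d = d' \<oplus> \<one>" using cases_zero by blast
  have cn: "c ~= \<zero>" using c unfolding less_def by blast
  have eq: "c \<otimes> b = c \<otimes> d \<oplus> c \<otimes> a" by (simp add: distrib_left' flip: d(1))
  have "c \<otimes> d ~= \<zero>" using cn by (simp add: d' mult_succ add_eq_zero)
  then have "c \<otimes> b ~= c \<otimes> a" using eq add_cancel[of "c \<otimes> d" "c \<otimes> a" \<zero>] by (simp add: zero_add)
  then show ?thesis unfolding less_def le_def using eq by auto
qed

lemma minus_zero: "\<not> b \<sqsubseteq> a ==> a \<ominus> b = \<zero>"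
  by (simp add: minus_def)

lemma zero_minus: "\<zero> \<ominus> c = \<zero>"
  using add_minus[of \<zero> \<zero>] by (cases "c = \<zero>") (auto simp: minus_def le_def add_zero add_eq_zero)

text \<open>Stated as a predicate on the operations of the model, the class makes the library facts
  on ordered semirings available by local interpretation.\<close>

lemma linordered_semidom: "class.linordered_semidom add minus le less zero mult one"
proof unfold_locales
  show "a \<oplus> b \<ominus> a = b" for a b using add_minus[of b a] by (simp add: add_comm')
  show "a \<ominus> b \<ominus> c = a \<ominus> (b \<oplus> c)" for a b c
  proof (cases "b \<oplus> c \<sqsubseteq> a")
    case True
    then obtain d where d: "d \<oplus> (b \<oplus> c) = a" unfolding le_def by blast
    have "a \<ominus> b \<ominus> c = d"
      using add_minus[of "d \<oplus> c" b] add_minus[of d c] by (simp add: add_assoc' add_comm'[of b c] flip: d)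
    then show ?thesis using d add_minus[of d "b \<oplus> c"] by simp
  next
    case False
    have "a \<ominus> b \<ominus> c = \<zero>"
    proof (cases "b \<sqsubseteq> a")
      case True
      then obtain d where d: "d \<oplus> b = a" unfolding le_def by blast
      have "\<not> c \<sqsubseteq> d"
      proof
        assume "c \<sqsubseteq> d"
        then obtain f where "f \<oplus> c = d" unfolding le_def by blast
        then have "f \<oplus> (b \<oplus> c) = a" using d by (simp add: add_left_comm' add_comm')
        then have "b \<oplus> c \<sqsubseteq> a" unfolding le_def by blast
        then show False using \<open>\<not> b \<oplus> c \<sqsubseteq> a\<close> by blast
      qed
      then show ?thesis using d add_minus[of d b] by (simp add: minus_zero)
    qed (simp add: minus_zero zero_minus)
    then show ?thesis using False by (simp add: minus_zero)
  qed
  show "a \<otimes> (b \<ominus> c) = a \<otimes> b \<ominus> a \<otimes> c" for a b c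
  proof (cases "c \<sqsubseteq> b")
    case True
    then obtain d where d: "d \<oplus> c = b" unfolding le_def by blast
    then show ?thesis by (simp add: distrib_left' add_minus flip: d)
  next
    case False
    then have bc: "b \<sqsubset> c" using le_linear' unfolding less_def by auto
    show ?thesis
    proof (cases "a = \<zero>")
      case False
      then have "\<zero> \<sqsubset> a" unfolding less_def le_def using add_zero by blast
      then have "a \<otimes> b \<sqsubset> a \<otimes> c" using bc mult_strict_mono' by blast
      then have "\<not> a \<otimes> c \<sqsubseteq> a \<otimes> b" using le_antisym' unfolding less_def by blast
      then show ?thesis using \<open>\<not> c \<sqsubseteq> b\<close> by (simp add: minus_zero mult_zero)
    qed (simp add: zero_mult zero_minus)
  qed
  show "b \<sqsubseteq> a ==> a \<ominus> b \<oplus> b = a" for a b unfolding le_def using add_minus by auto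
  show "a \<sqsubseteq> b ==> c \<oplus> a \<sqsubseteq> c \<oplus> b" for a b c unfolding le_def by (auto simp: add_left_comm'[of _ c])
  show "(a \<sqsubset> b) = (a \<sqsubseteq> b \<and> \<not> b \<sqsubseteq> a)" for a b unfolding less_def using le_antisym' le_linear' by blast
  show "a \<sqsubseteq> a" for a unfolding le_def using zero_add by blast
  show "\<zero> \<sqsubset> \<one>" unfolding less_def le_def using add_zero[of \<one>] succ_not_zero[of \<zero>] zero_add[of \<one>] by auto
  show "a \<otimes> b ~= \<zero>" if nz: "a ~= \<zero>" "b ~= \<zero>" for a b
  proof -
    obtain c where "b = c \<oplus> \<one>" using cases_zero[OF nz(2)] by blast
    then show ?thesis using nz by (simp add: mult_succ add_eq_zero)
  qed
  show "(a \<oplus> b) \<otimes> c = a \<otimes> c \<oplus> b \<otimes> c" for a b c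
    by (simp only: mult_comm'[of _ c] distrib_left')
  show "\<one> \<otimes> a = a" for a using mult_one[of a] mult_comm'[of a \<one>] by simp
  show "\<zero> ~= \<one>" using succ_not_zero[of \<zero>] zero_add[of \<one>] by auto
qed (fact add_assoc' add_comm' zero_add le_trans' le_antisym' le_linear' mult_assoc' mult_comm' zero_mult mult_zero
    mult_strict_mono' distrib_left')+

end

section \<open>The model as an ordered semiring; strong induction and least elements\<close>

context pa_model
begin

sublocale M: comm_semiring_1 mult one add zero
proof -
  interpret linordered_semidom add minus le less zero mult one by (rule linordered_semidom)
  show "class.comm_semiring_1 mult one add zero" by unfold_locales
qed

sublocale M: linorder le less
proof -
  interpret linordered_semidom add minus le less zero mult one by (rule linordered_semidom)
  show "class.linorder le less" by unfold_locales
qed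

lemma
  less_add_one: "a \<sqsubset> a \<oplus> \<one>" and
  add_left_cancel [simp]: "a \<oplus> b = a \<oplus> c <-> b = c" and
  add_right_cancel [simp]: "b \<oplus> a = c \<oplus> a <-> b = c" and
  add_le_left [simp]: "a \<oplus> b \<sqsubseteq> a \<oplus> c <-> b \<sqsubseteq> c" and
  add_le_right [simp]: "b \<oplus> a \<sqsubseteq> c \<oplus> a <-> b \<sqsubseteq> c" and
  add_less_left [simp]: "a \<oplus> b \<sqsubset> a \<oplus> c <-> b \<sqsubset> c" and
  add_less_right [simp]: "b \<oplus> a \<sqsubset> c \<oplus> a <-> b \<sqsubset> c" and
  add_mono: "a \<sqsubseteq> b ==> c \<sqsubseteq> d ==> a \<oplus> c \<sqsubseteq> b \<oplus> d" and
  mult_eq_zero [simp]: "a \<otimes> b = \<zero> <-> a = \<zero> \<or> b = \<zero>" and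
  mult_mono: "a \<sqsubseteq> b ==> c \<sqsubseteq> d ==> a \<otimes> c \<sqsubseteq> b \<otimes> d" and
  one_neq_zero [simp]: "\<one> ~= \<zero>" and
  not_less_zero [simp]: "\<not> a \<sqsubset> \<zero>" and
  zero_less: "\<zero> \<sqsubset> a <-> a ~= \<zero>"
proof -
  interpret linordered_semidom add minus le less zero mult one by (rule linordered_semidom)
  have z: "\<zero> \<sqsubseteq> x" for x unfolding le_def using add_zero by blast
  show "a \<sqsubset> a \<oplus> \<one>" by (rule less_add_one)
  show "a \<oplus> b = a \<oplus> c <-> b = c" "b \<oplus> a = c \<oplus> a <-> b = c" by simp_all
  show "a \<oplus> b \<sqsubseteq> a \<oplus> c <-> b \<sqsubseteq> c" "b \<oplus> a \<sqsubseteq> c \<oplus> a <-> b \<sqsubseteq> c"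
    "a \<oplus> b \<sqsubset> a \<oplus> c <-> b \<sqsubset> c" "b \<oplus> a \<sqsubset> c \<oplus> a <-> b \<sqsubset> c" by simp_all
  show "a \<sqsubseteq> b ==> c \<sqsubseteq> d ==> a \<oplus> c \<sqsubseteq> b \<oplus> d" by (rule add_mono)
  show "a \<otimes> b = \<zero> <-> a = \<zero> \<or> b = \<zero>" by simp
  show pos: "\<zero> \<sqsubset> x <-> x ~= \<zero>" for x using z[of x] by (auto simp: less_def)
  show "a \<sqsubseteq> b ==> c \<sqsubseteq> d ==> a \<otimes> c \<sqsubseteq> b \<otimes> d" using z by (intro mult_mono)
  show "\<one> ~= \<zero>" by simp
  show "\<not> a \<sqsubset> \<zero>" using z[of a] by simp
qed

lemma mult_less_left: "a ~= \<zero> ==> a \<otimes> b \<sqsubset> a \<otimes> c <-> b \<sqsubset> c"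
proof -
  have sm: "b \<sqsubset> c ==> a \<otimes> b \<sqsubset> a \<otimes> c" if "a ~= \<zero>" for b c
    using mult_strict_mono' that by (simp add: zero_less)
  show "a ~= \<zero> ==> a \<otimes> b \<sqsubset> a \<otimes> c <-> b \<sqsubset> c"
    using sm[of b c] sm[of c b] M.not_less M.le_less M.less_asym M.less_irrefl by metis
qed

lemma mult_le_left: "a ~= \<zero> ==> a \<otimes> b \<sqsubseteq> a \<otimes> c <-> b \<sqsubseteq> c"
  using mult_less_left[of a c b] by (simp flip: M.not_less)

lemma mult_left_cancel: "a ~= \<zero> ==> a \<otimes> b = a \<otimes> c <-> b = c"
  using mult_le_left[of a b c] mult_le_left[of a c b] by (metis M.order.refl M.order.antisym)

lemma mult_right_cancel: "a ~= \<zero> ==> b \<otimes> a = c \<otimes> a <-> b = c"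
  using mult_left_cancel[of a b c] by (simp add: mult_comm'[of _ a])

lemma less_succ: "a \<sqsubset> b \<oplus> \<one> <-> a \<sqsubseteq> b"
proof
  assume "a \<sqsubset> b \<oplus> \<one>"
  then obtain c where c: "c \<oplus> a = b \<oplus> \<one>" "c ~= \<zero>" unfolding less_def le_def by (metis zero_add)
  then obtain d where "c = d \<oplus> \<one>" using cases_zero by blast
  then have "(d \<oplus> a) \<oplus> \<one> = b \<oplus> \<one>" using c(1) by (simp only: succ_add)
  then have "d \<oplus> a = b" by simp
  then show "a \<sqsubseteq> b" unfolding le_def by blast
next
  assume "a \<sqsubseteq> b"
  then show "a \<sqsubset> b \<oplus> \<one>" using less_add_one M.le_less_trans by blast
qed

lemma succ_le: "a \<oplus> \<one> \<sqsubseteq> b <-> a \<sqsubset> b"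
  using less_succ[of b a] M.not_le M.not_less by blast

lemma zero_le [simp]: "\<zero> \<sqsubseteq> a"
  unfolding le_def using add_zero by blast

lemma strong_ind:
  assumes "Dfn (%e. P (e 0))" "\<And>a. (\<And>b. b \<sqsubset> a ==> P b) ==> P a"
  shows "P a"
proof -
  have "Dfn (%e. P (e n))" for n using Dfn1[OF assms(1) dft_var] .
  note [dfn] = this
  have "\<forall>b. b \<sqsubset> a --> P b"
  proof (induction a rule: ind)
    show "Dfn (%e. \<forall>b. b \<sqsubset> e 0 --> P b)" by (intro dfn)
    show "\<forall>b. b \<sqsubset> \<zero> --> P b" using M.not_less zero_le by blast
    show "\<forall>b. b \<sqsubset> a \<oplus> \<one> --> P b" if "\<forall>b. b \<sqsubset> a --> P b" for a
      using that assms(2) unfolding less_succ by (metis M.le_less)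
  qed
  then show ?thesis using assms(2) by blast
qed

lemma least:
  assumes "Dfn (%e. P (e 0))" "P a"
  shows "\<exists>b. P b \<and> (\<forall>c. P c --> b \<sqsubseteq> c)"
proof (rule ccontr)
  assume neg: "\<not> ?thesis"
  have "\<not> P a" for a
  proof (induction a rule: strong_ind)
    show "Dfn (%e. \<not> P (e 0))" by (intro dfn assms(1))
    show "\<not> P a" if "\<And>b. b \<sqsubset> a ==> \<not> P b" for a
      using neg that M.not_le by blast
  qed
  then show False using assms(2) by blast
qed

end

section \<open>First-order definability\<close>

context arith_structure
begin

text \<open>Even variables carry the environment and odd ones a sequence of parameters, so one
  formula can refer to both without counting the parameters.\<close>

definition merge :: "(nat => 'a) => (nat => 'a) => nat => 'a" where
  "merge e q n = (if even n then e (n div 2) else q (n div 2))"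

definition fo :: "((nat => 'a) => bool) => bool" where
  "fo \<Phi> <-> (\<exists>F q. \<forall>e. \<Phi> e <-> sat (merge e q) F)"

lemma tval_ren: "tval e (tm_ren r t) = tval (%n. e (r n)) t"
  by (induction t) auto

text \<open>The map \<open>r\<close> may identify variables, so a bound variable is moved outside
  the image of the free ones to avoid capture. This is why only the existence of a renamed formula
  is claimed.\<close>

lemma sat_ren: "\<exists>F'. \<forall>e. sat e F' <-> sat (%n. e (r n)) F"
proof (induction F arbitrary: r)
  case (Eq s t)
  show ?case by (rule exI[of _ "Eq (tm_ren r s) (tm_ren r t)"]) (simp add: tval_ren)
next
  case (Neg F)
  then obtain F' where "\<forall>e. sat e F' <-> sat (%n. e (r n)) F" by blast
  then show ?case by (intro exI[of _ "Neg F'"]) simp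
next
  case (Imp F G)
  obtain F' where "\<forall>e. sat e F' <-> sat (%n. e (r n)) F" using Imp.IH(1) by blast
  moreover obtain G' where "\<forall>e. sat e G' <-> sat (%n. e (r n)) G" using Imp.IH(2) by blast
  ultimately show ?case by (intro exI[of _ "Imp F' G'"]) simp
next
  case (All x F)
  obtain z where z: "z \<notin> r ` free_vars F" using fresh_var[of "r ` free_vars F"] by auto
  obtain F' where F': "\<forall>e. sat e F' <-> sat (%n. e ((r(x := z)) n)) F" using All by blast
  have "sat (%n. (e(z := a)) ((r(x := z)) n)) F <-> sat ((%n. e (r n))(x := a)) F" for e a
    by (rule sat_cong) (use z in auto)
  then show ?case using F' by (intro exI[of _ "All z F'"]) simp
qed

lemma sat_reindex:
  obtains F' where "\<And>e. sat e F' <-> sat (%n. e (r n)) F"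
  using sat_ren by blast

lemma fo_intro:
  assumes "\<And>e. \<Phi> e <-> sat (%n. merge e q (r n)) F"
  shows "fo \<Phi>"
  using sat_ren[of r F] assms unfolding fo_def by metis

theorem fo_model:
  assumes PA: "\<And>F e. PA_axiom F ==> sat e F"
  shows "pa_model zero one add mult fo"
proof
  show "PA_axiom F ==> sat e F" for F e by (rule PA)
  show "fo (%e. sat e F)" for F
    by (rule fo_intro[where q = "%_. \<zero>" and r = "%n. 2 * n"]) (simp add: merge_def)
  show "fo (%e. \<not> \<Phi> e)" if \<Phi>: "fo \<Phi>" for \<Phi>
  proof -
    obtain F q where "\<forall>e. \<Phi> e <-> sat (merge e q) F" using \<Phi> unfolding fo_def by blast
    then have "\<forall>e. (\<not> \<Phi> e) <-> sat (merge e q) (Neg F)" by simp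
    then show ?thesis unfolding fo_def by blast
  qed
  show "fo (%e. \<Phi> e --> \<Psi> e)" if fo: "fo \<Phi>" "fo \<Psi>" for \<Phi> \<Psi>
  proof -
    obtain F q where F: "\<forall>e. \<Phi> e <-> sat (merge e q) F" using fo unfolding fo_def by blast
    obtain G p where G: "\<forall>e. \<Psi> e <-> sat (merge e p) G" using fo unfolding fo_def by blast
    \<comment> \<open>\<open>merge q p\<close> serves as the common parameter sequence. In it
      \<open>q m\<close> has the position \<open>2 * m\<close>, hence sits in the variable
      \<open>2 * (2 * m) + 1\<close>; for \<open>p m\<close> the position is
      \<open>2 * m + 1\<close>.\<close>
    have eq1: "merge e q = (%n. merge e (merge q p) (if even n then n else 2 * (2 * (n div 2)) + 1))" for e
      by (rule ext) (auto simp: merge_def elim!: oddE)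
    obtain F' where F': "\<And>e. sat e F' <-> sat (%n. e (if even n then n else 2 * (2 * (n div 2)) + 1)) F"
      by (rule sat_reindex[of "%n. if even n then n else 2 * (2 * (n div 2)) + 1" F]) blast
    have 1: "sat (merge e q) F <-> sat (merge e (merge q p)) F'" for e by (subst eq1) (rule F'[symmetric])
    have eq2: "merge e p = (%n. merge e (merge q p) (if even n then n else 2 * (2 * (n div 2) + 1) + 1))" for e
      by (rule ext) (simp add: merge_def)
    obtain G' where G': "\<And>e. sat e G' <-> sat (%n. e (if even n then n else 2 * (2 * (n div 2) + 1) + 1)) G"
      by (rule sat_reindex[of "%n. if even n then n else 2 * (2 * (n div 2) + 1) + 1" G]) blast
    have 2: "sat (merge e p) G <-> sat (merge e (merge q p)) G'" for e by (subst eq2) (rule G'[symmetric])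
    show ?thesis unfolding fo_def
      by (rule exI[of _ "Imp F' G'"], rule exI[of _ "merge q p"]) (simp add: F G 1 2)
  qed
  show "fo (%e. \<forall>a. \<Theta> e a)" if \<Theta>: "fo (%e. \<Theta> (%n. e (Suc n)) (e 0))" for \<Theta>
  proof -
    obtain F q where F: "\<forall>e. \<Theta> (%n. e (Suc n)) (e 0) <-> sat (merge e q) F"
      using \<Theta> unfolding fo_def by blast
    have \<Theta>_sat: "\<Theta> e a <-> sat (merge (case_nat a e) q) F" for e a
      using F[rule_format, of "case_nat a e"] by simp
    \<comment> \<open>Popping the stack moves the variable \<open>2 * k + 2\<close> to
      \<open>2 * k\<close>; the variable 0 becomes the bound variable \<open>z\<close>.\<close>
    let ?s = "%n::nat. if even n then n - 2 else n"
    obtain z where z: "z \<notin> ?s ` free_vars F" using fresh_var[of "?s ` free_vars F"] by auto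
    obtain F' where F': "\<And>e. sat e F' <-> sat (%n. e ((?s(0 := z)) n)) F"
      by (rule sat_reindex[of "?s(0 := z)" F]) blast
    have "sat (%n. ((merge e q)(z := a)) ((?s(0 := z)) n)) F <-> sat (merge (case_nat a e) q) F" for e a
    proof (rule sat_cong)
      fix n assume n: "n \<in> free_vars F"
      then have "?s n ~= z" using z by blast
      then show "((merge e q)(z := a)) ((?s(0 := z)) n) = merge (case_nat a e) q n"
        by (cases "n = 0") (auto simp: merge_def elim!: evenE split: nat.split)
    qed
    then have "(\<forall>a. \<Theta> e a) <-> sat (merge e q) (All z F')" for e by (simp add: \<Theta>_sat F')
    then show ?thesis unfolding fo_def by blast
  qed
  show "fo (%e. \<Theta> e c)" if \<Theta>: "fo (%e. \<Theta> (%n. e (Suc n)) (e 0))" for \<Theta> c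
  proof -
    obtain F q where F: "\<forall>e. \<Theta> (%n. e (Suc n)) (e 0) <-> sat (merge e q) F"
      using \<Theta> unfolding fo_def by blast
    have \<Theta>_sat: "\<Theta> e a <-> sat (merge (case_nat a e) q) F" for e a
      using F[rule_format, of "case_nat a e"] by simp
    \<comment> \<open>The constant \<open>c\<close> is pushed onto the parameters: the variable 0
      becomes 1, the other even variables drop by 2, and the odd ones rise by 2.\<close>
    have "merge (case_nat c e) q =
      (%n. merge e (case_nat c q) (if n = 0 then 1 else if even n then n - 2 else n + 2))" for e
      by (rule ext) (auto simp: merge_def elim!: evenE oddE split: nat.split)
    then show ?thesis by (intro fo_intro[where q = "case_nat c q"]) (simp add: \<Theta>_sat)
  qed
  show "fo (%e. \<Phi> (%n. e (r n)))" if \<Phi>: "fo \<Phi>" for \<Phi> r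
  proof -
    obtain F q where F: "\<forall>e. \<Phi> e <-> sat (merge e q) F" using \<Phi> unfolding fo_def by blast
    have "merge (%n. e (r n)) q = (%n. merge e q (if even n then 2 * r (n div 2) else n))" for e
      by (rule ext) (simp add: merge_def)
    then show ?thesis by (intro fo_intro[where q = q]) (simp add: F)
  qed
  show "P a" if P: "fo (%e. P (e 0))" "P \<zero>" "\<And>a. P a ==> P (a \<oplus> \<one>)" for P a
  proof -
    obtain F q where F: "\<forall>e. P (e 0) <-> sat (merge e q) F" using P(1) unfolding fo_def by blast
    define E where "E = merge (%_. \<zero>) q"
    have E0: "E(0 := a) = merge (%n. if n = 0 then a else \<zero>) q" for a
      by (rule ext) (auto simp: E_def merge_def elim!: evenE)
    have PF: "P a <-> sat (E(0 := a)) F" for a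
      unfolding E0 using F[rule_format, of "%n. if n = 0 then a else \<zero>"] by simp
    obtain y where y: "y \<notin> insert 0 (fm_vars F)" using fresh_var[of "insert 0 (fm_vars F)"] by auto
    have y': "sat (E(y := b, 0 := c)) F <-> P c" for b c
      unfolding PF by (rule sat_cong) (use y free_vars_subset[of F] in auto)
    have "PA_axiom (induction_axiom 0 y F)" unfolding PA_axiom_def
      by (rule disjI2, rule exI[of _ 0], rule exI[of _ y], rule exI[of _ F]) (use y in simp)
    then have "sat E (induction_axiom 0 y F)" by (rule PA)
    moreover have "sat E (induction_axiom 0 y F) <-> (P \<zero> --> (\<forall>a. P a --> P (a \<oplus> \<one>)) --> (\<forall>a. P a))"
      using y by (simp add: induction_axiom_def y' flip: PF)
    ultimately show ?thesis using P(2,3) by blast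
  qed
qed

end

section \<open>The standard model\<close>

lemma nat_PA: "PA_axiom F ==> arith_structure.sat (0::nat) (Suc 0) (+) (*) e F"
proof -
  interpret arith_structure "0::nat" "Suc 0" "(+)" "(*)" .
  assume "PA_axiom F"
  then consider "F \<in> set Q_axioms" | x y G where "x ~= y" "y \<notin> fm_vars G" "F = induction_axiom x y G"
    unfolding PA_axiom_def by blast
  then show "sat e F"
  proof cases
    case 1
    then show ?thesis by (auto simp: Q_axioms_def gr0_conv_Suc)
  next
    case (2 x y G)
    have "sat (e(x := a, y := b, x := c)) G <-> sat (e(x := c)) G" for a b c
      using 2 free_vars_subset[of G] by (intro sat_cong) auto
    then have *: "sat e F <-> (sat (e(x := 0)) G --> (\<forall>a. sat (e(x := a)) G --> sat (e(x := Suc a)) G) -->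
      (\<forall>a. sat (e(x := a)) G))"
      using 2 by (simp add: induction_axiom_def)
    have "sat (e(x := a)) G" if "sat (e(x := 0)) G" "\<forall>a. sat (e(x := a)) G --> sat (e(x := Suc a)) G" for a
      using that by (induction a) auto
    then show ?thesis using * by blast
  qed
qed

interpretation N: pa_model "0::nat" "Suc 0" "(+)" "(*)" "%_. True"
proof
  show "P a" if "P 0" "\<And>a. P a ==> P (a + Suc 0)" for P and a :: nat
    using that by (induction a) auto
qed (auto intro: nat_PA)

context pa_model
begin

section \<open>Powers of two in a model\<close>

definition pw2 :: "'a => bool" where
  "pw2 t <-> t ~= \<zero> \<and> (\<forall>d e. d \<otimes> e = t --> d = \<one> \<or> (\<exists>c. d = c \<oplus> c))"

lemma Dfn_pw2 [dfn]: "dft t ==> Dfn (%e. pw2 (t e))"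
  by (rule Dfn1[of pw2]) (unfold pw2_def, intro dfn)

lemma parity: "\<exists>c. a = c \<oplus> c \<or> a = c \<oplus> c \<oplus> \<one>"
proof (induction a rule: ind)
  show "Dfn (%e. \<exists>c. e 0 = c \<oplus> c \<or> e 0 = c \<oplus> c \<oplus> \<one>)" by (intro dfn)
  show "\<exists>c. \<zero> = c \<oplus> c \<or> \<zero> = c \<oplus> c \<oplus> \<one>" by (rule exI[of _ \<zero>]) simp
  fix a assume "\<exists>c. a = c \<oplus> c \<or> a = c \<oplus> c \<oplus> \<one>"
  then obtain c where "a = c \<oplus> c \<or> a = c \<oplus> c \<oplus> \<one>" by blast
  then show "\<exists>c. a \<oplus> \<one> = c \<oplus> c \<or> a \<oplus> \<one> = c \<oplus> c \<oplus> \<one>"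
  proof
    assume "a = c \<oplus> c"
    then show ?thesis by (intro exI[of _ c]) simp
  next
    assume "a = c \<oplus> c \<oplus> \<one>"
    then show ?thesis by (intro exI[of _ "c \<oplus> \<one>"] disjI1) (simp add: ac_simps)
  qed
qed

lemma double_less: "c \<oplus> c \<sqsubset> d \<oplus> d <-> c \<sqsubset> d"
proof
  show "c \<oplus> c \<sqsubset> d \<oplus> d" if "c \<sqsubset> d"
    using that M.less_trans[of "c \<oplus> c" "c \<oplus> d" "d \<oplus> d"] by simp
  show "c \<sqsubset> d" if "c \<oplus> c \<sqsubset> d \<oplus> d"
  proof (rule ccontr)
    assume "\<not> c \<sqsubset> d"
    then have "d \<sqsubseteq> c" by (simp add: M.not_less)
    then have "d \<oplus> d \<sqsubseteq> c \<oplus> c" by (intro add_mono)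
    then show False using that by (simp flip: M.not_le)
  qed
qed

lemma double_le: "c \<oplus> c \<sqsubseteq> d \<oplus> d <-> c \<sqsubseteq> d"
  using double_less[of d c] by (simp flip: M.not_less)

lemma double_inj [simp]: "c \<oplus> c = d \<oplus> d <-> c = d"
  using double_le[of c d] double_le[of d c] by (metis M.order.antisym M.order.refl)

lemma even_odd [simp]: "c \<oplus> c ~= d \<oplus> d \<oplus> \<one>"
proof (cases "c \<sqsubseteq> d")
  case True
  then have "c \<oplus> c \<sqsubset> d \<oplus> d \<oplus> \<one>" by (simp add: less_succ double_le)
  then show ?thesis by auto
next
  case False
  then have "d \<oplus> \<one> \<sqsubseteq> c" by (simp add: succ_le M.not_le)
  then have "(d \<oplus> \<one>) \<oplus> (d \<oplus> \<one>) \<sqsubseteq> c \<oplus> c" by (intro add_mono)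
  then have "d \<oplus> d \<oplus> \<one> \<sqsubset> c \<oplus> c" by (simp add: ac_simps flip: succ_le)
  then show ?thesis by auto
qed

lemma odd_even [simp]: "d \<oplus> d \<oplus> \<one> ~= c \<oplus> c"
  using even_odd[of c d] by metis

lemma pw2_nonzero: "pw2 p ==> p ~= \<zero>"
  by (simp add: pw2_def)

lemma one_mult_eq: "d \<otimes> e = \<one> ==> d = \<one>"
proof (rule ccontr)
  assume *: "d \<otimes> e = \<one>" "d ~= \<one>"
  have "d ~= \<zero>" "e ~= \<zero>" using * by auto
  then obtain d' e' where d: "d = d' \<oplus> \<one>" "e = e' \<oplus> \<one>" using cases_zero by metis
  then have "d' \<otimes> e' \<oplus> d' \<oplus> e' \<oplus> \<one> = \<zero> \<oplus> \<one>" using *(1) by (simp add: algebra_simps)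
  then have "d' \<otimes> e' \<oplus> d' \<oplus> e' = \<zero>" by (simp only: add_right_cancel)
  then show False using * d by (simp add: add_eq_zero)
qed

lemma pw2_one [simp]: "pw2 \<one>"
  unfolding pw2_def using one_mult_eq by auto

lemma pw2_even: "pw2 p ==> p ~= \<one> ==> \<exists>q. p = q \<oplus> q"
  unfolding pw2_def using M.mult_1_right[of p] by blast

lemma pw2_double [simp]: "pw2 (p \<oplus> p) <-> pw2 p"
proof
  assume p: "pw2 (p \<oplus> p)"
  then have "p ~= \<zero>" by (auto simp: pw2_def)
  moreover have "d = \<one> \<or> (\<exists>c. d = c \<oplus> c)" if "d \<otimes> e = p" for d e
  proof -
    have "d \<otimes> (e \<oplus> e) = p \<oplus> p" using that by (simp add: M.distrib_left)
    then show ?thesis using p unfolding pw2_def by blast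
  qed
  ultimately show "pw2 p" unfolding pw2_def by blast
next
  assume p: "pw2 p"
  have "d = \<one> \<or> (\<exists>c. d = c \<oplus> c)" if de: "d \<otimes> e = p \<oplus> p" for d e
  proof -
    obtain d' e' where d: "d = d' \<oplus> d' \<or> d = d' \<oplus> d' \<oplus> \<one>" and e: "e = e' \<oplus> e' \<or> e = e' \<oplus> e' \<oplus> \<one>"
      using parity by metis
    show ?thesis
    proof (cases "d = d' \<oplus> d'")
      case False
      then have d: "d = d' \<oplus> d' \<oplus> \<one>" using d by blast
      have "e = e' \<oplus> e'"
      proof (rule ccontr)
        assume "e ~= e' \<oplus> e'"
        then have "e = e' \<oplus> e' \<oplus> \<one>" using e by blast
        then have "p \<oplus> p = (d' \<otimes> e' \<oplus> d' \<otimes> e' \<oplus> d' \<oplus> e') \<oplus> (d' \<otimes> e' \<oplus> d' \<otimes> e' \<oplus> d' \<oplus> e') \<oplus> \<one>"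
          using de by (simp add: d algebra_simps)
        then show False by (simp only: even_odd)
      qed
      then have "(d \<otimes> e') \<oplus> (d \<otimes> e') = p \<oplus> p" using de by (simp add: M.distrib_left)
      then have "d \<otimes> e' = p" by simp
      then show ?thesis using p unfolding pw2_def by blast
    qed blast
  qed
  moreover have "p \<oplus> p ~= \<zero>" using p by (simp add: pw2_def add_eq_zero)
  ultimately show "pw2 (p \<oplus> p)" unfolding pw2_def by blast
qed

lemma less_double: "p ~= \<zero> ==> p \<sqsubset> p \<oplus> p"
  using add_less_left[of p \<zero> p] by (simp add: zero_less)

text \<open>A power of two other than 1 is the double of a smaller one. This gives induction on the
  exponent without an exponential function.\<close>

lemma pw2_induct [consumes 1]:
  assumes "pw2 p" "Dfn (%e. P (e 0))" "P \<one>" "\<And>q. pw2 q ==> P q ==> P (q \<oplus> q)"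
  shows "P p"
proof -
  have "Dfn (%e. pw2 (e 0) --> P (e 0))" using assms(2) by (intro dfn)
  then have "pw2 p --> P p"
  proof (rule strong_ind)
    fix p assume IH: "\<And>q. q \<sqsubset> p ==> pw2 q --> P q"
    show "pw2 p --> P p"
    proof
      assume p: "pw2 p"
      show "P p"
      proof (cases "p = \<one>")
        case False
        then obtain q where q: "p = q \<oplus> q" using pw2_even p by blast
        then have "pw2 q" using p by simp
        moreover have "q \<sqsubset> p" using less_double pw2_nonzero[OF \<open>pw2 q\<close>] q by simp
        ultimately show ?thesis using IH assms(4) q by blast
      qed (use assms(3) in simp)
    qed
  qed
  then show ?thesis using assms(1) by blast
qed

lemma pw2_mult:
  assumes "pw2 p" "pw2 q"
  shows "pw2 (p \<otimes> q)"
  using assms(2)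
proof (induction q rule: pw2_induct)
  show "Dfn (%e. pw2 (p \<otimes> e 0))" by (intro dfn)
qed (use assms(1) in \<open>simp_all add: M.distrib_left\<close>)

text \<open>For powers of two comparison by size implies divisibility; this is what lets a string be
  cut at the length of a shorter one.\<close>

lemma pw2_dvd:
  assumes "pw2 p" "pw2 q" "p \<sqsubseteq> q"
  shows "\<exists>r. pw2 r \<and> q = p \<otimes> r"
proof -
  have "\<forall>q. pw2 q --> p \<sqsubseteq> q --> (\<exists>r. pw2 r \<and> q = p \<otimes> r)"
    using assms(1)
  proof (induction p rule: pw2_induct)
    show "Dfn (%e. \<forall>q. pw2 q --> e 0 \<sqsubseteq> q --> (\<exists>r. pw2 r \<and> q = e 0 \<otimes> r))" by (intro dfn)
  next
    fix p assume p: "pw2 p" and IH: "\<forall>q. pw2 q --> p \<sqsubseteq> q --> (\<exists>r. pw2 r \<and> q = p \<otimes> r)"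
    show "\<forall>q. pw2 q --> p \<oplus> p \<sqsubseteq> q --> (\<exists>r. pw2 r \<and> q = (p \<oplus> p) \<otimes> r)"
    proof (intro allI impI)
      fix q assume q: "pw2 q" "p \<oplus> p \<sqsubseteq> q"
      have "p \<sqsubset> q" using less_double[OF pw2_nonzero[OF p]] q(2) by (rule M.less_le_trans)
      then have "\<one> \<sqsubset> q" using pw2_nonzero[OF p] succ_le[of \<zero> p] by (metis M.add_0 zero_less M.le_less_trans)
      then obtain r where r: "q = r \<oplus> r" using pw2_even q(1) by blast
      then have "pw2 r" "p \<sqsubseteq> r" using q by (simp_all add: double_le)
      then obtain s where "pw2 s" "r = p \<otimes> s" using IH by blast
      then show "\<exists>r. pw2 r \<and> q = (p \<oplus> p) \<otimes> r" using r by (intro exI[of _ s]) (simp add: M.distrib_right)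
    qed
  qed simp
  then show ?thesis using assms(2,3) by blast
qed

lemma pw2_exists: "y ~= \<zero> ==> \<exists>p. pw2 p \<and> p \<sqsubseteq> y \<and> y \<sqsubset> p \<oplus> p"
proof -
  have "y ~= \<zero> --> (\<exists>p. pw2 p \<and> p \<sqsubseteq> y \<and> y \<sqsubset> p \<oplus> p)"
  proof (induction y rule: ind)
    show "Dfn (%e. e 0 ~= \<zero> --> (\<exists>p. pw2 p \<and> p \<sqsubseteq> e 0 \<and> e 0 \<sqsubset> p \<oplus> p))" by (intro dfn)
    fix y assume IH: "y ~= \<zero> --> (\<exists>p. pw2 p \<and> p \<sqsubseteq> y \<and> y \<sqsubset> p \<oplus> p)"
    show "y \<oplus> \<one> ~= \<zero> --> (\<exists>p. pw2 p \<and> p \<sqsubseteq> y \<oplus> \<one> \<and> y \<oplus> \<one> \<sqsubset> p \<oplus> p)"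
    proof (cases "y = \<zero>")
      case True
      then show ?thesis using less_add_one[of \<one>] by (intro impI exI[of _ \<one>]) simp
    next
      case False
      then obtain p where p: "pw2 p" "p \<sqsubseteq> y" "y \<sqsubset> p \<oplus> p" using IH by blast
      show ?thesis
      proof (cases "y \<oplus> \<one> = p \<oplus> p")
        case True
        then show ?thesis using p less_double pw2_nonzero by (intro impI exI[of _ "p \<oplus> p"]) simp
      next
        case False
        then have "y \<oplus> \<one> \<sqsubset> p \<oplus> p" using p(3) by (simp add: less_def succ_le)
        moreover have "p \<sqsubseteq> y \<oplus> \<one>" using p(2) less_succ[of p y] M.less_imp_le by blast
        ultimately show ?thesis using p(1) by blast
      qed
    qed
  qed simp
  then show "y ~= \<zero> ==> ?thesis" by blast
qed

lemma pw2_unique: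
  assumes "pw2 p" "p \<sqsubseteq> y" "y \<sqsubset> p \<oplus> p" "pw2 q" "q \<sqsubseteq> y" "y \<sqsubset> q \<oplus> q"
  shows "p = q"
proof -
  have *: "\<not> p \<sqsubset> q" if p: "pw2 p" "y \<sqsubset> p \<oplus> p" and q: "pw2 q" "q \<sqsubseteq> y" for p q
  proof
    assume pq: "p \<sqsubset> q"
    obtain r where r: "pw2 r" "q = p \<otimes> r" using pw2_dvd[OF p(1) q(1) M.less_imp_le[OF pq]] by blast
    then have "r ~= \<one>" using pq by auto
    then obtain s where s: "r = s \<oplus> s" using pw2_even r(1) by blast
    then have s0: "s ~= \<zero>" using pw2_nonzero r(1) by simp
    have "p \<otimes> \<one> \<sqsubseteq> p \<otimes> s"
      using s0 succ_le[of \<zero> s] by (intro mult_mono) (simp_all add: zero_less)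
    then have "p \<oplus> p \<sqsubseteq> p \<otimes> s \<oplus> p \<otimes> s" by (intro add_mono) simp_all
    also have "\<dots> = q" using r s by (simp add: M.distrib_left)
    finally have "p \<oplus> p \<sqsubseteq> y" using q(2) by (rule M.order.trans)
    then show False using p(2) by (simp flip: M.not_le)
  qed
  show ?thesis using *[of p q] *[of q p] assms M.less_linear[of p q] by blast
qed

lemma division:
  assumes b: "b ~= \<zero>"
  shows "\<exists>q r. a = q \<otimes> b \<oplus> r \<and> r \<sqsubset> b"
proof (induction a rule: ind)
  show "Dfn (%e. \<exists>q r. e 0 = q \<otimes> b \<oplus> r \<and> r \<sqsubset> b)" by (intro dfn)
  show "\<exists>q r. \<zero> = q \<otimes> b \<oplus> r \<and> r \<sqsubset> b"
    using b by (intro exI[of _ \<zero>]) (simp add: zero_less)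
  fix a assume "\<exists>q r. a = q \<otimes> b \<oplus> r \<and> r \<sqsubset> b"
  then obtain q r where qr: "a = q \<otimes> b \<oplus> r" "r \<sqsubset> b" by blast
  show "\<exists>q r. a \<oplus> \<one> = q \<otimes> b \<oplus> r \<and> r \<sqsubset> b"
  proof (cases "r \<oplus> \<one> = b")
    case True
    have "a \<oplus> \<one> = q \<otimes> b \<oplus> (r \<oplus> \<one>)" using qr by (simp add: add_assoc')
    then have "a \<oplus> \<one> = (q \<oplus> \<one>) \<otimes> b \<oplus> \<zero>" using True by (simp add: M.distrib_right)
    then show ?thesis using b zero_less by blast
  next
    case False
    then have "r \<oplus> \<one> \<sqsubset> b" using qr(2) by (simp add: less_def succ_le)
    moreover have "a \<oplus> \<one> = q \<otimes> b \<oplus> (r \<oplus> \<one>)" using qr by (simp add: ac_simps)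
    ultimately show ?thesis by blast
  qed
qed

lemma division_unique:
  assumes "q \<otimes> b \<oplus> r = q' \<otimes> b \<oplus> r'" "r \<sqsubset> b" "r' \<sqsubset> b"
  shows "q = q' \<and> r = r'"
proof -
  have False if "q \<otimes> b \<oplus> r = q' \<otimes> b \<oplus> r'" "r \<sqsubset> b" "q \<sqsubset> q'" for q q' r r'
  proof -
    have "q \<otimes> b \<oplus> r \<sqsubset> q \<otimes> b \<oplus> b" using that(2) by simp
    also have "\<dots> = (q \<oplus> \<one>) \<otimes> b" by (simp add: M.distrib_right)
    also have "\<dots> \<sqsubseteq> q' \<otimes> b" using that(3) by (intro mult_mono) (simp_all add: succ_le)
    also have "\<dots> \<sqsubseteq> q' \<otimes> b \<oplus> r'" using add_le_left[of "q' \<otimes> b" \<zero> r'] by simp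
    finally show False using that(1) by simp
  qed
  then have "q = q'" using assms M.less_linear[of q q'] by metis
  then show ?thesis using assms(1) by simp
qed

end

context pa_model
begin

section \<open>Binary strings in a model\<close>

text \<open>
  The element \<open>a\<close> stands for the string whose code is the number \<open>S a = a + 1\<close>, so that concatenation is a
  total operation.  \<open>Lp y\<close> is the leading power of two of \<open>y\<close>.
\<close>

declare M.one_add_one [simp del]

abbreviation S :: "'a => 'a" where "S a \<equiv> a \<oplus> \<one>"

definition Lp :: "'a => 'a" where
  "Lp y = (THE p. pw2 p \<and> p \<sqsubseteq> y \<and> y \<sqsubset> p \<oplus> p)"

definition tl :: "'a => 'a" where
  "tl y = (THE d. y = Lp y \<oplus> d)"

lemma Lp_eqI: "pw2 p ==> p \<sqsubseteq> y ==> y \<sqsubset> p \<oplus> p ==> Lp y = p"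
  unfolding Lp_def using pw2_unique by (intro the_equality) blast+

lemma
  assumes "y ~= \<zero>"
  shows Lp_pw2: "pw2 (Lp y)" and Lp_tl: "Lp y \<oplus> tl y = y" and tl_less: "tl y \<sqsubset> Lp y"
proof -
  obtain p where p: "pw2 p" "p \<sqsubseteq> y" "y \<sqsubset> p \<oplus> p" using pw2_exists[OF assms] by blast
  then have Lp: "Lp y = p" by (rule Lp_eqI)
  obtain d where d: "y = p \<oplus> d" using p(2) unfolding le_def by (metis M.add_commute)
  then have "tl y = d" unfolding tl_def Lp by (intro the_equality) simp_all
  then show "pw2 (Lp y)" "Lp y \<oplus> tl y = y" "tl y \<sqsubset> Lp y" using p d Lp by simp_all
qed

lemma Lp_nonzero: "y ~= \<zero> ==> Lp y ~= \<zero>"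
  using Lp_pw2 pw2_nonzero by blast

lemma
  assumes "pw2 p" "d \<sqsubset> p"
  shows Lp_add: "Lp (p \<oplus> d) = p" and tl_add: "tl (p \<oplus> d) = d"
proof -
  show Lp: "Lp (p \<oplus> d) = p"
    by (rule Lp_eqI[OF assms(1)]) (use assms(2) add_le_left[of p \<zero> d] in simp_all)
  show "tl (p \<oplus> d) = d" unfolding tl_def Lp by (rule the_equality) simp_all
qed

text \<open>\<open>x\<close> is shifted by the length of \<open>y\<close>, and \<open>y\<close>
  loses its leading 1: concatenation of codes.\<close>

definition ncat :: "'a => 'a => 'a" where
  "ncat x y = x \<otimes> Lp y \<oplus> tl y"

lemma
  assumes "x ~= \<zero>" "y ~= \<zero>"
  shows Lp_ncat: "Lp (ncat x y) = Lp x \<otimes> Lp y" and tl_ncat: "tl (ncat x y) = tl x \<otimes> Lp y \<oplus> tl y"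
proof -
  have "x \<otimes> Lp y = Lp x \<otimes> Lp y \<oplus> tl x \<otimes> Lp y"
    using Lp_tl[OF assms(1)] by (metis M.distrib_right)
  then have n: "ncat x y = Lp x \<otimes> Lp y \<oplus> (tl x \<otimes> Lp y \<oplus> tl y)" by (simp add: ncat_def M.add_assoc)
  have "tl x \<otimes> Lp y \<oplus> tl y \<sqsubset> tl x \<otimes> Lp y \<oplus> Lp y" using tl_less[OF assms(2)] by simp
  also have "\<dots> = (tl x \<oplus> \<one>) \<otimes> Lp y" by (simp add: M.distrib_right)
  also have "\<dots> \<sqsubseteq> Lp x \<otimes> Lp y" using tl_less[OF assms(1)] by (intro mult_mono) (simp_all add: succ_le)
  finally have l: "tl x \<otimes> Lp y \<oplus> tl y \<sqsubset> Lp x \<otimes> Lp y" .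
  have p: "pw2 (Lp x \<otimes> Lp y)" using assms by (intro pw2_mult Lp_pw2)
  show "Lp (ncat x y) = Lp x \<otimes> Lp y" "tl (ncat x y) = tl x \<otimes> Lp y \<oplus> tl y"
    unfolding n by (rule Lp_add[OF p l], rule tl_add[OF p l])
qed

lemma ncat_nonzero: "x ~= \<zero> ==> y ~= \<zero> ==> ncat x y ~= \<zero>"
  by (simp add: ncat_def add_eq_zero Lp_nonzero)

lemma ncat_assoc:
  assumes "x ~= \<zero>" "y ~= \<zero>" "z ~= \<zero>"
  shows "ncat (ncat x y) z = ncat x (ncat y z)"
proof -
  have "ncat x (ncat y z) = x \<otimes> (Lp y \<otimes> Lp z) \<oplus> (tl y \<otimes> Lp z \<oplus> tl z)"
    unfolding ncat_def[of x] Lp_ncat[OF assms(2,3)] tl_ncat[OF assms(2,3)] ..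
  moreover have "ncat (ncat x y) z = (x \<otimes> Lp y \<oplus> tl y) \<otimes> Lp z \<oplus> tl z"
    by (simp only: ncat_def)
  ultimately show ?thesis by (simp only: algebra_simps)
qed

text \<open>Levi's lemma for codes. Dividing the bits of the longer right part \<open>v\<close> by
  the leading power of \<open>y\<close> separates the common part \<open>w\<close> from
  \<open>y\<close>, and uniqueness of division matches the remaining digits.\<close>

lemma ncat_levi:
  assumes "x ~= \<zero>" "y ~= \<zero>" "u ~= \<zero>" "v ~= \<zero>" "ncat x y = ncat u v" "Lp y \<sqsubseteq> Lp v"
  shows "\<exists>w. w ~= \<zero> \<and> x = ncat u w \<and> v = ncat w y"
proof -
  obtain r where r: "pw2 r" "Lp v = Lp y \<otimes> r" using pw2_dvd[OF Lp_pw2 Lp_pw2] assms by blast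
  obtain c b where cb: "tl v = c \<otimes> Lp y \<oplus> b" "b \<sqsubset> Lp y" using division[OF Lp_nonzero] assms(2) by blast
  have "x \<otimes> Lp y \<oplus> tl y = u \<otimes> (Lp y \<otimes> r) \<oplus> (c \<otimes> Lp y \<oplus> b)"
    using assms(5) unfolding ncat_def r cb .
  also have "\<dots> = (u \<otimes> r \<oplus> c) \<otimes> Lp y \<oplus> b" by (simp add: M.distrib_right ac_simps)
  finally have xb: "x = u \<otimes> r \<oplus> c" "tl y = b"
    using division_unique tl_less[OF assms(2)] cb(2) by blast+
  have "c \<sqsubset> r"
  proof (rule ccontr)
    assume "\<not> c \<sqsubset> r"
    then have "Lp v \<sqsubseteq> c \<otimes> Lp y" unfolding r M.mult_commute[of "Lp y"]
      by (intro mult_mono) (simp_all add: M.not_less)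
    also have "\<dots> \<sqsubseteq> tl v" unfolding cb using add_le_left[of "c \<otimes> Lp y" \<zero> b] by simp
    finally show False using tl_less[OF assms(4)] by (simp flip: M.not_less)
  qed
  note w = Lp_add[OF r(1) this] tl_add[OF r(1) this]
  have "ncat (r \<oplus> c) y = Lp y \<otimes> r \<oplus> (c \<otimes> Lp y \<oplus> b)"
    unfolding ncat_def xb by (simp add: M.distrib_right ac_simps)
  also have "\<dots> = v" using Lp_tl[OF assms(4)] unfolding r cb .
  finally have "v = ncat (r \<oplus> c) y" ..
  moreover have "x = ncat u (r \<oplus> c)" unfolding ncat_def w by (rule xb)
  moreover have "r \<oplus> c ~= \<zero>" using pw2_nonzero[OF r(1)] by (simp add: add_eq_zero)
  ultimately show ?thesis by blast
qed

definition cat :: "'a => 'a => 'a" (infixr "@@" 75) where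
  "a @@ b = (THE c. S c = ncat (S a) (S b))"

lemma S_nonzero [simp]: "S a ~= \<zero>"
  by (simp add: add_eq_zero)

lemma S_cat: "S (a @@ b) = ncat (S a) (S b)"
proof -
  have "ncat (S a) (S b) ~= \<zero>" by (rule ncat_nonzero) simp_all
  then obtain c where "ncat (S a) (S b) = S c" using cases_zero by blast
  then show ?thesis unfolding cat_def by simp
qed

lemma S_inj: "S a = S b <-> a = b"
  by simp

lemma cat_assoc [simp]: "(a @@ b) @@ c = a @@ b @@ c"
  unfolding S_inj[of "(a @@ b) @@ c", symmetric] S_cat by (rule ncat_assoc) simp_all

lemma Lp_one: "Lp \<one> = \<one>" "tl \<one> = \<zero>"
  using Lp_add[OF pw2_one, of \<zero>] tl_add[OF pw2_one, of \<zero>] by (simp_all add: zero_less)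

lemma eps_cat [simp]: "\<zero> @@ a = a"
  unfolding S_inj[of "\<zero> @@ a", symmetric] S_cat by (simp add: ncat_def Lp_tl)

lemma cat_eps [simp]: "a @@ \<zero> = a"
  unfolding S_inj[of "a @@ \<zero>", symmetric] S_cat by (simp add: ncat_def Lp_one)

lemma cat_right_cancel [simp]: "a @@ c = b @@ c <-> a = b"
proof
  assume "a @@ c = b @@ c"
  then have "ncat (S a) (S c) = ncat (S b) (S c)" by (simp flip: S_cat)
  then show "a = b" by (simp add: ncat_def mult_right_cancel Lp_nonzero)
qed simp

lemma cat_left_cancel [simp]: "a @@ b = a @@ c <-> b = c"
proof
  assume "a @@ b = a @@ c"
  then have *: "ncat (S a) (S b) = ncat (S a) (S c)" by (simp flip: S_cat)
  have "Lp (S a) \<otimes> Lp (S b) = Lp (S a) \<otimes> Lp (S c)"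
    using arg_cong[OF *, of Lp] by (simp add: Lp_ncat)
  then have L: "Lp (S b) = Lp (S c)" by (simp add: mult_left_cancel Lp_nonzero)
  then have "tl (S b) = tl (S c)" using * by (simp add: ncat_def)
  then have "Lp (S b) \<oplus> tl (S b) = Lp (S c) \<oplus> tl (S c)" using L by (simp only:)
  then show "b = c" by (simp add: Lp_tl)
qed simp

lemma levi:
  assumes "a @@ b = c @@ d"
  obtains w where "a = c @@ w" "d = w @@ b" | w where "c = a @@ w" "b = w @@ d"
proof -
  have L: "\<exists>w. a = c @@ w \<and> d = w @@ b" if eq: "a @@ b = c @@ d" and le: "Lp (S b) \<sqsubseteq> Lp (S d)" for a b c d
  proof -
    have "ncat (S a) (S b) = ncat (S c) (S d)" using eq by (simp flip: S_cat)
    then obtain w' where w': "w' ~= \<zero>" "S a = ncat (S c) w'" "S d = ncat w' (S b)"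
      using ncat_levi[of "S a" "S b" "S c" "S d"] le by auto
    then obtain w where "w' = S w" using cases_zero by blast
    then have "S a = S (c @@ w)" "S d = S (w @@ b)" using w'(2,3) by (simp_all only: S_cat)
    then show ?thesis by auto
  qed
  show thesis using L[OF assms] L[OF assms[symmetric]] that(1,2) M.linear[of "Lp (S b)" "Lp (S d)"] by blast
qed

text \<open>The strings 0 and 1 have the codes 2 and 3, in binary 10 and 11, and elements are one
  less than codes.\<close>

definition b0 :: 'a where "b0 = \<one>"
definition b1 :: 'a where "b1 = \<one> \<oplus> \<one>"

lemma S_b0: "S (a @@ b0) = S a \<oplus> S a" and S_b1: "S (a @@ b1) = S a \<oplus> S a \<oplus> \<one>"
proof -
  have p: "pw2 (\<one> \<oplus> \<one>)" by simp
  have "Lp (\<one> \<oplus> \<one>) = \<one> \<oplus> \<one>" "tl (\<one> \<oplus> \<one>) = \<zero>"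
    using Lp_add[OF p, of \<zero>] tl_add[OF p, of \<zero>] by (simp_all add: zero_less add_eq_zero)
  then show "S (a @@ b0) = S a \<oplus> S a" unfolding S_cat ncat_def b0_def by (simp add: M.distrib_left)
  have "\<one> \<sqsubset> \<one> \<oplus> \<one>" by (rule less_add_one)
  then have "Lp (\<one> \<oplus> \<one> \<oplus> \<one>) = \<one> \<oplus> \<one>" "tl (\<one> \<oplus> \<one> \<oplus> \<one>) = \<one>"
    using Lp_add[OF p, of \<one>] tl_add[OF p, of \<one>] by simp_all
  then show "S (a @@ b1) = S a \<oplus> S a \<oplus> \<one>" unfolding S_cat ncat_def b1_def by (simp add: M.distrib_left)
qed

lemma last_letter: "a = \<zero> \<or> (\<exists>c. a = c @@ b0) \<or> (\<exists>c. a = c @@ b1)"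
proof -
  obtain c where c: "S a = c \<oplus> c \<or> S a = c \<oplus> c \<oplus> \<one>" using parity by blast
  show ?thesis
  proof (cases "c = \<zero>")
    case True
    then have "S a = \<one>" using c by simp
    then show ?thesis using add_right_cancel[of a \<one> \<zero>] by simp
  next
    case False
    then obtain d where d: "c = S d" using cases_zero by blast
    then have "S a = S (d @@ b0) \<or> S a = S (d @@ b1)" using c by (simp only: S_b0 S_b1)
    then show ?thesis by auto
  qed
qed

lemma letters [simp]: "b0 ~= b1" "b1 ~= b0" "b0 ~= \<zero>" "b1 ~= \<zero>" "a @@ b0 ~= b @@ b1" "b @@ b1 ~= a @@ b0"
proof -
  show *: "a @@ b0 ~= b @@ b1" for a b
    unfolding S_inj[of "a @@ b0", symmetric] S_b0 S_b1 by simp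
  show "b @@ b1 ~= a @@ b0" using *[of a b] by metis
  show "b0 ~= b1" "b1 ~= b0" using *[of \<zero> \<zero>] by auto
qed (simp_all add: b0_def b1_def add_eq_zero)

text \<open>Appending a letter increases the element, so strong induction on numbers yields
  induction on strings, whose length may be nonstandard.\<close>

lemma string_ind:
  assumes "Dfn (%e. P (e 0))" "P \<zero>" "\<And>a. P a ==> P (a @@ b0)" "\<And>a. P a ==> P (a @@ b1)"
  shows "P a"
  using assms(1)
proof (rule strong_ind)
  fix a assume IH: "\<And>b. b \<sqsubset> a ==> P b"
  have "c \<sqsubset> c @@ b0" "c \<sqsubset> c @@ b1" for c
  proof -
    have "S c \<sqsubset> S c \<oplus> S c" by (rule less_double) simp
    also have "\<dots> \<sqsubset> S c \<oplus> S c \<oplus> \<one>" by (rule less_add_one)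
    finally have "S c \<sqsubset> S (c @@ b1)" unfolding S_b1 .
    then show "c \<sqsubset> c @@ b1" by simp
    have "S c \<sqsubset> S (c @@ b0)" unfolding S_b0 by (rule less_double) simp
    then show "c \<sqsubset> c @@ b0" by simp
  qed
  then show "P a" using last_letter[of a] IH assms(2-4) by metis
qed

lemma dft_cat [dfn]:
  assumes "dft s" "dft t"
  shows "dft (%e. s e @@ t e)"
proof (rule dft2[OF _ assms])
  have *: "c = a @@ b <-> (\<exists>p d. pw2 p \<and> d \<sqsubset> p \<and> S b = p \<oplus> d \<and> S c = S a \<otimes> p \<oplus> d)" for a b c
  proof
    assume "c = a @@ b"
    then have "S c = S a \<otimes> Lp (S b) \<oplus> tl (S b)" by (simp only: S_cat ncat_def)
    moreover have "pw2 (Lp (S b))" "tl (S b) \<sqsubset> Lp (S b)" "S b = Lp (S b) \<oplus> tl (S b)"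
      by (simp_all only: Lp_pw2 tl_less Lp_tl S_nonzero not_False_eq_True)
    ultimately show "\<exists>p d. pw2 p \<and> d \<sqsubset> p \<and> S b = p \<oplus> d \<and> S c = S a \<otimes> p \<oplus> d" by blast
  next
    assume "\<exists>p d. pw2 p \<and> d \<sqsubset> p \<and> S b = p \<oplus> d \<and> S c = S a \<otimes> p \<oplus> d"
    then obtain p d where p: "pw2 p" "d \<sqsubset> p" "S b = p \<oplus> d" "S c = S a \<otimes> p \<oplus> d" by blast
    then have "S c = S (a @@ b)" by (simp only: S_cat ncat_def Lp_add tl_add)
    then show "c = a @@ b" by simp
  qed
  show "dft (%e. e 0 @@ e 1)" unfolding dft_def * by (intro dfn)
qed

lemma le_cat: "a \<sqsubseteq> a @@ b" "b \<sqsubseteq> a @@ b"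
proof -
  have one: "\<one> \<sqsubseteq> x" if "x ~= \<zero>" for x using succ_le[of \<zero> x] that by (simp add: zero_less)
  have "S a \<sqsubseteq> S a \<otimes> Lp (S b)" using mult_mono[of "S a" "S a" \<one> "Lp (S b)"] one Lp_nonzero by simp
  also have "\<dots> \<sqsubseteq> S (a @@ b)" unfolding S_cat ncat_def using add_le_left[of _ \<zero>] by fastforce
  finally show "a \<sqsubseteq> a @@ b" by simp
  have "S b = Lp (S b) \<oplus> tl (S b)" by (simp add: Lp_tl)
  also have "\<dots> \<sqsubseteq> S (a @@ b)" unfolding S_cat ncat_def
    using mult_mono[of \<one> "S a" "Lp (S b)" "Lp (S b)"] one[of "S a"] by (intro add_mono) simp_all
  finally show "b \<sqsubseteq> a @@ b" by simp
qed

end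

context pa_model
begin

lemma cat_eq_eps [simp]: "a @@ b = \<zero> <-> a = \<zero> \<and> b = \<zero>"
proof
  assume "a @@ b = \<zero>"
  then show "a = \<zero> \<and> b = \<zero>"
    using le_cat[where a = a and b = b] M.order.antisym[OF _ zero_le] by simp
qed simp

lemma cat_eq_right [simp]: "b = a @@ b <-> a = \<zero>" "a @@ b = b <-> a = \<zero>"
  using cat_right_cancel[of \<zero> b a] cat_right_cancel[of a b \<zero>] by (metis eps_cat)+

lemma cat_eq_left [simp]: "a = a @@ b <-> b = \<zero>" "a @@ b = a <-> b = \<zero>"
  using cat_left_cancel[of a \<zero> b] cat_left_cancel[of a b \<zero>] by (metis cat_eps)+

lemma last_letters' [simp]: "b0 ~= b @@ b1" "b @@ b1 ~= b0" "b1 ~= b @@ b0" "b @@ b0 ~= b1"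
  using letters(5)[of \<zero> b] letters(6)[of b \<zero>] letters(5)[of b \<zero>] letters(6)[of \<zero> b] by simp_all

lemma first_letter: "a = \<zero> \<or> (\<exists>c. a = b0 @@ c) \<or> (\<exists>c. a = b1 @@ c)"
proof (induction a rule: string_ind)
  show "Dfn (%e. e 0 = \<zero> \<or> (\<exists>c. e 0 = b0 @@ c) \<or> (\<exists>c. e 0 = b1 @@ c))" by (intro dfn)
next
  fix a assume *: "a = \<zero> \<or> (\<exists>c. a = b0 @@ c) \<or> (\<exists>c. a = b1 @@ c)"
  have "(\<exists>c. a @@ x = b0 @@ c) \<or> (\<exists>c. a @@ x = b1 @@ c)" if x: "x = b0 \<or> x = b1" for x
  proof -
    consider "a = \<zero>" | c where "a = b0 @@ c" | c where "a = b1 @@ c" using * by blast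
    then show ?thesis
    proof cases
      case 1
      then have "a @@ x = x @@ \<zero>" by simp
      then show ?thesis using x by blast
    next
      case (2 c)
      then have "a @@ x = b0 @@ c @@ x" by simp
      then show ?thesis by blast
    next
      case (3 c)
      then have "a @@ x = b1 @@ c @@ x" by simp
      then show ?thesis by blast
    qed
  qed
  then show "a @@ b0 = \<zero> \<or> (\<exists>c. a @@ b0 = b0 @@ c) \<or> (\<exists>c. a @@ b0 = b1 @@ c)"
    "a @@ b1 = \<zero> \<or> (\<exists>c. a @@ b1 = b0 @@ c) \<or> (\<exists>c. a @@ b1 = b1 @@ c)"
    by blast+
qed simp

lemma first_letters' [simp]: "b0 ~= b1 @@ b" "b1 @@ b ~= b0" "b1 ~= b0 @@ b" "b0 @@ b ~= b1"
proof -
  show *: "b0 ~= b1 @@ b" "b1 ~= b0 @@ b" using last_letter[of b] by (auto simp flip: cat_assoc)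
  show "b1 @@ b ~= b0" "b0 @@ b ~= b1" using * by simp_all
qed

lemma first_letters [simp]: "b0 @@ a ~= b1 @@ b" "b1 @@ b ~= b0 @@ a"
proof -
  show *: "b0 @@ a ~= b1 @@ b"
  proof
    assume "b0 @@ a = b1 @@ b"
    then show False by (cases rule: levi) simp_all
  qed
  then show "b1 @@ b ~= b0 @@ a" by simp
qed

subsection \<open>Factors\<close>

definition fac :: "'a => 'a => bool" where
  "fac u x <-> (\<exists>p q. x = p @@ u @@ q)"

lemma Dfn_fac [dfn]: "dft s ==> dft t ==> Dfn (%e. fac (s e) (t e))"
  by (rule Dfn2[of fac]) (unfold fac_def, intro dfn)

lemma facI: "x = p @@ u @@ q ==> fac u x"
  unfolding fac_def by blast

lemma fac_refl [simp]: "fac a a"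
  by (rule facI[of _ \<zero> _ \<zero>]) simp

lemma fac_eps [simp]: "fac \<zero> a"
  by (rule facI[of _ \<zero> _ a]) simp

lemma fac_eps_iff [simp]: "fac a \<zero> <-> a = \<zero>"
  unfolding fac_def by (metis cat_eq_eps)

lemma fac_trans: "fac a b ==> fac b c ==> fac a c"
proof -
  assume "fac a b" "fac b c"
  then obtain p q p' q' where "b = p @@ a @@ q" "c = p' @@ b @@ q'" unfolding fac_def by blast
  then show "fac a c" by (intro facI[of _ "p' @@ p" _ "q @@ q'"]) simp
qed

lemma fac_left: "fac a b ==> fac a (c @@ b)" and fac_right: "fac a b ==> fac a (b @@ c)"
  by (rule fac_trans[of _ b], assumption, rule facI[of _ c _ \<zero>], simp)
    (rule fac_trans[of _ b], assumption, rule facI[of _ \<zero> _ c], simp)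

lemma fac_catI: "fac a (a @@ b)" "fac b (a @@ b)"
  by (simp_all add: fac_left fac_right)

lemma fac_le: "fac a b ==> a \<sqsubseteq> b"
  unfolding fac_def using le_cat M.order.trans by blast

subsection \<open>Runs of ones\<close>

text \<open>The code of a run of ones is one less than a power of two. The empty run is
  included.\<close>

definition ONE :: "'a => bool" where
  "ONE a <-> pw2 (S a \<oplus> \<one>)"

lemma Dfn_ONE [dfn]: "dft t ==> Dfn (%e. ONE (t e))"
  unfolding ONE_def by (intro dfn)

lemma ONE_eps [simp]: "ONE \<zero>"
  unfolding ONE_def by simp

lemma ONE_b1 [simp]: "ONE (a @@ b1) <-> ONE a" and ONE_b0 [simp]: "\<not> ONE (a @@ b0)"
proof -
  have "S (a @@ b1) \<oplus> \<one> = (S a \<oplus> \<one>) \<oplus> (S a \<oplus> \<one>)" unfolding S_b1 by (simp add: ac_simps)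
  then show "ONE (a @@ b1) <-> ONE a" unfolding ONE_def by simp
  show "\<not> ONE (a @@ b0)"
  proof
    assume "ONE (a @@ b0)"
    then have "pw2 (S a \<oplus> S a \<oplus> \<one>)" unfolding ONE_def S_b0 .
    moreover have "S a \<oplus> S a \<oplus> \<one> ~= \<one>" using add_right_cancel[of "S a \<oplus> S a" \<one> \<zero>] by (simp add: add_eq_zero)
    ultimately show False using pw2_even by (metis odd_even)
  qed
qed

lemma ONE_cat [simp]: "ONE (a @@ b) <-> ONE a \<and> ONE b"
proof (induction b rule: string_ind)
  show "Dfn (%e. ONE (a @@ e 0) <-> ONE a \<and> ONE (e 0))" by (intro dfn)
qed (simp_all flip: cat_assoc)

lemma ONE_letters [simp]: "ONE b1" "\<not> ONE b0"
  using ONE_b1[of \<zero>] ONE_b0[of \<zero>] by simp_all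

lemma ONE_comm1: "ONE a ==> a @@ b1 = b1 @@ a"
proof -
  have "ONE a --> a @@ b1 = b1 @@ a"
  proof (induction a rule: string_ind)
    show "Dfn (%e. ONE (e 0) --> e 0 @@ b1 = b1 @@ e 0)" by (intro dfn)
    show "ONE (a @@ b1) --> (a @@ b1) @@ b1 = b1 @@ a @@ b1" if "ONE a --> a @@ b1 = b1 @@ a" for a
      using that cat_assoc[of b1 a b1] by simp
  qed simp_all
  then show "ONE a ==> ?thesis" by blast
qed

lemma ONE_comm: "ONE a ==> ONE b ==> a @@ b = b @@ a"
proof -
  assume a: "ONE a"
  have "ONE b --> a @@ b = b @@ a"
  proof (induction b rule: string_ind)
    show "Dfn (%e. ONE (e 0) --> a @@ e 0 = e 0 @@ a)" by (intro dfn)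
    show "ONE (b @@ b1) --> a @@ b @@ b1 = (b @@ b1) @@ a" if "ONE b --> a @@ b = b @@ a" for b
    proof
      assume "ONE (b @@ b1)"
      then have "(a @@ b) @@ b1 = (b @@ a) @@ b1" using that by simp
      then show "a @@ b @@ b1 = (b @@ b1) @@ a" using ONE_comm1[OF a] by simp
    qed
  qed simp_all
  then show "ONE b ==> ?thesis" by blast
qed

lemma ONE_last: "ONE a ==> a = \<zero> \<or> (\<exists>c. a = c @@ b1 \<and> ONE c)"
  using last_letter[of a] by auto

lemma ONE_first: "ONE a ==> a = \<zero> \<or> (\<exists>c. a = b1 @@ c \<and> ONE c)"
  using ONE_last[of a] ONE_comm1 by auto

lemma ONE_first_b0: "ONE a ==> a @@ x = b0 @@ y ==> a = \<zero>"
  using ONE_first[of a] by auto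

lemma ONE_first_b0': "ONE a ==> b0 @@ y = a @@ x ==> a = \<zero>"
  using ONE_first[of a] by auto

lemma ONE_last_b0: "ONE a ==> x @@ a = y @@ b0 ==> a = \<zero>"
  using ONE_last[of a] by (auto simp flip: cat_assoc)

lemma ONE_linear:
  assumes "ONE a" "ONE b"
  obtains w where "ONE w" "b = a @@ w" | w where "ONE w" "a = b @@ w"
proof -
  have "a @@ b = b @@ a" using assms by (rule ONE_comm)
  then show thesis
  proof (cases rule: levi)
    case (1 w) then show ?thesis using that(2) assms by auto
  next
    case (2 w) then show ?thesis using that(1) assms by auto
  qed
qed

lemma ones_run: "ONE s ==> ONE m ==> s @@ b0 @@ q = m @@ b0 @@ r ==> s = m \<and> q = r"
proof -
  assume a: "ONE s" "ONE m" and eq: "s @@ b0 @@ q = m @@ b0 @@ r"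
  from a show ?thesis
  proof (cases rule: ONE_linear)
    case (1 w)
    then have "w @@ b0 @@ r = b0 @@ q" using eq by simp
    then have "w = \<zero>" using 1(1) ONE_first_b0 by blast
    then show ?thesis using 1 eq by simp
  next
    case (2 w)
    then have "w @@ b0 @@ q = b0 @@ r" using eq by simp
    then have "w = \<zero>" using 2(1) ONE_first_b0 by blast
    then show ?thesis using 2 eq by simp
  qed
qed

text \<open>Provides separators longer than any given strings. The witness is the element
  \<open>4 * p - 2\<close> for the leading power \<open>p\<close> of \<open>S x\<close>; it exceeds
  \<open>x\<close> because \<open>S x\<close> is below \<open>2 * p\<close>.\<close>

lemma ONE_big: "\<exists>s. ONE s \<and> x \<sqsubset> s"
proof -
  define p where "p = Lp (S x)"
  have p: "pw2 p" "S x \<sqsubset> p \<oplus> p"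
  proof -
    show "pw2 p" unfolding p_def by (rule Lp_pw2) simp
    have "Lp (S x) \<oplus> tl (S x) \<sqsubset> p \<oplus> p" using tl_less[of "S x"] by (simp add: p_def)
    then show "S x \<sqsubset> p \<oplus> p" by (simp add: Lp_tl)
  qed
  have "S x \<oplus> S x \<sqsubset> (p \<oplus> p) \<oplus> (p \<oplus> p)" using p(2) by (simp add: double_less)
  moreover have "S x \<oplus> S x = x \<oplus> x \<oplus> \<one> \<oplus> \<one>" by (simp add: ac_simps)
  moreover obtain s where s: "(p \<oplus> p) \<oplus> (p \<oplus> p) = s \<oplus> \<one> \<oplus> \<one>"
  proof -
    have "p \<oplus> p ~= \<zero>" using pw2_nonzero[OF p(1)] by (simp add: add_eq_zero)
    then obtain r where r: "p \<oplus> p = r \<oplus> \<one>" using cases_zero by blast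
    then have "(p \<oplus> p) \<oplus> (p \<oplus> p) = (r \<oplus> r) \<oplus> \<one> \<oplus> \<one>" by (simp add: ac_simps)
    then show thesis by (rule that)
  qed
  ultimately have "x \<oplus> x \<sqsubset> s" by simp
  moreover have "x \<sqsubseteq> x \<oplus> x" using add_le_left[of x \<zero> x] by simp
  ultimately have "x \<sqsubset> s" by (rule M.le_less_trans[rotated])
  moreover have "ONE s" using p(1) unfolding ONE_def by (simp flip: s)
  ultimately show ?thesis by blast
qed

lemma fac_ones_cat:
  assumes s: "ONE s" "s ~= \<zero>" and f: "fac s (x @@ b0 @@ y)"
  shows "fac s x \<or> fac s y"
proof -
  obtain p q where "p @@ s @@ q = x @@ b0 @@ y" using f unfolding fac_def by metis
  then show ?thesis
  proof (cases rule: levi)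
    case (1 w)
    show ?thesis
    proof (cases "w = \<zero>")
      case True
      then show ?thesis using 1(2) ONE_first_b0'[OF s(1), of y q] s(2) by simp
    next
      case False
      then obtain v where "w = b0 @@ v" using first_letter[of w] 1(2) by auto
      then show ?thesis using 1(2) by (auto intro: facI)
    qed
  next
    case (2 w)
    from 2(2) show ?thesis
    proof (cases rule: levi)
      case (1 t)
      then have "t = \<zero>" using s ONE_first_b0'[of t y q] by simp
      then show ?thesis using 1 2 by (auto intro: facI[of _ p _ \<zero>])
    next
      case (2 t)
      then show ?thesis using \<open>x = p @@ w\<close> by (auto intro: facI)
    qed
  qed
qed

lemma fac_ones_b0: "ONE s ==> s ~= \<zero> ==> \<not> fac s b0"
  using fac_ones_cat[of s \<zero> \<zero>] by auto

text \<open>The first separator can be located from the left: \<open>u\<close> ends in 0 and the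
  letter after its separator is 0, so the run can be shifted in neither direction. The rest
  \<open>r\<close> is arbitrary, and of \<open>v\<close> it is only known that it does not contain
  the run.\<close>

lemma scan:
  assumes s: "ONE s" and u: "u = u' @@ b0" "\<not> fac s u" and v: "\<not> fac s v"
    and eq: "u @@ s @@ b0 @@ q = v @@ s @@ r"
  shows "u = v \<and> r = b0 @@ q"
  using eq
proof (cases rule: levi)
  case (1 w)
  have "w = \<zero>"
  proof (rule ccontr)
    assume "w ~= \<zero>"
    then obtain w' where w': "w = w' @@ b0"
      using last_letter[of w] 1(1) u(1) by (auto simp flip: cat_assoc)
    from 1(2) show False
    proof (cases rule: levi)
      case (1 t)
      then have "ONE w" using s by simp
      then show False using w' by simp
    next
      case (2 t)
      then have "fac s u" using \<open>u = v @@ w\<close> by (intro facI[of _ v _ t]) simp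
      then show False using u(2) by blast
    qed
  qed
  then show ?thesis using 1 eq by simp
next
  case (2 w)
  from 2(2) show ?thesis
  proof (cases rule: levi)
    case (1 t)
    then have "ONE w" "ONE t" using s by simp_all
    then have "s = t @@ w" using 1(1) ONE_comm by simp
    then have "w @@ r = b0 @@ q" using 1(2) by simp
    then have "w = \<zero>" using \<open>ONE w\<close> ONE_first_b0 by blast
    then show ?thesis using 2 \<open>w @@ r = b0 @@ q\<close> by simp
  next
    case (2 t)
    then have "fac s v" using \<open>v = u @@ w\<close> by (intro facI[of _ u _ t]) simp
    then show ?thesis using v by blast
  qed
qed

text \<open>An occurrence of \<open>0 1\<^sup>m 00\<close> cannot straddle a separator, except that it can begin just before it.\<close>

lemma occurrence_split:
  assumes m: "ONE m" "m ~= \<zero>" and s: "ONE s" "s ~= \<zero>"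
    and eq: "p @@ b0 @@ m @@ b0 @@ b0 @@ q = (X @@ b0) @@ s @@ b0 @@ Y"
  obtains (left) q' where "X @@ b0 = p @@ b0 @@ m @@ b0 @@ b0 @@ q'" "q = q' @@ s @@ b0 @@ Y"
  | (right) p' where "b0 @@ Y = p' @@ b0 @@ m @@ b0 @@ b0 @@ q" "p = (X @@ b0) @@ s @@ p'"
  | (across) "X = p" "m = s" "Y = b0 @@ q"
  using eq
proof (cases rule: levi)
  case (1 u)
  from 1(2) show thesis
  proof (cases rule: levi)
    case (1 v)
    then have "v = \<zero>" using s ONE_first_b0'[of v "m @@ b0 @@ b0 @@ q" "b0 @@ Y"] by simp
    then show ?thesis using right[of \<zero>] 1 \<open>p = (X @@ b0) @@ u\<close> by simp
  next
    case (2 v)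
    then show ?thesis using right[of v] \<open>p = (X @@ b0) @@ u\<close> by simp
  qed
next
  case (2 u)
  have "u ~= \<zero>"
  proof
    assume "u = \<zero>"
    then have "s @@ b0 @@ Y = b0 @@ m @@ b0 @@ b0 @@ q" using 2(2) by simp
    then show False using s ONE_first_b0 by blast
  qed
  then obtain u1 where u1: "u = b0 @@ u1" using first_letter[of u] 2(2) by auto
  then have X: "X @@ b0 = p @@ b0 @@ u1" and "m @@ b0 @@ b0 @@ q = u1 @@ s @@ b0 @@ Y" using 2 by simp_all
  from this(2) show thesis
  proof (cases rule: levi)
    case (1 v)
    have "u1 = \<zero>" using X ONE_last_b0[of u1 "p @@ b0" X] 1(1) m(1) by simp
    then have "s @@ b0 @@ Y = m @@ b0 @@ b0 @@ q" using 1 by simp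
    then have "s = m \<and> Y = b0 @@ q" using ones_run s(1) m(1) by blast
    moreover have "X = p" using X \<open>u1 = \<zero>\<close> by simp
    ultimately show ?thesis using across by blast
  next
    case (2 v)
    have "v ~= \<zero>"
    proof
      assume "v = \<zero>"
      then have "(p @@ b0) @@ m = X @@ b0" using X 2(1) by simp
      then show False using ONE_last_b0 m by blast
    qed
    then obtain v1 where v1: "v = b0 @@ v1" using first_letter[of v] 2(2) by auto
    then have e: "b0 @@ q = v1 @@ s @@ b0 @@ Y" using 2(2) by simp
    have "v1 ~= \<zero>"
    proof
      assume "v1 = \<zero>"
      then have "s @@ b0 @@ Y = b0 @@ q" using e by simp
      then show False using s ONE_first_b0 by blast
    qed
    then obtain v2 where "v1 = b0 @@ v2" using first_letter[of v1] e by auto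
    then show ?thesis using left[of v2] X 2(1) v1 e by simp
  qed
qed

end

context pa_model
begin

section \<open>Codes of expressions in a model\<close>

primrec zeros :: "nat => 'a" where
  "zeros 0 = \<zero>"
| "zeros (Suc n) = b0 @@ zeros n"

definition tagM :: "nat => 'a" where
  "tagM j = b0 @@ b0 @@ zeros j"

primrec seps :: "'a => 'a list => 'a" where
  "seps s [] = b0"
| "seps s (t # ts) = t @@ s @@ seps s ts"

text \<open>The separator is \<open>s @@ b1\<close>, hence not empty, and it is minimal because the
  shorter run \<open>s\<close> is a factor of some item. This replaces the \<open>LEAST\<close> in
  \<open>sep_length\<close> by a definable condition.\<close>

definition ENC :: "'a => 'a list => bool" where
  "ENC z ts <-> (\<exists>s. ONE s \<and> z = b0 @@ (s @@ b1) @@ seps (s @@ b1) ts \<and>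
    (\<forall>t\<in>set ts. \<not> fac (s @@ b1) t) \<and> (\<exists>t\<in>set ts. fac s t))"

definition mk :: "'a list => 'a" where
  "mk ts = (THE z. ENC z ts)"

definition ends0 :: "'a => bool" where "ends0 t <-> (\<exists>c. t = c @@ b0)"

definition begins0 :: "'a => bool" where "begins0 t <-> (\<exists>c. t = b0 @@ c)"

text \<open>The shape of the codes of expressions and of indices of variables.\<close>

definition sh :: "'a => bool" where
  "sh t <-> (\<exists>c. t = b0 @@ b1 @@ c) \<and> ends0 t"

lemma eps_eq_cat [simp]: "\<zero> = a @@ b <-> a = \<zero> \<and> b = \<zero>"
  by (subst eq_commute) (rule cat_eq_eps)

lemma Dfn_list_all: "(\<And>t. t \<in> set ts ==> Dfn (%e. \<Phi> t e)) ==> Dfn (%e. \<forall>t\<in>set ts. \<Phi> t e)"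
  by (induction ts) (auto intro!: dfn)

lemma zeros_snoc: "zeros n @@ b0 = b0 @@ zeros n"
  by (induction n) simp_all

lemma tagM_ends: "tagM j = (b0 @@ zeros j) @@ b0"
  unfolding tagM_def by (simp add: zeros_snoc)

lemma fac_zeros: "ONE s ==> s ~= \<zero> ==> \<not> fac s (zeros n)"
proof (induction n)
  case (Suc n)
  then show ?case using fac_ones_cat[of s \<zero> "zeros n"] by auto
qed simp

lemma fac_tag: "ONE s ==> s ~= \<zero> ==> \<not> fac s (tagM n)"
  using fac_zeros[of s "Suc (Suc n)"] by (simp add: tagM_def)

lemma tag_inj: "tagM j @@ b1 @@ q = tagM i @@ b1 @@ r ==> j = i \<and> q = r"
proof -
  have "zeros j @@ b1 @@ q = zeros i @@ b1 @@ r ==> j = i \<and> q = r" for i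
  proof (induction j arbitrary: i)
    case 0 then show ?case by (cases i) simp_all
  next
    case (Suc j) then show ?case by (cases i) simp_all
  qed
  then show "tagM j @@ b1 @@ q = tagM i @@ b1 @@ r ==> j = i \<and> q = r" by (simp add: tagM_def)
qed

lemma ENC_unique: "ENC z ts ==> ENC z' ts ==> z = z'"
proof -
  assume "ENC z ts" "ENC z' ts"
  then obtain s s' where s: "ONE s" "z = b0 @@ (s @@ b1) @@ seps (s @@ b1) ts" "\<forall>t\<in>set ts. \<not> fac (s @@ b1) t" "\<exists>t\<in>set ts. fac s t"
    and s': "ONE s'" "z' = b0 @@ (s' @@ b1) @@ seps (s' @@ b1) ts" "\<forall>t\<in>set ts. \<not> fac (s' @@ b1) t" "\<exists>t\<in>set ts. fac s' t"
    unfolding ENC_def by blast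
  have *: "w = \<zero>" if w: "ONE w" "\<exists>t\<in>set ts. fac (s @@ w) t" "\<forall>t\<in>set ts. \<not> fac (s @@ b1) t" for s w
  proof (rule ccontr)
    assume "w ~= \<zero>"
    then obtain c where "w = b1 @@ c" using ONE_first[OF w(1)] by blast
    then have "fac (s @@ b1) (s @@ w)" using fac_catI(1)[of "s @@ b1" c] by simp
    then show False using w(2,3) fac_trans by blast
  qed
  from s(1) s'(1) have "s = s'"
  proof (cases rule: ONE_linear)
    case (1 w)
    then have "w = \<zero>" using *[of w s] s(3) s'(4) by simp
    then show ?thesis using 1 by simp
  next
    case (2 w)
    then have "w = \<zero>" using *[of w s'] s(4) s'(3) by simp
    then show ?thesis using 2 by simp
  qed
  then show "z = z'" using s(2) s'(2) by simp
qed

text \<open>Nonstandard items have a separator too: \<open>ONE_big\<close> gives a run that is a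
  factor of none of them, and the least number principle a shortest one.\<close>

lemma ENC_exists: "ts ~= [] ==> \<exists>z. ENC z ts"
proof -
  assume ts: "ts ~= []"
  let ?P = "%s. ONE s \<and> (\<forall>t\<in>set ts. \<not> fac (s @@ b1) t)"
  obtain x where x: "\<forall>t\<in>set ts. t \<sqsubseteq> x"
  proof -
    have "\<exists>x. \<forall>t\<in>set ts. t \<sqsubseteq> x"
    proof (induction ts)
      case (Cons t ts)
      then obtain x where x: "\<forall>t\<in>set ts. t \<sqsubseteq> x" by blast
      have "t \<sqsubseteq> t \<oplus> x" "x \<sqsubseteq> t \<oplus> x" using add_le_left[of t \<zero> x] add_le_right[of \<zero> x t] by simp_all
      then have "\<forall>u\<in>set (t # ts). u \<sqsubseteq> t \<oplus> x" using x M.order.trans by auto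
      then show ?case by blast
    qed simp
    then show thesis using that by blast
  qed
  obtain s where s: "ONE s" "x \<sqsubset> s" using ONE_big by blast
  have "?P s"
  proof (intro conjI ballI notI)
    fix t assume t: "t \<in> set ts" "fac (s @@ b1) t"
    then have "s \<sqsubseteq> t" using fac_le fac_trans fac_catI(1) by blast
    then show False using s(2) x t(1) M.order.trans M.not_le by blast
  qed (rule s(1))
  moreover have "Dfn (%e. ?P (e 0))" by (intro dfn Dfn_list_all)
  ultimately obtain s where s: "?P s" "\<And>c. ?P c ==> s \<sqsubseteq> c" using least[of ?P s] by blast
  have "\<exists>t\<in>set ts. fac s t"
  proof (cases "s = \<zero>")
    case True then show ?thesis using ts by (cases ts) auto
  next
    case False
    then obtain c where c: "s = c @@ b1" "ONE c" using ONE_last s(1) by blast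
    show ?thesis
    proof (rule ccontr)
      assume "\<not> ?thesis"
      then have "s \<sqsubseteq> c" using s(2) c by blast
      moreover have "c \<sqsubseteq> s" using le_cat(1)[of c b1] c by simp
      ultimately have "c = c @@ b1" using c M.order.antisym[of c "c @@ b1"] by simp
      then show False by simp
    qed
  qed
  then show ?thesis using s(1) unfolding ENC_def by blast
qed

lemma ENC_mk: "ts ~= [] ==> ENC z ts <-> z = mk ts"
  unfolding mk_def using ENC_exists ENC_unique by (metis the_equality)

lemma ENC_sh: "ENC z ts ==> sh z"
proof -
  assume "ENC z ts"
  then obtain s where s: "ONE s" "z = b0 @@ (s @@ b1) @@ seps (s @@ b1) ts" unfolding ENC_def by blast
  have "\<exists>c. seps r ts = c @@ b0" for r
    by (induction ts) (auto simp flip: cat_assoc intro: exI[of _ \<zero>])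
  then have "ends0 z" unfolding ends0_def s(2) by (metis cat_assoc)
  moreover have "z = b0 @@ b1 @@ s @@ seps (s @@ b1) ts" using ONE_comm1[OF s(1)] s(2) by (simp flip: cat_assoc)
  ultimately show "sh z" unfolding sh_def by blast
qed

lemma ENC_item: "ENC z ts ==> t \<in> set ts ==> fac t z"
proof -
  assume "ENC z ts" "t \<in> set ts"
  then obtain s where s: "z = b0 @@ (s @@ b1) @@ seps (s @@ b1) ts" unfolding ENC_def by blast
  have "t \<in> set ts ==> fac t (seps r ts)" for r
    by (induction ts) (auto intro: fac_left fac_catI)
  then show "fac t z" using \<open>t \<in> set ts\<close> unfolding s by (intro fac_left)
qed

lemma seps_begins: "\<forall>a\<in>set as. sh a ==> (\<exists>y. seps s as = b0 @@ y \<and> \<not> begins0 y)"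
proof (cases as)
  case Nil
  then show ?thesis by (intro exI[of _ \<zero>]) (simp add: begins0_def)
next
  case (Cons a as')
  assume "\<forall>a\<in>set as. sh a"
  then obtain c where "a = b0 @@ b1 @@ c" using Cons unfolding sh_def by auto
  then show ?thesis using Cons by (intro exI[of _ "b1 @@ c @@ s @@ seps s as'"]) (simp add: begins0_def)
qed

lemma b0_cat: "p @@ y = b0 ==> p = \<zero> \<or> y = \<zero>"
  using last_letter[of y] by (auto simp flip: cat_assoc)

lemma occurrence_seps:
  assumes m: "ONE m" "m ~= \<zero>" and s: "ONE s" "s ~= \<zero>" and as: "\<forall>a\<in>set as. sh a"
    and eq: "p @@ b0 @@ m @@ b0 @@ b0 @@ q = seps s as"
  shows "\<exists>a\<in>set as. \<exists>P Q p' q'. seps s as = P @@ a @@ Q \<and> a = p' @@ b0 @@ m @@ b0 @@ b0 @@ q' \<and> p = P @@ p' \<and> q = q' @@ Q"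
  using as eq
proof (induction as arbitrary: p)
  case Nil
  then show ?case using b0_cat[of p "b0 @@ m @@ b0 @@ b0 @@ q"] m(2) by auto
next
  case (Cons a as)
  obtain X where X: "a = X @@ b0" using Cons.prems(1) unfolding sh_def ends0_def by auto
  obtain y where y: "seps s as = b0 @@ y" "\<not> begins0 y" using seps_begins Cons.prems(1) by (metis list.set_intros(2))
  have "p @@ b0 @@ m @@ b0 @@ b0 @@ q = (X @@ b0) @@ s @@ b0 @@ y" using Cons.prems(2) X y(1) by simp
  with m s show ?case
  proof (cases rule: occurrence_split)
    case (left q')
    then show ?thesis using X y(1)
      by (intro bexI[of _ a] exI[of _ \<zero>] exI[of _ "s @@ seps s as"] exI[of _ p] exI[of _ q']) simp_all
  next
    case (right p')
    then obtain a' P Q p'' q' where a': "a' \<in> set as" "seps s as = P @@ a' @@ Q"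
      "a' = p'' @@ b0 @@ m @@ b0 @@ b0 @@ q'" "p' = P @@ p''" "q = q' @@ Q"
      using Cons.IH[of p'] Cons.prems(1) y(1) by auto
    then show ?thesis using X right(2)
      by (intro bexI[of _ a'] exI[of _ "a @@ s @@ P"] exI[of _ Q] exI[of _ p''] exI[of _ q']) simp_all
  next
    case across
    then show ?thesis using y(2) unfolding begins0_def by blast
  qed
qed

text \<open>By \<open>occurrence_split\<close> a marker \<open>0 1...1 00\<close> that is not inside
  an argument or the tag begins just before a separator that is followed by 00. The only such
  separator is the one before the tag, at the front, as arguments begin with 01; the tag itself
  contains no ones.\<close>

lemma occurrence_node:
  assumes m: "ONE m" "m ~= \<zero>" and z: "ENC z (tagM j # as)" and as: "\<forall>a\<in>set as. sh a"
    and eq: "z = p @@ b0 @@ m @@ b0 @@ b0 @@ q"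
  shows "p = \<zero> \<or> (\<exists>a\<in>set as. \<exists>P Q p' q'. z = P @@ a @@ Q \<and> a = p' @@ b0 @@ m @@ b0 @@ b0 @@ q' \<and> p = P @@ p' \<and> q = q' @@ Q)"
proof -
  obtain s' where s': "ONE s'" "z = b0 @@ (s' @@ b1) @@ seps (s' @@ b1) (tagM j # as)" using z unfolding ENC_def by blast
  define s where "s = s' @@ b1"
  have s: "ONE s" "s ~= \<zero>" "z = b0 @@ s @@ seps s (tagM j # as)" using s' by (simp_all add: s_def)
  have "p @@ b0 @@ m @@ b0 @@ b0 @@ q = (\<zero> @@ b0) @@ s @@ b0 @@ b0 @@ zeros j @@ s @@ seps s as"
    using s(3) eq by (simp add: tagM_def)
  with m s(1,2) show ?thesis
  proof (cases rule: occurrence_split)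
    case (left q')
    then have "p @@ b0 @@ m @@ b0 @@ b0 @@ q' = b0" by simp
    then show ?thesis using b0_cat[of p "b0 @@ m @@ b0 @@ b0 @@ q'"] by auto
  next
    case (right p')
    obtain y where y: "seps s as = b0 @@ y" "\<not> begins0 y" using seps_begins as by blast
    have "p' @@ b0 @@ m @@ b0 @@ b0 @@ q = ((b0 @@ zeros j) @@ b0) @@ s @@ b0 @@ y"
      using right(1) unfolding tagM_ends[symmetric] by (simp add: tagM_def y(1))
    with m s(1,2) show ?thesis
    proof (cases rule: occurrence_split)
      case (left q')
      then have "fac m (tagM j)" unfolding tagM_ends by (intro facI[of _ "p' @@ b0" _ "b0 @@ b0 @@ q'"]) simp
      then show ?thesis using fac_tag m by blast
    next
      case (right p'')
      then have "p'' @@ b0 @@ m @@ b0 @@ b0 @@ q = seps s as" by (simp add: y(1))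
      then obtain a P Q r q' where a: "a \<in> set as" "seps s as = P @@ a @@ Q"
        "a = r @@ b0 @@ m @@ b0 @@ b0 @@ q'" "p'' = P @@ r" "q = q' @@ Q"
        using occurrence_seps[OF m s(1,2) as] by blast
      have "z = (b0 @@ s @@ tagM j @@ s @@ P) @@ a @@ Q" using s(3) a(2) by simp
      moreover have "p = (b0 @@ s @@ tagM j @@ s @@ P) @@ r"
        using \<open>p = (\<zero> @@ b0) @@ s @@ p'\<close> right(2) a(4) unfolding tagM_ends by simp
      ultimately show ?thesis using a(1,3,5) by blast
    next
      case across
      then show ?thesis using y(2) unfolding begins0_def by blast
    qed
  next
    case across
    then show ?thesis by simp
  qed
qed

lemma scan_seps:
  assumes s: "ONE s"
  shows "length as = length cs ==> \<forall>a\<in>set as. sh a \<and> \<not> fac s a ==> \<forall>c\<in>set cs. \<not> fac s c ==>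
    seps s as @@ q = seps s cs @@ r ==> as = cs \<and> q = r"
proof (induction as cs rule: list_induct2)
  case (Cons a as c cs)
  obtain X where X: "a = X @@ b0" using Cons.prems(1) unfolding sh_def ends0_def by auto
  obtain y where y: "seps s as = b0 @@ y" using seps_begins Cons.prems(1) by (metis list.set_intros(2))
  have "a @@ s @@ b0 @@ y @@ q = c @@ s @@ seps s cs @@ r" using Cons.prems(3) y by simp
  then have "a = c \<and> seps s cs @@ r = b0 @@ y @@ q"
    using scan[OF s X, of c "y @@ q" "seps s cs @@ r"] Cons.prems(1,2) by simp
  then show ?case using Cons.IH Cons.prems(1,2) y by simp
qed simp

text \<open>Unique readability, also for nodes that are prefixes of longer strings. The run after
  the front 0 is the separator, the zeros behind it give the tag, and the arguments are scanned off
  one by one. The shape of the arguments is known only for \<open>u\<close>, as \<open>v\<close> may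
  be any factor that looks like a node.\<close>

lemma scan_node:
  assumes u: "ENC u (tagM j # as)" "\<forall>a\<in>set as. sh a" and v: "ENC v (tagM i # cs)"
    and len: "i = j ==> length cs = length as" and eq: "u @@ q = v @@ r"
  shows "i = j \<and> as = cs \<and> u = v"
proof -
  obtain s' where s': "ONE s'" "u = b0 @@ (s' @@ b1) @@ seps (s' @@ b1) (tagM j # as)" "\<forall>t\<in>set as. \<not> fac (s' @@ b1) t"
    using u(1) unfolding ENC_def by auto
  obtain m' where m': "ONE m'" "v = b0 @@ (m' @@ b1) @@ seps (m' @@ b1) (tagM i # cs)" "\<forall>t\<in>set cs. \<not> fac (m' @@ b1) t"
    using v unfolding ENC_def by auto
  define s m where "s = s' @@ b1" and "m = m' @@ b1"
  have s: "ONE s" "s = b1 @@ s'" and m: "ONE m" "m = b1 @@ m'" using s' m' ONE_comm1 by (simp_all add: s_def m_def)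
  have "s @@ b0 @@ (b0 @@ zeros j @@ s @@ seps s as @@ q) = m @@ b0 @@ (b0 @@ zeros i @@ m @@ seps m cs @@ r)"
    using eq s'(2) m'(2) by (simp add: tagM_def flip: s_def m_def)
  from ones_run[OF s(1) m(1) this] have sm: "s = m"
    and eq1: "b0 @@ zeros j @@ s @@ seps s as @@ q = b0 @@ zeros i @@ m @@ seps m cs @@ r" by blast+
  have "tagM j @@ s @@ seps s as @@ q = tagM i @@ m @@ seps m cs @@ r"
    using arg_cong[OF eq1, of "%x. b0 @@ x"] by (simp only: tagM_def cat_assoc)
  then have "tagM j @@ b1 @@ s' @@ seps s as @@ q = tagM i @@ b1 @@ m' @@ seps m cs @@ r"
    by (simp only: s(2)[THEN arg_cong, of "%x. x @@ seps s as @@ q"] m(2)[THEN arg_cong, of "%x. x @@ seps m cs @@ r"] cat_assoc)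
  from tag_inj[OF this] have "j = i" and eq': "s' @@ seps s as @@ q = m' @@ seps m cs @@ r" by simp_all
  have "s' = m'" using sm by (simp add: s_def m_def)
  then have "seps s as @@ q = seps s cs @@ r" using eq' sm by simp
  moreover have "\<forall>a\<in>set as. sh a \<and> \<not> fac s a" "\<forall>c\<in>set cs. \<not> fac s c" "length as = length cs"
    using u(2) s'(3) m'(3) sm len \<open>j = i\<close> by (simp_all add: s_def m_def)
  ultimately have "as = cs" using scan_seps[OF s(1)] by blast
  then show ?thesis using \<open>j = i\<close> \<open>s' = m'\<close> s'(2) m'(2) by simp
qed

end

context pa_model
begin

subsection \<open>Terms and formulas\<close>

definition IDX :: "'a => bool" where
  "IDX i <-> (\<exists>s. ONE s \<and> i = b0 @@ (s @@ b1) @@ b0)"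

definition VAR :: "'a => bool" where
  "VAR z <-> (\<exists>i. IDX i \<and> ENC z [tagM 0, i])"

definition TMH :: "'a => bool" where
  "TMH z <-> VAR z \<or> ENC z [tagM 1] \<or> ENC z [tagM 2] \<or> (\<exists>a b. ENC z [tagM 3, a, b] \<or> ENC z [tagM 4, a, b])"

definition FMH :: "'a => bool" where
  "FMH z <-> (\<exists>a. ENC z [tagM 6, a]) \<or>
    (\<exists>a b. ENC z [tagM 5, a, b] \<or> ENC z [tagM 7, a, b] \<or> ENC z [tagM 8, a, b])"

definition WF :: "'a => bool" where
  "WF z <-> (\<forall>u. fac u z --> (\<forall>a. (ENC u [tagM 6, a] --> FMH a) \<and>
    (\<forall>b. (ENC u [tagM 3, a, b] \<or> ENC u [tagM 4, a, b] \<or> ENC u [tagM 5, a, b] --> TMH a \<and> TMH b) \<and>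
      (ENC u [tagM 7, a, b] --> FMH a \<and> FMH b) \<and> (ENC u [tagM 8, a, b] --> VAR a \<and> FMH b))))"

definition TRM :: "'a => bool" where "TRM z <-> TMH z \<and> WF z"

definition FRM :: "'a => bool" where "FRM z <-> FMH z \<and> WF z"

definition kind :: "nat => 'a list => bool" where
  "kind j as <-> (j = 0 \<and> (\<exists>i. as = [i] \<and> IDX i)) \<or> ((j = 1 \<or> j = 2) \<and> as = []) \<or>
    ((j = 3 \<or> j = 4 \<or> j = 5) \<and> (\<exists>a b. as = [a, b] \<and> TMH a \<and> TMH b)) \<or>
    (j = 6 \<and> (\<exists>a. as = [a] \<and> FMH a)) \<or>
    (j = 7 \<and> (\<exists>a b. as = [a, b] \<and> FMH a \<and> FMH b)) \<or>
    (j = 8 \<and> (\<exists>a b. as = [a, b] \<and> VAR a \<and> FMH b))"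

definition OK :: "'a => bool" where
  "OK z <-> (\<exists>j as. kind j as \<and> ENC z (tagM j # as))"

text \<open>
  Well-formedness by positions: every occurrence of \<open>0 1\<^sup>m 00\<close> begins a well-formed node.  Unlike the
  condition \<open>WF\<close> on factors, this is easily seen to be inherited by compound expressions.
\<close>

definition WFP :: "'a => bool" where
  "WFP z <-> (\<forall>p m q. ONE m \<and> m ~= \<zero> \<and> z = p @@ b0 @@ m @@ b0 @@ b0 @@ q --> (\<exists>u r. z = p @@ u @@ r \<and> OK u))"

definition GE :: "'a => bool" where "GE z <-> OK z \<and> WFP z"

lemma Dfn_ENC1 [dfn]: "dft z ==> dft a ==> Dfn (%e. ENC (z e) [a e])"
  by (rule Dfn2[of "%z a. ENC z [a]"]) (simp_all only: ENC_def seps.simps list.set ball_simps bex_simps, intro dfn)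

lemma Dfn_ENC2 [dfn]: "dft z ==> dft a ==> dft b ==> Dfn (%e. ENC (z e) [a e, b e])"
  by (rule Dfn3[of "%z a b. ENC z [a, b]"]) (simp_all only: ENC_def seps.simps list.set ball_simps bex_simps, intro dfn)

lemma Dfn_ENC3 [dfn]: "dft z ==> dft a ==> dft b ==> Dfn (%e. ENC (z e) [tagM j, a e, b e])"
  by (rule Dfn3[of "%z a b. ENC z [tagM j, a, b]"]) (simp_all only: ENC_def seps.simps list.set ball_simps bex_simps, intro dfn)

lemma Dfn_IDX [dfn]: "dft z ==> Dfn (%e. IDX (z e))"
  by (rule Dfn1[of IDX]) (unfold IDX_def, intro dfn)

lemma Dfn_VAR [dfn]: "dft z ==> Dfn (%e. VAR (z e))"
  by (rule Dfn1[of VAR]) (unfold VAR_def, intro dfn)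

lemma Dfn_TMH [dfn]: "dft z ==> Dfn (%e. TMH (z e))"
  by (rule Dfn1[of TMH]) (unfold TMH_def, intro dfn)

lemma Dfn_FMH [dfn]: "dft z ==> Dfn (%e. FMH (z e))"
  by (rule Dfn1[of FMH]) (unfold FMH_def, intro dfn)

text \<open>Removes the quantifiers over tags and lists, which the definability rules cannot
  treat.\<close>

lemma OK_iff: "OK z <-> VAR z \<or> ENC z [tagM 1] \<or> ENC z [tagM 2] \<or>
    (\<exists>a b. TMH a \<and> TMH b \<and> (ENC z [tagM 3, a, b] \<or> ENC z [tagM 4, a, b] \<or> ENC z [tagM 5, a, b])) \<or>
    (\<exists>a. FMH a \<and> ENC z [tagM 6, a]) \<or> (\<exists>a b. FMH a \<and> FMH b \<and> ENC z [tagM 7, a, b]) \<or>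
    (\<exists>a b. VAR a \<and> FMH b \<and> ENC z [tagM 8, a, b])"
    (is "_ = ?R")
proof
  assume "OK z"
  then obtain j as where "kind j as" "ENC z (tagM j # as)" unfolding OK_def by blast
  then show ?R unfolding kind_def VAR_def[of z] by (elim disjE exE conjE; simp; blast?)
next
  have OKI: "OK z" if "kind j as" "ENC z (tagM j # as)" for j as using that unfolding OK_def by blast
  assume ?R
  then show "OK z" unfolding VAR_def[of z]
    by (elim disjE exE conjE) (erule OKI[rotated], simp add: kind_def)+
qed

lemma Dfn_OK [dfn]: "dft z ==> Dfn (%e. OK (z e))"
  by (rule Dfn1[of OK]) (unfold OK_iff, intro dfn)

lemma Dfn_GE [dfn]: "dft z ==> Dfn (%e. GE (z e))"
  by (rule Dfn1[of GE]) (unfold GE_def WFP_def, intro dfn)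

lemma IDX_sh: "IDX i ==> sh i"
  unfolding IDX_def sh_def ends0_def
proof (elim exE conjE)
  fix s assume s: "ONE s" "i = b0 @@ (s @@ b1) @@ b0"
  then have "i = b0 @@ b1 @@ s @@ b0" using ONE_comm1[OF s(1)] by (simp flip: cat_assoc)
  moreover have "i = (b0 @@ s @@ b1) @@ b0" using s(2) by simp
  ultimately show "(\<exists>c. i = b0 @@ b1 @@ c) \<and> (\<exists>c. i = c @@ b0)" by blast
qed

lemma VAR_sh: "VAR z ==> sh z" and TMH_sh: "TMH z ==> sh z" and FMH_sh: "FMH z ==> sh z"
  unfolding VAR_def TMH_def FMH_def using ENC_sh by blast+

lemma kind_sh: "kind j as ==> \<forall>a\<in>set as. sh a"
  unfolding kind_def using IDX_sh VAR_sh TMH_sh FMH_sh by auto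

lemma kind_length: "kind j as ==> length as = (if j = 0 \<or> j = 6 then 1 else if j = 1 \<or> j = 2 then 0 else 2)"
  unfolding kind_def by auto

lemma kind_OK: "kind j as ==> OK (mk (tagM j # as))"
  unfolding OK_def using ENC_mk[of "tagM j # as"] by blast

lemma occurrence_IDX:
  assumes "IDX i" "ONE m" "m ~= \<zero>"
  shows "i ~= p @@ b0 @@ m @@ b0 @@ b0 @@ q"
proof
  assume eq: "i = p @@ b0 @@ m @@ b0 @@ b0 @@ q"
  obtain s where s: "ONE s" "i = b0 @@ (s @@ b1) @@ b0" using assms(1) unfolding IDX_def by blast
  have s': "ONE (s @@ b1)" "s @@ b1 ~= \<zero>" using s(1) by simp_all
  have e: "p @@ b0 @@ m @@ b0 @@ b0 @@ q = (\<zero> @@ b0) @@ (s @@ b1) @@ b0 @@ \<zero>" using eq s(2) by simp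
  from assms(2,3) s' e show False
  proof (cases rule: occurrence_split)
    case (left q')
    then show ?thesis using b0_cat[of p "b0 @@ m @@ b0 @@ b0 @@ q'"] by auto
  next
    case (right p')
    then show ?thesis using b0_cat[of p' "b0 @@ m @@ b0 @@ b0 @@ q"] assms(3) by auto
  next
    case across
    show ?thesis using across(3) by (simp only: eps_eq_cat letters simp_thms)
  qed
qed

lemma node_begin: "ENC x (tagM i # cs) ==> \<exists>m y. ONE m \<and> m ~= \<zero> \<and> x = b0 @@ m @@ b0 @@ b0 @@ y"
proof -
  assume "ENC x (tagM i # cs)"
  then obtain s where s: "ONE s" "x = b0 @@ (s @@ b1) @@ seps (s @@ b1) (tagM i # cs)" unfolding ENC_def by blast
  show ?thesis
  proof (intro exI conjI)
    show "ONE (s @@ b1)" using s(1) by simp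
    show "s @@ b1 ~= \<zero>" by simp
    show "x = b0 @@ (s @@ b1) @@ b0 @@ b0 @@ (zeros i @@ (s @@ b1) @@ seps (s @@ b1) cs)"
      unfolding s(2) by (simp only: seps.simps tagM_def cat_assoc)
  qed
qed

text \<open>A marker lies at the front of the node or inside an argument, where the assumption
  accounts for it; an index contains no 00 and hence no marker. So \<open>GE\<close> is inherited by
  compound expressions.\<close>

lemma GE_mk:
  assumes k: "kind j as" and as: "\<And>a. a \<in> set as ==> GE a \<or> IDX a"
  shows "GE (mk (tagM j # as))"
proof -
  let ?z = "mk (tagM j # as)"
  have z: "ENC ?z (tagM j # as)" using ENC_mk[of "tagM j # as"] by blast
  have "WFP ?z"
    unfolding WFP_def
  proof (intro allI impI, elim conjE)
    fix p m q assume m: "ONE m" "m ~= \<zero>" and eq: "?z = p @@ b0 @@ m @@ b0 @@ b0 @@ q"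
    from occurrence_node[OF m z kind_sh[OF k] eq] show "\<exists>u r. ?z = p @@ u @@ r \<and> OK u"
    proof (elim disjE bexE exE conjE)
      assume "p = \<zero>"
      then show ?thesis using kind_OK[OF k] by (intro exI[of _ ?z] exI[of _ \<zero>]) simp
    next
      fix a P Q p' q' assume a: "a \<in> set as" "?z = P @@ a @@ Q" "a = p' @@ b0 @@ m @@ b0 @@ b0 @@ q'" "p = P @@ p'"
      have "GE a" using as[OF a(1)] occurrence_IDX[OF _ m, of a p' q'] a(3) by blast
      then obtain u r where u: "a = p' @@ u @@ r" "OK u" using a(3) m unfolding GE_def WFP_def by blast
      then show ?thesis using a(2,4) by (intro exI[of _ u] exI[of _ "r @@ Q"]) simp
    qed
  qed
  then show ?thesis unfolding GE_def using kind_OK[OF k] by blast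
qed

text \<open>The marker at the front of \<open>x\<close> also starts a well-formed node
  \<open>u\<close>, and unique readability forces \<open>x = u\<close>. Thus whatever looks like a
  compound expression inside \<open>z\<close> is one.\<close>

lemma GE_node:
  assumes "GE z" "z = p @@ x @@ q" "ENC x (tagM i # cs)"
    "length cs = (if i = 0 \<or> i = 6 then 1 else if i = 1 \<or> i = 2 then 0 else 2)"
  shows "kind i cs"
proof -
  obtain m y where m: "ONE m" "m ~= \<zero>" "x = b0 @@ m @@ b0 @@ b0 @@ y" using node_begin[OF assms(3)] by blast
  then have "z = p @@ b0 @@ m @@ b0 @@ b0 @@ y @@ q" using assms(2) by simp
  then obtain u r where u: "z = p @@ u @@ r" "OK u" using assms(1) m(1,2) unfolding GE_def WFP_def by blast
  obtain j as where j: "kind j as" "ENC u (tagM j # as)" using u(2) unfolding OK_def by blast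
  have "u @@ r = x @@ q" using u(1) assms(2) by simp
  from scan_node[OF j(2) kind_sh[OF j(1)] assms(3) _ this] have "i = j \<and> as = cs \<and> u = x"
    using kind_length[OF j(1)] assms(4) by simp
  then show ?thesis using j(1) u(2) by blast
qed

lemma GE_WF: "GE z ==> WF z"
  unfolding WF_def
proof (intro allI impI)
  fix u a assume z: "GE z" and "fac u z"
  then obtain p q where pq: "z = p @@ u @@ q" unfolding fac_def by blast
  note n = GE_node[OF z pq]
  have 1: "FMH a" if "ENC u [tagM 6, a]" using n[of 6 "[a]"] that by (simp add: kind_def)
  have 2: "TMH a \<and> TMH b" if "ENC u [tagM 3, a, b] \<or> ENC u [tagM 4, a, b] \<or> ENC u [tagM 5, a, b]" for b
    using n[of 3 "[a, b]"] n[of 4 "[a, b]"] n[of 5 "[a, b]"] that by (auto simp: kind_def)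
  have 3: "FMH a \<and> FMH b" if "ENC u [tagM 7, a, b]" for b using n[of 7 "[a, b]"] that by (simp add: kind_def)
  have 4: "VAR a \<and> FMH b" if "ENC u [tagM 8, a, b]" for b using n[of 8 "[a, b]"] that by (simp add: kind_def)
  show "(ENC u [tagM 6, a] --> FMH a) \<and>
    (\<forall>b. (ENC u [tagM 3, a, b] \<or> ENC u [tagM 4, a, b] \<or> ENC u [tagM 5, a, b] --> TMH a \<and> TMH b) \<and>
      (ENC u [tagM 7, a, b] --> FMH a \<and> FMH b) \<and> (ENC u [tagM 8, a, b] --> VAR a \<and> FMH b))"
    using 1 2 3 4 by blast
qed

text \<open>Justifies the tests with \<open>factor_fm\<close> in the axiom schemes: the code of a
  variable never arises across constituents. For \<open>j ~= 0\<close> the occurrence cannot be the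
  node itself, so its marker lies in an argument.\<close>

lemma VAR_fac_mk:
  assumes k: "kind j as" "j ~= 0" and as: "\<And>a. a \<in> set as ==> GE a" and x: "VAR x" "fac x (mk (tagM j # as))"
  shows "\<exists>a\<in>set as. fac x a"
proof -
  let ?z = "mk (tagM j # as)"
  have z: "ENC ?z (tagM j # as)" using ENC_mk[of "tagM j # as"] by blast
  obtain i where i: "ENC x (tagM 0 # [i])" using x(1) unfolding VAR_def by blast
  obtain p q where pq: "?z = p @@ x @@ q" using x(2) unfolding fac_def by blast
  obtain m y where m: "ONE m" "m ~= \<zero>" "x = b0 @@ m @@ b0 @@ b0 @@ y" using node_begin[OF i] by blast
  then have "?z = p @@ b0 @@ m @@ b0 @@ b0 @@ y @@ q" using pq by simp
  from occurrence_node[OF m(1,2) z kind_sh[OF k(1)] this] show ?thesis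
  proof (elim disjE bexE exE conjE)
    assume "p = \<zero>"
    then have "?z @@ \<zero> = x @@ q" using pq by simp
    from scan_node[OF z kind_sh[OF k(1)] i _ this] have "0 = j" using k(2) by simp
    then show ?thesis using k(2) by simp
  next
    fix a P Q p' q' assume a: "a \<in> set as" "?z = P @@ a @@ Q" "a = p' @@ b0 @@ m @@ b0 @@ b0 @@ q'" "p = P @@ p'"
    obtain u r where u: "a = p' @@ u @@ r" "OK u" using as[OF a(1)] a(3) m(1,2) unfolding GE_def WFP_def by blast
    obtain j' as' where j: "kind j' as'" "ENC u (tagM j' # as')" using u(2) unfolding OK_def by blast
    have "u @@ (r @@ Q) = x @@ q" using pq a(2,4) u(1) by simp
    from scan_node[OF j(2) kind_sh[OF j(1)] i _ this] have "u = x"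
      using kind_length[OF j(1)] by simp
    with u(1) have "a = p' @@ x @@ r" by (simp only:)
    then have "fac x a" by (rule facI)
    then show ?thesis using a(1) by blast
  qed
qed

lemma VAR_fac_VAR:
  assumes "VAR x" "VAR y" "fac x y"
  shows "x = y"
proof -
  obtain i where i: "ENC x (tagM 0 # [i])" using assms(1) unfolding VAR_def by blast
  obtain k where k: "IDX k" "ENC y (tagM 0 # [k])" using assms(2) unfolding VAR_def by blast
  then have kk: "kind 0 [k]" unfolding kind_def by blast
  obtain p q where pq: "y = p @@ x @@ q" using assms(3) unfolding fac_def by blast
  obtain m r where m: "ONE m" "m ~= \<zero>" "x = b0 @@ m @@ b0 @@ b0 @@ r" using node_begin[OF i] by blast
  then have "y = p @@ b0 @@ m @@ b0 @@ b0 @@ r @@ q" using pq by simp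
  from occurrence_node[OF m(1,2) k(2) kind_sh[OF kk] this] have "p = \<zero>"
  proof (elim disjE bexE exE conjE)
    fix a P Q p' q' assume "a \<in> set [k]" "a = p' @@ b0 @@ m @@ b0 @@ b0 @@ q'"
    then have "k = p' @@ b0 @@ m @@ b0 @@ b0 @@ q'" by simp
    then show ?thesis using occurrence_IDX[OF k(1) m(1,2), of p' q'] by (rule notE[rotated])
  qed
  then have "y @@ \<zero> = x @@ q" using pq by simp
  from scan_node[OF k(2) kind_sh[OF kk] i _ this] show "x = y" by simp
qed

end

lemma code_snoc: "code (w @ [b]) = 2 * code w + of_bool b"
  by (simp add: code_def)

lemma numeral_induct [case_names zero one even odd]:
  fixes P :: "nat => bool"
  assumes "P 0" "P 1" "\<And>m. 0 < m ==> P m ==> P (2 * m)" "\<And>m. 0 < m ==> P m ==> P (2 * m + 1)"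
  shows "P n"
proof (induction n rule: less_induct)
  case (less n)
  show ?case
  proof (cases "n div 2 = 0")
    case True
    then have "n = 0 \<or> n = 1" by linarith
    then show ?thesis using assms(1,2) by blast
  next
    case False
    then have "P (n div 2)" by (intro less) simp
    moreover have "n = 2 * (n div 2) \<or> n = 2 * (n div 2) + 1" by linarith
    ultimately show ?thesis using assms(3,4)[of "n div 2"] False by (metis gr0I)
  qed
qed

lemma numeral_even: "0 < m ==> numeral_tm (2 * m) = Times (Plus One One) (numeral_tm m)"
  and numeral_odd: "0 < m ==> numeral_tm (2 * m + 1) = Plus (Times (Plus One One) (numeral_tm m)) One"
  by (subst numeral_tm.simps, simp)+

lemma numeral_zero: "numeral_tm 0 = Zero" and numeral_one: "numeral_tm 1 = One"
  by (simp_all add: numeral_tm.simps)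

lemma fresh_numeral [simp]: "fresh (numeral_tm n) = 0"
proof (induction n rule: numeral_induct)
  case (even m)
  then show ?case by (simp add: numeral_even)
next
  case (odd m)
  then show ?case by (simp only: numeral_odd) simp
qed (simp_all add: numeral_tm.simps)

context arith_structure
begin

lemma tval_fresh [simp]: "fresh t \<le> k ==> tval (e(k := a)) t = tval e t"
proof (rule tval_upd)
  have "x < fresh t" if "x \<in> tm_vars t" for x using that by (induction t) auto
  then show "fresh t \<le> k ==> k \<notin> tm_vars t" using leD by blast
qed

lemma sat_conjs: "sat e (conjs Fs) <-> (\<forall>F\<in>set Fs. sat e F)"
  by (induction Fs rule: conjs.induct) auto

end

context pa_model
begin

section \<open>The meaning of the proof predicate in a model\<close>

lemma sat_disjs: "sat e (disjs Fs) <-> (\<exists>F\<in>set Fs. sat e F)"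
  by (induction Fs rule: disjs.induct) auto

text \<open>No string has the code \<open>\<zero>\<close>, and \<open>pr \<zero>\<close> is unspecified; hence the conditions \<open>x ~= \<zero>\<close> below.\<close>

definition pr :: "'a => 'a" where "pr x = (THE a. x = S a)"

lemma pr_S [simp]: "pr (S a) = a"
  unfolding pr_def by (rule the_equality) simp_all

lemma S_pr: "x ~= \<zero> ==> S (pr x) = x"
proof -
  assume "x ~= \<zero>"
  then obtain a where "x = S a" using cases_zero by blast
  then show ?thesis by simp
qed

lemma ex_num: "(\<exists>x. Q x) <-> Q \<zero> \<or> (\<exists>a. Q (S a))"
  by (metis S_pr)

lemma all_num: "(\<forall>x. Q x) <-> Q \<zero> \<and> (\<forall>a. Q (S a))"
  by (metis S_pr)

lemma S_le [simp]: "S a \<sqsubseteq> S b <-> a \<sqsubseteq> b"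
  by simp

lemma sat_Leq: "sat e (Leq s t) <-> tval e s \<sqsubseteq> tval e t"
  by (simp add: Leq_def Let_def le_def)

lemma sat_BAll: "fresh t \<le> k ==> sat e (BAll k t B) <-> (\<forall>x. x \<sqsubseteq> tval e t --> sat (e(k := x)) (B (Var k) (Suc k)))"
  by (simp add: BAll_def sat_Leq)

lemma sat_BEx: "fresh t \<le> k ==> sat e (BEx k t B) <-> (\<exists>x. x \<sqsubseteq> tval e t \<and> sat (e(k := x)) (B (Var k) (Suc k)))"
  by (simp add: BEx_def sat_BAll)

text \<open>Bounded quantifiers over numbers become unbounded ones over strings: the body rules out
  the number \<open>\<zero>\<close>, which codes no string, and it implies the bound.\<close>

lemma sat_BExS:
  assumes "fresh t \<le> k" "\<And>x. sat (e(k := x)) (B (Var k) (Suc k)) <-> x ~= \<zero> \<and> Q (pr x)"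
    "\<And>a. Q a ==> S a \<sqsubseteq> tval e t"
  shows "sat e (BEx k t B) <-> (\<exists>a. Q a)"
  unfolding sat_BEx[OF assms(1)] assms(2) by (subst ex_num) (simp, use assms(3) in blast)

lemma sat_BAllS:
  assumes "fresh t \<le> k" "\<And>x. sat (e(k := x)) (B (Var k) (Suc k)) <-> (x = \<zero> \<or> Q (pr x))"
    "\<And>a. \<not> S a \<sqsubseteq> tval e t ==> Q a"
  shows "sat e (BAll k t B) <-> (\<forall>a. Q a)"
  unfolding sat_BAll[OF assms(1)] assms(2) by (subst all_num) (simp, use assms(3) in blast)

lemma sat_pow2: "fresh t \<le> k ==> sat e (pow2_fm k t) <-> pw2 (tval e t)"
proof -
  assume t: "fresh t \<le> k"
  have "sat e (pow2_fm k t) <-> tval e t ~= \<zero> \<and> (\<forall>d. d \<sqsubseteq> tval e t --> (\<forall>c. c \<sqsubseteq> tval e t --> d \<otimes> c = tval e t -->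
    d = \<one> \<or> (\<exists>a. a \<sqsubseteq> d \<and> d = a \<oplus> a)))"
    using t by (simp add: pow2_fm_def sat_BAll sat_BEx)
  also have "\<dots> <-> pw2 (tval e t)"
    unfolding pw2_def
  proof (rule conj_cong[OF refl])
    assume nz: "tval e t ~= \<zero>"
    have 1: "d \<sqsubseteq> tval e t \<and> c \<sqsubseteq> tval e t" if "d \<otimes> c = tval e t" for d c
    proof -
      have "d ~= \<zero>" "c ~= \<zero>" using that nz by auto
      then have "d \<otimes> \<one> \<sqsubseteq> d \<otimes> c" "\<one> \<otimes> c \<sqsubseteq> d \<otimes> c"
        by (intro mult_mono; simp add: succ_le[of \<zero>, simplified] zero_less)+
      then show ?thesis using that by simp
    qed
    have "a \<sqsubseteq> d" if "d = a \<oplus> a" for a d using that add_le_left[of a \<zero> a] by simp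
    then show "(\<forall>d. d \<sqsubseteq> tval e t --> (\<forall>c. c \<sqsubseteq> tval e t --> d \<otimes> c = tval e t --> d = \<one> \<or> (\<exists>a. a \<sqsubseteq> d \<and> d = a \<oplus> a))) <->
      (\<forall>d c. d \<otimes> c = tval e t --> d = \<one> \<or> (\<exists>a. d = a \<oplus> a))"
      using 1 by blast
  qed
  finally show ?thesis .
qed

lemma sat_cat:
  assumes "fresh x \<le> k" "fresh y \<le> k" "fresh z \<le> k"
  shows "sat e (cat_fm k x y z) <-> tval e x ~= \<zero> \<and> tval e y ~= \<zero> \<and> tval e z = S (pr (tval e x) @@ pr (tval e y))"
proof -
  have 1: "sat e (cat_fm k x y z) <-> tval e x ~= \<zero> \<and> (\<exists>p. p \<sqsubseteq> tval e y \<and> (\<exists>d. d \<sqsubseteq> p \<and> pw2 p \<and> d ~= p \<and>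
    tval e y = p \<oplus> d \<and> tval e z = tval e x \<otimes> p \<oplus> d))"
    using assms by (simp add: cat_fm_def sat_BEx sat_pow2 sat_conjs)
  show ?thesis
  proof
    assume "sat e (cat_fm k x y z)"
    then obtain p d where x: "tval e x ~= \<zero>" and p: "d \<sqsubseteq> p" "pw2 p" "d ~= p" "tval e y = p \<oplus> d"
      "tval e z = tval e x \<otimes> p \<oplus> d" unfolding 1 by blast
    have d: "d \<sqsubset> p" using p(1,3) M.less_le by blast
    have y: "tval e y ~= \<zero>" using pw2_nonzero[OF p(2)] p(4) by (simp add: add_eq_zero)
    have "tval e z = ncat (tval e x) (tval e y)" unfolding ncat_def p(4) Lp_add[OF p(2) d] tl_add[OF p(2) d] p(5) ..
    then show "tval e x ~= \<zero> \<and> tval e y ~= \<zero> \<and> tval e z = S (pr (tval e x) @@ pr (tval e y))"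
      unfolding S_cat using x y by (simp add: S_pr)
  next
    assume *: "tval e x ~= \<zero> \<and> tval e y ~= \<zero> \<and> tval e z = S (pr (tval e x) @@ pr (tval e y))"
    then have z: "tval e z = ncat (tval e x) (tval e y)" unfolding S_cat by (simp add: S_pr)
    have y: "tval e y ~= \<zero>" using * by blast
    have d: "tl (tval e y) \<sqsubseteq> Lp (tval e y)" "tl (tval e y) ~= Lp (tval e y)"
      using tl_less[OF y] M.less_le by blast+
    have "Lp (tval e y) \<sqsubseteq> tval e y" using Lp_tl[OF y] add_le_left[of "Lp (tval e y)" \<zero> "tl (tval e y)"] by simp
    then show "sat e (cat_fm k x y z)" unfolding 1 using * d Lp_pw2[OF y] Lp_tl[OF y]
      by (intro conjI exI[of _ "Lp (tval e y)"] exI[of _ "tl (tval e y)"]) (simp_all add: z ncat_def)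
  qed
qed

abbreviation vals :: "(nat => 'a) => tm list => 'a list" where
  "vals e ts \<equiv> map (%t. pr (tval e t)) ts"

primrec conc :: "'a list => 'a" where
  "conc [] = \<zero>"
| "conc (a # as) = a @@ conc as"

declare cats_fm.simps [simp del]

lemma sat_cats:
  assumes "\<forall>t\<in>set ts. fresh t \<le> k" "fresh z \<le> k"
  shows "sat e (cats_fm k ts z) <-> (\<forall>t\<in>set ts. tval e t ~= \<zero>) \<and> tval e z = S (conc (vals e ts))"
  using assms
proof (induction ts arbitrary: k z e)
  case (Cons t ts)
  have f: "\<forall>t\<in>set ts. fresh t \<le> k" using Cons.prems by simp
  then have f': "\<forall>t\<in>set ts. fresh t \<le> Suc k" by fastforce
  have IH: "sat (e(k := x)) (cats_fm (Suc k) ts (Var k)) <->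
    (\<forall>t\<in>set ts. tval e t ~= \<zero>) \<and> x = S (conc (vals e ts))" for x
  proof -
    show ?thesis using f by (subst Cons.IH[OF f']) (simp_all cong: map_cong)
  qed
  have le: "S (conc (vals e ts)) \<sqsubseteq> tval e z" if "tval e z = S (pr (tval e t) @@ conc (vals e ts))"
    unfolding that S_le by (rule le_cat(2))
  show ?case using Cons.prems
    by (simp add: cats_fm.simps sat_BEx IH sat_cat) (use le in blast)
qed (simp add: cats_fm.simps)

lemma sat_factor:
  assumes "fresh u \<le> k" "fresh x \<le> k"
  shows "sat e (factor_fm k u x) <-> tval e u ~= \<zero> \<and> tval e x ~= \<zero> \<and> fac (pr (tval e u)) (pr (tval e x))"
proof -
  let ?u = "tval e u" and ?x = "tval e x"
  have "sat e (factor_fm k u x) <-> ?u ~= \<zero> \<and> (\<exists>p. p \<sqsubseteq> ?x \<and> p ~= \<zero> \<and> (\<exists>q. q \<sqsubseteq> ?x \<and> q ~= \<zero> \<and> ?x = S (pr p @@ pr ?u @@ pr q)))"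
    using assms unfolding factor_fm_def by (simp add: sat_BEx sat_cats) blast
  also have "\<dots> <-> ?u ~= \<zero> \<and> (\<exists>p. S p \<sqsubseteq> ?x \<and> (\<exists>q. S q \<sqsubseteq> ?x \<and> ?x = S (p @@ pr ?u @@ q)))"
    by (subst ex_num, subst (2) ex_num) simp
  also have "\<dots> <-> ?u ~= \<zero> \<and> ?x ~= \<zero> \<and> fac (pr ?u) (pr ?x)"
  proof -
    have "S p \<sqsubseteq> ?x \<and> S q \<sqsubseteq> ?x" if "?x = S (p @@ pr ?u @@ q)" for p q
      unfolding that S_le using le_cat(1)[of p "pr ?u @@ q"] M.order.trans[OF le_cat(2)[of q "pr ?u"] le_cat(2)[of _ p]]
      by simp
    then have "(\<exists>p. S p \<sqsubseteq> ?x \<and> (\<exists>q. S q \<sqsubseteq> ?x \<and> ?x = S (p @@ pr ?u @@ q))) <-> (\<exists>p q. ?x = S (p @@ pr ?u @@ q))"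
      by blast
    also have "\<dots> <-> ?x ~= \<zero> \<and> fac (pr ?u) (pr ?x)"
    proof
      assume "\<exists>p q. ?x = S (p @@ pr ?u @@ q)"
      then show "?x ~= \<zero> \<and> fac (pr ?u) (pr ?x)" unfolding fac_def by (metis pr_S S_nonzero)
    next
      assume "?x ~= \<zero> \<and> fac (pr ?u) (pr ?x)"
      then show "\<exists>p q. ?x = S (p @@ pr ?u @@ q)" unfolding fac_def by (metis S_pr)
    qed
    finally show ?thesis by blast
  qed
  finally show ?thesis .
qed

abbreviation (input) bit :: "bool => 'a" where
  "bit b \<equiv> if b then b1 else b0"

primrec bs :: "bool list => 'a" where
  "bs [] = \<zero>"
| "bs (b # w) = bit b @@ bs w"

lemma bs_append [simp]: "bs (u @ v) = bs u @@ bs v"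
  by (induction u) simp_all

lemma tval_numeral: "tval e (numeral_tm n) = M.of_nat n"
proof (induction n rule: numeral_induct)
  case (even m)
  then show ?case by (simp only: numeral_even tval.simps) (simp only: mult_2 M.of_nat_add M.distrib_right M.mult_1_left)
next
  case (odd m)
  then show ?case
    by (simp only: numeral_odd tval.simps) (simp only: mult_2 M.of_nat_add M.of_nat_1 M.distrib_right M.mult_1_left)
qed (simp_all only: numeral_zero numeral_one tval.simps M.of_nat_0 M.of_nat_1)

lemma of_nat_code: "M.of_nat (code w) = S (bs w)"
proof (induction w rule: rev_induct)
  case Nil
  then show ?case by (simp add: code_def)
next
  case (snoc b w)
  then show ?case by (cases b) (simp_all only: code_snoc mult_2 M.of_nat_add of_bool_eq M.of_nat_1 M.of_nat_0 S_b0 S_b1 add_zero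
      bs_append bs.simps cat_eps if_True if_False)
qed

lemma fresh_const [simp]: "fresh (const w) = 0"
  by (simp add: const_def)

lemma tval_const [simp]: "tval e (const w) = S (bs w)"
  by (simp add: const_def tval_numeral of_nat_code)

lemma bs_tag: "bs (tag j) = tagM j"
  by (induction j) (simp_all add: tag_def tagM_def)

lemma sat_ones:
  assumes "fresh s \<le> k" "fresh s' \<le> k"
  shows "sat e (ones_fm k s s') <-> tval e s' ~= \<zero> \<and> ONE (pr (tval e s')) \<and> tval e s = S (pr (tval e s') @@ b1)"
proof (cases "tval e s' = \<zero>")
  case True
  then show ?thesis by (simp add: ones_fm_def sat_conjs)
next
  case False
  define a where "a = pr (tval e s')"
  have a: "tval e s' = S a" using False by (simp add: a_def S_pr)
  have "pw2 (S (a @@ b1) \<oplus> \<one>) <-> ONE a" using ONE_b1[of a] unfolding ONE_def[of "a @@ b1"] by simp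
  then show ?thesis using assms by (auto simp: ones_fm_def sat_conjs sat_pow2 a S_b1)
qed

lemma sat_enc:
  assumes "fresh z \<le> k" "\<forall>t\<in>set ts. fresh t \<le> k"
  shows "sat e (enc_fm k z ts) <-> tval e z ~= \<zero> \<and> (\<forall>t\<in>set ts. tval e t ~= \<zero>) \<and> ENC (pr (tval e z)) (vals e ts)"
proof -
  have v: "tval (e(k := x, Suc k := y)) t = tval e t" if "t \<in> set ts" for t x y
    using assms(2) that by (simp add: le_SucI)
  have fs: "\<forall>t\<in>set (separated s us). fresh t \<le> m" if "fresh s \<le> m" "\<forall>t\<in>set us. fresh t \<le> m" for s us m
    using that by (induction us) auto
  have z: "tval (e(k := x, Suc k := y)) z = tval e z" for x y using assms(1) by (simp add: le_SucI)
  have f2: "\<forall>t\<in>set ts. fresh t \<le> Suc (Suc k)" using assms(2) by (auto intro: le_SucI)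
  have sep: "(\<forall>t\<in>set (separated s us). tval d t ~= \<zero>) <-> (us = [] \<or> tval d s ~= \<zero>) \<and> (\<forall>t\<in>set us. tval d t ~= \<zero>)" for s us d
    by (induction us) auto
  have conc: "conc (vals d (separated s us)) = seps (pr (tval d s)) (vals d us)" for d s us
    by (induction us) simp_all
  let ?d = "%x y. e(k := x, Suc k := y)" and ?k = "Suc (Suc k)"
  let ?B = "%x y. y ~= \<zero> \<and> ONE (pr y) \<and> x = S (pr y @@ b1) \<and>
     (\<forall>t\<in>set ts. tval e t ~= \<zero>) \<and> tval e z = S (b0 @@ pr x @@ seps (pr x) (vals e ts)) \<and>
     (\<forall>t\<in>set ts. \<not> fac (pr x) (pr (tval e t))) \<and> (\<exists>t\<in>set ts. fac (pr y) (pr (tval e t)))"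
  have 1: "sat e (enc_fm k z ts) <-> (\<exists>x. x \<sqsubseteq> tval e z \<and> (\<exists>y. y \<sqsubseteq> x \<and> ?B x y))"
  proof -
    have B: "sat (?d x y) (conjs
     [ones_fm (?k) (Var k) (Var (Suc k)),
      cats_fm (?k) (const [False] # Var k # separated (Var k) ts) z,
      conjs (map (%t. Neg (factor_fm (?k) (Var k) t)) ts),
      disjs (map (%t. factor_fm (?k) (Var (Suc k)) t) ts)]) <->
      ?B x y" for x y
    proof -
      define d where "d = ?d x y"
      have d: "d k = x" "d (Suc k) = y" "tval d z = tval e z" and dv: "\<And>t. t \<in> set ts ==> tval d t = tval e t"
        using v[of _ x y] z[of x y] by (simp_all add: d_def)
      have vs: "vals d ts = vals e ts" using dv by (intro map_cong) simp_all
      have ff: "\<forall>t\<in>set (const [False] # Var k # separated (Var k) ts). fresh t \<le> ?k" "fresh z \<le> ?k"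
        using fs[of "Var k" "?k" ts] f2 assms(1) by simp_all
      have dts: "(\<forall>t\<in>set ts. tval d t ~= \<zero>) <-> (\<forall>t\<in>set ts. tval e t ~= \<zero>)" using dv by simp
      have c: "sat d (cats_fm (?k) (const [False] # Var k # separated (Var k) ts) z) <->
        x ~= \<zero> \<and> (\<forall>t\<in>set ts. tval e t ~= \<zero>) \<and> tval e z = S (b0 @@ pr x @@ seps (pr x) (vals e ts))"
        unfolding sat_cats[OF ff] by (simp add: sep conc d dts vs cong: map_cong) blast
      have n: "sat d (conjs (map (%t. Neg (factor_fm (?k) (Var k) t)) ts)) <->
        (\<forall>t\<in>set ts. \<not> (x ~= \<zero> \<and> tval e t ~= \<zero> \<and> fac (pr x) (pr (tval e t))))"
        using f2 by (simp add: sat_conjs sat_factor dv d)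
      have p: "sat d (disjs (map (%t. factor_fm (?k) (Var (Suc k)) t) ts)) <->
        (\<exists>t\<in>set ts. y ~= \<zero> \<and> tval e t ~= \<zero> \<and> fac (pr y) (pr (tval e t)))"
        using f2 by (simp add: sat_disjs sat_factor dv d)
      have o: "sat d (ones_fm (?k) (Var k) (Var (Suc k))) <-> y ~= \<zero> \<and> ONE (pr y) \<and> x = S (pr y @@ b1)"
        using sat_ones[of "Var k" "?k" "Var (Suc k)" d] by (simp add: d)
      have "x ~= \<zero>" if "x = S (pr y @@ b1)" using that by simp
      then show ?thesis unfolding d_def[symmetric] conjs.simps sat_Con c n p o by blast
    qed
    show ?thesis unfolding enc_fm_def
      by (simp only: sat_BEx[OF assms(1)] sat_BEx[of "Var k" "Suc k"] fresh.simps le_refl B tval.simps fun_upd_same)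
  qed
  show ?thesis
  proof
    assume "sat e (enc_fm k z ts)"
    then obtain x y where y: "ONE (pr y)" "\<forall>t\<in>set ts. tval e t ~= \<zero>" "x = S (pr y @@ b1)"
      "tval e z = S (b0 @@ pr x @@ seps (pr x) (vals e ts))"
      "\<forall>t\<in>set ts. \<not> fac (pr x) (pr (tval e t))" "\<exists>t\<in>set ts. fac (pr y) (pr (tval e t))"
      unfolding 1 by blast
    then show "tval e z ~= \<zero> \<and> (\<forall>t\<in>set ts. tval e t ~= \<zero>) \<and> ENC (pr (tval e z)) (vals e ts)"
      unfolding ENC_def by auto
  next
    assume *: "tval e z ~= \<zero> \<and> (\<forall>t\<in>set ts. tval e t ~= \<zero>) \<and> ENC (pr (tval e z)) (vals e ts)"
    then obtain s where s: "ONE s" "pr (tval e z) = b0 @@ (s @@ b1) @@ seps (s @@ b1) (vals e ts)"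
      "\<forall>t\<in>set ts. \<not> fac (s @@ b1) (pr (tval e t))" "\<exists>t\<in>set ts. fac s (pr (tval e t))"
      unfolding ENC_def by auto
    have z: "tval e z = S (b0 @@ (s @@ b1) @@ seps (s @@ b1) (vals e ts))"
      using s(2) * S_pr by metis
    have "fac (s @@ b1) (b0 @@ (s @@ b1) @@ seps (s @@ b1) (vals e ts))" by (rule facI[OF refl])
    then have "S (s @@ b1) \<sqsubseteq> tval e z" unfolding z using fac_le by simp
    moreover have "s \<sqsubseteq> s @@ b1" using le_cat by blast
    ultimately have le: "S (s @@ b1) \<sqsubseteq> tval e z" "S s \<sqsubseteq> S (s @@ b1)" by simp_all
    show "sat e (enc_fm k z ts)" unfolding 1
      by (rule exI[of _ "S (s @@ b1)"], rule conjI, rule le, rule exI[of _ "S s"]) (use le s(1,3,4) * z in simp)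
  qed
qed

lemma sat_node:
  assumes "fresh z \<le> k"
  shows "sat e (node0_fm j k z) <-> tval e z ~= \<zero> \<and> ENC (pr (tval e z)) [tagM j]"
    "fresh t \<le> k ==> sat e (node1_fm j k z t) <-> tval e z ~= \<zero> \<and> tval e t ~= \<zero> \<and> ENC (pr (tval e z)) [tagM j, pr (tval e t)]"
    "fresh s \<le> k ==> fresh t \<le> k ==> sat e (node2_fm j k z s t) <-> tval e z ~= \<zero> \<and> tval e s ~= \<zero> \<and> tval e t ~= \<zero> \<and>
      ENC (pr (tval e z)) [tagM j, pr (tval e s), pr (tval e t)]"
  using assms by (simp_all add: node0_fm_def node1_fm_def node2_fm_def sat_enc bs_tag)

end

context pa_model
begin

lemma ENC_le: "ENC z ts ==> t \<in> set ts ==> t \<sqsubseteq> z"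
  using ENC_item fac_le by blast

lemma ENC_leS: "ENC (pr x) ts ==> x ~= \<zero> ==> t \<in> set ts ==> S t \<sqsubseteq> x"
  using ENC_le[of "pr x" ts t] S_le[of t "pr x"] S_pr[of x] by simp

lemma sat_var:
  assumes "fresh z \<le> k"
  shows "sat e (var_fm k z) <-> tval e z ~= \<zero> \<and> VAR (pr (tval e z))"
proof -
  let ?F = "%i k. BEx k i (%s k. BEx k s (%s' k. conjs
    [ones_fm k s s', cats_fm k [const [False], s, const [False]] i, node1_fm 0 k z i]))"
  have "sat e (var_fm k z) <-> (\<exists>i. tval e z ~= \<zero> \<and> IDX i \<and> ENC (pr (tval e z)) [tagM 0, i])"
    unfolding var_fm_def
  proof (rule sat_BExS[OF assms])
    fix x
    let ?E = "tval e z ~= \<zero> \<and> x ~= \<zero> \<and> ENC (pr (tval e z)) [tagM 0, pr x]"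
    have "sat (e(k := x)) (?F (Var k) (Suc k)) <->
        (\<exists>s. s \<sqsubseteq> x \<and> (\<exists>y. y \<sqsubseteq> s \<and> y ~= \<zero> \<and> ONE (pr y) \<and> s = S (pr y @@ b1) \<and> s ~= \<zero> \<and> x = S (b0 @@ pr s @@ b0) \<and> ?E))"
      using assms by (simp add: sat_BEx sat_ones sat_cats sat_node)
    also have "\<dots> <-> (\<exists>a. ONE a \<and> pr x = b0 @@ (a @@ b1) @@ b0 \<and> ?E)" (is "?L <-> ?R")
    proof
      assume ?R
      then obtain a where a: "ONE a" "pr x = b0 @@ (a @@ b1) @@ b0" ?E by blast
      have x: "x = S (b0 @@ (a @@ b1) @@ b0)" using a(2,3) S_pr by metis
      have "a @@ b1 \<sqsubseteq> b0 @@ (a @@ b1) @@ b0" by (rule fac_le[OF facI[OF refl]])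
      then have le: "S (a @@ b1) \<sqsubseteq> x" "S a \<sqsubseteq> S (a @@ b1)" unfolding x using le_cat by simp_all
      show ?L by (rule exI[of _ "S (a @@ b1)"], rule conjI, rule le, rule exI[of _ "S a"]) (use a x le in simp)
    qed (metis pr_S)
    finally show "sat (e(k := x)) (?F (Var k) (Suc k)) <->
      x ~= \<zero> \<and> tval e z ~= \<zero> \<and> IDX (pr x) \<and> ENC (pr (tval e z)) [tagM 0, pr x]"
      unfolding IDX_def by blast
  next
    fix a assume "tval e z ~= \<zero> \<and> IDX a \<and> ENC (pr (tval e z)) [tagM 0, a]"
    then show "S a \<sqsubseteq> tval e z" using ENC_leS[of "tval e z" _ a] by auto
  qed
  then show ?thesis unfolding VAR_def by blast
qed

lemma sat_ex_node1:
  assumes "fresh z \<le> k" "\<And>x. sat (e(k := x)) (B (Var k) (Suc k)) <-> x ~= \<zero> \<and> Q (pr x)"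
  shows "sat e (BEx k z (%a k. Con (node1_fm j k z a) (B a k))) <->
    tval e z ~= \<zero> \<and> (\<exists>a. ENC (pr (tval e z)) [tagM j, a] \<and> Q a)"
proof -
  have "sat e (BEx k z (%a k. Con (node1_fm j k z a) (B a k))) <-> (\<exists>a. tval e z ~= \<zero> \<and> ENC (pr (tval e z)) [tagM j, a] \<and> Q a)"
  proof (rule sat_BExS[OF assms(1)])
    show "S a \<sqsubseteq> tval e z" if "tval e z ~= \<zero> \<and> ENC (pr (tval e z)) [tagM j, a] \<and> Q a" for a
      using that ENC_leS[of "tval e z" _ a] by auto
  qed (use assms(1) in \<open>auto simp: sat_node assms(2)\<close>)
  then show ?thesis by blast
qed

lemma sat_ex2:
  assumes "fresh z \<le> k"
    "\<And>x y. sat (e(k := x, Suc k := y)) (B (Var k) (Var (Suc k)) (Suc (Suc k))) <->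
      tval e z ~= \<zero> \<and> x ~= \<zero> \<and> y ~= \<zero> \<and> Q (pr x) (pr y)"
    "\<And>a b. Q a b ==> \<exists>j. ENC (pr (tval e z)) [tagM j, a, b]"
  shows "sat e (BEx k z (%a k. BEx k z (%b k. B a b k))) <-> tval e z ~= \<zero> \<and> (\<exists>a b. Q a b)"
proof -
  have le: "S a \<sqsubseteq> tval e z \<and> S b \<sqsubseteq> tval e z" if h: "tval e z ~= \<zero>" "Q a b" for a b
  proof -
    obtain j where j: "ENC (pr (tval e z)) [tagM j, a, b]" using assms(3)[OF h(2)] by blast
    show ?thesis using ENC_leS[OF j h(1), of a] ENC_leS[OF j h(1), of b] by simp
  qed
  have "sat e (BEx k z (%a k. BEx k z (%b k. B a b k))) <-> (\<exists>a b. tval e z ~= \<zero> \<and> Q a b)"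
  proof (rule sat_BExS[OF assms(1)])
    fix x
    have "sat (e(k := x)) (BEx (Suc k) z (%b k'. B (Var k) b k')) <-> (\<exists>b. x ~= \<zero> \<and> tval e z ~= \<zero> \<and> Q (pr x) b)"
    proof (rule sat_BExS)
      show "fresh z \<le> Suc k" using assms(1) by simp
    next
      fix b assume "x ~= \<zero> \<and> tval e z ~= \<zero> \<and> Q (pr x) b"
      then show "S b \<sqsubseteq> tval (e(k := x)) z" using le[of "pr x" b] assms(1) by simp
    qed (auto simp: assms(2))
    then show "sat (e(k := x)) (BEx (Suc k) z (%b k'. B (Var k) b k')) <-> x ~= \<zero> \<and> (\<exists>b. tval e z ~= \<zero> \<and> Q (pr x) b)" by blast
  qed (use le in blast)
  then show ?thesis by blast
qed

lemma sat_tm_head: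
  assumes "fresh z \<le> k"
  shows "sat e (tm_head_fm k z) <-> tval e z ~= \<zero> \<and> TMH (pr (tval e z))"
proof -
  have "sat e (BEx k z (%a k. BEx k z (%b k. Dis (node2_fm 3 k z a b) (node2_fm 4 k z a b)))) <->
    tval e z ~= \<zero> \<and> (\<exists>a b. ENC (pr (tval e z)) [tagM 3, a, b] \<or> ENC (pr (tval e z)) [tagM 4, a, b])"
    by (rule sat_ex2[OF assms]) (use assms in \<open>auto simp: sat_node le_SucI\<close>)
  then show ?thesis unfolding tm_head_fm_def TMH_def disjs.simps sat_Dis sat_var[OF assms] sat_node(1)[OF assms]
    by blast
qed

lemma sat_fm_head:
  assumes "fresh z \<le> k"
  shows "sat e (fm_head_fm k z) <-> tval e z ~= \<zero> \<and> FMH (pr (tval e z))"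
proof -
  have 1: "sat e (BEx k z (%a k. BEx k z (%b k. disjs
        [node2_fm 5 k z a b, node2_fm 7 k z a b, node2_fm 8 k z a b]))) <->
    tval e z ~= \<zero> \<and> (\<exists>a b. ENC (pr (tval e z)) [tagM 5, a, b] \<or> ENC (pr (tval e z)) [tagM 7, a, b] \<or>
      ENC (pr (tval e z)) [tagM 8, a, b])"
    by (rule sat_ex2[OF assms]) (use assms in \<open>auto simp: sat_node le_SucI\<close>)
  have 2: "sat e (BEx k z (%a k. node1_fm 6 k z a)) <-> (\<exists>a. tval e z ~= \<zero> \<and> ENC (pr (tval e z)) [tagM 6, a])"
  proof (rule sat_BExS[OF assms])
    fix a assume "tval e z ~= \<zero> \<and> ENC (pr (tval e z)) [tagM 6, a]"
    then show "S a \<sqsubseteq> tval e z" using ENC_leS[of "tval e z" _ a] by auto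
  qed (use assms in \<open>auto simp: sat_node\<close>)
  show ?thesis unfolding fm_head_fm_def FMH_def by (simp only: sat_disjs list.set bex_simps simp_thms 1 2) blast
qed

lemma sat_wf:
  assumes z: "fresh z \<le> k" and nz: "tval e z ~= \<zero>"
  shows "sat e (wf_fm k z) <-> WF (pr (tval e z))"
proof -
  let ?C = "%u a b. (ENC u [tagM 3, a, b] \<or> ENC u [tagM 4, a, b] \<or> ENC u [tagM 5, a, b] --> TMH a \<and> TMH b) \<and>
      (ENC u [tagM 7, a, b] --> FMH a \<and> FMH b) \<and> (ENC u [tagM 8, a, b] --> VAR a \<and> FMH b)"
  let ?B = "%u a. (ENC u [tagM 6, a] --> FMH a) \<and> (\<forall>b. ?C u a b)"
  let ?G = "%u a b k. conjs
        [Imp (disjs [node2_fm 3 k u a b, node2_fm 4 k u a b, node2_fm 5 k u a b]) (Con (tm_head_fm k a) (tm_head_fm k b)),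
         Imp (node2_fm 7 k u a b) (Con (fm_head_fm k a) (fm_head_fm k b)),
         Imp (node2_fm 8 k u a b) (Con (var_fm k a) (fm_head_fm k b))]"
  let ?F = "%u a k. Con (Imp (node1_fm 6 k u a) (fm_head_fm k a)) (BAll k u (?G u a))"
  let ?k1 = "Suc k" and ?k2 = "Suc (Suc k)"
  have in1: "sat (e(k := x, ?k1 := y, ?k2 := w)) (?G (Var k) (Var ?k1) (Var ?k2) (Suc ?k2)) <->
    w = \<zero> \<or> x = \<zero> \<or> y = \<zero> \<or> ?C (pr x) (pr y) (pr w)" for x y w
    by (simp add: sat_node sat_tm_head sat_fm_head sat_var) blast
  have in2: "sat (e(k := x, ?k1 := y)) (BAll ?k2 (Var k) (?G (Var k) (Var ?k1))) <->
      (\<forall>b. x = \<zero> \<or> y = \<zero> \<or> ?C (pr x) (pr y) b)" for x y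
  proof (rule sat_BAllS)
    fix b assume "\<not> S b \<sqsubseteq> tval (e(k := x, ?k1 := y)) (Var k)"
    then have "x = \<zero> \<or> \<not> ENC (pr x) [t, pr y, b]" for t using ENC_leS[of x "[t, pr y, b]" b] by auto
    then show "x = \<zero> \<or> y = \<zero> \<or> ?C (pr x) (pr y) b" by blast
  qed (simp, rule in1)
  have in3: "sat (e(k := x)) (BAll ?k1 (Var k) (?F (Var k))) <-> (\<forall>a. x = \<zero> \<or> ?B (pr x) a)" for x
  proof (rule sat_BAllS)
    fix a assume "\<not> S a \<sqsubseteq> tval (e(k := x)) (Var k)"
    then have "x = \<zero> \<or> (\<not> ENC (pr x) [t, a, b] \<and> \<not> ENC (pr x) [t, a])" for t b
      using ENC_leS[of x "[t, a, b]" a] ENC_leS[of x "[t, a]" a] by auto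
    then show "x = \<zero> \<or> ?B (pr x) a" by blast
  next
    fix y
    have "sat (e(k := x, ?k1 := y)) (Imp (node1_fm 6 ?k2 (Var k) (Var ?k1)) (fm_head_fm ?k2 (Var ?k1))) <->
      (x = \<zero> \<or> y = \<zero> \<or> (ENC (pr x) [tagM 6, pr y] --> FMH (pr y)))"
      by (simp add: sat_node sat_fm_head) blast
    then show "sat (e(k := x, ?k1 := y)) (?F (Var k) (Var ?k1) ?k2) <-> (y = \<zero> \<or> x = \<zero> \<or> ?B (pr x) (pr y))"
      unfolding sat_Con in2 by blast
  qed simp
  have "sat e (wf_fm k z) <-> (\<forall>u. fac u (pr (tval e z)) --> (\<forall>a. ?B u a))"
    unfolding wf_fm_def
  proof (rule sat_BAllS[OF z])
    fix u assume "\<not> S u \<sqsubseteq> tval e z"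
    then have "\<not> u \<sqsubseteq> pr (tval e z)" using nz by (metis S_le S_pr)
    then show "fac u (pr (tval e z)) --> (\<forall>a. ?B u a)" using fac_le by blast
  next
    fix x
    have f: "sat (e(k := x)) (factor_fm ?k1 (Var k) z) <-> x ~= \<zero> \<and> fac (pr x) (pr (tval e z))"
      using z nz by (simp add: sat_factor)
    show "sat (e(k := x)) (Imp (factor_fm ?k1 (Var k) z) (BAll ?k1 (Var k) (?F (Var k)))) <->
     (x = \<zero> \<or> (fac (pr x) (pr (tval e z)) --> (\<forall>a. ?B (pr x) a)))"
      unfolding sat.simps in3 f by blast
  qed
  then show ?thesis unfolding WF_def by blast
qed

lemma sat_term: "fresh z \<le> k ==> sat e (term_fm k z) <-> tval e z ~= \<zero> \<and> TRM (pr (tval e z))"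
  and sat_form: "fresh z \<le> k ==> sat e (form_fm k z) <-> tval e z ~= \<zero> \<and> FRM (pr (tval e z))"
  unfolding term_fm_def form_fm_def TRM_def FRM_def sat_Con
  using sat_tm_head[of z k e] sat_fm_head[of z k e] sat_wf[of z k e] by blast+

end

section \<open>Patterns and axiom schemes in a model\<close>

primrec pmetas :: "pat => tm set" where
  "pmetas (PMeta t) = {t}"
| "pmetas (PNode0 j) = {}"
| "pmetas (PNode1 j p) = pmetas p"
| "pmetas (PNode2 j p q) = pmetas p \<union> pmetas q"

context pa_model
begin

primrec pv :: "(nat => 'a) => pat => 'a" where
  "pv e (PMeta t) = pr (tval e t)"
| "pv e (PNode0 j) = mk [tagM j]"
| "pv e (PNode1 j p) = mk [tagM j, pv e p]"
| "pv e (PNode2 j p q) = mk [tagM j, pv e p, pv e q]"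

abbreviation cVar :: "'a => 'a" where "cVar i \<equiv> mk [tagM 0, i]"
abbreviation cZero :: 'a where "cZero \<equiv> mk [tagM (Suc 0)]"
abbreviation cOne :: 'a where "cOne \<equiv> mk [tagM 2]"
abbreviation cPlus :: "'a => 'a => 'a" where "cPlus s t \<equiv> mk [tagM 3, s, t]"
abbreviation cTimes :: "'a => 'a => 'a" where "cTimes s t \<equiv> mk [tagM 4, s, t]"
abbreviation cEq :: "'a => 'a => 'a" where "cEq s t \<equiv> mk [tagM 5, s, t]"
abbreviation cNeg :: "'a => 'a" where "cNeg F \<equiv> mk [tagM 6, F]"
abbreviation cImp :: "'a => 'a => 'a" where "cImp F G \<equiv> mk [tagM 7, F, G]"
abbreviation cAll :: "'a => 'a => 'a" where "cAll x F \<equiv> mk [tagM 8, x, F]"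

lemma pv_upd [simp]: "\<forall>t\<in>pmetas p. fresh t \<le> k ==> pv (e(k := a)) p = pv e p"
  by (induction p) auto

lemma sat_pat:
  assumes "\<forall>t\<in>pmetas p. fresh t \<le> k \<and> tval e t ~= \<zero>" "fresh z \<le> k"
  shows "sat e (pat_fm p k z) <-> tval e z ~= \<zero> \<and> pr (tval e z) = pv e p"
  using assms
proof (induction p arbitrary: e k z)
  case (PMeta t)
  then show ?case by simp (metis S_pr)
next
  case (PNode0 j)
  then show ?case by (simp add: sat_node ENC_mk)
next
  case (PNode1 j p)
  have "sat e (pat_fm (PNode1 j p) k z) <-> tval e z ~= \<zero> \<and> (\<exists>a. ENC (pr (tval e z)) [tagM j, a] \<and> a = pv e p)"
    unfolding pat_fm.simps
  proof (rule sat_ex_node1[OF PNode1.prems(2)])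
    fix x
    have "\<forall>t\<in>pmetas p. fresh t \<le> Suc k \<and> tval (e(k := x)) t ~= \<zero>" using PNode1.prems(1) by (simp add: le_SucI)
    then show "sat (e(k := x)) (pat_fm p (Suc k) (Var k)) <-> x ~= \<zero> \<and> pr x = pv e p"
      using PNode1.prems(1) by (subst PNode1.IH) simp_all
  qed
  then show ?case by (simp add: ENC_mk)
next
  case (PNode2 j p q)
  have "sat e (pat_fm (PNode2 j p q) k z) <->
    tval e z ~= \<zero> \<and> (\<exists>a b. ENC (pr (tval e z)) [tagM j, a, b] \<and> a = pv e p \<and> b = pv e q)"
    unfolding pat_fm.simps
  proof (rule sat_ex2[OF PNode2.prems(2)])
    fix x y
    let ?d = "e(k := x, Suc k := y)"
    have m: "\<forall>t\<in>pmetas p \<union> pmetas q. fresh t \<le> Suc (Suc k) \<and> tval ?d t ~= \<zero>"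
      using PNode2.prems(1) by (auto simp: le_SucI)
    have pv: "pv ?d p = pv e p" "pv ?d q = pv e q" using PNode2.prems(1) by (simp_all add: le_SucI)
    have z: "fresh z \<le> Suc (Suc k)" "tval ?d z = tval e z" using PNode2.prems(2) by (simp_all add: le_SucI)
    have 1: "sat ?d (pat_fm p (Suc (Suc k)) (Var k)) <-> x ~= \<zero> \<and> pr x = pv e p"
      using m by (subst PNode2.IH(1)) (simp_all add: pv)
    have 2: "sat ?d (pat_fm q (Suc (Suc k)) (Var (Suc k))) <-> y ~= \<zero> \<and> pr y = pv e q"
      using m by (subst PNode2.IH(2)) (simp_all add: pv)
    show "sat ?d (conjs [node2_fm j (Suc (Suc k)) z (Var k) (Var (Suc k)), pat_fm p (Suc (Suc k)) (Var k),
      pat_fm q (Suc (Suc k)) (Var (Suc k))]) <-> tval e z ~= \<zero> \<and> x ~= \<zero> \<and> y ~= \<zero> \<and>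
      ENC (pr (tval e z)) [tagM j, pr x, pr y] \<and> pr x = pv e p \<and> pr y = pv e q"
      unfolding conjs.simps sat_Con 1 2 using z by (auto simp: sat_node)
  qed blast
  then show ?case by (simp add: ENC_mk)
qed

declare pat_fm.simps [simp del]

lemma sat_ex_var:
  "fresh z \<le> k ==> tval e z = S c ==> sat e (ex_var k z B) <-> (\<exists>a. a \<sqsubseteq> c \<and> VAR a \<and> sat (e(k := S a)) (B (Var k) (Suc k)))"
  unfolding ex_var_def by (simp only: sat_BEx, subst ex_num) (simp add: sat_var)

lemma sat_ex_term:
  "fresh z \<le> k ==> tval e z = S c ==> sat e (ex_term k z B) <-> (\<exists>a. a \<sqsubseteq> c \<and> TRM a \<and> sat (e(k := S a)) (B (Var k) (Suc k)))"
  unfolding ex_term_def by (simp only: sat_BEx, subst ex_num) (simp add: sat_term)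

lemma sat_ex_form:
  "fresh z \<le> k ==> tval e z = S c ==> sat e (ex_form k z B) <-> (\<exists>a. a \<sqsubseteq> c \<and> FRM a \<and> sat (e(k := S a)) (B (Var k) (Suc k)))"
  unfolding ex_form_def by (simp only: sat_BEx, subst ex_num) (simp add: sat_form)

lemma mk_le: "a \<in> set ts ==> a \<sqsubseteq> mk ts"
  using ENC_le[of "mk ts" ts a] ENC_mk[of ts "mk ts"] by (cases ts) simp_all

lemma le_mk: "a \<sqsubseteq> b ==> a \<sqsubseteq> mk [t, b]" "a \<sqsubseteq> b \<or> a \<sqsubseteq> c ==> a \<sqsubseteq> mk [t, b, c]"
  using M.order.trans[OF _ mk_le[of b "[t, b]"]] M.order.trans[OF _ mk_le[of b "[t, b, c]"]]
    M.order.trans[OF _ mk_le[of c "[t, b, c]"]] by auto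

lemma ex_bound: "(\<And>a. P a ==> Q a <-> Q' a) ==> (\<And>a. Q' a ==> a \<sqsubseteq> c) ==> (\<exists>a. a \<sqsubseteq> c \<and> P a \<and> Q a) <-> (\<exists>a. P a \<and> Q' a)"
  by blast

definition LAX :: "'a => bool" where
  "LAX z <->
    (\<exists>F. FRM F \<and> (\<exists>G. FRM G \<and> z = cImp F (cImp G F))) \<or>
    (\<exists>F. FRM F \<and> (\<exists>G. FRM G \<and> (\<exists>H. FRM H \<and>
       z = cImp (cImp F (cImp G H)) (cImp (cImp F G) (cImp F H))))) \<or>
    (\<exists>F. FRM F \<and> (\<exists>G. FRM G \<and> z = cImp (cImp (cNeg F) (cNeg G)) (cImp G F))) \<or>
    (\<exists>x. VAR x \<and> (\<exists>F. FRM F \<and> (\<exists>G. FRM G \<and>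
       z = cImp (cAll x (cImp F G)) (cImp (cAll x F) (cAll x G))))) \<or>
    (\<exists>x. VAR x \<and> (\<exists>F. FRM F \<and> z = cImp (cAll x F) F)) \<or>
    (\<exists>x. VAR x \<and> (\<exists>F. FRM F \<and> \<not> fac x F \<and> z = cImp F (cAll x F))) \<or>
    (\<exists>x. VAR x \<and> (\<exists>t. TRM t \<and> \<not> fac x t \<and> z = cNeg (cAll x (cNeg (cEq x t))))) \<or>
    (\<exists>t. TRM t \<and> z = cEq t t) \<or>
    (\<exists>s. TRM s \<and> (\<exists>t. TRM t \<and> (\<exists>r. TRM r \<and> z = cImp (cEq s t) (cImp (cEq s r) (cEq t r))))) \<or>
    (\<exists>s. TRM s \<and> (\<exists>t. TRM t \<and> (\<exists>s'. TRM s' \<and> (\<exists>t'. TRM t' \<and>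
       z = cImp (cEq s t) (cImp (cEq s' t') (cEq (cPlus s s') (cPlus t t'))))))) \<or>
    (\<exists>s. TRM s \<and> (\<exists>t. TRM t \<and> (\<exists>s'. TRM s' \<and> (\<exists>t'. TRM t' \<and>
       z = cImp (cEq s t) (cImp (cEq s' t') (cEq (cTimes s s') (cTimes t t')))))))"

definition PAX :: "'a => bool" where
  "PAX z <-> (\<exists>F\<in>set Q_axioms. z = bs (fm_string F)) \<or>
    (\<exists>x. VAR x \<and> (\<exists>y. VAR y \<and> (\<exists>F. FRM F \<and> x ~= y \<and> \<not> fac y F \<and>
      z = cImp (cAll x (cImp (cEq x cZero) F))
         (cImp (cAll x (cImp F (cAll y (cImp (cEq y (cPlus x cOne)) (cAll x (cImp (cEq x y) F))))))
           (cAll x F)))))"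

lemma sat_logic_axiom:
  assumes "fresh z \<le> k" "tval e z = S c"
  shows "sat e (logic_axiom_fm k z) <-> LAX c"
proof -
  note s = sat_ex_form sat_ex_var sat_ex_term sat_pat sat_factor assms le_SucI
  show ?thesis unfolding logic_axiom_fm_def LAX_def sat_disjs list.set bex_simps simp_thms
    by (intro arg_cong2[where f = "(\<or>)"]; simp add: s; (intro ex_bound refl; (elim exE conjE)?; simp add: le_mk)?)
qed

lemma sat_PA_axiom:
  assumes "fresh z \<le> k" "tval e z = S c"
  shows "sat e (PA_axiom_fm k z) <-> PAX c"
proof -
  have 1: "sat e (Eq z (quot F)) <-> c = bs (fm_string F)" for F
    using assms(2) by (simp add: quot_def goedel_number_def tval_numeral of_nat_code)
  have 2: "sat e (ex_var k z (%x k. ex_var k z (%y k. ex_form k z (%F k. conjs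
       [Neg (Eq x y), Neg (factor_fm k y F),
        pat_fm
          (PImp (PAll (PMeta x) (PImp (PEq (PMeta x) PZero) (PMeta F)))
          (PImp (PAll (PMeta x) (PImp (PMeta F)
                   (PAll (PMeta y) (PImp (PEq (PMeta y) (PPlus (PMeta x) POne))
                                         (PAll (PMeta x) (PImp (PEq (PMeta x) (PMeta y)) (PMeta F)))))))
                (PAll (PMeta x) (PMeta F)))) k z])))) <->
    (\<exists>x. VAR x \<and> (\<exists>y. VAR y \<and> (\<exists>F. FRM F \<and> x ~= y \<and> \<not> fac y F \<and>
      c = cImp (cAll x (cImp (cEq x cZero) F))
         (cImp (cAll x (cImp F (cAll y (cImp (cEq y (cPlus x cOne)) (cAll x (cImp (cEq x y) F))))))
           (cAll x F)))))"
    by (simp add: sat_ex_form sat_ex_var sat_pat sat_factor assms le_SucI)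
      (intro ex_bound refl; (elim exE conjE)?; simp add: le_mk)
  show ?thesis unfolding PA_axiom_fm_def PAX_def sat_disjs set_append set_map bex_Un list.set(1,2) bex_simps 1 2
    by (simp only: 1 2 simp_thms)
qed

section \<open>Items, lines and proofs in a model\<close>

definition ITEM :: "'a => 'a => 'a => bool" where
  "ITEM s u x <-> \<not> fac s u \<and> fac (s @@ u @@ s) x"

lemma sat_item:
  assumes "fresh s \<le> k" "fresh u \<le> k" "fresh x \<le> k" "tval e s = S s'" "tval e x = S x'"
  shows "sat e (item_fm k s u x) <-> tval e u = \<zero> \<and> False \<or> (tval e u ~= \<zero> \<and> ITEM s' (pr (tval e u)) x')"
proof (cases "tval e u = \<zero>")
  case True
  then show ?thesis using assms by (simp add: item_fm_def sat_BEx sat_cats)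
next
  case False
  have "sat e (BEx k x (%w k. Con (cats_fm k [s, u, s] w) (factor_fm k w x))) <->
    (\<exists>w. w = s' @@ pr (tval e u) @@ s' \<and> fac w x')"
  proof (rule sat_BExS[OF assms(3)])
    fix w assume "w = s' @@ pr (tval e u) @@ s' \<and> fac w x'"
    then have "fac w x'" by blast
    then show "S w \<sqsubseteq> tval e x" using fac_le[of w x'] assms(5) by simp
  next
    fix w
    show "sat (e(k := w)) (Con (cats_fm (Suc k) [s, u, s] (Var k)) (factor_fm (Suc k) (Var k) x)) <->
      w ~= \<zero> \<and> pr w = s' @@ pr (tval e u) @@ s' \<and> fac (pr w) x'"
      using assms False by (simp add: sat_cats sat_factor) (metis S_pr pr_S S_nonzero)
  qed
  then show ?thesis using False assms by (simp add: item_fm_def ITEM_def sat_factor)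
qed

definition LINE :: "'a => 'a => 'a => bool" where
  "LINE s r z <-> LAX z \<or> PAX z \<or> (\<exists>G H. ITEM s G r \<and> ITEM s H r \<and> ENC H [tagM 7, G, z]) \<or>
    (\<exists>G x. VAR x \<and> ITEM s G r \<and> ENC z [tagM 8, x, G])"

lemma ITEM_le: "ITEM s u r ==> u \<sqsubseteq> r"
  unfolding ITEM_def using fac_le[of "s @@ u @@ s" r] fac_le[OF facI[OF refl, of u s s]] M.order.trans by blast

lemma sat_line:
  assumes "fresh s \<le> k" "fresh r \<le> k" "fresh z \<le> k" "tval e s = S s'" "tval e r = S r'" "tval e z = S z'"
  shows "sat e (line_fm k s r z) <-> LINE s' r' z'"
proof -
  have 1: "sat e (BEx k r (%G k. BEx k r (%H k. conjs [item_fm k s G r, item_fm k s H r, node2_fm 7 k H G z]))) <->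
    (\<exists>G H. ITEM s' G r' \<and> ITEM s' H r' \<and> ENC H [tagM 7, G, z'])"
  proof (rule sat_BExS[OF assms(2)])
    fix G
    have "sat (e(k := G)) (BEx (Suc k) r (%H k'. conjs [item_fm k' s (Var k) r, item_fm k' s H r, node2_fm 7 k' H (Var k) z])) <->
      (\<exists>H. G ~= \<zero> \<and> ITEM s' (pr G) r' \<and> ITEM s' H r' \<and> ENC H [tagM 7, pr G, z'])"
    proof (rule sat_BExS)
      fix H
      show "sat (e(k := G, Suc k := H)) (conjs [item_fm (Suc (Suc k)) s (Var k) r, item_fm (Suc (Suc k)) s (Var (Suc k)) r,
        node2_fm 7 (Suc (Suc k)) (Var (Suc k)) (Var k) z]) <->
        H ~= \<zero> \<and> (G ~= \<zero> \<and> ITEM s' (pr G) r' \<and> ITEM s' (pr H) r' \<and> ENC (pr H) [tagM 7, pr G, z'])"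
        using assms by (auto simp: sat_item sat_node le_SucI)
    next
      fix H assume "G ~= \<zero> \<and> ITEM s' (pr G) r' \<and> ITEM s' H r' \<and> ENC H [tagM 7, pr G, z']"
      then show "S H \<sqsubseteq> tval (e(k := G)) r" using ITEM_le[of s' H r'] assms(2,5) by simp
    qed (use assms(2) in simp)
    then show "sat (e(k := G)) (BEx (Suc k) r (%H k'. conjs [item_fm k' s (Var k) r, item_fm k' s H r, node2_fm 7 k' H (Var k) z])) <->
      G ~= \<zero> \<and> (\<exists>H. ITEM s' (pr G) r' \<and> ITEM s' H r' \<and> ENC H [tagM 7, pr G, z'])" by blast
  next
    fix G assume "\<exists>H. ITEM s' G r' \<and> ITEM s' H r' \<and> ENC H [tagM 7, G, z']"
    then show "S G \<sqsubseteq> tval e r" using ITEM_le[of s' G r'] assms(5) by auto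
  qed
  have 2: "sat e (BEx k r (%G k. ex_var k z (%x k. Con (item_fm k s G r) (node2_fm 8 k z x G)))) <->
    (\<exists>G x. VAR x \<and> ITEM s' G r' \<and> ENC z' [tagM 8, x, G])"
  proof (rule sat_BExS[OF assms(2)])
    fix G
    have "sat (e(k := G)) (ex_var (Suc k) z (%x k'. Con (item_fm k' s (Var k) r) (node2_fm 8 k' z x (Var k)))) <->
      (\<exists>x. x \<sqsubseteq> z' \<and> VAR x \<and> G ~= \<zero> \<and> ITEM s' (pr G) r' \<and> ENC z' [tagM 8, x, pr G])"
      using assms by (auto simp: sat_ex_var sat_item sat_node le_SucI)
    then show "sat (e(k := G)) (ex_var (Suc k) z (%x k'. Con (item_fm k' s (Var k) r) (node2_fm 8 k' z x (Var k)))) <->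
      G ~= \<zero> \<and> (\<exists>x. VAR x \<and> ITEM s' (pr G) r' \<and> ENC z' [tagM 8, x, pr G])"
      using ENC_le[of z' "[tagM 8, _, pr G]"] by auto
  next
    fix G assume "\<exists>x. VAR x \<and> ITEM s' G r' \<and> ENC z' [tagM 8, x, G]"
    then show "S G \<sqsubseteq> tval e r" using ITEM_le[of s' G r'] assms(5) by auto
  qed
  show ?thesis unfolding line_fm_def LINE_def
    by (simp only: sat_disjs list.set bex_simps simp_thms 1 2 sat_logic_axiom[OF assms(3,6)] sat_PA_axiom[OF assms(3,6)])
qed

definition PRF :: "'a => 'a => bool" where
  "PRF x y <-> (\<exists>a. ONE a \<and> \<not> fac ((a @@ b1) @@ b1) x \<and> (\<exists>q. x = b0 @@ (a @@ b1) @@ q) \<and> \<not> fac (a @@ b1) y \<and>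
    (\<exists>p. x = p @@ (a @@ b1) @@ y @@ (a @@ b1) @@ b0) \<and> (\<exists>u. ITEM (a @@ b1) u x \<and> fac a u) \<and>
    (\<forall>r u. (\<exists>p. r = p @@ (a @@ b1)) \<and> \<not> fac (a @@ b1) u \<and> (\<exists>q. x = r @@ u @@ (a @@ b1) @@ q) --> LINE (a @@ b1) r u))"

text \<open>The last conjunct of \<open>prf_fm\<close>, named in order to compute its meaning
  separately.\<close>

definition steps_fm :: "nat => tm => tm => fm" where
  "steps_fm k s x = BAll k x (%r k. BAll k x (%u k. Imp
        (conjs
          [BEx k r (%p k. cats_fm k [p, s] r),
           Neg (factor_fm k s u),
           BEx k x (%q k. cats_fm k [r, u, s, q] x)])
        (line_fm k s r u)))"

lemma sat_steps:
  assumes k: "fresh x \<le> k" "fresh s \<le> k" and s: "tval d s = S c" and x: "tval d x = S x'"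
  shows "sat d (steps_fm k s x) <->
    (\<forall>r u. (\<exists>p. r = p @@ c) \<and> \<not> fac c u \<and> (\<exists>q. x' = r @@ u @@ c @@ q) --> LINE c r u)"
proof -
  let ?k1 = "Suc k" and ?k2 = "Suc (Suc k)"
  let ?F = "%r u k. Imp (conjs [BEx k r (%p k. cats_fm k [p, s] r), Neg (factor_fm k s u), BEx k x (%q k. cats_fm k [r, u, s, q] x)])
        (line_fm k s r u)"
  let ?Q = "%r u. (\<exists>p. r = p @@ c) \<and> \<not> fac c u \<and> (\<exists>q. x' = r @@ u @@ c @@ q) --> LINE c r u"
  have inner: "sat (d(k := v, ?k1 := w)) (?F (Var k) (Var ?k1) ?k2) <-> w = \<zero> \<or> v = \<zero> \<or> ?Q (pr v) (pr w)" for v w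
  proof -
    let ?d = "d(k := v, ?k1 := w)"
    have t: "tval ?d x = S x'" "tval ?d s = S c" "fresh x \<le> ?k2" "fresh s \<le> ?k2" "tval ?d (Var k) = v" "tval ?d (Var ?k1) = w"
      using k s x by (simp_all add: le_SucI)
    have 3: "sat ?d (BEx ?k2 x (%q k'. cats_fm k' [Var k, Var ?k1, s, q] x)) <-> (\<exists>q. v ~= \<zero> \<and> w ~= \<zero> \<and> x' = pr v @@ pr w @@ c @@ q)"
    proof (rule sat_BExS)
      fix q assume "v ~= \<zero> \<and> w ~= \<zero> \<and> x' = pr v @@ pr w @@ c @@ q"
      then have "q \<sqsubseteq> x'" using le_cat(2)[of q "pr v @@ pr w @@ c"] by simp
      then show "S q \<sqsubseteq> tval ?d x" unfolding t(1) by simp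
    next
      fix q
      have f: "\<forall>t\<in>set [Var k, Var ?k1, s, Var ?k2]. fresh t \<le> Suc ?k2" "fresh x \<le> Suc ?k2" using t(3,4) by simp_all
      show "sat (?d(?k2 := q)) (cats_fm (Suc ?k2) [Var k, Var ?k1, s, Var ?k2] x) <->
        q ~= \<zero> \<and> v ~= \<zero> \<and> w ~= \<zero> \<and> x' = pr v @@ pr w @@ c @@ pr q"
        unfolding sat_cats[OF f] using t by (simp add: conj_ac)
    qed (rule t(3))
    have 1: "sat ?d (BEx ?k2 (Var k) (%p k'. cats_fm k' [p, s] (Var k))) <-> (\<exists>p. v ~= \<zero> \<and> pr v = p @@ c)"
    proof (rule sat_BExS)
      fix p assume "v ~= \<zero> \<and> pr v = p @@ c"
      then have "S p \<sqsubseteq> S (pr v)" "v ~= \<zero>" using le_cat(1)[of p c] by simp_all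
      then show "S p \<sqsubseteq> tval ?d (Var k)" unfolding t(5) using S_pr[of v] by simp
    next
      fix p
      have f: "\<forall>t\<in>set [Var ?k2, s]. fresh t \<le> Suc ?k2" "fresh (Var k) \<le> Suc ?k2" using t(3,4) by simp_all
      have "v = S (pr p @@ c) <-> v ~= \<zero> \<and> pr v = pr p @@ c" by (metis S_pr pr_S S_nonzero)
      then show "sat (?d(?k2 := p)) (cats_fm (Suc ?k2) [Var ?k2, s] (Var k)) <-> p ~= \<zero> \<and> v ~= \<zero> \<and> pr v = pr p @@ c"
        unfolding sat_cats[OF f] using t by simp
    qed simp
    have 2: "sat ?d (factor_fm ?k2 s (Var ?k1)) <-> w ~= \<zero> \<and> fac c (pr w)"
      using t by (simp add: sat_factor)
    show ?thesis
    proof (cases "v = \<zero> \<or> w = \<zero>")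
      case True
      then show ?thesis unfolding sat.simps conjs.simps sat_Con 3 by blast
    next
      case False
      have 4: "sat ?d (line_fm ?k2 s (Var k) (Var ?k1)) <-> LINE c (pr v) (pr w)"
        by (rule sat_line) (use False t S_pr in simp_all)
      show ?thesis unfolding sat.simps conjs.simps sat_Con 1 2 3 4 using False by blast
    qed
  qed
  have le: "v \<sqsubseteq> x'" if "x' = p @@ v @@ q" for v p q using fac_le[OF facI[OF that]] .
  have mid: "sat (d(k := v)) (BAll ?k1 x (?F (Var k))) <-> (\<forall>u. v = \<zero> \<or> ?Q (pr v) u)" for v
  proof (rule sat_BAllS)
    fix u assume "\<not> S u \<sqsubseteq> tval (d(k := v)) x"
    then have "\<not> u \<sqsubseteq> x'" using k x by simp
    then have "x' ~= pr v @@ u @@ c @@ q" for q using le[of "pr v" u "c @@ q"] by blast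
    then show "v = \<zero> \<or> ?Q (pr v) u" by blast
  qed (use k in simp, rule inner)
  show ?thesis unfolding steps_fm_def
  proof (rule sat_BAllS)
    fix r assume "\<not> S r \<sqsubseteq> tval d x"
    then have "\<not> r \<sqsubseteq> x'" using x by simp
    then have "x' ~= r @@ u @@ c @@ q" for u q using le[of \<zero> r "u @@ c @@ q"] by auto
    then show "\<forall>u. ?Q r u" by blast
  next
    show "sat (d(k := v)) (BAll ?k1 x (?F (Var k))) <-> (v = \<zero> \<or> (\<forall>u. ?Q (pr v) u))" for v unfolding mid by blast
  qed (rule k)
qed

lemma sat_prf:
  assumes k: "fresh x \<le> k" "fresh y \<le> k"
  shows "sat e (prf_fm k x y) <-> tval e x ~= \<zero> \<and> tval e y ~= \<zero> \<and> PRF (pr (tval e x)) (pr (tval e y))"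
proof (cases "tval e x = \<zero>")
  case True
  have "\<not> sat d (conjs (ones_fm (Suc (Suc k)) (Var k) (Var (Suc k)) # Fs))" if "d k = \<zero>" for d Fs
  proof -
    have "\<not> sat d (ones_fm (Suc (Suc k)) (Var k) (Var (Suc k)))"
      using sat_ones[of "Var k" "Suc (Suc k)" "Var (Suc k)" d] that S_nonzero[of "pr (d (Suc k)) @@ b1"] by simp
    then show ?thesis unfolding sat_conjs by simp
  qed
  moreover have "z \<sqsubseteq> \<zero> <-> z = \<zero>" for z using M.order.antisym[OF _ zero_le] M.order.refl by blast
  ultimately show ?thesis using True k unfolding prf_fm_def by (simp add: sat_BEx del: conjs.simps)
next
  case False
  define x' y' where "x' = pr (tval e x)" and "y' = pr (tval e y)"
  have x: "tval e x = S x'" using False by (simp add: x'_def S_pr)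
  let ?k = "Suc (Suc k)"
  let ?A = "%a. \<not> fac ((a @@ b1) @@ b1) x' \<and> (\<exists>q. x' = b0 @@ (a @@ b1) @@ q) \<and> \<not> fac (a @@ b1) y' \<and>
    (\<exists>p. x' = p @@ (a @@ b1) @@ y' @@ (a @@ b1) @@ b0) \<and> (\<exists>u. ITEM (a @@ b1) u x' \<and> fac a u) \<and>
    (\<forall>r u. (\<exists>p. r = p @@ (a @@ b1)) \<and> \<not> fac (a @@ b1) u \<and> (\<exists>q. x' = r @@ u @@ (a @@ b1) @@ q) --> LINE (a @@ b1) r u)"
  let ?F = "%s s' k. conjs
     [ones_fm k s s',
      Neg (factor_fm k (Plus (Plus s s) One) x),
      BEx k x (%q k. cats_fm k [const [False], s, q] x),
      Neg (factor_fm k s y),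
      BEx k x (%p k. cats_fm k [p, s, y, s, const [False]] x),
      BEx k x (%u k. Con (item_fm k s u x) (factor_fm k s' u)),
      steps_fm k s x]"
  have core: "sat (e(k := v, Suc k := w)) (?F (Var k) (Var (Suc k)) ?k) <->
    tval e y ~= \<zero> \<and> w ~= \<zero> \<and> ONE (pr w) \<and> v = S (pr w @@ b1) \<and> ?A (pr w)" for v w
  proof -
    let ?d = "e(k := v, Suc k := w)"
    have t: "tval ?d x = S x'" "tval ?d y = tval e y" "tval ?d (Var k) = v" "tval ?d (Var (Suc k)) = w"
      "fresh x \<le> ?k" "fresh y \<le> ?k" "fresh x \<le> Suc ?k" "fresh y \<le> Suc ?k" "fresh (Var k) \<le> ?k" "fresh (Var (Suc k)) \<le> ?k"
      using x k by (simp_all add: le_SucI)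
    have ones: "sat ?d (ones_fm ?k (Var k) (Var (Suc k))) <-> w ~= \<zero> \<and> ONE (pr w) \<and> v = S (pr w @@ b1)"
      unfolding sat_ones[OF t(9,10)] t ..
    show ?thesis
    proof (cases "w ~= \<zero> \<and> ONE (pr w) \<and> v = S (pr w @@ b1)")
      case False
      then show ?thesis unfolding conjs.simps sat_Con ones by blast
    next
      case True
      define a where "a = pr w"
      define s where "s = a @@ b1"
      have v: "v = S s" "w = S a" using True by (simp_all add: a_def s_def S_pr)
      have 2: "sat ?d (Neg (factor_fm ?k (Plus (Plus (Var k) (Var k)) One) x)) <-> \<not> fac (s @@ b1) x'"
      proof -
        have "tval ?d (Plus (Plus (Var k) (Var k)) One) = S (s @@ b1)" using v by (simp add: S_b1)
        then show ?thesis using t by (simp add: sat_factor del: tval.simps)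
      qed
      have 3: "sat ?d (BEx ?k x (%q k'. cats_fm k' [const [False], Var k, q] x)) <-> (\<exists>q. x' = b0 @@ s @@ q)"
      proof (rule sat_BExS[OF t(5)])
        fix q assume "x' = b0 @@ s @@ q"
        then have "q \<sqsubseteq> x'" using fac_le[OF facI[of x' "b0 @@ s" q \<zero>]] by simp
        then show "S q \<sqsubseteq> tval ?d x" unfolding t(1) by simp
      next
        fix q
        have f: "\<forall>u\<in>set [const [False], Var k, Var ?k]. fresh u \<le> Suc ?k" by simp
        show "sat (?d(?k := q)) (cats_fm (Suc ?k) [const [False], Var k, Var ?k] x) <-> q ~= \<zero> \<and> x' = b0 @@ s @@ pr q"
          unfolding sat_cats[OF f t(7)] using t v by simp
      qed
      have 4: "sat ?d (Neg (factor_fm ?k (Var k) y)) <-> \<not> (tval e y ~= \<zero> \<and> fac s y')"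
        using t v by (simp add: sat_factor y'_def)
      have 5: "sat ?d (BEx ?k x (%p k'. cats_fm k' [p, Var k, y, Var k, const [False]] x)) <->
        (\<exists>p. tval e y ~= \<zero> \<and> x' = p @@ s @@ y' @@ s @@ b0)"
      proof (rule sat_BExS[OF t(5)])
        fix p assume "tval e y ~= \<zero> \<and> x' = p @@ s @@ y' @@ s @@ b0"
        then have "p \<sqsubseteq> x'" using le_cat(1)[of p "s @@ y' @@ s @@ b0"] by simp
        then show "S p \<sqsubseteq> tval ?d x" unfolding t(1) by simp
      next
        fix p
        have f: "\<forall>u\<in>set [Var ?k, Var k, y, Var k, const [False]]. fresh u \<le> Suc ?k" using t by simp
        show "sat (?d(?k := p)) (cats_fm (Suc ?k) [Var ?k, Var k, y, Var k, const [False]] x) <->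
          p ~= \<zero> \<and> tval e y ~= \<zero> \<and> x' = pr p @@ s @@ y' @@ s @@ b0"
          unfolding sat_cats[OF f t(7)] using t v by (simp add: y'_def)
      qed
      have 6: "sat ?d (BEx ?k x (%u k'. Con (item_fm k' (Var k) u x) (factor_fm k' (Var (Suc k)) u))) <->
        (\<exists>u. ITEM s u x' \<and> fac a u)"
      proof (rule sat_BExS[OF t(5)])
        fix u assume "ITEM s u x' \<and> fac a u"
        then show "S u \<sqsubseteq> tval ?d x" unfolding t(1) using ITEM_le[of s u x'] by simp
      next
        fix u
        have "sat (?d(?k := u)) (item_fm (Suc ?k) (Var k) (Var ?k) x) <-> u ~= \<zero> \<and> ITEM s (pr u) x'"
          by (subst sat_item[where s' = s and x' = x']) (use t v in simp_all)
        then show "sat (?d(?k := u)) (Con (item_fm (Suc ?k) (Var k) (Var ?k) x) (factor_fm (Suc ?k) (Var (Suc k)) (Var ?k))) <->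
          u ~= \<zero> \<and> ITEM s (pr u) x' \<and> fac a (pr u)"
          using t v by (auto simp: sat_factor)
      qed
      have 7: "tval ?d (Var k) = S s" using v by simp
      show ?thesis unfolding conjs.simps sat_Con ones 2 3 4 5 6
          sat_steps[OF t(5,9) 7 t(1)]
        using v unfolding a_def[symmetric] s_def[symmetric] by blast
    qed
  qed
  have "sat e (prf_fm k x y) <-> (\<exists>v. v \<sqsubseteq> S x' \<and> (\<exists>w. w \<sqsubseteq> v \<and>
    tval e y ~= \<zero> \<and> w ~= \<zero> \<and> ONE (pr w) \<and> v = S (pr w @@ b1) \<and> ?A (pr w)))"
    unfolding prf_fm_def steps_fm_def[symmetric]
    by (simp only: sat_BEx[OF k(1)] sat_BEx[of "Var k" "Suc k"] fresh.simps le_refl core tval.simps fun_upd_apply simp_thms x if_True)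
  also have "\<dots> <-> tval e y ~= \<zero> \<and> PRF x' y'" (is "?L <-> _")
  proof
    assume ?L
    then show "tval e y ~= \<zero> \<and> PRF x' y'" unfolding PRF_def by blast
  next
    assume y: "tval e y ~= \<zero> \<and> PRF x' y'"
    then obtain a where a: "ONE a" "?A a" unfolding PRF_def by blast
    obtain q where "x' = b0 @@ (a @@ b1) @@ q" using a(2) by blast
    then have le: "S (a @@ b1) \<sqsubseteq> S x'" "S a \<sqsubseteq> S (a @@ b1)" using fac_le[OF facI[of x' b0 "a @@ b1" q]] le_cat(1)[of a b1] by simp_all
    show ?L
      by (rule exI[of _ "S (a @@ b1)"], rule conjI, rule le, rule exI[of _ "S a"], unfold pr_S)
        (use y a le S_nonzero in blast)
  qed
  finally show ?thesis using x by (simp add: y'_def)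
qed

lemma sat_Prf: "sat e Prf <-> e 0 ~= \<zero> \<and> e 1 ~= \<zero> \<and> PRF (pr (e 0)) (pr (e 1))"
  unfolding Prf_def by (subst sat_prf) simp_all

end

section \<open>Derivations in a model\<close>

text \<open>
  An initial segment \<open>0 1\<^sup>k w\<^sub>1 1\<^sup>k \<dots> w\<^sub>n 1\<^sup>k\<close> of a proof, with \<open>s = 1\<^sup>k\<close>.  The set of its items is
  \<open>{w. ITEM s w r}\<close>, and \<open>\<Psi> X u\<close> says that \<open>u\<close> may be appended to a list with the set \<open>X\<close> of items.
\<close>

locale derivation = pa_model +
  fixes \<Psi> :: "('a => bool) => 'a => bool"
  assumes step_mono: "(\<And>w. X w ==> Y w) ==> \<Psi> X u ==> \<Psi> Y u"
    and Dfn_step: "Dfn (%e. \<Psi> (%w. ITEM (e 0) w (e 1)) (e 2))"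

context pa_model
begin

lemma Dfn_ITEM [dfn]: "dft s ==> dft u ==> dft r ==> Dfn (%e. ITEM (s e) (u e) (r e))"
  unfolding ITEM_def by (intro dfn)

lemma ITEM_right: "ITEM s u r ==> ITEM s u (r @@ q)"
  unfolding ITEM_def using fac_right by blast

lemma fac_antisym: "a = t @@ a @@ z ==> t = \<zero> \<and> z = \<zero>"
proof -
  assume a: "a = t @@ a @@ z"
  have "a @@ z \<sqsubseteq> a" using le_cat(2)[of "a @@ z" t] a by simp
  then have "a = a @@ z" using le_cat(1)[of a z] by (rule M.order.antisym[rotated])
  then have z: "z = \<zero>" by simp
  then have "a = t @@ a" using a by simp
  then show ?thesis using z by simp
qed

lemma not_fac_longer: "\<not> fac (s @@ b1) s"
proof
  assume "fac (s @@ b1) s"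
  then obtain p q where "s = p @@ (s @@ b1) @@ q" unfolding fac_def by blast
  then have "s = p @@ s @@ (b1 @@ q)" by simp
  from fac_antisym[OF this] show False by simp
qed

lemma last_run:
  assumes s: "ONE s" and u: "\<not> fac s u" "ends0 u" and eq: "u @@ s = y @@ s @@ q"
  shows "y = u \<and> q = \<zero>"
  using eq
proof (cases rule: levi)
  case (1 w)
  from 1(2) show ?thesis
  proof (cases rule: levi)
    case (1 t)
    have "ONE w" using s 1(1) by simp
    moreover obtain c where "y @@ w = c @@ b0" using u(2) \<open>u = y @@ w\<close> unfolding ends0_def by auto
    ultimately have "w = \<zero>" by (rule ONE_last_b0)
    then have "s = s @@ q" "y = u" using 1 \<open>u = y @@ w\<close> by simp_all
    then show ?thesis by simp
  next
    case (2 t)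
    have "u = y @@ s @@ t" using \<open>u = y @@ w\<close> 2(1) by simp
    then show ?thesis using u(1) facI by blast
  qed
next
  case (2 w)
  have "w = \<zero> \<and> q = \<zero>" using 2(2) by (rule fac_antisym)
  then show ?thesis using 2(1) by simp
qed

text \<open>As \<open>u\<close> begins and ends with 0 and \<open>r\<close> contains no longer run,
  a separator found in the extended string lies in \<open>r\<close> or is the new one. So no
  delimited occurrence of an item straddles the junction.\<close>

lemma appended_item:
  assumes s: "ONE s" and r: "r = p0 @@ s" "\<not> fac (s @@ b1) r"
    and u: "begins0 u" "ends0 u" "\<not> fac s u" and w: "\<not> fac s w" and eq: "p @@ s @@ w @@ s @@ q = r @@ u @@ s"
  shows "(q = \<zero> \<and> p @@ s = r \<and> w = u) \<or> (\<exists>q'. q = q' @@ u @@ s \<and> r = p @@ s @@ w @@ s @@ q')"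
proof -
  obtain c where c: "u = b0 @@ c" using u(1) unfolding begins0_def by blast
  have "(p @@ s @@ w @@ s) @@ q = r @@ (u @@ s)" using eq by simp
  then show ?thesis
  proof (cases rule: levi)
    case (1 v)
    have "(p @@ s @@ w) @@ s = r @@ v" using 1(1) by simp
    then show ?thesis
    proof (cases rule: levi)
      case (1 y)
      have "u @@ s = y @@ s @@ q" using \<open>u @@ s = v @@ q\<close> 1(2) by simp
      from last_run[OF s u(3,2) this] have y: "y = u" "q = \<zero>" by blast+
      have "(p @@ s) @@ w = (p0 @@ s) @@ u" using 1(1) y(1) r(1) by simp
      then have "p @@ s = r \<and> w = u"
      proof (cases rule: levi)
        case (1 t)
        from 1(1) show ?thesis
        proof (cases rule: levi)
          case (1 t')
          have "u = t' @@ s @@ w" using \<open>u = t @@ w\<close> 1(2) by simp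
          then show ?thesis using u(3) facI by blast
        next
          case (2 t')
          then have "ONE t" using s by simp
          moreover have "t @@ w = b0 @@ c" using c \<open>u = t @@ w\<close> by simp
          ultimately have "t = \<zero>" by (rule ONE_first_b0)
          then show ?thesis using 1 r(1) by simp
        qed
      next
        case (2 t)
        from 2(1) show ?thesis
        proof (cases rule: levi)
          case (1 t')
          have "w = t' @@ s @@ u" using \<open>w = t @@ u\<close> 1(2) by simp
          then show ?thesis using w facI by blast
        next
          case 3: (2 t')
          then have "ONE t" using s by simp
          moreover have "t ~= b1 @@ d" for d
          proof
            assume "t = b1 @@ d"
            then have "r = p @@ (s @@ b1) @@ d" using r(1) 2(1) by simp
            then show False using r(2) facI by blast
          qed
          ultimately have "t = \<zero>" using ONE_first[of t] by blast
          then show ?thesis using 2 r(1) by simp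
        qed
      qed
      then show ?thesis using y(2) by blast
    next
      case (2 y)
      have "ONE v" using s 2(2) by simp
      moreover have "b0 @@ (c @@ s) = v @@ q" using \<open>u @@ s = v @@ q\<close> c by simp
      ultimately have "v = \<zero>" by (rule ONE_first_b0')
      then have "q = \<zero> @@ u @@ s" "r = p @@ s @@ w @@ s @@ \<zero>" using \<open>u @@ s = v @@ q\<close> \<open>p @@ s @@ w @@ s = r @@ v\<close> by simp_all
      then show ?thesis by blast
    qed
  next
    case (2 v)
    then have "q = v @@ u @@ s" "r = p @@ s @@ w @@ s @@ v" by simp_all
    then show ?thesis by blast
  qed
qed

text \<open>Among the words between some separator and the final one, the least contains no
  separator, since otherwise its tail would be smaller.\<close>

lemma last_item:
  assumes "p @@ s = p' @@ s @@ w @@ s @@ q" "s ~= \<zero>"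
  shows "\<exists>p' u. p @@ s = p' @@ s @@ u @@ s \<and> \<not> fac s u"
proof -
  let ?Q = "%u. \<exists>p'. p @@ s = p' @@ s @@ u @@ s"
  have "\<exists>u. ?Q u"
  proof -
    have "(p' @@ s @@ w) @@ (s @@ q) = p @@ s" using assms(1) by simp
    then show ?thesis
    proof (cases rule: levi)
      case (1 t)
      have "t = \<zero> \<and> q = \<zero>" using 1(2) by (rule fac_antisym)
      then have "p @@ s = p' @@ s @@ w @@ s" using 1(1) by auto
      then show ?thesis by blast
    next
      case (2 t)
      then have "p @@ s = p' @@ s @@ (w @@ t) @@ s" by simp
      then show ?thesis by blast
    qed
  qed
  moreover have "Dfn (%e. ?Q (e 0))" by (intro dfn)
  ultimately obtain u where u: "?Q u" "\<And>c. ?Q c ==> u \<sqsubseteq> c" using least[of ?Q] by blast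
  obtain p' where p': "p @@ s = p' @@ s @@ u @@ s" using u(1) by blast
  have "\<not> fac s u"
  proof
    assume "fac s u"
    then obtain a c where c: "u = a @@ s @@ c" unfolding fac_def by blast
    then have "p @@ s = (p' @@ s @@ a) @@ s @@ c @@ s" using p' by simp
    then have "u \<sqsubseteq> c" using u(2) by blast
    moreover have "c \<sqsubseteq> u" using c le_cat(2)[of c "a @@ s"] by simp
    ultimately have "u = c" by (rule M.order.antisym)
    then have "c = a @@ s @@ c" using c by (simp only:)
    then have "c = (a @@ s) @@ c" by simp
    then have "a @@ s = \<zero>" by (simp only: cat_eq_right)
    then show False using assms(2) by simp
  qed
  then show ?thesis using p' by blast
qed

lemma ITEM_occurs: "ITEM s u r <-> \<not> fac s u \<and> (\<exists>p q. r = p @@ s @@ u @@ s @@ q)"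
  unfolding ITEM_def fac_def[of "s @@ u @@ s"] by simp

text \<open>A letter 1 next to a separator, or two adjacent separators, would produce a longer run
  of ones, which is excluded.\<close>

lemma ITEM_bounds:
  assumes s: "ONE s" "s ~= \<zero>" and r: "\<not> fac (s @@ b1) r" and u: "ITEM s u r"
  shows "begins0 u" "ends0 u"
proof -
  obtain p q where pq: "r = p @@ s @@ u @@ s @@ q" "\<not> fac s u" using u unfolding ITEM_occurs by blast
  have b: "s @@ u @@ s ~= a @@ s @@ b1 @@ c" for a c
  proof
    assume "s @@ u @@ s = a @@ s @@ b1 @@ c"
    then have "fac (s @@ b1) (s @@ u @@ s)" by (intro facI[of _ a _ c]) simp
    moreover have "fac (s @@ u @@ s) r" by (rule facI[of _ p _ q]) (simp add: pq)
    ultimately show False using r fac_trans by blast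
  qed
  have 1: "s ~= b1 @@ c" if "u = \<zero>" for c using b[of \<zero> "c"] that by auto
  have u0: "u ~= \<zero>" using 1 ONE_first[OF s(1)] s(2) by blast
  have "u ~= b1 @@ c" for c using b[of \<zero> "c @@ s"] by auto
  then show "begins0 u" using first_letter[of u] u0 unfolding begins0_def by blast
  have "u ~= c @@ b1" for c
  proof
    assume "u = c @@ b1"
    then have "s @@ u @@ s = (s @@ c) @@ s @@ b1 @@ \<zero>" using ONE_comm1[OF s(1)] by simp
    then show False using b by blast
  qed
  then show "ends0 u" using last_letter[of u] u0 unfolding ends0_def by blast
qed

lemma ITEM_append:
  assumes s: "ONE s" and r: "r = p0 @@ s" "\<not> fac (s @@ b1) r"
    and u: "begins0 u" "ends0 u" "\<not> fac s u"
  shows "ITEM s w (r @@ u @@ s) <-> ITEM s w r \<or> w = u"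
proof
  assume "ITEM s w (r @@ u @@ s)"
  then obtain p q where pq: "p @@ s @@ w @@ s @@ q = r @@ u @@ s" "\<not> fac s w" unfolding ITEM_occurs by metis
  from appended_item[OF s r u pq(2,1)] show "ITEM s w r \<or> w = u"
    unfolding ITEM_occurs using pq(2) by blast
next
  have "r @@ u @@ s = p0 @@ s @@ u @@ s @@ \<zero>" using r(1) by simp
  then have "ITEM s u (r @@ u @@ s)" unfolding ITEM_occurs using u(3) by blast
  then show "ITEM s w r \<or> w = u ==> ITEM s w (r @@ u @@ s)" using ITEM_right by blast
qed

end

context derivation
begin

text \<open>There is no closing 0, and the separator need not be minimal; this freedom makes
  appending and copying possible. The notion is used for proofs, with \<open>STEP\<close>, and for
  tables of numerals, with \<open>NSTEP\<close>.\<close>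

definition LST :: "'a => 'a => bool" where
  "LST s r <-> ONE s \<and> s ~= \<zero> \<and> (\<exists>q. r = b0 @@ s @@ q) \<and> (\<exists>p. r = p @@ s) \<and> \<not> fac (s @@ b1) r \<and>
    (\<forall>p u q. r = p @@ s @@ u @@ s @@ q \<and> \<not> fac s u --> \<Psi> (%w. ITEM s w (p @@ s)) u)"

definition DRV :: "'a => bool" where
  "DRV u <-> (\<exists>s r. LST s r \<and> ITEM s u r)"

lemma Dfn_step' [dfn]: "dft s ==> dft r ==> dft u ==> Dfn (%e. \<Psi> (%w. ITEM (s e) w (r e)) (u e))"
  by (rule Dfn3[of "%s r u. \<Psi> (%w. ITEM s w r) u"]) (rule Dfn_step)

lemma Dfn_LST [dfn]: "dft s ==> dft r ==> Dfn (%e. LST (s e) (r e))"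
  by (rule Dfn2[of LST]) (unfold LST_def, intro dfn)

lemma Dfn_DRV [dfn]: "dft u ==> Dfn (%e. DRV (u e))"
  by (rule Dfn1[of DRV]) (unfold DRV_def, intro dfn)

lemma LST_D:
  assumes "LST s r"
  shows "ONE s" "s ~= \<zero>" "\<exists>q. r = b0 @@ s @@ q" "\<exists>p. r = p @@ s" "\<not> fac (s @@ b1) r"
    "r = p @@ s @@ u @@ s @@ q ==> \<not> fac s u ==> \<Psi> (%w. ITEM s w (p @@ s)) u"
  using assms unfolding LST_def by blast+

lemma LST_empty: "ONE s ==> s ~= \<zero> ==> LST s (b0 @@ s)"
proof -
  assume s: "ONE s" "s ~= \<zero>"
  have "\<not> fac (s @@ b1) (b0 @@ s)"
    using fac_ones_cat[of "s @@ b1" \<zero> s] s(1) not_fac_longer[of s] by auto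
  moreover have "b0 @@ s ~= p @@ s @@ u @@ s @@ q" for p u q
  proof
    assume "b0 @@ s = p @@ s @@ u @@ s @@ q"
    then have eq: "b0 @@ s = (p @@ s @@ u) @@ s @@ q" by simp
    have b: "\<not> fac s b0" "ends0 b0" using fac_ones_b0[OF s] by (auto simp: ends0_def intro: exI[of _ \<zero>])
    have "p @@ s @@ u = b0" using last_run[OF s(1) b eq] by blast
    then have "fac s b0" using facI[of b0 p s u] by simp
    then show False using b(1) by blast
  qed
  moreover have "b0 @@ s = b0 @@ s @@ \<zero>" by simp
  ultimately show ?thesis unfolding LST_def using s by blast
qed

lemma LST_append:
  assumes r: "LST s r" and u: "begins0 u" "ends0 u" "\<not> fac s u" "\<Psi> (%w. ITEM s w r) u"
  shows "LST s (r @@ u @@ s)"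
proof -
  note s = LST_D(1,2)[OF r]
  obtain p0 where p0: "r = p0 @@ s" using LST_D(4)[OF r] by blast
  obtain q0 where q0: "r = b0 @@ s @@ q0" using LST_D(3)[OF r] by blast
  have n: "\<not> fac (s @@ b1) (r @@ u @@ s)"
  proof
    assume f: "fac (s @@ b1) (r @@ u @@ s)"
    obtain c d where c: "u = b0 @@ c" "u = d @@ b0" using u(1,2) unfolding begins0_def ends0_def by blast
    have s1: "ONE (s @@ b1)" "s @@ b1 ~= \<zero>" using s by simp_all
    have nu: "\<not> fac (s @@ b1) u" using u(3) fac_trans[OF fac_catI(1)] by blast
    have "r @@ u @@ s = (r @@ d) @@ b0 @@ s" unfolding c(2) by simp
    then have "fac (s @@ b1) (r @@ d)" using fac_ones_cat[OF s1, of "r @@ d" s] f not_fac_longer[of s] by auto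
    then have "fac (s @@ b1) (r @@ d @@ b0)" using fac_right[of "s @@ b1" "r @@ d" b0] by simp
    then have "fac (s @@ b1) (r @@ b0 @@ c)" using c by simp
    then have "fac (s @@ b1) c" using fac_ones_cat[OF s1] LST_D(5)[OF r] by blast
    then show False using nu c(1) fac_left by blast
  qed
  have st: "\<Psi> (%w. ITEM s w (p @@ s)) v" if v: "r @@ u @@ s = p @@ s @@ v @@ s @@ q" "\<not> fac s v" for p v q
    using appended_item[OF s(1) p0 LST_D(5)[OF r] u(1-3) v(2) v(1)[symmetric]]
  proof (elim disjE conjE exE)
    assume "p @@ s = r" "v = u"
    then show ?thesis using u(4) by simp
  next
    fix q' assume "r = p @@ s @@ v @@ s @@ q'"
    then show ?thesis using LST_D(6)[OF r] v(2) by blast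
  qed
  have "\<exists>q. r @@ u @@ s = b0 @@ s @@ q" by (rule exI[of _ "q0 @@ u @@ s"]) (simp add: q0)
  moreover have "\<exists>p. r @@ u @@ s = p @@ s" by (rule exI[of _ "r @@ u"]) simp
  ultimately show ?thesis unfolding LST_def using s n st by blast
qed

lemma LST_prefix:
  assumes "LST s r" "r = p @@ s @@ q" "p ~= \<zero>"
  shows "LST s (p @@ s)"
proof -
  obtain q0 where q0: "b0 @@ s @@ q0 = (p @@ s) @@ q" using LST_D(3)[OF assms(1)] assms(2) by auto
  have "\<exists>q. p @@ s = b0 @@ s @@ q"
  proof -
    have "(b0 @@ s) @@ q0 = (p @@ s) @@ q" using q0 by simp
    then show ?thesis
    proof (cases rule: levi)
      case (1 w)
      have "b0 @@ s = p @@ s @@ w" using 1(1) by simp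
      moreover have "\<not> fac s b0" "ends0 b0" using fac_ones_b0[OF LST_D(1,2)[OF assms(1)]] by (auto simp: ends0_def intro: exI[of _ \<zero>])
      ultimately have "p = b0" using last_run[OF LST_D(1)[OF assms(1)]] by blast
      then show ?thesis by (intro exI[of _ \<zero>]) simp
    next
      case (2 w)
      then show ?thesis by (intro exI[of _ w]) simp
    qed
  qed
  moreover have "\<not> fac (s @@ b1) (p @@ s)"
    using LST_D(5)[OF assms(1)] fac_right[of "s @@ b1" "p @@ s" q] assms(2) by auto
  moreover have "\<Psi> (%w. ITEM s w (p' @@ s)) u" if h: "p @@ s = p' @@ s @@ u @@ s @@ q'" "\<not> fac s u" for p' u q'
  proof -
    have "r = (p @@ s) @@ q" using assms(2) by simp
    then have "r = p' @@ s @@ u @@ s @@ (q' @@ q)" unfolding h(1) by simp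
    then show ?thesis using LST_D(6)[OF assms(1)] h(2) by blast
  qed
  ultimately show ?thesis unfolding LST_def using LST_D(1,2)[OF assms(1)] by blast
qed

text \<open>The list may have nonstandard length, so the induction runs over the position of an
  item: the items of the segment before it have smaller positions.\<close>

lemma LST_induct:
  assumes r: "LST s r" and \<Phi>: "Dfn (%e. \<Phi> (e 0))" and step: "\<And>X u. (\<And>w. X w ==> \<Phi> w) ==> \<Psi> X u ==> \<Phi> u"
    and u: "ITEM s u r"
  shows "\<Phi> u"
proof -
  have s: "s ~= \<zero>" using LST_D(2)[OF r] .
  have \<Phi>': "dft t ==> Dfn (%e. \<Phi> (t e))" for t using \<Phi> by (rule Dfn1)
  have "\<forall>u q. r = p @@ s @@ u @@ s @@ q \<and> \<not> fac s u --> \<Phi> u" for p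
  proof (rule strong_ind[of "%p. \<forall>u q. r = p @@ s @@ u @@ s @@ q \<and> \<not> fac s u --> \<Phi> u" p])
    show "Dfn (%e. \<forall>u q. r = e 0 @@ s @@ u @@ s @@ q \<and> \<not> fac s u --> \<Phi> u)" by (intro dfn \<Phi>')
  next
    fix p assume IH: "\<And>p'. p' \<sqsubset> p ==> \<forall>u q. r = p' @@ s @@ u @@ s @@ q \<and> \<not> fac s u --> \<Phi> u"
    show "\<forall>u q. r = p @@ s @@ u @@ s @@ q \<and> \<not> fac s u --> \<Phi> u"
    proof (intro allI impI, elim conjE)
      fix u q assume u: "r = p @@ s @@ u @@ s @@ q" "\<not> fac s u"
      have "\<Phi> w" if w: "ITEM s w (p @@ s)" for w
      proof -
        obtain p' q' where p': "p @@ s = p' @@ s @@ w @@ s @@ q'" "\<not> fac s w" using w unfolding ITEM_occurs by blast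
        have "p' \<sqsubset> p"
          using p'(1)
        proof (cases rule: levi)
          case (1 t)
          have "t ~= \<zero>"
          proof
            assume "t = \<zero>"
            then have "s = \<zero> @@ s @@ (w @@ s @@ q')" using 1(2) by simp
            from fac_antisym[OF this] show False using s by simp
          qed
          then have "p ~= p'" using 1(1) by simp
          moreover have "p' \<sqsubseteq> p" unfolding 1(1) by (rule le_cat(1))
          ultimately show ?thesis using M.less_le by blast
        next
          case (2 t)
          then have "s = t @@ s @@ (w @@ s @@ q')" by simp
          from fac_antisym[OF this] show ?thesis using s by simp
        qed
        moreover have "r = p' @@ s @@ w @@ s @@ (q' @@ u @@ s @@ q)"
        proof -
          have "r = (p @@ s) @@ u @@ s @@ q" using u(1) by simp
          then show ?thesis unfolding p'(1) by simp
        qed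
        ultimately show ?thesis using IH[rule_format, of p' w] p'(2) by blast
      qed
      then show "\<Phi> u" using LST_D(6)[OF r u] by (rule step)
    qed
  qed
  moreover obtain p q where "r = p @@ s @@ u @@ s @@ q \<and> \<not> fac s u" using u unfolding ITEM_occurs by blast
  ultimately show ?thesis by blast
qed

lemma DRV_induct:
  assumes "DRV u" "Dfn (%e. \<Phi> (e 0))" "\<And>X u. (\<And>w. X w ==> \<Phi> w) ==> \<Psi> X u ==> \<Phi> u"
  shows "\<Phi> u"
proof -
  obtain s r where r: "LST s r" "ITEM s u r" using assms(1) unfolding DRV_def by blast
  show ?thesis by (rule LST_induct[OF r(1) assms(2) _ r(2)]) (rule assms(3))
qed

lemma LST_item_bounds: "LST s r ==> ITEM s u r ==> begins0 u \<and> ends0 u"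
  using ITEM_bounds[of s r u] LST_D(1,2,5)[of s r] by blast

text \<open>The two lists may have different separators, so they cannot be concatenated. The items
  of the second are appended one by one with the separator of the first; monotonicity of
  \<open>\<Psi>\<close> keeps every step valid, and the assumption \<open>n\<close> prevents the new
  separator from occurring in an item.\<close>

lemma LST_merge:
  assumes r: "LST s r" and r1: "LST s1 r1" and n: "\<And>u. ITEM s1 u r1 ==> \<not> fac s u"
  shows "\<exists>r'. LST s r' \<and> (\<forall>w. ITEM s w r \<or> ITEM s1 w r1 --> ITEM s w r')"
proof -
  let ?P = "%p. \<forall>q. r1 = p @@ s1 @@ q --> (\<exists>r'. LST s r' \<and> (\<forall>w. ITEM s w r \<or> ITEM s1 w (p @@ s1) --> ITEM s w r'))"
  have s1: "ONE s1" "s1 ~= \<zero>" using LST_D[OF r1] by blast+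
  have "?P p" for p
  proof (rule strong_ind[of ?P])
    show "Dfn (%e. ?P (e 0))" by (intro dfn)
  next
    fix p assume IH: "\<And>p'. p' \<sqsubset> p ==> ?P p'"
    show "?P p"
    proof (intro allI impI)
      fix q assume q: "r1 = p @@ s1 @@ q"
      show "\<exists>r'. LST s r' \<and> (\<forall>w. ITEM s w r \<or> ITEM s1 w (p @@ s1) --> ITEM s w r')"
      proof (cases "\<exists>w. ITEM s1 w (p @@ s1)")
        case False
        then show ?thesis using r by blast
      next
        case True
        then obtain p' u where u: "p @@ s1 = p' @@ s1 @@ u @@ s1" "\<not> fac s1 u"
          using last_item[OF _ s1(2)] unfolding ITEM_occurs by blast
        have p: "p = (p' @@ s1) @@ u"
        proof -
          have "p @@ s1 = ((p' @@ s1) @@ u) @@ s1" using u(1) by simp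
          then show ?thesis by (simp only: cat_right_cancel)
        qed
        have r1': "r1 = p' @@ s1 @@ u @@ s1 @@ q" using q p by simp
        have "p' ~= p"
        proof
          assume "p' = p"
          then have "p' = p' @@ (s1 @@ u)" using p by simp
          then show False using s1(2) by (simp only: cat_eq_left cat_eq_eps simp_thms)
        qed
        moreover have "p' \<sqsubseteq> p" unfolding p using le_cat(1)[of p' "s1 @@ u"] by simp
        ultimately have "p' \<sqsubset> p" using M.less_le by blast
        then obtain r' where r': "LST s r'" "\<And>w. ITEM s w r \<or> ITEM s1 w (p' @@ s1) ==> ITEM s w r'"
          using IH r1' by blast
        have u1: "ITEM s1 u r1" unfolding ITEM_occurs using u(2) r1' by blast
        then have b: "begins0 u" "ends0 u" "\<not> fac s u" using LST_item_bounds[OF r1] n by blast+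
        have "\<Psi> (%w. ITEM s1 w (p' @@ s1)) u" using LST_D(6)[OF r1 r1' u(2)] .
        then have "\<Psi> (%w. ITEM s w r') u" using step_mono[of "%w. ITEM s1 w (p' @@ s1)" "%w. ITEM s w r'"] r'(2) by blast
        from LST_append[OF r'(1) b this] have L: "LST s (r' @@ u @@ s)" .
        have "\<not> fac (s1 @@ b1) (p' @@ s1)"
          using LST_D(5)[OF r1] fac_right[of "s1 @@ b1" "p' @@ s1" "u @@ s1 @@ q"] r1' by auto
        from ITEM_append[OF s1(1) refl this b(1,2) u(2)]
        have i: "ITEM s1 w (p @@ s1) <-> ITEM s1 w (p' @@ s1) \<or> w = u" for w unfolding p by simp
        obtain p0 where p0: "r' = p0 @@ s" using LST_D(4)[OF r'(1)] by blast
        have "ITEM s w (r' @@ u @@ s) <-> ITEM s w r' \<or> w = u" for w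
          by (rule ITEM_append[OF LST_D(1)[OF r'(1)] p0 LST_D(5)[OF r'(1)] b])
        then show ?thesis using L i r'(2) by blast
      qed
    qed
  qed
  moreover obtain p where "r1 = p @@ s1" using LST_D(4)[OF r1] by blast
  ultimately show ?thesis using cat_eps by metis
qed

lemma DRV_intro:
  assumes "DRV v" "DRV w" "\<Psi> (%a. a = v \<or> a = w) u" "begins0 u" "ends0 u"
  shows "DRV u"
proof -
  obtain s1 r1 s2 r2 where 1: "LST s1 r1" "ITEM s1 v r1" and 2: "LST s2 r2" "ITEM s2 w r2"
    using assms(1,2) unfolding DRV_def by blast
  \<comment> \<open>A run larger than all strings involved is a factor of no item, so both
    derivations can be copied with it as the separator.\<close>
  obtain s where s: "ONE s" "r1 \<oplus> r2 \<oplus> u \<sqsubset> s" using ONE_big by blast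
  have le: "r1 \<sqsubseteq> r1 \<oplus> r2 \<oplus> u" "r2 \<sqsubseteq> r1 \<oplus> r2 \<oplus> u" "u \<sqsubseteq> r1 \<oplus> r2 \<oplus> u"
  proof -
    have *: "a \<sqsubseteq> a \<oplus> b" "b \<sqsubseteq> a \<oplus> b" for a b using add_le_left[of a \<zero> b] add_le_right[of \<zero> b a] by simp_all
    show "r1 \<sqsubseteq> r1 \<oplus> r2 \<oplus> u" "r2 \<sqsubseteq> r1 \<oplus> r2 \<oplus> u" "u \<sqsubseteq> r1 \<oplus> r2 \<oplus> u" using * M.order.trans by blast+
  qed
  have s0: "s ~= \<zero>" using s(2) zero_le M.not_le by blast
  have nf: "\<not> fac s a" if a: "a \<sqsubseteq> r1 \<oplus> r2 \<oplus> u" for a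
    using fac_le[of s a] M.order.trans[OF _ a, of s] s(2) M.not_le by blast
  have 3: "\<not> fac s a" if "ITEM s1 a r1" for a using nf[OF M.order.trans[OF ITEM_le[OF that] le(1)]] .
  have 4: "\<not> fac s a" if "ITEM s2 a r2" for a using nf[OF M.order.trans[OF ITEM_le[OF that] le(2)]] .
  obtain r where r: "LST s r" "ITEM s v r" using LST_merge[OF LST_empty[OF s(1) s0] 1(1) 3] 1(2) by blast
  obtain r' where r': "LST s r'" "ITEM s v r'" "ITEM s w r'" using LST_merge[OF r(1) 2(1) 4] r(2) 2(2) by blast
  have "\<Psi> (%a. ITEM s a r') u" by (rule step_mono[OF _ assms(3)]) (use r'(2,3) in blast)
  then have L: "LST s (r' @@ u @@ s)" using LST_append[OF r'(1) assms(4,5) nf[OF le(3)]] by blast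
  obtain p0 where "r' = p0 @@ s" using LST_D(4)[OF r'(1)] by blast
  then have "ITEM s u (r' @@ u @@ s)"
    using ITEM_append[OF LST_D(1)[OF r'(1)] _ LST_D(5)[OF r'(1)] assms(4,5) nf[OF le(3)], of p0 u] by blast
  then show ?thesis unfolding DRV_def using L by blast
qed

lemma DRV_axiom:
  assumes "\<Psi> (%a. False) u" "begins0 u" "ends0 u"
  shows "DRV u"
proof -
  obtain s where s: "ONE s" "u \<sqsubset> s" using ONE_big by blast
  then have s0: "s ~= \<zero>" using zero_le M.not_le by blast
  have nf: "\<not> fac s u" using fac_le[of s u] s(2) M.not_le by blast
  have "\<Psi> (%a. ITEM s a (b0 @@ s)) u" by (rule step_mono[OF _ assms(1)]) simp
  then have L: "LST s ((b0 @@ s) @@ u @@ s)" using LST_append[OF LST_empty[OF s(1) s0] assms(2,3) nf] by blast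
  have "(b0 @@ s) @@ u @@ s = b0 @@ s @@ u @@ s @@ \<zero>" by simp
  then have "ITEM s u ((b0 @@ s) @@ u @@ s)" unfolding ITEM_occurs using nf by blast
  then show ?thesis unfolding DRV_def using L by blast
qed

lemma DRV_cases:
  assumes "DRV u"
  shows "\<exists>X. (\<forall>w. X w --> DRV w) \<and> \<Psi> X u"
proof -
  obtain s r where r: "LST s r" "ITEM s u r" using assms unfolding DRV_def by blast
  then obtain p q where pq: "r = p @@ s @@ u @@ s @@ q" "\<not> fac s u" unfolding ITEM_occurs by blast
  have "DRV w" if "ITEM s w (p @@ s)" for w
  proof -
    have "ITEM s w r" using ITEM_right[OF that, of "u @@ s @@ q"] pq(1) by simp
    then show ?thesis using r(1) unfolding DRV_def by blast
  qed
  then show ?thesis using LST_D(6)[OF r(1) pq] by (intro exI[of _ "%w. ITEM s w (p @@ s)"]) blast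
qed

end

section \<open>Provability in a model\<close>

context pa_model
begin

lemma
  assumes "dft a"
  shows dft_mk1 [dfn]: "dft (%e. mk [a e])"
    and dft_mk2 [dfn]: "dft b ==> dft (%e. mk [a e, b e])"
    and dft_mk3 [dfn]: "dft b ==> dft (%e. mk [tagM j, a e, b e])"
proof -
  have "dft (%e. mk [e 0])" unfolding dft_def by (simp only: ENC_mk[symmetric] list.simps simp_thms not_False_eq_True, intro dfn)
  then show "dft (%e. mk [a e])" by (rule dft1[of "%a. mk [a]"]) (rule assms)
  have "dft (%e. mk [e 0, e 1])" unfolding dft_def by (simp only: ENC_mk[symmetric] list.simps simp_thms not_False_eq_True, intro dfn)
  then show "dft b ==> dft (%e. mk [a e, b e])" by (rule dft2[of "%a b. mk [a, b]"]) (rule assms)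
  have "dft (%e. mk [tagM j, e 0, e 1])" unfolding dft_def by (simp only: ENC_mk[symmetric] list.simps simp_thms not_False_eq_True, intro dfn)
  then show "dft b ==> dft (%e. mk [tagM j, a e, b e])" by (rule dft2[of "%a b. mk [tagM j, a, b]"]) (rule assms)
qed

lemma Dfn_WF [dfn]: "dft z ==> Dfn (%e. WF (z e))"
  by (rule Dfn1[of WF]) (unfold WF_def, intro dfn)

lemma Dfn_TRM [dfn]: "dft z ==> Dfn (%e. TRM (z e))" and Dfn_FRM [dfn]: "dft z ==> Dfn (%e. FRM (z e))"
  unfolding TRM_def FRM_def by (intro dfn; assumption)+

lemma Dfn_LAX [dfn]: "dft z ==> Dfn (%e. LAX (z e))"
  by (rule Dfn1[of LAX]) (unfold LAX_def, intro dfn)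

lemma Dfn_PAX [dfn]: "dft z ==> Dfn (%e. PAX (z e))"
proof (rule Dfn1[of PAX])
  have "Dfn (%e. \<exists>F\<in>set Fs. e 0 = bs (fm_string F))" for Fs
    by (induction Fs) (auto intro!: dfn)
  then show "Dfn (%e. PAX (e 0))" unfolding PAX_def by (intro dfn)
qed

lemma LAX_intros:
  "FRM F ==> FRM G ==> LAX (cImp F (cImp G F))"
  "FRM F ==> FRM G ==> FRM H ==> LAX (cImp (cImp F (cImp G H)) (cImp (cImp F G) (cImp F H)))"
  "FRM F ==> FRM G ==> LAX (cImp (cImp (cNeg F) (cNeg G)) (cImp G F))"
  "VAR x ==> FRM F ==> FRM G ==> LAX (cImp (cAll x (cImp F G)) (cImp (cAll x F) (cAll x G)))"
  "VAR x ==> FRM F ==> LAX (cImp (cAll x F) F)"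
  "VAR x ==> FRM F ==> \<not> fac x F ==> LAX (cImp F (cAll x F))"
  "VAR x ==> TRM t ==> \<not> fac x t ==> LAX (cNeg (cAll x (cNeg (cEq x t))))"
  "TRM t ==> LAX (cEq t t)"
  "TRM s ==> TRM t ==> TRM r ==> LAX (cImp (cEq s t) (cImp (cEq s r) (cEq t r)))"
  "TRM s ==> TRM t ==> TRM s' ==> TRM t' ==> LAX (cImp (cEq s t) (cImp (cEq s' t') (cEq (cPlus s s') (cPlus t t'))))"
  "TRM s ==> TRM t ==> TRM s' ==> TRM t' ==> LAX (cImp (cEq s t) (cImp (cEq s' t') (cEq (cTimes s s') (cTimes t t'))))"
  unfolding LAX_def
  by (metis | blast)+

definition STEP :: "('a => bool) => 'a => bool" where
  "STEP X z <-> LAX z \<or> PAX z \<or> (\<exists>G H. X G \<and> X H \<and> ENC H [tagM 7, G, z]) \<or>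
    (\<exists>G x. VAR x \<and> X G \<and> ENC z [tagM 8, x, G])"

lemma LINE_STEP: "LINE s r = STEP (%w. ITEM s w r)"
  unfolding LINE_def STEP_def fun_eq_iff by blast

sublocale PR: derivation zero one add mult Dfn STEP
proof
  show "STEP Y u" if "\<And>w. X w ==> Y w" "STEP X u" for X Y u
    using that unfolding STEP_def by blast
  show "Dfn (%e. STEP (%w. ITEM (e 0) w (e 1)) (e 2))"
    unfolding STEP_def by (intro dfn)
qed

definition PRV :: "'a => bool" where
  "PRV y <-> (\<exists>x. PRF x y)"

text \<open>A separator ends in 1, so the closing 0 of a proof string cannot belong to it.\<close>

lemma strip_b0:
  assumes "r @@ b0 = w @@ (a @@ b1) @@ q"
  shows "\<exists>q'. r = w @@ (a @@ b1) @@ q'"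
proof -
  consider "q = \<zero>" | c where "q = c @@ b0" | c where "q = c @@ b1" using last_letter by blast
  then show ?thesis
  proof cases
    case 1
    then have "r @@ b0 = (w @@ a) @@ b1" using assms by simp
    then show ?thesis by (simp only: letters)
  next
    case (2 c)
    then have "r @@ b0 = (w @@ (a @@ b1) @@ c) @@ b0" using assms by simp
    then have "r = w @@ (a @@ b1) @@ c" by (simp only: cat_right_cancel)
    then show ?thesis by blast
  next
    case (3 c)
    then have "r @@ b0 = (w @@ (a @@ b1) @@ c) @@ b1" using assms by simp
    then show ?thesis by (simp only: letters)
  qed
qed

lemma PRF_PRV:
  assumes "PRF x y"
  shows "PR.DRV y"
proof -
  obtain a where a: "ONE a" "\<not> fac ((a @@ b1) @@ b1) x" "\<exists>q. x = b0 @@ (a @@ b1) @@ q" "\<not> fac (a @@ b1) y"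
    "\<exists>p. x = p @@ (a @@ b1) @@ y @@ (a @@ b1) @@ b0"
    "\<And>r u. (\<exists>p. r = p @@ (a @@ b1)) \<and> \<not> fac (a @@ b1) u \<and> (\<exists>q. x = r @@ u @@ (a @@ b1) @@ q) ==> LINE (a @@ b1) r u"
    using assms unfolding PRF_def by blast
  define s where "s = a @@ b1"
  note a = a[folded s_def]
  obtain p where p: "x = p @@ s @@ y @@ s @@ b0" using a(5) by blast
  define r where "r = p @@ s @@ y @@ s"
  have x: "x = r @@ b0" unfolding p r_def by simp
  have s: "ONE s" "s ~= \<zero>" using a(1) by (simp_all add: s_def)
  have start: "\<exists>q. r = b0 @@ s @@ q"
    using a(3) strip_b0[of r b0 a] unfolding x s_def by blast
  have "PR.LST s r" unfolding PR.LST_def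
  proof (intro conjI allI impI)
    show "\<exists>p. r = p @@ s" by (rule exI[of _ "p @@ s @@ y"]) (simp add: r_def)
    show "\<not> fac (s @@ b1) r" using a(2) fac_right[of "s @@ b1" r b0] x by auto
    fix p' u q assume u: "r = p' @@ s @@ u @@ s @@ q \<and> \<not> fac s u"
    then have "x = (p' @@ s) @@ u @@ s @@ (q @@ b0)" using x by simp
    then have "LINE s (p' @@ s) u" using a(6)[of "p' @@ s" u] u by blast
    then show "STEP (%w. ITEM s w (p' @@ s)) u" unfolding LINE_STEP .
  qed (rule s start)+
  moreover have "r = p @@ s @@ y @@ s @@ \<zero>" by (simp add: r_def)
  then have "ITEM s y r" unfolding ITEM_occurs using a(4) by blast
  ultimately show ?thesis unfolding PR.DRV_def by blast
qed

text \<open>A derivation may have a longer separator than necessary and go on after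
  \<open>y\<close>, whereas \<open>PRF\<close> wants the shortest separator and \<open>y\<close> as
  the last item. So the derivation is cut after \<open>y\<close>, its items are copied with the
  least run that is a factor of none of them, and a closing 0 is added.\<close>

lemma PRV_PRF:
  assumes "PR.DRV y"
  shows "PRV y"
proof -
  obtain s1 r1 where 1: "PR.LST s1 r1" "ITEM s1 y r1" using assms unfolding PR.DRV_def by blast
  obtain p q where pq: "r1 = p @@ s1 @@ y @@ s1 @@ q" "\<not> fac s1 y" using 1(2) unfolding ITEM_occurs by blast
  define r2 where "r2 = p @@ s1 @@ y @@ s1"
  have y0: "begins0 y" "ends0 y" using PR.LST_item_bounds[OF 1] by blast+
  have p0: "p ~= \<zero>"
  proof
    assume "p = \<zero>"
    then obtain c where "b0 @@ c = s1 @@ y @@ s1 @@ q" using PR.LST_D(3)[OF 1(1)] pq(1) by auto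
    then show False using ONE_first_b0'[of s1 c] PR.LST_D(1,2)[OF 1(1)] by blast
  qed
  have L2: "PR.LST s1 r2"
    using PR.LST_prefix[OF 1(1), of "p @@ s1 @@ y" q] pq(1) p0 by (simp add: r2_def)
  have r2: "r2 = p @@ s1 @@ y @@ s1 @@ \<zero>" by (simp add: r2_def)
  have y2: "ITEM s1 y r2" unfolding ITEM_occurs using r2 pq(2) by blast
  \<comment> \<open>Once a least such run is taken, deleting a 1 from it leaves a factor of some
    item, which is the minimality clause of \<open>PRF\<close>.\<close>
  let ?Q = "%s. ONE s \<and> s ~= \<zero> \<and> (\<forall>u. ITEM s1 u r2 --> \<not> fac s u)"
  have "?Q s1" using PR.LST_D(1,2)[OF L2] unfolding ITEM_def by blast
  moreover have "Dfn (%e. ?Q (e 0))" by (intro dfn)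
  ultimately obtain s where s: "?Q s" "\<And>c. ?Q c ==> s \<sqsubseteq> c" using least[of ?Q s1] by blast
  obtain a where a: "s = a @@ b1" "ONE a" using ONE_last[of s] s(1) by blast
  have min: "\<exists>u. ITEM s1 u r2 \<and> fac a u"
  proof (cases "a = \<zero>")
    case True
    then show ?thesis using y2 by auto
  next
    case False
    show ?thesis
    proof (rule ccontr)
      assume "\<not> ?thesis"
      then have "s \<sqsubseteq> a" using s(2) a(2) False by blast
      moreover have "a \<sqsubseteq> s" unfolding a(1) by (rule le_cat(1))
      ultimately have "a = a @@ b1" unfolding a(1) by (rule M.order.antisym[rotated])
      then show False by simp
    qed
  qed
  have so: "ONE s" "s ~= \<zero>" and nf: "\<And>u. ITEM s1 u r2 ==> \<not> fac s u" using s(1) by blast+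
  have Lp: "PR.LST s1 (p @@ s1)" using PR.LST_prefix[OF 1(1), of p "y @@ s1 @@ q"] pq(1) p0 by simp
  have nfp: "\<not> fac s u" if "ITEM s1 u (p @@ s1)" for u
    using nf[of u] ITEM_right[OF that, of "y @@ s1"] by (simp add: r2_def)
  obtain r' where r': "PR.LST s r'" "\<And>w. ITEM s1 w (p @@ s1) ==> ITEM s w r'"
    using PR.LST_merge[OF PR.LST_empty[OF so] Lp nfp] by blast
  have "STEP (%w. ITEM s1 w (p @@ s1)) y" using PR.LST_D(6)[OF 1(1) pq] .
  then have "STEP (%w. ITEM s w r') y" using PR.step_mono[of "%w. ITEM s1 w (p @@ s1)" "%w. ITEM s w r'"] r'(2) by blast
  from PR.LST_append[OF r'(1) y0 nf[OF y2] this] have L: "PR.LST s (r' @@ y @@ s)" .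
  define r where "r = r' @@ y @@ s"
  obtain p1 where p1: "r' = p1 @@ s" using PR.LST_D(4)[OF r'(1)] by blast
  have items: "ITEM s w r" if "ITEM s1 w r2" for w
  proof -
    have "\<not> fac (s1 @@ b1) (p @@ s1)" using PR.LST_D(5)[OF Lp] .
    from ITEM_append[OF PR.LST_D(1)[OF L2] refl this y0 pq(2), of w]
    have "ITEM s1 w (p @@ s1) \<or> w = y" using that by (simp add: r2_def)
    then show ?thesis unfolding r_def ITEM_append[OF so(1) p1 PR.LST_D(5)[OF r'(1)] y0 nf[OF y2]] using r'(2) by blast
  qed
  note L = L[folded r_def]
  have "PRF (r @@ b0) y" unfolding PRF_def
  proof (rule exI[of _ a], fold a(1), intro conjI allI impI)
    show "ONE a" by (rule a)
    show "\<not> fac (s @@ b1) (r @@ b0)"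
      using fac_ones_cat[of "s @@ b1" r \<zero>] so(1) PR.LST_D(5)[OF L] by auto
    obtain q where "r = b0 @@ s @@ q" using PR.LST_D(3)[OF L] by blast
    then have "r @@ b0 = b0 @@ s @@ (q @@ b0)" by simp
    then show "\<exists>q. r @@ b0 = b0 @@ s @@ q" by blast
    show "\<not> fac s y" using nf[OF y2] .
    have "r @@ b0 = p1 @@ s @@ y @@ s @@ b0" unfolding r_def p1 by simp
    then show "\<exists>p. r @@ b0 = p @@ s @@ y @@ s @@ b0" by blast
    show "\<exists>u. ITEM s u (r @@ b0) \<and> fac a u" using min items ITEM_right by blast
    fix r0 u assume "(\<exists>p. r0 = p @@ s) \<and> \<not> fac s u \<and> (\<exists>q. r @@ b0 = r0 @@ u @@ s @@ q)"
    then obtain p0 q0 where h: "r0 = p0 @@ s" "\<not> fac s u" "r @@ b0 = r0 @@ u @@ s @@ q0" by blast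
    have "r @@ b0 = (r0 @@ u) @@ (a @@ b1) @@ q0" unfolding h(3) a(1) by simp
    then obtain q' where "r = (r0 @@ u) @@ s @@ q'" using strip_b0[of r "r0 @@ u" a q0] unfolding a(1) by blast
    then have "r = p0 @@ s @@ u @@ s @@ q'" using h(1) by simp
    then show "LINE s r0 u" using PR.LST_D(6)[OF L _ h(2)] unfolding LINE_STEP h(1) by blast
  qed
  then show ?thesis unfolding PRV_def by blast
qed

lemma PRV_DRV: "PRV y <-> PR.DRV y"
  using PRF_PRV PRV_PRF unfolding PRV_def by blast

lemma mk_bounds: "ts ~= [] ==> begins0 (mk ts) \<and> ends0 (mk ts)"
  using ENC_sh[of "mk ts" ts] ENC_mk[of ts "mk ts"] unfolding sh_def begins0_def by blast

lemma mk_ENC: "ts ~= [] ==> ENC (mk ts) ts"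
  using ENC_mk by blast

lemma Dfn_PRV [dfn]: "dft t ==> Dfn (%e. PRV (t e))"
  unfolding PRV_DRV by (rule PR.Dfn_DRV)

lemma PRV_ax: "LAX u \<or> PAX u ==> begins0 u ==> ends0 u ==> PRV u"
  unfolding PRV_DRV by (rule PR.DRV_axiom) (auto simp: STEP_def)

lemma PRV_MP:
  assumes "PRV G" "PRV (cImp G F)" "begins0 F" "ends0 F"
  shows "PRV F"
  unfolding PRV_DRV
proof (rule PR.DRV_intro[OF assms(1,2)[unfolded PRV_DRV] _ assms(3,4)])
  show "STEP (%a. a = G \<or> a = cImp G F) F" unfolding STEP_def using mk_ENC[of "[tagM 7, G, F]"] by blast
qed

lemma PRV_Gen: "PRV F ==> VAR x ==> PRV (cAll x F)"
  unfolding PRV_DRV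
proof (rule PR.DRV_intro[of F F])
  show "VAR x ==> STEP (%a. a = F \<or> a = F) (cAll x F)" unfolding STEP_def using mk_ENC[of "[tagM 8, x, F]"] by blast
qed (use mk_bounds[of "[tagM 8, x, F]"] in simp_all)

end

section \<open>Standard codes and their instances\<close>

lemma sep_length:
  assumes "ws ~= []"
  obtains k where "sep_length ws = Suc k" "\<forall>w\<in>set ws. \<not> sublist (ones (Suc k)) w" "\<exists>w\<in>set ws. sublist (ones k) w"
proof -
  let ?Q = "%k. \<forall>w\<in>set ws. \<not> sublist (ones k) w"
  obtain n where n: "\<forall>w\<in>set ws. length w < n"
    using finite_nat_set_iff_bounded[of "length ` set ws"] by auto
  have "?Q n" using n sublist_length_le[of "ones n"] by fastforce
  then have k: "?Q (sep_length ws)" unfolding sep_length_def by (rule LeastI)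
  have k2: "\<not> ?Q k" if "k < sep_length ws" for k using that unfolding sep_length_def by (rule not_less_Least)
  have "sep_length ws ~= 0"
  proof
    assume "sep_length ws = 0"
    then show False using k assms by (cases ws) auto
  qed
  then obtain k' where k': "sep_length ws = Suc k'" using not0_implies_Suc by blast
  then show thesis using that[of k'] k k2[of k'] by auto
qed

context pa_model
begin

lemma bs_inj: "bs u = bs v <-> u = v"
proof
  show "bs u = bs v ==> u = v"
  proof (induction u arbitrary: v)
    case Nil
    then show ?case by (cases v) (auto split: if_splits)
  next
    case (Cons a u)
    then show ?case by (cases v) (auto split: if_splits)
  qed
qed simp

lemma bs_split: "bs w = p @@ q ==> \<exists>u v. w = u @ v \<and> p = bs u \<and> q = bs v"
proof (induction w arbitrary: p)
  case Nil
  then show ?case by (intro exI[of _ "[]"]) auto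
next
  case (Cons a w)
  consider "p = \<zero>" | p' where "p = b0 @@ p'" | p' where "p = b1 @@ p'" using first_letter by blast
  then show ?case
  proof cases
    case 1
    then show ?thesis using Cons.prems by (intro exI[of _ "[]"] exI[of _ "a # w"]) auto
  next
    case (2 p')
    then have "\<not> a" "bs w = p' @@ q" using Cons.prems by (auto split: if_splits)
    then obtain u v where "w = u @ v" "p' = bs u" "q = bs v" using Cons.IH by blast
    then show ?thesis using 2 \<open>\<not> a\<close> by (intro exI[of _ "a # u"] exI[of _ v]) simp
  next
    case (3 p')
    then have "a" "bs w = p' @@ q" using Cons.prems by (auto split: if_splits)
    then obtain u v where "w = u @ v" "p' = bs u" "q = bs v" using Cons.IH by blast
    then show ?thesis using 3 \<open>a\<close> by (intro exI[of _ "a # u"] exI[of _ v]) simp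
  qed
qed

lemma fac_bs: "fac (bs u) (bs w) <-> sublist u w"
proof
  assume "fac (bs u) (bs w)"
  then obtain p q where "bs w = p @@ bs u @@ q" unfolding fac_def by blast
  then obtain w1 w2 where 1: "w = w1 @ w2" "bs u @@ q = bs w2" using bs_split by blast
  then obtain u' w3 where 2: "w2 = u' @ w3" "bs u = bs u'" using bs_split[of w2 "bs u" q] by metis
  then show "sublist u w" using 1(1) by (simp add: bs_inj)
next
  assume "sublist u w"
  then obtain p q where "w = p @ u @ q" unfolding sublist_def by blast
  then show "fac (bs u) (bs w)" by (intro facI[of _ "bs p" _ "bs q"]) simp
qed

lemma ONE_bs: "ONE (bs (ones k))"
  by (induction k) simp_all

lemma bs_enc: "ws ~= [] ==> bs (enc ws) = mk (map bs ws)"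
proof -
  assume ws: "ws ~= []"
  obtain k where k: "sep_length ws = Suc k" "\<forall>w\<in>set ws. \<not> sublist (ones (Suc k)) w" "\<exists>w\<in>set ws. sublist (ones k) w"
    using sep_length[OF ws] .
  have s: "bs (ones (Suc k)) = bs (ones k) @@ b1" using ONE_comm1[OF ONE_bs[of k]] by simp
  have "bs (concat (map (%w. w @ v) vs) @ [False]) = seps (bs v) (map bs vs)" for vs v
    by (induction vs) simp_all
  then have e: "bs (enc ws) = b0 @@ (bs (ones k) @@ b1) @@ seps (bs (ones k) @@ b1) (map bs ws)"
    unfolding enc_def Let_def k(1) by (simp add: s del: replicate.simps)
  have "ENC (bs (enc ws)) (map bs ws)"
    unfolding ENC_def using k(2,3) e ONE_bs[of k]
    by (intro exI[of _ "bs (ones k)"]) (simp add: fac_bs del: replicate.simps flip: s)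
  then show ?thesis using ENC_mk[of "map bs ws"] ws by simp
qed

definition idx :: "nat => 'a" where "idx n = bs (index n)"

definition vr :: "nat => 'a" where "vr n = cVar (idx n)"

primrec ct :: "(nat => 'a) => tm => 'a" where
  "ct \<rho> (Var x) = \<rho> x"
| "ct \<rho> Zero = cZero"
| "ct \<rho> One = cOne"
| "ct \<rho> (Plus s t) = cPlus (ct \<rho> s) (ct \<rho> t)"
| "ct \<rho> (Times s t) = cTimes (ct \<rho> s) (ct \<rho> t)"

text \<open>The code of \<open>F\<close> with the terms \<open>\<rho> x\<close> in place of the free variables.\<close>

primrec cf :: "(nat => 'a) => fm => 'a" where
  "cf \<rho> (Eq s t) = cEq (ct \<rho> s) (ct \<rho> t)"
| "cf \<rho> (Neg F) = cNeg (cf \<rho> F)"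
| "cf \<rho> (Imp F G) = cImp (cf \<rho> F) (cf \<rho> G)"
| "cf \<rho> (All x F) = cAll (vr x) (cf (\<rho>(x := vr x)) F)"

lemma bs_tm_string: "bs (tm_string t) = ct vr t"
  by (induction t) (simp_all add: bs_enc bs_tag vr_def idx_def)

lemma bs_fm_string: "bs (fm_string F) = cf vr F"
proof -
  have "cVar (bs (index n)) = vr n" for n by (simp add: vr_def idx_def)
  then show ?thesis by (induction F) (simp_all add: bs_enc bs_tag bs_tm_string)
qed

lemma IDX_idx: "IDX (idx n)"
proof -
  have "ONE (bs (ones n))" by (rule ONE_bs)
  moreover have "idx n = b0 @@ (bs (ones n) @@ b1) @@ b0"
    unfolding idx_def index_def by (simp add: ONE_comm1[OF ONE_bs])
  ultimately show ?thesis unfolding IDX_def by blast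
qed

lemma kind_var: "IDX i ==> kind 0 [i]" by (simp add: kind_def)

lemma VAR_cVar: "IDX i ==> VAR (cVar i)"
  unfolding VAR_def using mk_ENC by blast

lemma VAR_vr [simp]: "VAR (vr n)"
  unfolding vr_def by (rule VAR_cVar[OF IDX_idx])

lemma vr_inj [simp]: "vr m = vr n <-> m = n"
proof
  assume "vr m = vr n"
  then have eq: "vr m @@ \<zero> = vr n @@ \<zero>" by simp
  have e: "ENC (vr k) (tagM 0 # [idx k])" for k unfolding vr_def by (rule mk_ENC) simp
  from scan_node[OF e kind_sh[OF kind_var[OF IDX_idx]] e _ eq] have "idx m = idx n" by simp
  then have "index m = index n" by (simp add: idx_def bs_inj)
  then have "length (index m) = length (index n)" by simp
  then show "m = n" by (simp add: index_def)
qed simp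

text \<open>\<open>GE\<close> takes the place of \<open>WF\<close> because the constructors visibly
  preserve it; \<open>GE_WF\<close> leads back.\<close>

definition GT :: "'a => bool" where "GT t <-> GE t \<and> TMH t"
definition GF :: "'a => bool" where "GF F <-> GE F \<and> FMH F"

lemma GT_TRM: "GT t ==> TRM t" and GF_FRM: "GF F ==> FRM F"
  unfolding GT_def GF_def TRM_def FRM_def using GE_WF by blast+

lemma Dfn_GT [dfn]: "dft t ==> Dfn (%e. GT (t e))"
  unfolding GT_def by (intro dfn)

lemma GE_IDX: "IDX i ==> GE (cVar i)"
  by (rule GE_mk[OF kind_var]) auto

lemma GE_VAR: "VAR x ==> GE x"
  unfolding VAR_def using GE_IDX ENC_mk[of "[tagM 0, _]"] by auto

lemma GT_intros [simp]:
  "VAR x ==> GT x" "GT cZero" "GT cOne" "GT s ==> GT t ==> GT (cPlus s t)" "GT s ==> GT t ==> GT (cTimes s t)"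
proof -
  have h: "TMH cZero" "TMH cOne" "TMH (cPlus s t)" "TMH (cTimes s t)" for s t
    unfolding TMH_def One_nat_def using mk_ENC[of "[tagM (Suc 0)]"] mk_ENC[of "[tagM 2]"] mk_ENC[of "[tagM 3, s, t]"] mk_ENC[of "[tagM 4, s, t]"]
    by blast+
  show "GT cZero" "GT cOne" unfolding GT_def using h by (auto intro!: GE_mk simp: kind_def)
  show "GT s ==> GT t ==> GT (cPlus s t)" "GT s ==> GT t ==> GT (cTimes s t)"
    unfolding GT_def using h by (auto intro!: GE_mk simp: kind_def)
  show "VAR x ==> GT x" unfolding GT_def TMH_def using GE_VAR by blast
qed

lemma GF_intros [simp]:
  "GT s ==> GT t ==> GF (cEq s t)" "GF F ==> GF (cNeg F)" "GF F ==> GF G ==> GF (cImp F G)"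
  "VAR x ==> GF F ==> GF (cAll x F)"
proof -
  have h: "FMH (cEq s t)" "FMH (cNeg F)" "FMH (cImp F G)" "FMH (cAll x F)" for s t F G x
    unfolding FMH_def using mk_ENC[of "[tagM 5, s, t]"] mk_ENC[of "[tagM 6, F]"] mk_ENC[of "[tagM 7, F, G]"] mk_ENC[of "[tagM 8, x, F]"]
    by blast+
  show "GT s ==> GT t ==> GF (cEq s t)" "GF F ==> GF (cNeg F)" "GF F ==> GF G ==> GF (cImp F G)"
    unfolding GT_def GF_def using h by (auto intro!: GE_mk simp: kind_def)
  show "VAR x ==> GF F ==> GF (cAll x F)"
    unfolding GF_def using h GE_VAR by (auto intro!: GE_mk simp: kind_def)
qed

lemma GF_begins0: "GF F ==> begins0 F" and GF_ends0: "GF F ==> ends0 F"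
  unfolding GF_def using FMH_sh[of F] unfolding sh_def begins0_def by blast+

definition closed :: "'a => bool" where
  "closed t <-> (\<forall>x. VAR x --> \<not> fac x t)"

text \<open>Variables are kept or replaced by closed terms, so nothing can be captured and
  \<open>cf\<close> needs no renaming. The numerals of nonstandard elements are such terms.\<close>

definition good :: "(nat => 'a) => bool" where
  "good \<rho> <-> (\<forall>n. \<rho> n = vr n \<or> (GT (\<rho> n) \<and> closed (\<rho> n)))"

lemma good_vr [simp]: "good vr" "good \<rho> ==> good (\<rho>(x := vr x))"
  by (simp_all add: good_def)

lemma GT_ct [simp]: "good \<rho> ==> GT (ct \<rho> t)"
proof (induction t)
  case (Var x)
  then show ?case unfolding good_def by (cases "\<rho> x = vr x") auto
qed simp_all

lemma GF_cf [simp]: "good \<rho> ==> GF (cf \<rho> F)"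
  by (induction F arbitrary: \<rho>) simp_all

lemma GT_GE: "GT t ==> GE t" and GF_GE: "GF F ==> GE F"
  by (simp_all add: GT_def GF_def)

lemma VAR_fac:
  assumes x: "VAR x"
  shows "\<not> fac x cZero" "\<not> fac x cOne" "GT s ==> GT t ==> fac x (cPlus s t) ==> fac x s \<or> fac x t"
    "GT s ==> GT t ==> fac x (cTimes s t) ==> fac x s \<or> fac x t"
    "GT s ==> GT t ==> fac x (cEq s t) ==> fac x s \<or> fac x t"
    "GF F ==> fac x (cNeg F) ==> fac x F"
    "GF F ==> GF G ==> fac x (cImp F G) ==> fac x F \<or> fac x G"
    "VAR y ==> GF F ==> fac x (cAll y F) ==> x = y \<or> fac x F"
proof -
  note v = VAR_fac_mk[OF _ _ _ x]
  show "\<not> fac x cZero" "\<not> fac x cOne" using v[of 1 "[]"] v[of 2 "[]"] by (auto simp: kind_def)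
  have GE2: "\<And>a. a \<in> set [s, t] ==> GE a" if "GT s" "GT t" for s t using that GT_GE by auto
  have GF2: "\<And>a. a \<in> set [s, t] ==> GE a" if "GF s" "GF t" for s t using that GF_GE by auto
  show "GT s ==> GT t ==> fac x (cPlus s t) ==> fac x s \<or> fac x t"
    using v[of 3 "[s, t]", OF _ _ GE2] by (auto simp: kind_def GT_def)
  show "GT s ==> GT t ==> fac x (cTimes s t) ==> fac x s \<or> fac x t"
    using v[of 4 "[s, t]", OF _ _ GE2] by (auto simp: kind_def GT_def)
  show "GT s ==> GT t ==> fac x (cEq s t) ==> fac x s \<or> fac x t"
    using v[of 5 "[s, t]", OF _ _ GE2] by (auto simp: kind_def GT_def)
  show "GF F ==> fac x (cNeg F) ==> fac x F"
    using v[of 6 "[F]"] by (auto simp: kind_def GF_def)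
  show "GF F ==> GF G ==> fac x (cImp F G) ==> fac x F \<or> fac x G"
    using v[of 7 "[F, G]", OF _ _ GF2] by (auto simp: kind_def GF_def)
  show "VAR y ==> GF F ==> fac x (cAll y F) ==> x = y \<or> fac x F"
    using v[of 8 "[y, F]"] VAR_fac_VAR[OF x] GE_VAR[of y] by (auto simp: kind_def GF_def)
qed

lemma fac_ct: "good \<rho> ==> fac (vr x) (ct \<rho> t) ==> x \<in> tm_vars t \<and> \<rho> x = vr x"
proof (induction t)
  case (Var y)
  have "\<rho> y = vr y" using Var VAR_vr[of x] unfolding good_def closed_def by auto
  moreover have "vr x = vr y" using VAR_fac_VAR[OF VAR_vr VAR_vr] Var.prems(2) calculation by simp
  ultimately show ?case by simp
next
  case (Plus s t)
  then show ?case using VAR_fac(3)[OF VAR_vr GT_ct GT_ct, of \<rho> \<rho> x s t] by auto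
next
  case (Times s t)
  then show ?case using VAR_fac(4)[OF VAR_vr GT_ct GT_ct, of \<rho> \<rho> x s t] by auto
qed (simp_all add: VAR_fac(1,2))

text \<open>Supplies the side conditions of the internal axioms: the closed terms inserted by
  \<open>\<rho>\<close> contribute no variables.\<close>

lemma fac_cf: "good \<rho> ==> fac (vr x) (cf \<rho> F) ==> x \<in> bound_vars F \<or> (x \<in> free_vars F \<and> \<rho> x = vr x)"
proof (induction F arbitrary: \<rho>)
  case (Eq s t)
  then show ?case using VAR_fac(5)[OF VAR_vr GT_ct GT_ct, of \<rho> \<rho> x s t] fac_ct[of \<rho> x s] fac_ct[of \<rho> x t] by auto
next
  case (Neg F)
  then show ?case using VAR_fac(6)[OF VAR_vr GF_cf, of \<rho> x F] by auto
next
  case (Imp F G)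
  then show ?case using VAR_fac(7)[OF VAR_vr GF_cf GF_cf, of \<rho> \<rho> x F G] by auto
next
  case (All y F)
  have "vr x = vr y \<or> fac (vr x) (cf (\<rho>(y := vr y)) F)"
    using VAR_fac(8)[OF VAR_vr VAR_vr GF_cf, of "\<rho>(y := vr y)" x y F] All.prems by simp
  then consider "x = y" | "x ~= y" "x \<in> bound_vars F \<or> (x \<in> free_vars F \<and> (\<rho>(y := vr y)) x = vr x)"
    using All.IH[OF good_vr(2)[OF All.prems(1)]] by (metis vr_inj)
  then show ?case by cases auto
qed

lemma ct_cong: "(\<And>x. x \<in> tm_vars t ==> \<rho> x = \<sigma> x) ==> ct \<rho> t = ct \<sigma> t"
  by (induction t) auto

lemma cf_cong: "(\<And>x. x \<in> free_vars F ==> \<rho> x = \<sigma> x) ==> cf \<rho> F = cf \<sigma> F"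
proof (induction F arbitrary: \<rho> \<sigma>)
  case (Eq s t)
  have "ct \<rho> s = ct \<sigma> s" "ct \<rho> t = ct \<sigma> t" by (rule ct_cong, use Eq in auto)+
  then show ?case by simp
next
  case (Neg F)
  have "cf \<rho> F = cf \<sigma> F" by (rule Neg.IH) (use Neg.prems in auto)
  then show ?case by simp
next
  case (Imp F G)
  have "cf \<rho> F = cf \<sigma> F" by (rule Imp.IH(1)) (use Imp.prems in auto)
  moreover have "cf \<rho> G = cf \<sigma> G" by (rule Imp.IH(2)) (use Imp.prems in auto)
  ultimately show ?case by simp
next
  case (All y F)
  have "cf (\<rho>(y := vr y)) F = cf (\<sigma>(y := vr y)) F" by (rule All.IH) (use All.prems in auto)
  then show ?case by simp
qed

subsection \<open>Propositional reasoning about provable codes\<close>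

text \<open>Elements that are not codes of formulas are replaced by the code of
  \<open>0 = 0\<close>, because \<open>prop_calc\<close> imposes no side condition on its
  formulas.\<close>

definition nm :: "'a => 'a" where "nm F = (if GF F then F else cEq cZero cZero)"

lemma GF_nm [simp]: "GF (nm F)" and nm_GF [simp]: "GF F ==> nm F = F"
  by (simp_all add: nm_def)

lemma PRV_LAX: "LAX F ==> GF F ==> PRV F"
  using PRV_ax GF_begins0 GF_ends0 by blast

lemma PRV_mp: "PRV (cImp F G) ==> PRV F ==> GF G ==> PRV G"
  using PRV_MP GF_begins0 GF_ends0 by blast

lemma code_prop_calc: "prop_calc (%F. PRV (nm F)) (%F G. cImp (nm F) (nm G)) (%F. cNeg (nm F))"
proof
  have F: "FRM (nm F)" for F by (simp add: GF_FRM)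
  show "PRV (nm (cImp (nm F) (nm (cImp (nm G) (nm F)))))" for F G
    using PRV_LAX[OF LAX_intros(1)[OF F F]] by simp
  show "PRV (nm (cImp (nm (cImp (nm F) (nm (cImp (nm G) (nm H))))) (nm (cImp (nm (cImp (nm F) (nm G))) (nm (cImp (nm F) (nm H)))))))"
    for F G H
    using PRV_LAX[OF LAX_intros(2)[OF F F F]] by simp
  show "PRV (nm (cImp (nm (cImp (nm (cNeg (nm F))) (nm (cNeg (nm G))))) (nm (cImp (nm G) (nm F)))))" for F G
    using PRV_LAX[OF LAX_intros(3)[OF F F]] by simp
  show "PRV (nm F) ==> PRV (nm (cImp (nm F) (nm G))) ==> PRV (nm G)" for F G
    using PRV_mp[of "nm F" "nm G"] by simp
qed

definition cval :: "('a => bool) => bool" where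
  "cval v <-> (\<forall>F G. GF F --> GF G --> v (cImp F G) = (v F --> v G)) \<and> (\<forall>F. GF F --> v (cNeg F) = (\<not> v F))"

lemma cval_simps [simp]:
  "cval v ==> GF F ==> GF G ==> v (cImp F G) <-> (v F --> v G)" "cval v ==> GF F ==> v (cNeg F) <-> \<not> v F"
  unfolding cval_def by blast+

text \<open>Lindenbaum's argument is applied from outside to the predicate \<open>PRV\<close> on the
  carrier. Tautological steps between nonstandard codes thus need no analysis of derivations inside
  the model.\<close>

lemma code_taut:
  assumes Gs: "\<forall>G\<in>set Gs. PRV G \<and> GF G" and F: "GF F" and v: "\<And>v. cval v ==> \<forall>G\<in>set Gs. v G ==> v F"
  shows "PRV F"
proof -
  interpret C: prop_calc "%F. PRV (nm F)" "%F G. cImp (nm F) (nm G)" "%F. cNeg (nm F)" by (rule code_prop_calc)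
  have "PRV (nm F)"
  proof (rule C.taut_from[of Gs])
    fix v assume w: "C.val v" "\<forall>G\<in>set Gs. v G"
    have "cval v" unfolding cval_def
    proof (intro conjI allI impI)
      fix F G assume "GF F" "GF G"
      then show "v (cImp F G) = (v F --> v G)" using C.val_simps(1)[OF w(1), of F G] by simp
    next
      fix F assume "GF F"
      then show "v (cNeg F) = (\<not> v F)" using C.val_simps(2)[OF w(1), of F] by simp
    qed
    then show "v F" using v w(2) by blast
  qed (use Gs in simp)
  then show ?thesis using F by simp
qed

lemma PRV_Eq: "GT s ==> GT t ==> GT r ==> PRV (cImp (cEq s t) (cImp (cEq s r) (cEq t r)))"
  and PRV_refl: "GT t ==> PRV (cEq t t)"
  by (rule PRV_LAX, rule LAX_intros; simp add: GT_TRM)+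

lemma PRV_sym: "GT s ==> GT t ==> PRV (cImp (cEq s t) (cEq t s))"
  by (rule code_taut[of "[cImp (cEq s t) (cImp (cEq s s) (cEq t s)), cEq s s]"]) (simp_all add: PRV_Eq PRV_refl)

lemma PRV_AD: "VAR x ==> GF F ==> GF G ==> PRV (cImp (cAll x (cImp F G)) (cImp (cAll x F) (cAll x G)))"
  by (rule PRV_LAX, rule LAX_intros) (simp_all add: GF_FRM)

lemma PRV_AV: "VAR x ==> GF F ==> \<not> fac x F ==> PRV (cImp F (cAll x F))"
  by (rule PRV_LAX, rule LAX_intros) (simp_all add: GF_FRM)

lemma PRV_AE: "VAR x ==> GT t ==> \<not> fac x t ==> PRV (cNeg (cAll x (cNeg (cEq x t))))"
  by (rule PRV_LAX, rule LAX_intros) (simp_all add: GT_TRM)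

lemma PRV_cong:
  assumes "GT s" "GT t" "GT s'" "GT t'"
  shows "PRV (cImp (cEq s t) (cImp (cEq s' t') (cEq (cPlus s s') (cPlus t t'))))"
    "PRV (cImp (cEq s t) (cImp (cEq s' t') (cEq (cTimes s s') (cTimes t t'))))"
  using assms by (intro PRV_LAX LAX_intros; simp add: GT_TRM)+

section \<open>Substitution inside the model and instances of theorems\<close>

lemma subst_ct:
  assumes \<rho>: "good \<rho>" "\<sigma> = \<rho>(x := vr x)"
  shows "PRV (cImp (cEq (vr x) (\<rho> x)) (cEq (ct \<sigma> t) (ct \<rho> t)))"
proof -
  let ?H = "cEq (vr x) (\<rho> x)"
  have g: "good \<sigma>" "GT (\<rho> y)" for y using \<rho> GT_ct[OF \<rho>(1), of "Var y"] by simp_all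
  have weak: "PRV (cImp ?H (cEq u u))" if "GT u" for u
    by (rule code_taut[of "[cEq u u]"]) (use that g PRV_refl in simp_all)
  show ?thesis
  proof (induction t)
    case (Var y)
    show ?case
    proof (cases "y = x")
      case True
      then show ?thesis using g \<rho>(2) by (intro code_taut[of "[]"]) simp_all
    next
      case False
      then show ?thesis using g \<rho>(2) weak[of "\<rho> y"] by simp
    qed
  next
    case (Plus s t)
    show ?case
      by (rule code_taut[of "[cImp ?H (cEq (ct \<sigma> s) (ct \<rho> s)), cImp ?H (cEq (ct \<sigma> t) (ct \<rho> t)),
        cImp (cEq (ct \<sigma> s) (ct \<rho> s)) (cImp (cEq (ct \<sigma> t) (ct \<rho> t))
          (cEq (cPlus (ct \<sigma> s) (ct \<sigma> t)) (cPlus (ct \<rho> s) (ct \<rho> t))))]"])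
        (use Plus g \<rho>(1) PRV_cong(1)[of "ct \<sigma> s" "ct \<rho> s" "ct \<sigma> t" "ct \<rho> t"] in simp_all)
  next
    case (Times s t)
    show ?case
      by (rule code_taut[of "[cImp ?H (cEq (ct \<sigma> s) (ct \<rho> s)), cImp ?H (cEq (ct \<sigma> t) (ct \<rho> t)),
        cImp (cEq (ct \<sigma> s) (ct \<rho> s)) (cImp (cEq (ct \<sigma> t) (ct \<rho> t))
          (cEq (cTimes (ct \<sigma> s) (ct \<sigma> t)) (cTimes (ct \<rho> s) (ct \<rho> t))))]"])
        (use Times g \<rho>(1) PRV_cong(2)[of "ct \<sigma> s" "ct \<rho> s" "ct \<sigma> t" "ct \<rho> t"] in simp_all)
  qed (simp_all add: weak)
qed

lemma PRV_generalize:
  assumes x: "VAR x" "\<not> fac x H" and G: "GF H" "GF A" "GF B" and P: "PRV (cImp H (cImp A B))"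
  shows "PRV (cImp H (cImp (cAll x A) (cAll x B)))"
proof -
  have 1: "PRV (cAll x (cImp H (cImp A B)))" by (rule PRV_Gen[OF P x(1)])
  show ?thesis
    by (rule code_taut[of "[cAll x (cImp H (cImp A B)),
      cImp (cAll x (cImp H (cImp A B))) (cImp (cAll x H) (cAll x (cImp A B))), cImp H (cAll x H),
      cImp (cAll x (cImp A B)) (cImp (cAll x A) (cAll x B))]"])
      (use 1 G x PRV_AD[of x H "cImp A B"] PRV_AD[of x A B] PRV_AV[of x H] in simp_all)
qed

lemma subst_cf:
  assumes "good \<rho>"
  shows "PRV (cImp (cEq (vr x) (\<rho> x)) (cImp (cf (\<rho>(x := vr x)) F) (cf \<rho> F)))
    \<and> PRV (cImp (cEq (vr x) (\<rho> x)) (cImp (cf \<rho> F) (cf (\<rho>(x := vr x)) F)))"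
  using assms
proof (induction F arbitrary: \<rho>)
  case (Eq s t)
  let ?H = "cEq (vr x) (\<rho> x)" and ?\<sigma> = "\<rho>(x := vr x)"
  have g: "good \<rho>" "good ?\<sigma>" "GT (\<rho> x)" using Eq GT_ct[OF Eq(1), of "Var x"] by simp_all
  define a b c d where "a = ct ?\<sigma> s" and "b = ct \<rho> s" and "c = ct ?\<sigma> t" and "d = ct \<rho> t"
  have G: "GT a" "GT b" "GT c" "GT d" using g by (simp_all add: a_def b_def c_def d_def)
  have ab: "PRV (cImp ?H (cEq a b))" and cd: "PRV (cImp ?H (cEq c d))"
    unfolding a_def b_def c_def d_def by (rule subst_ct[OF Eq refl])+
  have swap: "PRV (cImp ?H (cImp (cEq a c) (cEq b d)))"
    if G: "GT a" "GT b" "GT c" "GT d" and h: "PRV (cImp ?H (cEq a b))" "PRV (cImp ?H (cEq c d))" for a b c d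
    by (rule code_taut[of "[cImp ?H (cEq a b), cImp ?H (cEq c d), cImp (cEq a b) (cImp (cEq a c) (cEq b c)),
      cImp (cEq b c) (cEq c b), cImp (cEq c d) (cImp (cEq c b) (cEq d b)), cImp (cEq d b) (cEq b d)]"])
      (use G h g PRV_Eq[OF G(1,2,3)] PRV_sym[OF G(2,3)] PRV_Eq[OF G(3,4,2)] PRV_sym[OF G(4,2)] in simp_all)
  have rev: "PRV (cImp ?H (cEq b a))" if G: "GT a" "GT b" and h: "PRV (cImp ?H (cEq a b))" for a b
    by (rule code_taut[of "[cImp ?H (cEq a b), cImp (cEq a b) (cEq b a)]"]) (use G h g PRV_sym[OF G] in simp_all)
  have "PRV (cImp ?H (cImp (cEq a c) (cEq b d)))" by (rule swap[OF G ab cd])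
  moreover have "PRV (cImp ?H (cImp (cEq b d) (cEq a c)))"
    by (rule swap[OF G(2,1,4,3) rev[OF G(1,2) ab] rev[OF G(3,4) cd]])
  ultimately show ?case unfolding a_def b_def c_def d_def cf.simps by blast
next
  case (Neg F)
  let ?H = "cEq (vr x) (\<rho> x)" and ?\<sigma> = "\<rho>(x := vr x)"
  have g: "good \<rho>" "good ?\<sigma>" "GT (\<rho> x)" using Neg.prems GT_ct[OF Neg.prems(1), of "Var x"] by simp_all
  note IH = Neg.IH[OF Neg.prems]
  have "PRV (cImp ?H (cImp (cNeg (cf ?\<sigma> F)) (cNeg (cf \<rho> F))))"
    by (rule code_taut[of "[cImp ?H (cImp (cf \<rho> F) (cf ?\<sigma> F))]"]) (use IH g in \<open>auto simp del: fun_upd_apply\<close>)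
  moreover have "PRV (cImp ?H (cImp (cNeg (cf \<rho> F)) (cNeg (cf ?\<sigma> F))))"
    by (rule code_taut[of "[cImp ?H (cImp (cf ?\<sigma> F) (cf \<rho> F))]"]) (use IH g in \<open>auto simp del: fun_upd_apply\<close>)
  ultimately show ?case unfolding cf.simps by blast
next
  case (Imp F G)
  let ?H = "cEq (vr x) (\<rho> x)" and ?\<sigma> = "\<rho>(x := vr x)"
  have g: "good \<rho>" "good ?\<sigma>" "GT (\<rho> x)" using Imp.prems GT_ct[OF Imp.prems(1), of "Var x"] by simp_all
  note IH = Imp.IH(1)[OF Imp.prems] Imp.IH(2)[OF Imp.prems]
  have "PRV (cImp ?H (cImp (cImp (cf ?\<sigma> F) (cf ?\<sigma> G)) (cImp (cf \<rho> F) (cf \<rho> G))))"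
    by (rule code_taut[of "[cImp ?H (cImp (cf \<rho> F) (cf ?\<sigma> F)), cImp ?H (cImp (cf ?\<sigma> G) (cf \<rho> G))]"]) (use IH g in \<open>auto simp del: fun_upd_apply\<close>)
  moreover have "PRV (cImp ?H (cImp (cImp (cf \<rho> F) (cf \<rho> G)) (cImp (cf ?\<sigma> F) (cf ?\<sigma> G))))"
    by (rule code_taut[of "[cImp ?H (cImp (cf ?\<sigma> F) (cf \<rho> F)), cImp ?H (cImp (cf \<rho> G) (cf ?\<sigma> G))]"]) (use IH g in \<open>auto simp del: fun_upd_apply\<close>)
  ultimately show ?case unfolding cf.simps by blast
next
  case (All y F)
  let ?H = "cEq (vr x) (\<rho> x)" and ?\<sigma> = "\<rho>(x := vr x)"
  have g: "good \<rho>" "good ?\<sigma>" "GT (\<rho> x)" using All.prems GT_ct[OF All.prems(1), of "Var x"] by simp_all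
  \<comment> \<open>Either the two substitutions agree under the quantifier, or \<open>x\<close> is
    replaced by a closed term. In the latter case \<open>y\<close> does not occur in the equation,
    and generalization applies.\<close>
  consider "?\<sigma>(y := vr y) = \<rho>(y := vr y)" | "y ~= x" "\<rho> x ~= vr x"
    by (cases "y = x"; cases "\<rho> x = vr x") (auto simp: fun_upd_idem)
  then show ?case
  proof cases
    case 1
    have "PRV (cImp ?H (cImp A A))" if "GF A" for A by (rule code_taut[of "[]"]) (use g that in auto)
    then show ?thesis unfolding cf.simps 1 using g by simp
  next
    case 2
    then have "closed (\<rho> x)" using g(1) unfolding good_def by blast
    then have "\<not> fac (vr y) ?H"
      using VAR_fac(5)[OF VAR_vr[of y] GT_intros(1)[OF VAR_vr[of x]] g(3)] VAR_fac_VAR[OF VAR_vr[of y] VAR_vr[of x]] 2(1)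
      unfolding closed_def by auto
    note gen = PRV_generalize[OF VAR_vr this]
    have r: "(\<rho>(y := vr y)) x = \<rho> x" "?\<sigma>(y := vr y) = (\<rho>(y := vr y))(x := vr x)"
      using 2(1) by (simp_all add: fun_upd_twist)
    have "PRV (cImp ?H (cImp (cf (?\<sigma>(y := vr y)) F) (cf (\<rho>(y := vr y)) F)))
      \<and> PRV (cImp ?H (cImp (cf (\<rho>(y := vr y)) F) (cf (?\<sigma>(y := vr y)) F)))"
      using All.IH[OF good_vr(2)[OF g(1)], of y] unfolding r .
    then show ?thesis unfolding cf.simps by (intro conjI gen; simp add: g)
  qed
qed

text \<open>Instantiation inside the model again goes through the equation of \<open>x\<close> with
  the closed term: if the instance failed, this equation would be refuted for all \<open>x\<close>,
  against an axiom.\<close>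

lemma PRV_instance:
  assumes \<rho>: "good \<rho>" and x: "x \<notin> bound_vars F" and P: "PRV (cf (\<rho>(x := vr x)) F)"
  shows "PRV (cf \<rho> F)"
proof (cases "\<rho> x = vr x")
  case True
  then show ?thesis using P by (simp add: fun_upd_idem)
next
  case False
  then have c: "closed (\<rho> x)" "GT (\<rho> x)" using \<rho> unfolding good_def by blast+
  define A B H where "A = cf \<rho> F" and "B = cf (\<rho>(x := vr x)) F" and "H = cEq (vr x) (\<rho> x)"
  have G: "GF A" "GF B" "GF H" using \<rho> c(2) by (simp_all add: A_def B_def H_def)
  have n: "\<not> fac (vr x) A" using fac_cf[OF \<rho>, of x F] x False by (auto simp: A_def)
  have "PRV (cImp H (cImp B A))" using subst_cf[OF \<rho>] by (simp add: A_def B_def H_def)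
  then have 1: "PRV (cImp (cNeg A) (cNeg H))"
    by (intro code_taut[of "[cImp H (cImp B A), B]"]) (use P G in \<open>auto simp flip: B_def\<close>)
  then have "PRV (cImp (cEq cZero cZero) (cImp (cNeg A) (cNeg H)))"
    by (intro code_taut[of "[cImp (cNeg A) (cNeg H)]"]) (use G in auto)
  then have "PRV (cImp (cEq cZero cZero) (cImp (cAll (vr x) (cNeg A)) (cAll (vr x) (cNeg H))))"
    by (intro PRV_generalize)
      (use G VAR_fac(5)[OF VAR_vr[of x], of cZero cZero] VAR_fac(1)[OF VAR_vr[of x]] in auto)
  moreover have "PRV (cImp (cNeg A) (cAll (vr x) (cNeg A)))"
    by (rule PRV_AV) (use G n VAR_fac(6)[OF VAR_vr[of x]] in auto)
  moreover have "PRV (cNeg (cAll (vr x) (cNeg H)))"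
    unfolding H_def by (rule PRV_AE) (use c in \<open>auto simp: closed_def\<close>)
  ultimately have "PRV A"
    by (intro code_taut[of "[cImp (cEq cZero cZero) (cImp (cAll (vr x) (cNeg A)) (cAll (vr x) (cNeg H))),
      cImp (cNeg A) (cAll (vr x) (cNeg A)), cNeg (cAll (vr x) (cNeg H)), cEq cZero cZero]"])
      (use G PRV_refl[of cZero] in auto)
  then show ?thesis by (simp add: A_def)
qed

text \<open>A standard proof is replayed line by line in the model; the side conditions on variables
  turn into statements about factors.\<close>

theorem PRV_provable:
  assumes "PA_provable F"
  shows "PRV (cf vr F)"
proof -
  obtain Fs where Fs: "PA_proof Fs F" using assms unfolding PA_provable_def by blast
  have fr: "FRM (cf vr F)" "TRM (ct vr t)" for F t by (simp_all add: GF_FRM GT_TRM)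
  have "PRV (cf vr (Fs ! i))" if "i < length Fs" for i
    using that
  proof (induction i rule: less_induct)
    case (less i)
    then consider "logic_axiom (Fs ! i)" | "PA_axiom (Fs ! i)"
      | j k where "j < i" "k < i" "Fs ! j = Imp (Fs ! k) (Fs ! i)" | j x where "j < i" "Fs ! i = All x (Fs ! j)"
      using Fs unfolding PA_proof_def by blast
    then show ?case
    proof cases
      case 1
      then have "LAX (cf vr (Fs ! i))"
      proof cases
        case (6 x G)
        have "\<not> fac (vr x) (cf vr G)"
          using fac_cf[of vr x G] 6(2) free_vars_subset[of G] bound_vars_subset[of G] by auto
        then show ?thesis unfolding 6(1) by (simp add: LAX_intros(6) fr)
      next
        case (7 x t)
        have "\<not> fac (vr x) (ct vr t)" using fac_ct[of vr x t] 7(2) by auto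
        then show ?thesis unfolding 7(1) by (simp add: LAX_intros(7) fr)
      qed (simp_all add: LAX_intros fr)
      then show ?thesis by (rule PRV_LAX) simp
    next
      case 2
      have "PAX (cf vr (Fs ! i))"
      proof (cases "Fs ! i \<in> set Q_axioms")
        case True
        then show ?thesis unfolding PAX_def by (auto simp: bs_fm_string)
      next
        case False
        then obtain x y G where G: "x ~= y" "y \<notin> fm_vars G" "Fs ! i = induction_axiom x y G"
          using 2 unfolding PA_axiom_def by blast
        have "\<not> fac (vr y) (cf vr G)"
          using fac_cf[of vr y G] G(2) free_vars_subset[of G] bound_vars_subset[of G] by auto
        note n = this
        show ?thesis unfolding PAX_def G(3) induction_axiom_def
          by (rule disjI2, rule exI[of _ "vr x"], rule conjI, rule VAR_vr, rule exI[of _ "vr y"], rule conjI, rule VAR_vr,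
              rule exI[of _ "cf vr G"]) (use n G(1) in \<open>simp add: fr\<close>)
      qed
      then show ?thesis using PRV_ax GF_begins0[OF GF_cf] GF_ends0[OF GF_cf] good_vr(1) by blast
    next
      case (3 j k)
      then show ?thesis using less.IH[of j] less.IH[of k] less.prems PRV_mp[of "cf vr (Fs ! k)" "cf vr (Fs ! i)"] by simp
    next
      case (4 j x)
      then show ?thesis using less.IH[of j] less.prems PRV_Gen[of "cf vr (Fs ! j)" "vr x"] by simp
    qed
  qed
  moreover have "Fs ~= []" "last Fs = F" using Fs unfolding PA_proof_def by blast+
  ultimately show ?thesis by (metis last_conv_nth length_greater_0_conv diff_less zero_less_one)
qed

theorem PRV_provable_instance:
  assumes F: "PA_provable F" "free_vars F \<inter> bound_vars F = {}" and \<rho>: "good \<rho>"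
  shows "PRV (cf \<rho> F)"
proof -
  \<comment> \<open>The variables are instantiated one at a time, and \<open>X\<close> collects
    those already done. \<open>PRV_instance\<close> asks that they are not bound in
    \<open>F\<close>.\<close>
  have "PRV (cf (%n. if n \<in> X then \<rho> n else vr n) F)" if "finite X" "X \<inter> bound_vars F = {}" for X
    using that
  proof (induction X rule: finite_induct)
    case empty
    have "(%n. if n \<in> {} then \<rho> n else vr n) = vr" by simp
    then show ?case using PRV_provable[OF F(1)] by simp
  next
    case (insert x X)
    let ?\<sigma> = "%n. if n \<in> insert x X then \<rho> n else vr n"
    have "?\<sigma>(x := vr x) = (%n. if n \<in> X then \<rho> n else vr n)" using insert.hyps(2) by auto
    then have "PRV (cf (?\<sigma>(x := vr x)) F)" using insert by simp
    then show ?case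
      by (rule PRV_instance[rotated 2]) (use insert.prems \<rho> in \<open>auto simp: good_def\<close>)
  qed
  from this[of "free_vars F"] have "PRV (cf (%n. if n \<in> free_vars F then \<rho> n else vr n) F)" using F(2) by simp
  moreover have "cf (%n. if n \<in> free_vars F then \<rho> n else vr n) F = cf \<rho> F" by (rule cf_cong) simp
  ultimately show ?thesis by simp
qed

end

section \<open>Numerals in a model\<close>

text \<open>A pair of a number \<open>a\<close> and a code \<open>t\<close> is a node with the tag
  3. The number enters as the string 01, \<open>a\<close>, 0, which has the shape that unique
  readability requires of an argument.\<close>

definition npair_fm :: "nat => tm => tm => tm => fm" where
  "npair_fm k u a t = Ex k (Con (cats_fm (Suc k) [const [False, True], Plus a One, const [False]] (Var k))
    (node2_fm 3 (Suc k) u (Var k) t))"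

definition nstep_fm :: "nat => tm => tm => tm => fm" where
  "nstep_fm k s r u = Ex k (Ex (k + 1) (Con (npair_fm (k + 2) u (Var k) (Var (k + 1)))
    (Dis (Con (Eq (Var k) Zero) (node0_fm 1 (k + 2) (Var (k + 1))))
      (Ex (k + 2) (Ex (k + 3) (Ex (k + 4) (Ex (k + 5) (conjs
        [npair_fm (k + 6) (Var (k + 2)) (Var (k + 3)) (Var (k + 4)),
         item_fm (k + 6) s (Var (k + 2)) r,
         Eq (Var k) (Plus (Var (k + 3)) One),
         node0_fm 2 (k + 6) (Var (k + 5)),
         node2_fm 3 (k + 6) (Var (k + 1)) (Var (k + 4)) (Var (k + 5))]))))))))"

text \<open>The graph of the map from a number, variable 0, to the code of its unary numeral,
  variable 1, by means of a list of pairs. Variable 2 is the separator, 3 the run that is shorter by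
  one, 4 the list, and 5 the pair sought.\<close>

definition Num_fm :: fm where
  "Num_fm = Ex 2 (Ex 3 (Ex 4 (Ex 5 (conjs
    [ones_fm 6 (Var 2) (Var 3),
     npair_fm 6 (Var 5) (Var 0) (Var 1),
     Ex 6 (cats_fm 7 [const [False], Var 2, Var 6] (Var 4)),
     Ex 6 (cats_fm 7 [Var 6, Var 2] (Var 4)),
     Neg (factor_fm 6 (Plus (Plus (Var 2) (Var 2)) One) (Var 4)),
     item_fm 6 (Var 2) (Var 5) (Var 4),
     All 6 (All 7 (All 8 (All 9 (Imp
       (conjs [cats_fm 10 [Var 6, Var 2] (Var 9), cats_fm 10 [Var 9, Var 7, Var 2, Var 8] (Var 4),
         Neg (factor_fm 10 (Var 2) (Var 7))])
       (nstep_fm 10 (Var 2) (Var 9) (Var 7))))))]))))"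

context pa_model
begin

definition quo :: "'a => 'a" where "quo a = b0 @@ b1 @@ a @@ b0"

abbreviation npair :: "'a => 'a => 'a" where "npair a t \<equiv> mk [tagM 3, quo a, t]"

definition NSTEP :: "('a => bool) => 'a => bool" where
  "NSTEP X u <-> (\<exists>a t. u = npair a t \<and>
    ((a = \<zero> \<and> t = cZero) \<or> (\<exists>b t'. X (npair b t') \<and> a = b \<oplus> \<one> \<and> t = cPlus t' cOne)))"

lemma dft_quo [dfn]: "dft t ==> dft (%e. quo (t e))"
  unfolding quo_def by (intro dfn)

lemma sh_quo: "sh (quo a)"
proof -
  have "quo a = (b0 @@ b1 @@ a) @@ b0" by (simp add: quo_def)
  then show ?thesis unfolding sh_def ends0_def by (metis quo_def)
qed

lemma npair_inj: "npair a t = npair b t' ==> sh t ==> a = b \<and> t = t'"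
proof -
  assume eq: "npair a t = npair b t'" and t: "sh t"
  have e: "ENC (npair a t) (tagM 3 # [quo a, t])" "ENC (npair b t') (tagM 3 # [quo b, t'])" using mk_ENC by blast+
  have "[quo a, t] = [quo b, t']"
    using scan_node[OF e(1) _ e(2), of \<zero> \<zero>] sh_quo t eq by simp
  then show ?thesis by (simp add: quo_def)
qed

sublocale NU: derivation zero one add mult Dfn NSTEP
proof
  show "NSTEP Y u" if "\<And>w. X w ==> Y w" "NSTEP X u" for X Y u
    using that unfolding NSTEP_def by blast
  show "Dfn (%e. NSTEP (%w. ITEM (e 0) w (e 1)) (e 2))"
    unfolding NSTEP_def by (intro dfn)
qed

definition NUM :: "'a => 'a => bool" where
  "NUM a t <-> NU.DRV (npair a t)"

lemma Dfn_NUM [dfn]: "dft a ==> dft t ==> Dfn (%e. NUM (a e) (t e))"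
  unfolding NUM_def by (rule NU.Dfn_DRV) (intro dfn)

lemma GT_sh: "GT t ==> sh t"
  unfolding GT_def using TMH_sh by blast

lemma closed_intros: "closed cZero" "closed cOne" "GT s ==> GT t ==> closed s ==> closed t ==> closed (cPlus s t)"
  unfolding closed_def using VAR_fac(1,2,3) by blast+

lemma NU_term: "NU.DRV u ==> \<exists>a t. u = npair a t \<and> GT t \<and> closed t"
proof (erule NU.DRV_induct)
  show "Dfn (%e. \<exists>a t. e 0 = npair a t \<and> GT t \<and> closed t)" unfolding closed_def by (intro dfn)
next
  fix X u assume X: "\<And>w. X w ==> \<exists>a t. w = npair a t \<and> GT t \<and> closed t" and "NSTEP X u"
  then obtain a t where u: "u = npair a t" and
    "(a = \<zero> \<and> t = cZero) \<or> (\<exists>b t'. X (npair b t') \<and> a = b \<oplus> \<one> \<and> t = cPlus t' cOne)" unfolding NSTEP_def by blast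
  then consider "t = cZero" | b t' where "X (npair b t')" "t = cPlus t' cOne" by blast
  then have "GT t \<and> closed t"
  proof cases
    case 1
    then show ?thesis using closed_intros by simp
  next
    case (2 b t')
    obtain b' t'' where t'': "npair b' t'' = npair b t'" "GT t''" "closed t''" using X[OF 2(1)] by metis
    then have "t'' = t'" using npair_inj GT_sh by blast
    then show ?thesis using t'' 2(2) closed_intros by simp
  qed
  then show "\<exists>a t. u = npair a t \<and> GT t \<and> closed t" using u by blast
qed

lemma NUM_term: "NUM a t ==> GT t \<and> closed t"
  unfolding NUM_def using NU_term npair_inj GT_sh by metis

lemma NUM_cases:
  assumes "NUM a t"
  shows "(a = \<zero> \<and> t = cZero) \<or> (\<exists>b t'. NUM b t' \<and> a = b \<oplus> \<one> \<and> t = cPlus t' cOne)"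
proof -
  obtain X where X: "\<And>w. X w ==> NU.DRV w" "NSTEP X (npair a t)" using NU.DRV_cases assms unfolding NUM_def by blast
  then obtain a' t' where *: "npair a t = npair a' t'"
    "(a' = \<zero> \<and> t' = cZero) \<or> (\<exists>b t''. X (npair b t'') \<and> a' = b \<oplus> \<one> \<and> t' = cPlus t'' cOne)" unfolding NSTEP_def by blast
  have "a = a' \<and> t = t'" using npair_inj[OF *(1)] NUM_term[OF assms] GT_sh by blast
  then show ?thesis using *(2) X(1) unfolding NUM_def by blast
qed

lemma NUM_intros: "NUM \<zero> cZero" "NUM a t ==> NUM (a \<oplus> \<one>) (cPlus t cOne)"
proof -
  show "NUM \<zero> cZero" unfolding NUM_def
    by (rule NU.DRV_axiom) (use mk_bounds[of "[tagM 3, quo \<zero>, cZero]"] in \<open>auto simp: NSTEP_def\<close>)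
  assume a: "NUM a t"
  show "NUM (a \<oplus> \<one>) (cPlus t cOne)" unfolding NUM_def
  proof (rule NU.DRV_intro[OF a[unfolded NUM_def] a[unfolded NUM_def]])
    show "NSTEP (%w. w = npair a t \<or> w = npair a t) (npair (a \<oplus> \<one>) (cPlus t cOne))" unfolding NSTEP_def by blast
  qed (use mk_bounds[of "[tagM 3, quo (a \<oplus> \<one>), cPlus t cOne]"] in simp_all)
qed

text \<open>Induction in the model gives a numeral to every element, nonstandard ones included;
  recursion over the natural numbers would reach only the standard ones.\<close>

lemma NUM_exists: "\<exists>t. NUM a t"
proof (rule ind[of "%a. \<exists>t. NUM a t"])
  show "Dfn (%e. \<exists>t. NUM (e 0) t)" by (intro dfn)
qed (use NUM_intros in blast)+

lemma NUM_unique: "\<forall>t t'. NUM a t \<and> NUM a t' --> t = t'"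
proof (rule ind[of "%a. \<forall>t t'. NUM a t \<and> NUM a t' --> t = t'"])
  show "Dfn (%e. \<forall>t t'. NUM (e 0) t \<and> NUM (e 0) t' --> t = t')" by (intro dfn)
  have "t = cZero" if "NUM \<zero> t" for t using NUM_cases[OF that] S_nonzero by metis
  then show "\<forall>t t'. NUM \<zero> t \<and> NUM \<zero> t' --> t = t'" by metis
next
  fix a assume IH: "\<forall>t t'. NUM a t \<and> NUM a t' --> t = t'"
  have *: "\<exists>t'. NUM a t' \<and> t = cPlus t' cOne" if "NUM (a \<oplus> \<one>) t" for t
    using NUM_cases[OF that] by auto
  show "\<forall>t t'. NUM (a \<oplus> \<one>) t \<and> NUM (a \<oplus> \<one>) t' --> t = t'"
  proof (intro allI impI, elim conjE)
    fix t t' assume "NUM (a \<oplus> \<one>) t" "NUM (a \<oplus> \<one>) t'"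
    then obtain s s' where "NUM a s" "t = cPlus s cOne" "NUM a s'" "t' = cPlus s' cOne" using * by blast
    then show "t = t'" using IH by blast
  qed
qed

definition num :: "'a => 'a" where "num a = (THE t. NUM a t)"

lemma NUM_num: "NUM a t <-> t = num a"
  unfolding num_def using NUM_exists NUM_unique by (metis the_equality)

lemma dft_num [dfn]: "dft t ==> dft (%e. num (t e))"
  by (rule dft1[of num]) (unfold dft_def NUM_num[symmetric], intro dfn)

lemma num_zero: "num \<zero> = cZero" and num_succ: "num (a \<oplus> \<one>) = cPlus (num a) cOne"
  using NUM_intros NUM_num by metis+

lemma GT_num [simp]: "GT (num a)" and closed_num: "closed (num a)"
  using NUM_term NUM_num by blast+

lemma good_num [simp]: "good (%n. num (e n))"
  unfolding good_def by (simp add: closed_num)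

lemma sat_ExS:
  assumes "\<And>x. sat (e(k := x)) F <-> x ~= \<zero> \<and> Q (pr x)"
  shows "sat e (Ex k F) <-> (\<exists>a. Q a)"
  unfolding sat_Ex assms by (subst ex_num) simp

lemma code_eq: "x = S c <-> x ~= \<zero> \<and> pr x = c"
  by (metis S_pr pr_S S_nonzero)

lemma sat_npair:
  assumes "fresh u \<le> k" "fresh a \<le> k" "fresh t \<le> k"
  shows "sat e (npair_fm k u a t) <-> tval e u ~= \<zero> \<and> tval e t ~= \<zero> \<and> pr (tval e u) = npair (tval e a) (pr (tval e t))"
proof -
  have q: "S (b0 @@ b1 @@ c @@ b0) = S (quo c)" for c by (simp add: quo_def)
  have "sat (e(k := x)) (Con (cats_fm (Suc k) [const [False, True], Plus a One, const [False]] (Var k))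
    (node2_fm 3 (Suc k) u (Var k) t)) <->
    x = S (quo (tval e a)) \<and> tval e u ~= \<zero> \<and> x ~= \<zero> \<and> tval e t ~= \<zero> \<and> ENC (pr (tval e u)) [tagM 3, pr x, pr (tval e t)]" for x
    using assms by (simp add: sat_cats sat_node le_SucI quo_def)
  then show ?thesis unfolding npair_fm_def sat_Ex by (auto simp: ENC_mk)
qed

lemma sat_nstep:
  assumes f: "fresh s \<le> k" "fresh r \<le> k" "fresh u \<le> k" and v: "tval e s = S s'" "tval e r = S r'" "tval e u = S u'"
  shows "sat e (nstep_fm k s r u) <-> NSTEP (%w. ITEM s' w r') u'"
proof -
  have 1: "sat (e(k := a, k + 1 := t)) (Ex (k + 2) (Ex (k + 3) (Ex (k + 4) (Ex (k + 5) (conjs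
        [npair_fm (k + 6) (Var (k + 2)) (Var (k + 3)) (Var (k + 4)),
         item_fm (k + 6) s (Var (k + 2)) r,
         Eq (Var k) (Plus (Var (k + 3)) One),
         node0_fm 2 (k + 6) (Var (k + 5)),
         node2_fm 3 (k + 6) (Var (k + 1)) (Var (k + 4)) (Var (k + 5))]))))) <->
    (\<exists>w b x y. w ~= \<zero> \<and> x ~= \<zero> \<and> pr w = npair b (pr x) \<and> ITEM s' (pr w) r' \<and> a = b \<oplus> \<one> \<and> y ~= \<zero> \<and> pr y = cOne \<and>
      t ~= \<zero> \<and> pr t = cPlus (pr x) (pr y))" (is "?L a t <-> _") for a t
  proof -
    have "sat (e(k := a, k + 1 := t, k + 2 := w, k + 3 := b, k + 4 := x, k + 5 := y)) (item_fm (k + 6) s (Var (k + 2)) r) <->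
      w ~= \<zero> \<and> ITEM s' (pr w) r'" for w b x y
      by (subst sat_item[where s' = s' and x' = r']) (use f v in \<open>simp_all add: le_SucI\<close>)
    then show ?thesis using f by (simp add: sat_npair sat_node ENC_mk) blast
  qed
  also have "\<dots> a t <-> t ~= \<zero> \<and> (\<exists>b t'. ITEM s' (npair b t') r' \<and> a = b \<oplus> \<one> \<and> pr t = cPlus t' cOne)" (is "?A <-> ?B") for a t
  proof
    show ?B if ?A using that by metis
  next
    assume ?B
    then obtain b t' where *: "t ~= \<zero>" "ITEM s' (npair b t') r'" "a = b \<oplus> \<one>" "pr t = cPlus t' cOne" by blast
    then have "S (npair b t') ~= \<zero> \<and> S t' ~= \<zero> \<and> pr (S (npair b t')) = npair b (pr (S t')) \<and> ITEM s' (pr (S (npair b t'))) r' \<and>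
      a = b \<oplus> \<one> \<and> S cOne ~= \<zero> \<and> pr (S cOne) = cOne \<and> t ~= \<zero> \<and> pr t = cPlus (pr (S t')) (pr (S cOne))"
      unfolding pr_S using S_nonzero by blast
    then show ?A by blast
  qed
  finally have 2: "?L a t <-> t ~= \<zero> \<and> (\<exists>b t'. ITEM s' (npair b t') r' \<and> a = b \<oplus> \<one> \<and> pr t = cPlus t' cOne)" for a t .
  have 3: "sat (e(k := a, k + 1 := t)) (npair_fm (k + 2) u (Var k) (Var (k + 1))) <-> t ~= \<zero> \<and> u' = npair a (pr t)" for a t
    using f v by (subst sat_npair) (simp_all add: le_SucI)
  have 4: "sat (e(k := a, k + 1 := t)) (node0_fm 1 (k + 2) (Var (k + 1))) <-> t ~= \<zero> \<and> pr t = cZero" for a t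
    by (simp add: sat_node ENC_mk)
  have "sat e (nstep_fm k s r u) <-> (\<exists>a t. t ~= \<zero> \<and> u' = npair a (pr t) \<and>
    ((a = \<zero> \<and> pr t = cZero) \<or> (\<exists>b t'. ITEM s' (npair b t') r' \<and> a = b \<oplus> \<one> \<and> pr t = cPlus t' cOne)))"
    unfolding nstep_fm_def sat_Ex[of e] sat_Ex[of "e(k := _)" "k + 1"] sat_Con sat_Dis 2 3 4 by auto
  also have "\<dots> <-> NSTEP (%w. ITEM s' w r') u'"
    unfolding NSTEP_def by (subst (2) ex_num) simp
  finally show ?thesis .
qed

lemma sat_Num_core:
  fixes d
  defines "F \<equiv> conjs
    [ones_fm 6 (Var 2) (Var 3),
     npair_fm 6 (Var 5) (Var 0) (Var 1),
     Ex 6 (cats_fm 7 [const [False], Var 2, Var 6] (Var 4)),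
     Ex 6 (cats_fm 7 [Var 6, Var 2] (Var 4)),
     Neg (factor_fm 6 (Plus (Plus (Var 2) (Var 2)) One) (Var 4)),
     item_fm 6 (Var 2) (Var 5) (Var 4),
     All 6 (All 7 (All 8 (All 9 (Imp
       (conjs [cats_fm 10 [Var 6, Var 2] (Var 9), cats_fm 10 [Var 9, Var 7, Var 2, Var 8] (Var 4),
         Neg (factor_fm 10 (Var 2) (Var 7))])
       (nstep_fm 10 (Var 2) (Var 9) (Var 7))))))]"
  shows "sat d F <-> d 1 ~= \<zero> \<and> (\<exists>s a r u. d 2 = S s \<and> d 3 = S a \<and> d 4 = S r \<and> d 5 = S u \<and> s = a @@ b1 \<and>
    NU.LST s r \<and> ITEM s u r \<and> u = npair (d 0) (pr (d 1)))"
proof -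
  have 1: "sat d (ones_fm 6 (Var 2) (Var 3)) <-> d 3 ~= \<zero> \<and> ONE (pr (d 3)) \<and> d 2 = S (pr (d 3) @@ b1)"
    by (simp add: sat_ones)
  have 2: "sat d (npair_fm 6 (Var 5) (Var 0) (Var 1)) <-> d 5 ~= \<zero> \<and> d 1 ~= \<zero> \<and> pr (d 5) = npair (d 0) (pr (d 1))"
    by (simp add: sat_npair)
  have 4: "sat d (Ex 6 (cats_fm 7 [Var 6, Var 2] (Var 4))) <-> (\<exists>x. x ~= \<zero> \<and> d 2 ~= \<zero> \<and> d 4 = S (pr x @@ pr (d 2)))"
    by (simp add: sat_cats)
  show ?thesis
  proof (cases "d 1 ~= \<zero> \<and> d 3 ~= \<zero> \<and> d 4 ~= \<zero> \<and> d 5 ~= \<zero> \<and> d 2 = S (pr (d 3) @@ b1)")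
    case False
    have "\<not> sat d F"
    proof
      assume "sat d F"
      then have "sat d (ones_fm 6 (Var 2) (Var 3))" "sat d (npair_fm 6 (Var 5) (Var 0) (Var 1))"
        "sat d (Ex 6 (cats_fm 7 [Var 6, Var 2] (Var 4)))" unfolding F_def conjs.simps sat_Con by blast+
      then show False using False unfolding 1 2 4 using S_nonzero by metis
    qed
    moreover have "\<not> (d 1 ~= \<zero> \<and> (\<exists>s a r u. d 2 = S s \<and> d 3 = S a \<and> d 4 = S r \<and> d 5 = S u \<and> s = a @@ b1 \<and>
      NU.LST s r \<and> ITEM s u r \<and> u = npair (d 0) (pr (d 1))))"
      using False pr_S S_nonzero by metis
    ultimately show ?thesis by blast
  next
    case True
    define s a r u t where "s = pr (d 2)" and "a = pr (d 3)" and "r = pr (d 4)" and "u = pr (d 5)" and "t = pr (d 1)"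
    have d: "d 2 = S s" "d 3 = S a" "d 4 = S r" "d 5 = S u" "d 1 = S t" and s: "s = a @@ b1"
      using True by (simp_all add: s_def a_def r_def u_def t_def S_pr)
    have 3: "sat d (Ex 6 (cats_fm 7 [const [False], Var 2, Var 6] (Var 4))) <-> (\<exists>q. r = b0 @@ s @@ q)"
      by (rule sat_ExS) (simp add: sat_cats d conj_commute)
    have 4: "sat d (Ex 6 (cats_fm 7 [Var 6, Var 2] (Var 4))) <-> (\<exists>p. r = p @@ s)"
      by (rule sat_ExS) (simp add: sat_cats d conj_commute)
    have 5: "sat d (Neg (factor_fm 6 (Plus (Plus (Var 2) (Var 2)) One) (Var 4))) <-> \<not> fac (s @@ b1) r"
    proof -
      have "tval d (Plus (Plus (Var 2) (Var 2)) One) = S (s @@ b1)" by (simp add: d S_b1)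
      then show ?thesis by (simp add: sat_factor d del: tval.simps(4))
    qed
    have 6: "sat d (item_fm 6 (Var 2) (Var 5) (Var 4)) <-> ITEM s u r"
      by (subst sat_item[where s' = s and x' = r]) (simp_all add: d)
    have ns: "sat (d(6 := x6, 7 := S x7, 8 := x8, 9 := S x9)) (nstep_fm 10 (Var 2) (Var 9) (Var 7)) <->
      NSTEP (%w. ITEM s w x9) x7" for x6 x7 x8 x9
      by (rule sat_nstep) (simp_all add: d)
    let ?G = "Imp
       (conjs [cats_fm 10 [Var 6, Var 2] (Var 9), cats_fm 10 [Var 9, Var 7, Var 2, Var 8] (Var 4),
         Neg (factor_fm 10 (Var 2) (Var 7))])
       (nstep_fm 10 (Var 2) (Var 9) (Var 7))"
    have 7: "sat d (All 6 (All 7 (All 8 (All 9 ?G)))) <->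
      (\<forall>p u q. r = p @@ s @@ u @@ s @@ q \<and> \<not> fac s u --> NSTEP (%w. ITEM s w (p @@ s)) u)"
    proof -
      have "sat (d(6 := x6, 7 := x7, 8 := x8, 9 := x9)) ?G <->
        x9 = \<zero> \<or> x8 = \<zero> \<or> x7 = \<zero> \<or> x6 = \<zero> \<or> (pr x9 = pr x6 @@ s \<and> r = pr x9 @@ pr x7 @@ s @@ pr x8 \<and> \<not> fac s (pr x7) -->
          NSTEP (%w. ITEM s w (pr x9)) (pr x7))" for x6 x7 x8 x9
      proof (cases "x9 = \<zero> \<or> x8 = \<zero> \<or> x7 = \<zero> \<or> x6 = \<zero>")
        case True
        then show ?thesis by (auto simp: sat_cats)
      next
        case False
        then have x: "x9 = S (pr x9)" "x8 = S (pr x8)" "x7 = S (pr x7)" "x6 = S (pr x6)" by (simp_all add: S_pr)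
        have "sat (d(6 := x6, 7 := x7, 8 := x8, 9 := x9)) (nstep_fm 10 (Var 2) (Var 9) (Var 7)) <->
          NSTEP (%w. ITEM s w (pr x9)) (pr x7)" using ns[of x6 "pr x7" x8 "pr x9"] x by metis
        moreover have "x9 = S (pr x6 @@ s) <-> pr x9 = pr x6 @@ s" using False by (simp add: code_eq)
        ultimately show ?thesis using False by (simp add: sat_cats sat_factor d)
      qed
      then have "sat d (All 6 (All 7 (All 8 (All 9 ?G)))) <->
       (\<forall>x6 x7 x8 x9. x9 = \<zero> \<or> x8 = \<zero> \<or> x7 = \<zero> \<or> x6 = \<zero> \<or> (pr x9 = pr x6 @@ s \<and> r = pr x9 @@ pr x7 @@ s @@ pr x8 \<and> \<not> fac s (pr x7) -->
          NSTEP (%w. ITEM s w (pr x9)) (pr x7)))"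
        unfolding sat.simps(4) by blast
      also have "\<dots> <-> (\<forall>p u q p'. p' = p @@ s \<and> r = p' @@ u @@ s @@ q \<and> \<not> fac s u --> NSTEP (%w. ITEM s w p') u)"
        by (subst all_num, subst (2) all_num, subst (3) all_num, subst (4) all_num) (simp only: pr_S S_nonzero simp_thms)
      also have "\<dots> <-> (\<forall>p u q. r = p @@ s @@ u @@ s @@ q \<and> \<not> fac s u --> NSTEP (%w. ITEM s w (p @@ s)) u)"
      proof -
        have "(p @@ s) @@ u @@ s @@ q = p @@ s @@ u @@ s @@ q" for p u q by simp
        then show ?thesis by metis
      qed
      finally show ?thesis .
    qed
    have s0: "s ~= \<zero>" "ONE s <-> ONE a" using s by simp_all
    have "sat d F <-> ONE a \<and> u = npair (d 0) t \<and> (\<exists>q. r = b0 @@ s @@ q) \<and> (\<exists>p. r = p @@ s) \<and> \<not> fac (s @@ b1) r \<and> ITEM s u r \<and>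
      (\<forall>p u q. r = p @@ s @@ u @@ s @@ q \<and> \<not> fac s u --> NSTEP (%w. ITEM s w (p @@ s)) u)"
      unfolding F_def conjs.simps(2,3) sat_Con 1 2 3 4 5 6
      by (subst 7[unfolded conjs.simps]) (use d s in auto)
    also have "\<dots> <-> NU.LST s r \<and> ITEM s u r \<and> u = npair (d 0) t" unfolding NU.LST_def using s0 by blast
    finally show ?thesis using d s by auto
  qed
qed

lemma sat_Num: "sat e Num_fm <-> e 1 ~= \<zero> \<and> pr (e 1) = num (e 0)"
proof -
  have "sat e Num_fm <-> (\<exists>x2 x3 x4 x5. e 1 ~= \<zero> \<and> (\<exists>s a r u. x2 = S s \<and> x3 = S a \<and> x4 = S r \<and> x5 = S u \<and> s = a @@ b1 \<and>
    NU.LST s r \<and> ITEM s u r \<and> u = npair (e 0) (pr (e 1))))"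
    unfolding Num_fm_def sat_Ex[of e] sat_Ex[of "_(2 := _)"] sat_Ex[of "_(3 := _)"] sat_Ex[of "_(4 := _)"] sat_Num_core by simp
  also have "\<dots> <-> e 1 ~= \<zero> \<and> (\<exists>a r. NU.LST (a @@ b1) r \<and> ITEM (a @@ b1) (npair (e 0) (pr (e 1))) r)" by blast
  also have "\<dots> <-> e 1 ~= \<zero> \<and> NUM (e 0) (pr (e 1))"
  proof -
    have "\<exists>a. s = a @@ b1" if "NU.LST s r" for s r using NU.LST_D(1,2)[OF that] ONE_last[of s] by blast
    then show ?thesis unfolding NUM_def NU.DRV_def by blast
  qed
  finally show ?thesis by (simp add: NUM_num)
qed

end

section \<open>Completeness for bounded formulas\<close>

text \<open>The way back from models to PA: the class \<open>fo\<close> turns any model of the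
  axioms into a \<open>pa_model\<close>, so PA theorems can be verified by mathematics in that
  locale.\<close>

lemma PA_complete:
  assumes "\<And>(zero :: nat) one add mult Dfn e. pa_model zero one add mult Dfn ==> arith_structure.sat zero one add mult e H"
  shows "PA_provable H"
proof (rule completeness)
  fix zero one :: nat and add mult e
  assume PA: "\<And>F e. PA_axiom F ==> arith_structure.sat zero one add mult e F"
  interpret arith_structure zero one add mult .
  have "pa_model zero one add mult fo" by (rule fo_model) (rule PA)
  then show "sat e H" by (rule assms)
qed

text \<open>Bounded formulas in the form that the counter discipline produces: free variables lie
  below \<open>k\<close> and bound ones from \<open>k\<close> on, so they never clash when numerals
  are inserted.\<close>

inductive bdd :: "nat => fm => bool" where
  bdd_Eq: "fresh s \<le> k ==> fresh t \<le> k ==> bdd k (Eq s t)"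
| bdd_Neg: "bdd k F ==> bdd k (Neg F)"
| bdd_Imp: "bdd k F ==> bdd k G ==> bdd k (Imp F G)"
| bdd_All: "fresh t \<le> k ==> bdd (Suc k) F ==> bdd k (All k (Imp (Leq (Var k) t) F))"

lemma tm_vars_fresh: "x \<in> tm_vars t ==> x < fresh t"
  by (induction t) auto

lemma bdd_free_vars: "bdd k F ==> x \<in> free_vars F ==> x < k"
proof (induction arbitrary: x rule: bdd.induct)
  case (bdd_Eq s k t)
  then show ?case using tm_vars_fresh[of x s] tm_vars_fresh[of x t] by auto
next
  case (bdd_All t k F)
  have "y < Suc k" if "y \<in> free_vars F" for y using bdd_All.IH[OF that] .
  then show ?case using tm_vars_fresh[of x t] bdd_All.prems bdd_All.hyps(1)
    by (fastforce simp: Leq_def Let_def Ex_def less_Suc_eq)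
qed auto

lemma bdd_bound_vars: "bdd k F ==> x \<in> bound_vars F ==> k \<le> x"
proof (induction arbitrary: x rule: bdd.induct)
  case (bdd_All t k F)
  have "Suc k \<le> y" if "y \<in> bound_vars F" for y using bdd_All.IH[OF that] .
  then show ?case using bdd_All.prems by (fastforce simp: Leq_def Let_def Ex_def)
qed auto

text \<open>\<open>Leq\<close> chooses its quantified variable depending on the bound, so replacing
  the bound \<open>w\<close> by another variable would change more than \<open>w\<close>. With
  \<open>z\<close> fixed, the codes for \<open>w\<close> and \<open>w'\<close> under the same value
  coincide, as the induction on the bound requires.\<close>

definition le_all :: "nat => nat => nat => fm => fm" where
  "le_all z k w F = All k (Imp (Ex z (Eq (Plus (Var z) (Var k)) (Var w))) F)"

lemma PA_le_all:
  assumes "k ~= w" "z ~= w" "z ~= k" "k ~= w'" "z ~= w'" "fresh t \<le> k"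
  shows PA_le_all_zero: "PA_provable (Imp (Eq (Var w) Zero) (Imp (All k (Imp (Eq (Var k) (Var w)) F)) (le_all z k w F)))"
    and PA_le_all_succ: "PA_provable (Imp (Eq (Var w') (Plus (Var w) One)) (Imp (le_all z k w F)
      (Imp (All k (Imp (Eq (Var k) (Var w')) F)) (le_all z k w' F))))"
    and PA_le_all_Leq: "PA_provable (Imp (Eq t (Var w)) (Imp (le_all z k w F) (All k (Imp (Leq (Var k) t) F))))"
proof -
  show "PA_provable (Imp (Eq (Var w) Zero) (Imp (All k (Imp (Eq (Var k) (Var w)) F)) (le_all z k w F)))"
  proof (rule PA_complete)
    fix zero one :: nat and add mult Dfn e assume "pa_model zero one add mult Dfn"
    then interpret m: pa_model zero one add mult Dfn .
    show "m.sat e (Imp (Eq (Var w) Zero) (Imp (All k (Imp (Eq (Var k) (Var w)) F)) (le_all z k w F)))"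
      using assms by (simp add: le_all_def m.add_eq_zero)
  qed
  show "PA_provable (Imp (Eq (Var w') (Plus (Var w) One)) (Imp (le_all z k w F)
      (Imp (All k (Imp (Eq (Var k) (Var w')) F)) (le_all z k w' F))))"
  proof (rule PA_complete)
    fix zero one :: nat and add mult Dfn e assume "pa_model zero one add mult Dfn"
    then interpret m: pa_model zero one add mult Dfn .
    have "(\<exists>c. add c a = e w) \<or> a = add (e w) one" if "add b a = add (e w) one" for a b
    proof (cases "b = zero")
      case True
      then show ?thesis using that by simp
    next
      case False
      then obtain c where "b = add c one" using m.cases_zero by blast
      then have "add (add c a) one = add (e w) one" using that m.succ_add by metis
      then show ?thesis using m.succ_inj by blast
    qed
    then show "m.sat e (Imp (Eq (Var w') (Plus (Var w) One)) (Imp (le_all z k w F)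
      (Imp (All k (Imp (Eq (Var k) (Var w')) F)) (le_all z k w' F))))"
      using assms by (simp add: le_all_def) metis
  qed
  show "PA_provable (Imp (Eq t (Var w)) (Imp (le_all z k w F) (All k (Imp (Leq (Var k) t) F))))"
  proof (rule PA_complete)
    fix zero one :: nat and add mult Dfn e assume "pa_model zero one add mult Dfn"
    then interpret m: pa_model zero one add mult Dfn .
    show "m.sat e (Imp (Eq t (Var w)) (Imp (le_all z k w F) (All k (Imp (Leq (Var k) t) F))))"
      using assms by (simp add: le_all_def m.sat_Leq m.le_def)
  qed
qed

text \<open>Intermediate values have variables of their own: once numerals are inserted, each step
  of an evaluation relates numerals only.\<close>

lemma PA_arith:
  "PA_provable (Eq (Plus (Var 0) Zero) (Var 0))"
  "PA_provable (Imp (Eq (Plus (Var 0) (Var 1)) (Var 2)) (Eq (Plus (Var 0) (Plus (Var 1) One)) (Plus (Var 2) One)))"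
  "PA_provable (Eq (Times (Var 0) Zero) Zero)"
  "PA_provable (Imp (Eq (Times (Var 0) (Var 1)) (Var 2)) (Imp (Eq (Plus (Var 2) (Var 0)) (Var 3))
    (Eq (Times (Var 0) (Plus (Var 1) One)) (Var 3))))"
  "PA_provable (Imp (Eq (Plus (Var 0) (Plus (Var 1) One)) (Var 2)) (Con (Neg (Eq (Var 0) (Var 2))) (Neg (Eq (Var 2) (Var 0)))))"
proof -
  show "PA_provable (Eq (Plus (Var 0) Zero) (Var 0))"
    and "PA_provable (Imp (Eq (Plus (Var 0) (Var 1)) (Var 2)) (Eq (Plus (Var 0) (Plus (Var 1) One)) (Plus (Var 2) One)))"
    and "PA_provable (Eq (Times (Var 0) Zero) Zero)"
    and "PA_provable (Imp (Eq (Times (Var 0) (Var 1)) (Var 2)) (Imp (Eq (Plus (Var 2) (Var 0)) (Var 3))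
      (Eq (Times (Var 0) (Plus (Var 1) One)) (Var 3))))"
    and "PA_provable (Imp (Eq (Plus (Var 0) (Plus (Var 1) One)) (Var 2)) (Con (Neg (Eq (Var 0) (Var 2))) (Neg (Eq (Var 2) (Var 0)))))"
  proof -
    have *: "arith_structure.sat zero one add mult e (Eq (Plus (Var 0) Zero) (Var 0)) \<and>
      arith_structure.sat zero one add mult e (Imp (Eq (Plus (Var 0) (Var 1)) (Var 2)) (Eq (Plus (Var 0) (Plus (Var 1) One)) (Plus (Var 2) One))) \<and>
      arith_structure.sat zero one add mult e (Eq (Times (Var 0) Zero) Zero) \<and>
      arith_structure.sat zero one add mult e (Imp (Eq (Times (Var 0) (Var 1)) (Var 2)) (Imp (Eq (Plus (Var 2) (Var 0)) (Var 3))
        (Eq (Times (Var 0) (Plus (Var 1) One)) (Var 3)))) \<and>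
      arith_structure.sat zero one add mult e (Imp (Eq (Plus (Var 0) (Plus (Var 1) One)) (Var 2))
        (Con (Neg (Eq (Var 0) (Var 2))) (Neg (Eq (Var 2) (Var 0)))))"
      if "pa_model zero one add mult Dfn" for zero one :: nat and add mult Dfn e
    proof -
      interpret m: pa_model zero one add mult Dfn by (rule that)
      have "add (e 0) (add (e 1) one) ~= e 0"
        using m.add_left_cancel[of "e 0" "add (e 1) one" zero] by simp
      then show ?thesis by (simp add: m.add_succ m.mult_succ m.mult_zero)
    qed
    show "PA_provable (Eq (Plus (Var 0) Zero) (Var 0))" by (rule PA_complete) (use * in blast)
    show "PA_provable (Imp (Eq (Plus (Var 0) (Var 1)) (Var 2)) (Eq (Plus (Var 0) (Plus (Var 1) One)) (Plus (Var 2) One)))"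
      by (rule PA_complete) (use * in blast)
    show "PA_provable (Eq (Times (Var 0) Zero) Zero)" by (rule PA_complete) (use * in blast)
    show "PA_provable (Imp (Eq (Times (Var 0) (Var 1)) (Var 2)) (Imp (Eq (Plus (Var 2) (Var 0)) (Var 3))
      (Eq (Times (Var 0) (Plus (Var 1) One)) (Var 3))))" by (rule PA_complete) (use * in blast)
    show "PA_provable (Imp (Eq (Plus (Var 0) (Plus (Var 1) One)) (Var 2)) (Con (Neg (Eq (Var 0) (Var 2))) (Neg (Eq (Var 2) (Var 0)))))"
      by (rule PA_complete) (use * in blast)
  qed
qed

context pa_model
begin

text \<open>
  The values \<open>e n\<close> can be nonstandard, and then so are the codes of their numerals.  That the truth
  of a bounded formula implies \<open>PrE\<close> is provable \<open>\<Sigma>\<^sub>1\<close>-completeness.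
\<close>

definition PrE :: "(nat => 'a) => fm => bool" where
  "PrE e F <-> PRV (cf (%n. num (e n)) F)"

lemma PrE_cong: "(\<And>x. x \<in> free_vars F ==> e x = e' x) ==> PrE e F = PrE e' F"
  unfolding PrE_def by (subst cf_cong[of F "%n. num (e n)" "%n. num (e' n)"]) simp_all

lemma PrE_MP: "PrE e (Imp F G) ==> PrE e F ==> PrE e G"
  unfolding PrE_def cf.simps using PRV_mp[of "cf (%n. num (e n)) F" "cf (%n. num (e n)) G"] by simp

lemma PrE_PA: "PA_provable F ==> free_vars F \<inter> bound_vars F = {} ==> PrE e F"
  unfolding PrE_def by (rule PRV_provable_instance) simp_all

lemma PrE_taut:
  assumes "\<forall>G\<in>set Gs. PrE e G" "\<And>v. cval v ==> \<forall>G\<in>set Gs. v (cf (%n. num (e n)) G) ==> v (cf (%n. num (e n)) F)"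
  shows "PrE e F"
  unfolding PrE_def by (rule code_taut[of "map (cf (%n. num (e n))) Gs"]) (use assms in \<open>auto simp: PrE_def\<close>)

text \<open>Makes induction in the model applicable to the provability of instances whose numerals
  vary with the environment.\<close>

lemma Dfn_PrE:
  assumes "\<And>n. dft (%d. \<sigma> d n)"
  shows "Dfn (%d. PrE (\<sigma> d) F)"
proof -
  have t: "dft (%d. ct (\<rho> d) t)" if "\<And>n. dft (%d. \<rho> d n)" for \<rho> and t :: tm
    using that by (induction t) (auto intro!: dfn)
  have f: "dft (%d. cf (\<rho> d) F)" if "\<And>n. dft (%d. \<rho> d n)" for \<rho>
    using that
  proof (induction F arbitrary: \<rho>)
    case (Eq s t')
    show ?case unfolding cf.simps by (intro dfn t Eq)
  next
    case (Neg F)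
    show ?case unfolding cf.simps by (intro dfn Neg.IH Neg.prems)
  next
    case (Imp F G)
    show ?case unfolding cf.simps by (intro dfn Imp.IH Imp.prems)
  next
    case (All x F)
    have "dft (%d. ((\<rho> d)(x := vr x)) n)" for n using All.prems[of n] dft_const by (cases "n = x") simp_all
    then have "dft (%d. cf ((\<rho> d)(x := vr x)) F)" by (rule All.IH)
    then show ?case unfolding cf.simps by (intro dfn)
  qed
  show ?thesis unfolding PrE_def by (rule Dfn_PRV, rule f, rule dft_num, rule assms)
qed

lemma PrE_all_eq:
  assumes "PrE (e(k := e w)) F" "w ~= k"
  shows "PrE e (All k (Imp (Eq (Var k) (Var w)) F))"
proof -
  let ?\<rho> = "%n. num ((e(k := e w)) n)"
  have g: "good ?\<rho>" by simp
  have \<rho>: "?\<rho>(k := vr k) = (%n. num (e n))(k := vr k)" by auto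
  have "PRV (cImp (cEq (vr k) (num (e w))) (cImp (cf ?\<rho> F) (cf ((%n. num (e n))(k := vr k)) F)))"
    using subst_cf[OF g, of k F] unfolding \<rho> by simp
  then have "PRV (cImp (cEq (vr k) (num (e w))) (cf ((%n. num (e n))(k := vr k)) F))"
    by (intro code_taut[of "[cImp (cEq (vr k) (num (e w))) (cImp (cf ?\<rho> F) (cf ((%n. num (e n))(k := vr k)) F)), cf ?\<rho> F]"])
      (use assms(1) in \<open>auto simp: PrE_def simp del: fun_upd_apply\<close>)
  then have "PRV (cAll (vr k) (cImp (cEq (vr k) (num (e w))) (cf ((%n. num (e n))(k := vr k)) F)))"
    by (rule PRV_Gen) simp
  then show ?thesis unfolding PrE_def cf.simps ct.simps using assms(2) by simp
qed

lemma PrE_Neg_All: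
  assumes "PrE (e(k := a)) (Neg F)"
  shows "PrE e (Neg (All k F))"
proof -
  let ?\<rho> = "%n. num ((e(k := a)) n)"
  have g: "good ?\<rho>" "good ((%n. num (e n))(k := vr k))" by simp_all
  have \<rho>: "?\<rho>(k := vr k) = (%n. num (e n))(k := vr k)" by auto
  define A H where "A = cf ((%n. num (e n))(k := vr k)) F" and "H = cEq (vr k) (num a)"
  have G: "GF A" "GF H" using g(2) by (simp_all add: A_def H_def del: fun_upd_apply)
  have "PRV (cImp H (cImp (cf ?\<rho> (Neg F)) (cNeg A)))"
    using subst_cf[OF g(1), of k "Neg F"] unfolding \<rho> by (simp add: A_def H_def)
  then have "PRV (cImp A (cNeg H))"
    by (intro code_taut[of "[cImp H (cImp (cf ?\<rho> (Neg F)) (cNeg A)), cf ?\<rho> (Neg F)]"])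
      (use assms(1) G g(1) in \<open>auto simp: PrE_def simp del: fun_upd_apply\<close>)
  then have "PRV (cAll (vr k) (cImp A (cNeg H)))" by (rule PRV_Gen) simp
  moreover have "PRV (cNeg (cAll (vr k) (cNeg H)))"
    unfolding H_def by (rule PRV_AE) (use closed_num[of a] in \<open>auto simp: closed_def\<close>)
  ultimately have "PRV (cNeg (cAll (vr k) A))"
    by (intro code_taut[of "[cAll (vr k) (cImp A (cNeg H)), cNeg (cAll (vr k) (cNeg H)),
      cImp (cAll (vr k) (cImp A (cNeg H))) (cImp (cAll (vr k) A) (cAll (vr k) (cNeg H)))]"])
      (use G PRV_AD[of "vr k" A "cNeg H"] in auto)
  then show ?thesis unfolding PrE_def cf.simps A_def .
qed

lemma PrE_Ex: "PrE (e(k := a)) F ==> PrE e (Ex k F)"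
  unfolding Ex_def by (rule PrE_Neg_All, rule PrE_taut[of "[F]"]) auto

subsection \<open>Evaluation of terms\<close>

lemma PRV_trans: "GT s ==> GT t ==> GT r ==> PRV (cEq s t) ==> PRV (cEq t r) ==> PRV (cEq s r)"
  by (rule code_taut[of "[cImp (cEq s t) (cEq t s), cImp (cEq t s) (cImp (cEq t r) (cEq s r)), cEq s t, cEq t r]"])
    (simp_all add: PRV_sym PRV_Eq)

lemma PrE_arith:
  "PRV (cEq (cPlus (num a) cZero) (num a))"
  "PRV (cImp (cEq (cPlus (num a) (num b)) (num c)) (cEq (cPlus (num a) (num (b \<oplus> \<one>))) (num (c \<oplus> \<one>))))"
  "PRV (cEq (cTimes (num a) cZero) cZero)"
  "PRV (cImp (cEq (cTimes (num a) (num b)) (num c)) (cImp (cEq (cPlus (num c) (num a)) (num d))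
    (cEq (cTimes (num a) (num (b \<oplus> \<one>))) (num d))))"
  "PRV (cImp (cEq (cPlus (num a) (num (b \<oplus> \<one>))) (num c)) (cNeg (cImp (cNeg (cEq (num a) (num c))) (cNeg (cNeg (cEq (num c) (num a)))))))"
proof -
  let ?e = "%n::nat. if n = 0 then a else if n = 1 then b else if n = 2 then c else d"
  note p = PA_arith[THEN PrE_PA[where e = ?e], unfolded PrE_def]
  show "PRV (cEq (cPlus (num a) cZero) (num a))" using p(1) by simp
  show "PRV (cImp (cEq (cPlus (num a) (num b)) (num c)) (cEq (cPlus (num a) (num (b \<oplus> \<one>))) (num (c \<oplus> \<one>))))"
    using p(2) by (simp add: num_succ)
  show "PRV (cEq (cTimes (num a) cZero) cZero)" using p(3) by simp
  show "PRV (cImp (cEq (cTimes (num a) (num b)) (num c)) (cImp (cEq (cPlus (num c) (num a)) (num d))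
    (cEq (cTimes (num a) (num (b \<oplus> \<one>))) (num d))))" using p(4) by (simp add: num_succ)
  show "PRV (cImp (cEq (cPlus (num a) (num (b \<oplus> \<one>))) (num c)) (cNeg (cImp (cNeg (cEq (num a) (num c))) (cNeg (cNeg (cEq (num c) (num a)))))))"
    using p(5) by (simp add: num_succ Con_def)
qed

text \<open>The induction on \<open>b\<close> takes place in the model, about the definable
  predicate \<open>PRV\<close>, and so covers nonstandard values.\<close>

lemma num_add: "PRV (cEq (cPlus (num a) (num b)) (num (a \<oplus> b)))"
proof (rule ind[of "%b. PRV (cEq (cPlus (num a) (num b)) (num (a \<oplus> b)))"])
  show "Dfn (%e. PRV (cEq (cPlus (num a) (num (e 0))) (num (a \<oplus> e 0))))" by (intro dfn)
  show "PRV (cEq (cPlus (num a) (num \<zero>)) (num (a \<oplus> \<zero>)))" using PrE_arith(1) by (simp add: num_zero)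
next
  fix b assume "PRV (cEq (cPlus (num a) (num b)) (num (a \<oplus> b)))"
  then have "PRV (cEq (cPlus (num a) (num (b \<oplus> \<one>))) (num ((a \<oplus> b) \<oplus> \<one>)))" by (rule PRV_mp[OF PrE_arith(2)]) simp
  then show "PRV (cEq (cPlus (num a) (num (b \<oplus> \<one>))) (num (a \<oplus> (b \<oplus> \<one>))))" by (simp add: add_succ)
qed

lemma num_mult: "PRV (cEq (cTimes (num a) (num b)) (num (a \<otimes> b)))"
proof (rule ind[of "%b. PRV (cEq (cTimes (num a) (num b)) (num (a \<otimes> b)))"])
  show "Dfn (%e. PRV (cEq (cTimes (num a) (num (e 0))) (num (a \<otimes> e 0))))" by (intro dfn)
  show "PRV (cEq (cTimes (num a) (num \<zero>)) (num (a \<otimes> \<zero>)))" using PrE_arith(3) by (simp add: num_zero)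
next
  fix b assume "PRV (cEq (cTimes (num a) (num b)) (num (a \<otimes> b)))"
  then have "PRV (cImp (cEq (cPlus (num (a \<otimes> b)) (num a)) (num (a \<otimes> b \<oplus> a))) (cEq (cTimes (num a) (num (b \<oplus> \<one>))) (num (a \<otimes> b \<oplus> a))))"
    by (rule PRV_mp[OF PrE_arith(4)]) simp
  then have "PRV (cEq (cTimes (num a) (num (b \<oplus> \<one>))) (num (a \<otimes> b \<oplus> a)))" by (rule PRV_mp) (simp_all add: num_add)
  then show "PRV (cEq (cTimes (num a) (num (b \<oplus> \<one>))) (num (a \<otimes> (b \<oplus> \<one>))))" by (simp add: mult_succ)
qed

lemma num_less:
  assumes "a \<sqsubset> c"
  shows "PRV (cNeg (cEq (num a) (num c)))" "PRV (cNeg (cEq (num c) (num a)))"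
proof -
  obtain b where b: "c = a \<oplus> (b \<oplus> \<one>)"
  proof -
    have "a \<oplus> \<one> \<sqsubseteq> c" using assms by (simp add: succ_le)
    then obtain b where "b \<oplus> (a \<oplus> \<one>) = c" unfolding le_def by blast
    then have "c = a \<oplus> (b \<oplus> \<one>)" by (simp only: ac_simps)
    then show thesis by (rule that)
  qed
  let ?A = "cEq (num a) (num c)" and ?B = "cEq (num c) (num a)"
  have "PRV (cNeg (cImp (cNeg ?A) (cNeg (cNeg ?B))))"
    by (rule PRV_mp[OF PrE_arith(5)[of a b c]]) (use num_add[of a "b \<oplus> \<one>"] b in simp_all)
  then show "PRV (cNeg ?A)" "PRV (cNeg ?B)"
    by (intro code_taut[of "[cNeg (cImp (cNeg ?A) (cNeg (cNeg ?B)))]"]; auto)+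
qed

lemma num_tval: "PRV (cEq (ct (%n. num (e n)) t) (num (tval e t)))"
proof (induction t)
  case (Plus s t)
  let ?\<rho> = "%n. num (e n)"
  have "PRV (cEq (cPlus (ct ?\<rho> s) (ct ?\<rho> t)) (cPlus (num (tval e s)) (num (tval e t))))"
    by (rule code_taut[of "[cImp (cEq (ct ?\<rho> s) (num (tval e s))) (cImp (cEq (ct ?\<rho> t) (num (tval e t)))
      (cEq (cPlus (ct ?\<rho> s) (ct ?\<rho> t)) (cPlus (num (tval e s)) (num (tval e t))))),
      cEq (ct ?\<rho> s) (num (tval e s)), cEq (ct ?\<rho> t) (num (tval e t))]"]) (use Plus in \<open>simp_all add: PRV_cong(1)\<close>)
  then show ?case using PRV_trans[OF _ _ _ _ num_add] by simp
next
  case (Times s t)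
  let ?\<rho> = "%n. num (e n)"
  have "PRV (cEq (cTimes (ct ?\<rho> s) (ct ?\<rho> t)) (cTimes (num (tval e s)) (num (tval e t))))"
    by (rule code_taut[of "[cImp (cEq (ct ?\<rho> s) (num (tval e s))) (cImp (cEq (ct ?\<rho> t) (num (tval e t)))
      (cEq (cTimes (ct ?\<rho> s) (ct ?\<rho> t)) (cTimes (num (tval e s)) (num (tval e t))))),
      cEq (ct ?\<rho> s) (num (tval e s)), cEq (ct ?\<rho> t) (num (tval e t))]"]) (use Times in \<open>simp_all add: PRV_cong(2)\<close>)
  then show ?case using PRV_trans[OF _ _ _ _ num_mult] by simp
next
  \<comment> \<open>The numeral of \<open>\<one>\<close> is the term \<open>0 + 1\<close>, which has
    to be proved equal to the constant \<open>One\<close>.\<close>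
  case One
  have "PRV (cEq (cPlus (num \<zero>) (num \<one>)) (num \<one>))" using num_add[of \<zero> \<one>] by simp
  have z: "PRV (cEq cOne (cPlus cZero cOne))"
  proof -
    have "PA_provable (Eq One (Plus Zero One))"
    proof (rule PA_complete)
      fix zero one :: nat and add mult Dfn e assume "pa_model zero one add mult Dfn"
      then interpret m: pa_model zero one add mult Dfn .
      show "m.sat e (Eq One (Plus Zero One))" by simp
    qed
    from PRV_provable[OF this] show ?thesis by simp
  qed
  have "num \<one> = cPlus cZero cOne" using num_succ[of \<zero>] by (simp add: num_zero)
  then show ?case using z by simp
qed (simp_all add: num_zero PRV_refl)

text \<open>Truth and falsity are treated together because negation exchanges them. The bound of a
  quantifier may be nonstandard, so its instances cannot be put together one by one from outside;
  instead \<open>le_all\<close> is proved for every \<open>m\<close> up to the bound by induction in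
  the model. Falsity needs only one refuted instance.\<close>

theorem bdd_complete:
  assumes "bdd k F"
  shows "(sat e F --> PrE e F) \<and> (\<not> sat e F --> PrE e (Neg F))"
  using assms
proof (induction arbitrary: e rule: bdd.induct)
  case (bdd_Eq s k t)
  let ?s = "ct (%n. num (e n)) s" and ?t = "ct (%n. num (e n)) t" and ?a = "num (tval e s)" and ?b = "num (tval e t)"
  have g: "GT ?s" "GT ?t" "GT ?a" "GT ?b" by simp_all
  have v: "PRV (cEq ?s ?a)" "PRV (cEq ?t ?b)" by (rule num_tval)+
  have sym: "PRV (cEq ?b ?t)" by (rule PRV_mp[OF PRV_sym[OF g(2,4)] v(2)]) simp
  show ?case
  proof (intro conjI impI)
    assume "sat e (Eq s t)"
    then have "?a = ?b" by simp
    then have "PRV (cEq ?s ?t)" using PRV_trans[OF g(1,4,2) _ sym] v(1) by simp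
    then show "PrE e (Eq s t)" unfolding PrE_def by simp
  next
    assume "\<not> sat e (Eq s t)"
    then have "tval e s \<sqsubset> tval e t \<or> tval e t \<sqsubset> tval e s" using M.less_linear by auto
    then have n: "PRV (cNeg (cEq ?a ?b))" using num_less by blast
    have "PRV (cNeg (cEq ?s ?t))"
      by (rule code_taut[of "[cNeg (cEq ?a ?b), cEq ?s ?a, cEq ?t ?b, cImp (cEq ?s ?a) (cImp (cEq ?s ?t) (cEq ?a ?t)),
        cImp (cEq ?a ?t) (cEq ?t ?a), cImp (cEq ?t ?a) (cImp (cEq ?t ?b) (cEq ?a ?b))]"])
        (use n v g PRV_Eq[OF g(1,3,2)] PRV_sym[OF g(3,2)] PRV_Eq[OF g(2,3,4)] in auto)
    then show "PrE e (Neg (Eq s t))" unfolding PrE_def by simp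
  qed
next
  case (bdd_Neg k F)
  have "PrE e (Neg (Neg F))" if "PrE e F" by (rule PrE_taut[of "[F]"]) (use that in auto)
  then show ?case using bdd_Neg.IH[of e] by auto
next
  case (bdd_Imp k F G)
  have "PrE e (Imp F G)" if "PrE e (Neg F)" by (rule PrE_taut[of "[Neg F]"]) (use that in auto)
  moreover have "PrE e (Imp F G)" if "PrE e G" by (rule PrE_taut[of "[G]"]) (use that in auto)
  moreover have "PrE e (Neg (Imp F G))" if "PrE e F" "PrE e (Neg G)" by (rule PrE_taut[of "[F, Neg G]"]) (use that in auto)
  ultimately show ?case using bdd_Imp.IH(1)[of e] bdd_Imp.IH(2)[of e] by auto
next
  case (bdd_All t k F)
  let ?B = "Imp (Leq (Var k) t) F"
  obtain N where N: "\<forall>x\<in>insert k (tm_vars t \<union> fm_vars F). x < N"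
    using finite_nat_set_iff_bounded[of "insert k (tm_vars t \<union> fm_vars F)"] by auto
  define z w w' where "z = Suc N" and "w = Suc z" and "w' = Suc w"
  have out: "x \<notin> fm_vars F \<and> x \<notin> tm_vars t" if "N \<le> x" for x using N that by (meson UnCI insertCI linorder_not_less)
  have fr: "z \<notin> fm_vars F" "w \<notin> fm_vars F" "w' \<notin> fm_vars F" "w \<notin> tm_vars t" "z \<notin> tm_vars t" "k < N"
    using N out[of z] out[of w] out[of w'] by (simp_all add: z_def w_def w'_def)
  have ne: "k ~= w" "z ~= w" "z ~= k" "k ~= w'" "z ~= w'" using fr(6) by (simp_all add: z_def w_def w'_def)
  have fv: "free_vars F \<subseteq> {..k}" "bound_vars F \<subseteq> {Suc k..}"
    using bdd_free_vars[OF bdd_All.hyps(2)] bdd_bound_vars[OF bdd_All.hyps(2)] by (auto simp: less_Suc_eq_le)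
  have tv: "tm_vars t \<subseteq> {..<k}" using tm_vars_fresh[of _ t] bdd_All.hyps(1) by fastforce
  have dj: "tm_vars t \<inter> bound_vars F = {}" "Suc k \<notin> tm_vars t" "k \<notin> bound_vars F" "free_vars F \<inter> bound_vars F = {}"
    "Suc k \<notin> free_vars F" "k \<notin> tm_vars t" "max (Suc k) (fresh t) = Suc k" "w ~= Suc k"
    using fv tv bdd_All.hyps(1) fr(6) by (force simp: w_def z_def)+
  have bF: "w \<notin> bound_vars F" "w' \<notin> bound_vars F" "z \<notin> bound_vars F" "w \<notin> free_vars F" "w' \<notin> free_vars F" "z \<notin> free_vars F"
    using fr bound_vars_subset[of F] free_vars_subset[of F] by auto
  show ?case
  proof (intro conjI impI)
    assume sat: "sat e (All k ?B)"
    have F: "PrE (e(k := a)) F" if "a \<sqsubseteq> tval e t" for a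
    proof -
      have "sat (e(k := a)) F" using sat that bdd_All.hyps(1) by (simp add: sat_Leq)
      then show ?thesis using bdd_All.IH[of "e(k := a)"] by blast
    qed
    have G: "PrE (e(w := m)) (le_all z k w F)" if "m \<sqsubseteq> tval e t" for m
    proof -
      have all_eq: "PrE d (All k (Imp (Eq (Var k) (Var x)) F))"
        if "m \<sqsubseteq> tval e t" "d x = m" "x ~= k" "\<And>y. y \<in> free_vars F ==> d y = e y" for m d x
      proof (rule PrE_all_eq[OF _ that(3)])
        show "PrE (d(k := d x)) F" using F[OF that(1)] that(2,4)
          by (subst PrE_cong[where e' = "e(k := m)"]) auto
      qed
      have "m \<sqsubseteq> tval e t --> PrE (e(w := m)) (le_all z k w F)"
      proof (rule ind[of "%m. m \<sqsubseteq> tval e t --> PrE (e(w := m)) (le_all z k w F)"])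
        have "dft (%d. (e(w := d 0)) n)" for n by (cases "n = w") (auto intro: dfn)
        then show "Dfn (%d. d 0 \<sqsubseteq> tval e t --> PrE (e(w := d 0)) (le_all z k w F))"
          by (intro dfn Dfn_PrE)
      next
        let ?d = "e(w := \<zero>)"
        have "PrE ?d (Imp (Eq (Var w) Zero) (Imp (All k (Imp (Eq (Var k) (Var w)) F)) (le_all z k w F)))"
          by (rule PrE_PA[OF PA_le_all_zero[OF ne bdd_All.hyps(1)]]) (use ne bF dj in \<open>auto simp: le_all_def Ex_def\<close>)
        moreover have "PrE ?d (Eq (Var w) Zero)" unfolding PrE_def by (simp add: num_zero PRV_refl)
        moreover have "PrE ?d (All k (Imp (Eq (Var k) (Var w)) F))"
          by (rule all_eq[of \<zero>]) (use bF ne in auto)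
        ultimately have "PrE ?d (le_all z k w F)" using PrE_MP by blast
        then show "\<zero> \<sqsubseteq> tval e t --> PrE ?d (le_all z k w F)" ..
      next
        fix m assume IH: "m \<sqsubseteq> tval e t --> PrE (e(w := m)) (le_all z k w F)"
        show "m \<oplus> \<one> \<sqsubseteq> tval e t --> PrE (e(w := m \<oplus> \<one>)) (le_all z k w F)"
        proof
          assume m: "m \<oplus> \<one> \<sqsubseteq> tval e t"
          then have "m \<sqsubseteq> tval e t" using less_add_one[of m] M.less_le_trans[of m "m \<oplus> \<one>"] M.less_imp_le by blast
          let ?d = "e(w := m, w' := m \<oplus> \<one>)"
          have ww: "w ~= w'" by (simp add: w'_def)
          have "PrE ?d (Imp (Eq (Var w') (Plus (Var w) One)) (Imp (le_all z k w F)
            (Imp (All k (Imp (Eq (Var k) (Var w')) F)) (le_all z k w' F))))"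
            by (rule PrE_PA[OF PA_le_all_succ[OF ne bdd_All.hyps(1)]]) (use ne bF dj in \<open>auto simp: le_all_def Ex_def\<close>)
          moreover have "PrE ?d (Eq (Var w') (Plus (Var w) One))"
            unfolding PrE_def using ww by (simp add: num_succ PRV_refl)
          moreover have "PrE ?d (le_all z k w F)"
            using IH \<open>m \<sqsubseteq> tval e t\<close> ne bF ww by (subst PrE_cong[where e' = "e(w := m)"]) (auto simp: le_all_def Ex_def)
          moreover have "PrE ?d (All k (Imp (Eq (Var k) (Var w')) F))"
            by (rule all_eq[OF m]) (use bF ne in auto)
          ultimately have *: "PrE ?d (le_all z k w' F)" using PrE_MP by blast
          let ?\<rho> = "%n. num (?d n)" and ?\<sigma> = "%n. num ((e(w := m \<oplus> \<one>)) n)"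
          have "cf (?\<rho>(k := vr k)) F = cf (?\<sigma>(k := vr k)) F" by (rule cf_cong) (use bF ww in auto)
          \<comment> \<open>The variable \<open>w'\<close> with the value \<open>m + 1\<close> and
            the variable \<open>w\<close> with the same value give literally the same code.\<close>
          then have "cf ?\<rho> (le_all z k w' F) = cf ?\<sigma> (le_all z k w F)"
            unfolding le_all_def Ex_def cf.simps ct.simps using ne by simp
          then show "PrE (e(w := m \<oplus> \<one>)) (le_all z k w F)" using * unfolding PrE_def by (simp only:)
        qed
      qed
      then show ?thesis using \<open>m \<sqsubseteq> tval e t\<close> by blast
    qed
    let ?d = "e(w := tval e t)"
    have "PrE ?d (Imp (Eq t (Var w)) (Imp (le_all z k w F) (All k ?B)))"
      by (rule PrE_PA[OF PA_le_all_Leq[OF ne bdd_All.hyps(1)]])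
        (use ne bF dj fr in \<open>auto simp: le_all_def Ex_def Leq_def Let_def\<close>)
    moreover have "PrE ?d (Eq t (Var w))"
    proof -
      have "ct (%n. num (?d n)) t = ct (%n. num (e n)) t" by (rule ct_cong) (use fr in auto)
      then show ?thesis unfolding PrE_def using num_tval[of e t] by simp
    qed
    ultimately have "PrE ?d (All k ?B)" using PrE_MP G[OF M.order.refl] by blast
    then show "PrE e (All k ?B)"
      by (subst PrE_cong[where e' = ?d]) (use bF fr ne in \<open>auto simp: Leq_def Let_def Ex_def\<close>)
  next
    assume "\<not> sat e (All k ?B)"
    then obtain a where a: "a \<sqsubseteq> tval e t" "\<not> sat (e(k := a)) F" using bdd_All.hyps(1) by (auto simp: sat_Leq)
    \<comment> \<open>\<open>c\<close> is the witness for the existential quantifier inside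
      \<open>Leq\<close>, whose variable is \<open>Suc k\<close> here.\<close>
    obtain c where c: "c \<oplus> a = tval e t" using a(1) unfolding le_def by blast
    let ?d = "e(k := a, Suc k := c)"
    have t: "tval ?d t = tval e t" using bdd_All.hyps(1) by (simp add: le_SucI)
    let ?X = "ct (%n. num (?d n)) (Plus (Var (Suc k)) (Var k))" and ?Y = "ct (%n. num (?d n)) t" and ?n = "num (tval e t)"
    have g: "GT ?X" "GT ?Y" "GT ?n" by (rule GT_ct, rule good_num)+ (rule GT_num)
    have "tval ?d (Plus (Var (Suc k)) (Var k)) = tval e t" using c by simp
    then have "PRV (cEq ?X ?n)" using num_tval[of ?d "Plus (Var (Suc k)) (Var k)"] by (simp only:)
    moreover have "PRV (cEq ?Y ?n)" using num_tval[of ?d t] unfolding t .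
    then have "PRV (cEq ?n ?Y)" by (rule PRV_mp[OF PRV_sym[OF g(2,3)]]) (rule GF_intros(1)[OF g(3,2)])
    ultimately have "PRV (cEq ?X ?Y)" by (rule PRV_trans[OF g(1,3,2)])
    then have "PrE ?d (Eq (Plus (Var (Suc k)) (Var k)) t)" unfolding PrE_def cf.simps .
    then have "PrE (e(k := a)) (Ex (Suc k) (Eq (Plus (Var (Suc k)) (Var k)) t))" by (rule PrE_Ex)
    then have L: "PrE (e(k := a)) (Leq (Var k) t)" using bdd_All.hyps(1) by (simp add: Leq_def max_def)
    have "PrE (e(k := a)) (Neg F)" using bdd_All.IH a(2) by blast
    then have "PrE (e(k := a)) (Neg ?B)" using L by (intro PrE_taut[of "[Leq (Var k) t, Neg F]"]) auto
    then show "PrE e (Neg (All k ?B))" by (rule PrE_Neg_All)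
  qed
qed

end

section \<open>The Solovay construction\<close>

lemma bdd_connectives [simp]:
  "bdd k F ==> bdd k (Neg F)" "bdd k F ==> bdd k G ==> bdd k (Imp F G)"
  "bdd k F ==> bdd k G ==> bdd k (Con F G)" "bdd k F ==> bdd k G ==> bdd k (Dis F G)"
  "fresh s \<le> k ==> fresh t \<le> k ==> bdd k (Eq s t)"
  "fresh t \<le> k ==> bdd (Suc k) (B (Var k) (Suc k)) ==> bdd k (BAll k t B)"
  "fresh t \<le> k ==> bdd (Suc k) (B (Var k) (Suc k)) ==> bdd k (BEx k t B)"
  by (auto simp: Con_def Dis_def BAll_def BEx_def intro!: bdd.intros)

lemma bdd_conjs [simp]: "(\<And>F. F \<in> set Fs ==> bdd k F) ==> bdd k (conjs Fs)"
  by (induction Fs rule: conjs.induct) auto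

lemma bdd_disjs [simp]: "(\<And>F. F \<in> set Fs ==> bdd k F) ==> bdd k (disjs Fs)"
  by (induction Fs rule: disjs.induct) auto

lemma bdd_cat [simp]: "fresh x \<le> k ==> fresh y \<le> k ==> fresh z \<le> k ==> bdd k (cat_fm k x y z)"
  and bdd_pow2 [simp]: "fresh x \<le> k ==> bdd k (pow2_fm k x)"
  by (simp_all add: cat_fm_def pow2_fm_def le_SucI)

lemma bdd_cats [simp]: "\<forall>t\<in>set ts. fresh t \<le> k ==> fresh z \<le> k ==> bdd k (cats_fm k ts z)"
proof (induction ts arbitrary: k z)
  case (Cons t ts)
  have "bdd (Suc k) (cats_fm (Suc k) ts (Var k))" by (rule Cons.IH) (use Cons.prems(1) in \<open>auto intro: le_SucI\<close>)
  then show ?case using Cons.prems by (simp add: cats_fm.simps le_SucI)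
qed (simp add: cats_fm.simps)

lemma bdd_factor [simp]: "fresh u \<le> k ==> fresh x \<le> k ==> bdd k (factor_fm k u x)"
  by (simp add: factor_fm_def le_SucI)

lemma bdd_ones [simp]: "fresh s \<le> k ==> fresh s' \<le> k ==> bdd k (ones_fm k s s')"
  by (simp add: ones_fm_def)

lemma bdd_enc [simp]: "fresh z \<le> k ==> \<forall>t\<in>set ts. fresh t \<le> k ==> bdd k (enc_fm k z ts)"
proof -
  assume a: "fresh z \<le> k" "\<forall>t\<in>set ts. fresh t \<le> k"
  have f: "\<forall>t\<in>set ts. fresh t \<le> Suc (Suc k)" using a(2) by (auto intro: le_SucI)
  have "\<forall>t\<in>set (separated s us). fresh t \<le> m" if "fresh s \<le> m" "\<forall>t\<in>set us. fresh t \<le> m" for s us m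
    using that by (induction us) auto
  from this[of "Var k" "Suc (Suc k)" ts] have "\<forall>t\<in>set (const [False] # Var k # separated (Var k) ts). fresh t \<le> Suc (Suc k)" using f by simp
  then have "bdd (Suc (Suc k)) (cats_fm (Suc (Suc k)) (const [False] # Var k # separated (Var k) ts) z)"
    using a by (intro bdd_cats) (simp_all add: le_SucI)
  moreover have "bdd (Suc (Suc k)) (conjs (map (%t. Neg (factor_fm (Suc (Suc k)) (Var k) t)) ts))"
    "bdd (Suc (Suc k)) (disjs (map (%t. factor_fm (Suc (Suc k)) (Var (Suc k)) t) ts))"
    using f by (auto intro!: bdd_conjs bdd_disjs)
  ultimately show ?thesis using a(1) unfolding enc_fm_def
    by (intro bdd_connectives) (auto intro!: bdd_conjs)
qed

lemma bdd_node [simp]: "fresh z \<le> k ==> bdd k (node0_fm j k z)" "fresh z \<le> k ==> fresh t \<le> k ==> bdd k (node1_fm j k z t)"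
  "fresh z \<le> k ==> fresh s \<le> k ==> fresh t \<le> k ==> bdd k (node2_fm j k z s t)"
  by (simp_all add: node0_fm_def node1_fm_def node2_fm_def)

lemma bdd_var [simp]: "fresh z \<le> k ==> bdd k (var_fm k z)"
  by (simp add: var_fm_def le_SucI)

lemma bdd_heads [simp]: "fresh z \<le> k ==> bdd k (tm_head_fm k z)" "fresh z \<le> k ==> bdd k (fm_head_fm k z)"
  by (simp_all add: tm_head_fm_def fm_head_fm_def le_SucI)

lemma bdd_wf [simp]: "fresh z \<le> k ==> bdd k (wf_fm k z)"
  by (simp add: wf_fm_def le_SucI)

lemma bdd_expr [simp]: "fresh z \<le> k ==> bdd k (term_fm k z)" "fresh z \<le> k ==> bdd k (form_fm k z)"
  by (simp_all add: term_fm_def form_fm_def)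

lemma bdd_ex [simp]:
  "fresh t \<le> k ==> bdd (Suc k) (B (Var k) (Suc k)) ==> bdd k (ex_var k t B)"
  "fresh t \<le> k ==> bdd (Suc k) (B (Var k) (Suc k)) ==> bdd k (ex_term k t B)"
  "fresh t \<le> k ==> bdd (Suc k) (B (Var k) (Suc k)) ==> bdd k (ex_form k t B)"
  by (simp_all add: ex_var_def ex_term_def ex_form_def)

lemma bdd_pat [simp]: "\<forall>t\<in>pmetas p. fresh t \<le> k ==> fresh z \<le> k ==> bdd k (pat_fm p k z)"
proof (induction p arbitrary: k z)
  case (PNode1 j p)
  have "bdd (Suc k) (pat_fm p (Suc k) (Var k))" by (rule PNode1.IH) (use PNode1.prems in \<open>auto intro: le_SucI\<close>)
  then show ?case using PNode1.prems by (simp add: pat_fm.simps le_SucI)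
next
  case (PNode2 j p q)
  have "bdd (Suc (Suc k)) (pat_fm p (Suc (Suc k)) (Var k))" by (rule PNode2.IH) (use PNode2.prems in \<open>auto intro!: le_SucI\<close>)
  moreover have "bdd (Suc (Suc k)) (pat_fm q (Suc (Suc k)) (Var (Suc k)))" by (rule PNode2.IH) (use PNode2.prems in \<open>auto intro!: le_SucI\<close>)
  ultimately show ?case using PNode2.prems(2) by (simp add: pat_fm.simps le_SucI)
qed (simp_all add: pat_fm.simps)

lemma bdd_logic_axiom [simp]: "fresh z \<le> k ==> bdd k (logic_axiom_fm k z)"
  unfolding logic_axiom_fm_def by (rule bdd_disjs) (auto simp: le_SucI)

lemma fresh_quot [simp]: "fresh (quot F) = 0"
  by (simp add: quot_def)

lemma bdd_PA_axiom [simp]: "fresh z \<le> k ==> bdd k (PA_axiom_fm k z)"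
  unfolding PA_axiom_fm_def by (rule bdd_disjs) (auto simp: le_SucI)

lemma bdd_item [simp]: "fresh s \<le> k ==> fresh u \<le> k ==> fresh x \<le> k ==> bdd k (item_fm k s u x)"
  by (simp add: item_fm_def le_SucI)

lemma bdd_line [simp]: "fresh s \<le> k ==> fresh r \<le> k ==> fresh z \<le> k ==> bdd k (line_fm k s r z)"
  unfolding line_fm_def by (rule bdd_disjs) (auto simp: le_SucI)

lemma bdd_prf [simp]: "fresh x \<le> k ==> fresh y \<le> k ==> bdd k (prf_fm k x y)"
  by (simp add: prf_fm_def le_SucI)

definition P_fm :: "(nat => tm) => nat => nat => tm => fm" where
  "P_fm c j k x = BEx k x (%y k. prf_fm k y (c j))"

text \<open>
  The Solovay function \<open>H\<close> starts at the node 0.  It moves at time \<open>x\<close> to the least successor \<open>j\<close> of its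
  current node such that some \<open>y \<le> x\<close> proves the sentence with code \<open>c j\<close>.  The formula \<open>H_fm\<close> says
  that \<open>H x = i\<close>, \<open>A_fm\<close> that \<open>H\<close> moves to \<open>i\<close> at time \<open>x\<close>, \<open>E_fm\<close> that \<open>H\<close> visits \<open>i\<close>, and \<open>L_fm\<close>
  that \<open>i\<close> is the limit of \<open>H\<close>; in a model they define \<open>HS\<close>, \<open>AR\<close>, \<open>VIS\<close> and \<open>LMT\<close>.  As all proofs up to \<open>x\<close>
  count at time \<open>x\<close>, it does not matter whether a theorem has arbitrarily long proofs.
\<close>

fun H_fm :: "(nat => tm) => (nat => nat => bool) => nat => nat => nat => tm => fm" where
  "H_fm c R n i k x = (if i = 0
    then BAll k x (%y k. Dis (Eq y x) (conjs (map (%j. Neg (P_fm c j k y)) (filter (R 0) [0..<Suc n]))))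
    else BEx k x (%y k. Con (Neg (Eq y x)) (Con
      (disjs (map (%h. Con (H_fm c R n h k y) (Con (P_fm c i k y)
         (conjs (map (%j. Neg (P_fm c j k y)) (filter (R h) [0..<i]))))) (filter (%h. R h i) [0..<i])))
      (BAll k x (%z k. Dis (Eq z x) (Dis (BEx k y (%w k. Eq w z))
         (conjs (map (%j. Neg (P_fm c j k z)) (filter (R i) [0..<Suc n])))))))))"

declare H_fm.simps [simp del]

definition A_fm :: "(nat => tm) => (nat => nat => bool) => nat => nat => nat => tm => fm" where
  "A_fm c R n i k y = disjs (map (%h. Con (H_fm c R n h k y) (Con (P_fm c i k y)
         (conjs (map (%j. Neg (P_fm c j k y)) (filter (R h) [0..<i]))))) (filter (%h. R h i) [0..<i]))"

definition E_fm :: "(nat => tm) => (nat => nat => bool) => nat => nat => nat => fm" where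
  "E_fm c R n k i = (if i = 0 then Eq Zero Zero else Ex k (A_fm c R n i (Suc k) (Var k)))"

definition L_fm :: "(nat => tm) => (nat => nat => bool) => nat => nat => nat => fm" where
  "L_fm c R n k i = Con (E_fm c R n k i) (conjs (map (%j. Neg (E_fm c R n k j)) (filter (R i) [0..<Suc n])))"

lemma bdd_P [simp]: "fresh (c j) \<le> k ==> fresh x \<le> k ==> bdd k (P_fm c j k x)"
  by (simp add: P_fm_def le_SucI)

lemma bdd_H: "\<forall>j. fresh (c j) \<le> k ==> fresh x \<le> k ==> bdd k (H_fm c R n i k x)"
proof (induction i arbitrary: k x rule: less_induct)
  case (less i)
  have c: "fresh (c j) \<le> Suc k" "fresh (c j) \<le> Suc (Suc k)" for j using less.prems(1) by (simp_all add: le_SucI)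
  have H: "bdd (Suc k) (H_fm c R n h (Suc k) (Var k))" if "h < i" for h
    by (rule less.IH[OF that]) (use c in simp_all)
  show ?case
    using less.prems(2) c H by (subst H_fm.simps) (auto simp: le_SucI intro!: bdd_connectives bdd_conjs bdd_disjs bdd_P)
qed

lemma bdd_A: "\<forall>j. fresh (c j) \<le> k ==> fresh x \<le> k ==> bdd k (A_fm c R n i k x)"
  unfolding A_fm_def by (auto intro!: bdd_connectives bdd_conjs bdd_disjs bdd_P bdd_H)

section \<open>The Solovay function in a model\<close>

context pa_model
begin

lemma Dfn_finite_ball: "finite A ==> (\<And>j. j \<in> A ==> Dfn (%e. \<Phi> j e)) ==> Dfn (%e. \<forall>j\<in>A. \<Phi> j e)"
  by (induction A rule: finite_induct) (auto intro!: dfn)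

lemma Dfn_finite_bex: "finite A ==> (\<And>j. j \<in> A ==> Dfn (%e. \<Phi> j e)) ==> Dfn (%e. \<exists>j\<in>A. \<Phi> j e)"
  by (induction A rule: finite_induct) (auto intro!: dfn)

text \<open>The recursion is on the node and not on the time: moves lead to larger numbers, so
  \<open>i\<close> can be entered only from some \<open>h < i\<close>. The defining formula is
  therefore of finite standard depth, and sequences of values are not coded.\<close>

fun HS :: "(nat => nat => bool) => nat => (nat => 'a => bool) => nat => 'a => bool" where
  "HS R n P i x <-> (if i = 0 then \<forall>y. y \<sqsubset> x --> (\<forall>j\<in>{..n}. R 0 j --> \<not> P j y)
    else \<exists>y. y \<sqsubset> x \<and> (\<exists>h\<in>{..<i}. R h i \<and> HS R n P h y \<and> P i y \<and> (\<forall>j\<in>{..<i}. R h j --> \<not> P j y)) \<and>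
      (\<forall>z. y \<sqsubset> z \<and> z \<sqsubset> x --> (\<forall>j\<in>{..n}. R i j --> \<not> P j z)))"

declare HS.simps [simp del]

definition AR :: "(nat => nat => bool) => nat => (nat => 'a => bool) => nat => 'a => bool" where
  "AR R n P i y <-> (\<exists>h\<in>{..<i}. R h i \<and> HS R n P h y \<and> P i y \<and> (\<forall>j\<in>{..<i}. R h j --> \<not> P j y))"

definition VIS :: "(nat => nat => bool) => nat => (nat => 'a => bool) => nat => bool" where
  "VIS R n P i <-> i = 0 \<or> (\<exists>y. AR R n P i y)"

lemma HS_zero: "HS R n P 0 x <-> (\<forall>y. y \<sqsubset> x --> (\<forall>j\<in>{..n}. R 0 j --> \<not> P j y))"
  by (subst HS.simps) simp

lemma HS_pos: "i ~= 0 ==> HS R n P i x <-> (\<exists>y. y \<sqsubset> x \<and> AR R n P i y \<and> (\<forall>z. y \<sqsubset> z \<and> z \<sqsubset> x --> (\<forall>j\<in>{..n}. R i j --> \<not> P j z)))"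
  by (subst HS.simps) (simp add: AR_def)

lemma HS_start: "HS R n P i \<zero> <-> i = 0"
  by (cases "i = 0") (simp_all add: HS_zero HS_pos)

text \<open>Recovers the usual recursion in time from the recursion on nodes: stay while no
  successor has a proof, or move.\<close>

lemma HS_succ: "HS R n P i (y \<oplus> \<one>) <-> (HS R n P i y \<and> (\<forall>j\<in>{..n}. R i j --> \<not> P j y)) \<or> AR R n P i y"
proof -
  have le: "z \<sqsubset> y \<oplus> \<one> <-> z = y \<or> z \<sqsubset> y" for z unfolding less_succ M.le_less by blast
  show ?thesis
  proof (cases "i = 0")
    case True
    have "\<not> AR R n P 0 y" by (simp add: AR_def)
    then show ?thesis unfolding True HS_zero le by blast
  next
    case False
    have irr: "\<not> y \<sqsubset> y" by simp
    have asym: "\<not> (y \<sqsubset> z \<and> z \<sqsubset> y)" for z using M.less_asym by blast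
    show ?thesis unfolding HS_pos[OF False] le using irr asym by blast
  qed
qed

lemma Dfn_HS:
  assumes "\<And>j. Dfn (%e. P j (e 0))" "dft t"
  shows "Dfn (%e. HS R n P i (t e))"
proof -
  have P: "Dfn (%e. P j (t e))" if "dft t" for j t using assms(1) that by (rule Dfn1)
  have "Dfn (%e. HS R n P i (e 0))"
  proof (induction i rule: less_induct)
    case (less i)
    have H: "Dfn (%e. HS R n P h (t e))" if "h < i" "dft t" for h t using less[OF that(1)] that(2) by (rule Dfn1)
    show ?case
    proof (cases "i = 0")
      case True
      show ?thesis unfolding True HS_zero by (intro dfn Dfn_finite_ball P finite_atMost)
    next
      case False
      show ?thesis unfolding HS_pos[OF False] AR_def
        by (intro dfn Dfn_finite_ball Dfn_finite_bex P H finite_atMost finite_lessThan) simp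
    qed
  qed
  then show ?thesis using assms(2) by (rule Dfn1)
qed

end

locale solovay = pa_model +
  fixes R :: "nat => nat => bool" and n :: nat and P :: "nat => 'a => bool"
  assumes R_less: "R i j ==> i < j \<and> j \<le> n" and R_trans: "R i j ==> R j k ==> R i k"
    and DfnP: "Dfn (%e. P j (e 0))" and P_mono: "P j x ==> x \<sqsubseteq> y ==> P j y"
begin

abbreviation "H \<equiv> HS R n P"
abbreviation "A \<equiv> AR R n P"
abbreviation "V \<equiv> VIS R n P"

lemma DfnH: "dft t ==> Dfn (%e. H i (t e))"
  by (rule Dfn_HS[OF DfnP])

lemma least_move:
  assumes "H i y" "R i j" "P j y"
  shows "\<exists>k. R i k \<and> A k y"
proof -
  define k where "k = (LEAST j. R i j \<and> P j y)"
  have k: "R i k" "P k y" unfolding k_def using LeastI[of "%j. R i j \<and> P j y" j] assms(2,3) by blast+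
  have "\<not> P j y" if "j < k" "R i j" for j using not_less_Least[of j "%j. R i j \<and> P j y"] that unfolding k_def by blast
  then have "A k y" unfolding AR_def using assms(1) k R_less[OF k(1)] by (intro bexI[of _ i]) auto
  then show ?thesis using k(1) by blast
qed

text \<open>By induction in time: moves made at the same time start from the same node, and each
  target is the least candidate.\<close>

lemma H_unique: "\<exists>i\<in>{..n}. H i y \<and> (\<forall>j. H j y --> j = i)"
proof -
  have Hn: "j \<le> n" if hj: "H j y" for j y
  proof (cases "j = 0")
    case False
    then obtain y' where "A j y'" using hj unfolding HS_pos[OF False] by blast
    then obtain h where "R h j" unfolding AR_def by blast
    then show ?thesis using R_less by blast
  qed simp
  have "\<exists>i\<in>{..n}. H i y \<and> (\<forall>j\<in>{..n}. H j y --> j = i)"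
  proof (rule ind[of "%y. \<exists>i\<in>{..n}. H i y \<and> (\<forall>j\<in>{..n}. H j y --> j = i)"])
    show "Dfn (%e. \<exists>i\<in>{..n}. H i (e 0) \<and> (\<forall>j\<in>{..n}. H j (e 0) --> j = i))"
      by (rule Dfn_finite_bex Dfn_finite_ball finite_atMost Dfn_conj Dfn_imp DfnH dft_var Dfn_const)+
    show "\<exists>i\<in>{..n}. H i \<zero> \<and> (\<forall>j\<in>{..n}. H j \<zero> --> j = i)" unfolding HS_start by auto
  next
    fix y assume "\<exists>i\<in>{..n}. H i y \<and> (\<forall>j\<in>{..n}. H j y --> j = i)"
    then obtain i where i0: "i \<in> {..n}" "H i y" "\<forall>j\<in>{..n}. H j y --> j = i" by blast
    have i: "i \<le> n" "H i y" "\<And>j. H j y ==> j = i" using i0 Hn[of _ y] by (simp_all add: Ball_def)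
    show "\<exists>i\<in>{..n}. H i (y \<oplus> \<one>) \<and> (\<forall>j\<in>{..n}. H j (y \<oplus> \<one>) --> j = i)"
    proof (cases "\<exists>j. R i j \<and> P j y")
      case False
      have "\<not> A j y" for j
      proof
        assume "A j y"
        then obtain h where "R h j" "H h y" "P j y" unfolding AR_def by blast
        then show False using i(3) False by blast
      qed
      then have "H j (y \<oplus> \<one>) <-> j = i" for j unfolding HS_succ using i False by blast
      then show ?thesis using i(1) by auto
    next
      case True
      then obtain k where k: "R i k" "A k y" using least_move i(2) by blast
      have "j = k" if "H j (y \<oplus> \<one>)" for j
      proof -
        from that[unfolded HS_succ] have "A j y" using i(3)[of j] True R_less by (auto simp: Ball_def)
        then obtain h where h: "h < j" "R h j" "H h y" "P j y" "\<forall>l\<in>{..<j}. R h l --> \<not> P l y" unfolding AR_def by blast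
        obtain h' where h': "h' < k" "R h' k" "H h' y" "P k y" "\<forall>l\<in>{..<k}. R h' l --> \<not> P l y" using k(2) unfolding AR_def by blast
        have "h = i" "h' = i" using h(3) h'(3) i(3) by blast+
        then have "\<not> j < k" "\<not> k < j" using h h' by blast+
        then show ?thesis by simp
      qed
      moreover have "H k (y \<oplus> \<one>)" unfolding HS_succ using k(2) by blast
      moreover have "k \<in> {..n}" using R_less[OF k(1)] by simp
      ultimately show ?thesis by blast
    qed
  qed
  then obtain i where "i \<in> {..n}" "H i y" "\<forall>j\<in>{..n}. H j y --> j = i" by blast
  then show ?thesis using Hn[of _ y] by (intro bexI[of _ i]) (simp_all add: Ball_def)
qed

lemma H_persists: "H i y ==> y \<sqsubseteq> y' ==> H j y' ==> j = i \<or> R i j"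
proof -
  assume i: "H i y" and le: "y \<sqsubseteq> y'" and j: "H j y'"
  obtain d where d: "y' = y \<oplus> d" using le unfolding le_def by (metis M.add_commute)
  have "\<forall>j\<in>{..n}. H j (y \<oplus> d) --> j = i \<or> R i j"
  proof (rule ind[of "%d. \<forall>j\<in>{..n}. H j (y \<oplus> d) --> j = i \<or> R i j"])
    show "Dfn (%e. \<forall>j\<in>{..n}. H j (y \<oplus> e 0) --> j = i \<or> R i j)"
      by (rule Dfn_finite_ball finite_atMost Dfn_imp DfnH dft_add dft_var dft_const Dfn_const)+
    show "\<forall>j\<in>{..n}. H j (y \<oplus> \<zero>) --> j = i \<or> R i j" using H_unique[of y] i unfolding add_zero by blast
  next
    fix d assume IH: "\<forall>j\<in>{..n}. H j (y \<oplus> d) --> j = i \<or> R i j"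
    have IH: "j = i \<or> R i j" if "H j (y \<oplus> d)" for j using IH H_unique[of "y \<oplus> d"] that by blast
    have "j = i \<or> R i j" if "H j ((y \<oplus> d) \<oplus> \<one>)" for j
      using that unfolding HS_succ
    proof
      assume "A j (y \<oplus> d)"
      then obtain h where "R h j" "H h (y \<oplus> d)" unfolding AR_def by blast
      then show ?thesis using IH R_trans by blast
    qed (use IH in blast)
    then show "\<forall>j\<in>{..n}. H j (y \<oplus> (d \<oplus> \<one>)) --> j = i \<or> R i j" by (simp add: add_succ)
  qed
  then show ?thesis using j H_unique[of y'] unfolding d by blast
qed

lemma V_H: "V i ==> \<exists>y. H i y"
  unfolding VIS_def using HS_start HS_succ by blast

lemma H_V: "H i y ==> V i"
  unfolding VIS_def by (cases "i = 0") (auto simp: HS_pos)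

lemma V_chain: "V i ==> V j ==> i = j \<or> R i j \<or> R j i"
proof -
  assume "V i" "V j"
  then obtain y y' where "H i y" "H j y'" using V_H by blast
  then show ?thesis using H_persists[of i y y' j] H_persists[of j y' y i] M.linear[of y y'] by auto
qed

lemma V_P: "V j ==> j ~= 0 ==> \<exists>y. P j y"
  unfolding VIS_def AR_def by blast

text \<open>As \<open>P\<close> is monotone, the proof for \<open>j\<close> still counts at the time
  \<open>y + x\<close>. By then the function has left \<open>i\<close> for a successor, or it moves
  to one at that moment.\<close>

lemma V_moves:
  assumes "V i" "R i j" "P j x"
  shows "\<exists>k. R i k \<and> V k"
proof -
  obtain y where y: "H i y" using V_H assms(1) by blast
  define m where "m = y \<oplus> x"
  have m: "y \<sqsubseteq> m" "x \<sqsubseteq> m" using add_le_left[of y \<zero> x] add_le_right[of \<zero> x y] by (simp_all add: m_def)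
  obtain k where k: "H k m" using H_unique by blast
  show ?thesis
  proof (cases "k = i")
    case True
    then obtain l where "R i l" "A l m" using least_move k assms(2) P_mono[OF assms(3) m(2)] by blast
    then show ?thesis unfolding VIS_def by blast
  next
    case False
    then show ?thesis using H_persists[OF y m(1) k] H_V k by blast
  qed
qed

lemma V_le: "V i ==> i \<le> n"
  unfolding VIS_def AR_def using R_less by auto

text \<open>There are only finitely many nodes in the standard sense, so the greatest visited one
  among \<open>i\<close> and its successors exists, even if the times are nonstandard.\<close>

lemma V_limit:
  assumes "V i"
  shows "\<exists>k. (k = i \<or> R i k) \<and> V k \<and> (\<forall>j. R k j --> \<not> V j)"
proof -
  have "finite {k. (k = i \<or> R i k) \<and> V k}" by (rule finite_subset[of _ "{..n}"]) (use V_le in auto)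
  moreover have "i \<in> {k. (k = i \<or> R i k) \<and> V k}" using assms by simp
  ultimately obtain k where k: "k \<in> {k. (k = i \<or> R i k) \<and> V k}" "\<And>j. j \<in> {k. (k = i \<or> R i k) \<and> V k} ==> j \<le> k"
    by (metis (no_types, lifting) Max_ge Max_in empty_iff)
  have "\<not> V j" if "R k j" for j
  proof
    assume "V j"
    then have "j \<le> k" using k that R_trans by blast
    then show False using R_less[OF that] by simp
  qed
  then show ?thesis using k(1) by blast
qed

end

section \<open>Diagonalization: the limit sentences\<close>

primrec un :: "nat => tm" where
  "un 0 = Zero"
| "un (Suc m) = Plus (un m) One"

primrec exs :: "nat => nat => fm => fm" where
  "exs k 0 F = F"
| "exs k (Suc m) F = Ex (k + m) (exs k m F)"

lemma tm_vars_un [simp]: "tm_vars (un m) = {}"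
  by (induction m) simp_all

lemma free_vars_exs: "free_vars (exs k m F) = free_vars F - {k..<k + m}"
proof (induction m)
  case (Suc m)
  have k: "{k..<k + Suc m} = insert (k + m) {k..<k + m}" by (simp add: atLeastLessThanSuc)
  show ?case unfolding exs.simps Ex_def free_vars.simps Suc k by blast
qed simp

text \<open>
  The sentence \<open>L_sent R n i\<close> says that \<open>i\<close> is the limit of the Solovay function which reads proofs of
  the negations of these same sentences.  They are obtained by diagonalization: \<open>Theta\<close> computes
  the codes of all \<open>Neg (L_sent R n j)\<close> from its own code \<open>x\<^sub>0\<close>, and \<open>x\<^sub>2\<close> is the index \<open>i\<close>.
\<close>

definition L_pat :: "nat => pat" where
  "L_pat j = (let x0 = PMeta (const (tm_string (Var 0))); x2 = PMeta (const (tm_string (Var 2))) in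
    PNeg (PAll x2 (PImp (PEq x2 (PMeta (const (tm_string (un j)))))
      (PAll x0 (PImp (PEq x0 (PMeta (Var 1))) (PMeta (Var 0)))))))"

text \<open>Variable 1 holds the code of the numeral of variable 0, which \<open>Num_fm\<close>
  computes. Variables 3 to \<open>n + 3\<close> hold the codes of all negated limit sentences, as
  the function reads proofs of each of them; \<open>min\<close> keeps every index within this
  block.\<close>

definition Theta :: "(nat => nat => bool) => nat => fm" where
  "Theta R n = Ex 1 (exs 3 (Suc n) (conjs
    [Num_fm, conjs (map (%j. pat_fm (L_pat j) (n + 4) (Var (3 + j))) [0..<Suc n]),
     disjs (map (%i. Con (Eq (Var 2) (un i)) (L_fm (%j. Var (3 + min j n)) R n (n + 4) i)) [0..<Suc n])]))"

text \<open>The code of \<open>Theta\<close> enters through a premise that equates variable 0 with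
  its numeral, not through substitution. So the code of the sentence is built from those of
  \<open>Theta\<close> and of the numeral by mere node formation, as in \<open>L_pat\<close>. The
  \<open>min\<close> repeats the last sentence beyond \<open>n\<close>, in step with
  \<open>Theta\<close>.\<close>

definition L_sent :: "(nat => nat => bool) => nat => nat => fm" where
  "L_sent R n i = All 2 (Imp (Eq (Var 2) (un (min i n)))
    (All 0 (Imp (Eq (Var 0) (un (goedel_number (Theta R n)))) (Theta R n))))"

text \<open>\<open>bdd\<close> does not cover the unbounded quantifiers of \<open>Num_fm\<close> and
  \<open>E_fm\<close>; for these only the free variables are tracked.\<close>

definition below :: "nat => fm => bool" where
  "below k F <-> free_vars F \<subseteq> {..<k}"

lemma below_bdd: "bdd k F ==> below k F"
  unfolding below_def using bdd_free_vars by blast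

lemma below_quantifiers: "m = k ==> below (Suc k) F ==> below m (Ex k F)" "m = k ==> below (Suc k) F ==> below m (All k F)"
  by (auto simp: below_def Ex_def less_Suc_eq)

lemma below_connectives: "below k F ==> below k (Neg F)" "below k F ==> below k G ==> below k (Imp F G)"
  "below k F ==> below k G ==> below k (Con F G)" "below k F ==> below k G ==> below k (Dis F G)"
  by (auto simp: below_def Con_def Dis_def)

lemma below_conjs: "(\<And>F. F \<in> set Fs ==> below k F) ==> below k (conjs Fs)"
  by (induction Fs rule: conjs.induct) (auto simp: below_def Con_def)

lemma below_disjs: "(\<And>F. F \<in> set Fs ==> below k F) ==> below k (disjs Fs)"
  by (induction Fs rule: disjs.induct) (auto simp: below_def Dis_def)

lemma below_atoms: "fresh s \<le> k ==> fresh t \<le> k ==> below k (Eq s t)"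
  "fresh s \<le> k ==> fresh t \<le> k ==> m = k ==> below m (ones_fm k s t)" "fresh z \<le> k ==> \<forall>t\<in>set ts. fresh t \<le> k ==> m = k ==> below m (cats_fm k ts z)"
  "fresh s \<le> k ==> fresh t \<le> k ==> m = k ==> below m (factor_fm k s t)"
  "fresh s \<le> k ==> fresh t \<le> k ==> fresh u \<le> k ==> m = k ==> below m (item_fm k s t u)"
  "fresh s \<le> k ==> m = k ==> below m (node0_fm j k s)"
  "fresh s \<le> k ==> fresh t \<le> k ==> fresh u \<le> k ==> m = k ==> below m (node2_fm j k s t u)"
  by (auto intro!: below_bdd)

lemma below_npair: "fresh s \<le> k ==> fresh t \<le> k ==> fresh u \<le> k ==> m = k ==> below m (npair_fm k s t u)"
  unfolding npair_fm_def by (intro below_quantifiers below_connectives below_atoms) (simp_all add: le_SucI)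

lemma below_nstep: "fresh s \<le> k ==> fresh t \<le> k ==> fresh u \<le> k ==> m = k ==> below m (nstep_fm k s t u)"
  unfolding nstep_fm_def conjs.simps
  by (intro below_quantifiers below_connectives below_atoms below_npair) (simp_all add: le_SucI)

lemma below_Num_fm: "below 2 Num_fm"
  unfolding Num_fm_def conjs.simps
  by (intro below_quantifiers below_connectives below_atoms below_npair below_nstep) simp_all

lemma below_L_fm:
  assumes "\<forall>j. fresh (c j) \<le> k"
  shows "below k (L_fm c R n k i)"
proof -
  have "below (Suc k) (A_fm c R n i (Suc k) (Var k))" for i by (rule below_bdd, rule bdd_A) (use assms in \<open>auto intro: le_SucI\<close>)
  then have "below k (E_fm c R n k i)" for i unfolding E_fm_def by (cases "i = 0") (simp_all add: below_quantifiers, simp add: below_def)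
  then show ?thesis unfolding L_fm_def by (intro below_connectives below_conjs) (auto intro!: below_connectives)
qed

lemma free_vars_Theta: "free_vars (Theta R n) \<subseteq> {0, 2}"
proof -
  let ?F = "conjs [Num_fm, conjs (map (%j. pat_fm (L_pat j) (n + 4) (Var (3 + j))) [0..<Suc n]),
     disjs (map (%i. Con (Eq (Var 2) (un i)) (L_fm (%j. Var (3 + min j n)) R n (n + 4) i)) [0..<Suc n])]"
  have 1: "below (n + 4) (pat_fm (L_pat j) (n + 4) (Var (3 + j)))" if "j \<le> n" for j
    by (rule below_bdd, rule bdd_pat) (use that in \<open>auto simp: L_pat_def Let_def const_def\<close>)
  have 2: "below (n + 4) (L_fm (%j. Var (3 + min j n)) R n (n + 4) i)" for i
    by (rule below_L_fm) simp
  have 3: "below (n + 4) (Eq (Var 2) (un i))" for i by (simp add: below_def)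
  have "below (n + 4) (conjs (map (%j. pat_fm (L_pat j) (n + 4) (Var (3 + j))) [0..<Suc n]))"
    by (rule below_conjs) (use 1 in \<open>auto simp: less_Suc_eq_le simp del: upt_Suc\<close>)
  moreover have "below (n + 4) (disjs (map (%i. Con (Eq (Var 2) (un i)) (L_fm (%j. Var (3 + min j n)) R n (n + 4) i)) [0..<Suc n]))"
    by (rule below_disjs) (use 2 3 in \<open>auto intro!: below_connectives simp del: upt_Suc\<close>)
  moreover have "below (n + 4) Num_fm" using below_Num_fm by (auto simp: below_def)
  ultimately have "below (n + 4) ?F" by (simp add: below_connectives)
  then have "free_vars ?F \<subseteq> {..<n + 4}" unfolding below_def .
  then show ?thesis unfolding Theta_def Ex_def free_vars.simps free_vars_exs by (auto simp del: conjs.simps)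
qed

lemma sentence_L: "sentence (L_sent R n i)"
  using free_vars_Theta[of R n] by (auto simp: sentence_def L_sent_def)

context pa_model
begin

lemma tval_un: "tval e (un m) = M.of_nat m"
  by (induction m) (simp_all only: un.simps tval.simps M.of_nat_0 M.of_nat_Suc M.add_commute)

text \<open>\<open>un\<close> follows the recursion of \<open>num\<close>, unlike the efficient
  numerals. Therefore the numeral written into \<open>L_sent\<close> is the one whose code
  \<open>Num_fm\<close> describes.\<close>

lemma ct_un: "ct \<rho> (un m) = num (M.of_nat m)"
  by (induction m) (simp_all only: un.simps ct.simps M.of_nat_0 M.of_nat_Suc num_zero num_succ M.add_commute[of \<one>])

lemma of_nat_inj: "M.of_nat i = M.of_nat j <-> i = j"
proof -
  have "M.of_nat (Suc m) ~= \<zero>" for m by (simp only: M.of_nat_Suc M.add_commute[of \<one>] succ_not_zero not_False_eq_True)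
  then have "M.of_nat i = M.of_nat j ==> i = j"
  proof (induction i arbitrary: j)
    case 0
    then show ?case by (cases j) (simp_all only: M.of_nat_0, metis)
  next
    case (Suc i)
    then show ?case by (cases j) (simp_all only: M.of_nat_0 M.of_nat_Suc M.add_commute[of \<one>] succ_inj succ_not_zero, metis)
  qed
  then show ?thesis by blast
qed

lemma sat_exs: "sat e (exs k m F) <-> (\<exists>d. (\<forall>x. x \<notin> {k..<k + m} --> d x = e x) \<and> sat d F)"
proof (induction m arbitrary: e)
  case 0
  have "(\<forall>x. d x = e x) <-> d = e" for d :: "nat => 'a" by (simp add: fun_eq_iff)
  then show ?case by simp
next
  case (Suc m)
  have "(\<exists>a. \<forall>x. x \<notin> {k..<k + m} --> d x = (e(k + m := a)) x) <-> (\<forall>x. x \<notin> {k..<k + Suc m} --> d x = e x)" for d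
  proof
    assume "\<forall>x. x \<notin> {k..<k + Suc m} --> d x = e x"
    then show "\<exists>a. \<forall>x. x \<notin> {k..<k + m} --> d x = (e(k + m := a)) x" by (intro exI[of _ "d (k + m)"]) (auto simp: less_Suc_eq)
  next
    assume "\<exists>a. \<forall>x. x \<notin> {k..<k + m} --> d x = (e(k + m := a)) x"
    then obtain a where a: "d x = (e(k + m := a)) x" if "x \<notin> {k..<k + m}" for x by blast
    have "d x = e x" if "x \<notin> {k..<k + Suc m}" for x
    proof -
      have "x \<notin> {k..<k + m}" "x ~= k + m" using that by auto
      then show ?thesis using a[of x] by (simp only: fun_upd_apply if_False not_False_eq_True simp_thms)
    qed
    then show "\<forall>x. x \<notin> {k..<k + Suc m} --> d x = e x" by blast
  qed
  then show ?case unfolding exs.simps sat_Ex Suc by blast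
qed

definition PB :: "'a => 'a => bool" where
  "PB c x <-> (\<exists>y. y \<sqsubseteq> x \<and> y ~= \<zero> \<and> c ~= \<zero> \<and> PRF (pr y) (pr c))"

lemma sat_P: "fresh (c j) \<le> k ==> fresh x \<le> k ==> sat e (P_fm c j k x) <-> PB (tval e (c j)) (tval e x)"
  unfolding P_fm_def PB_def sat_BEx by (subst sat_prf) (simp_all add: le_SucI)

lemma sat_A_step:
  assumes "\<And>h. h < i ==> sat e (H_fm c R n h k x) <-> HS R n (%j. PB (tval e (c j))) h (tval e x)"
    and "\<forall>j. fresh (c j) \<le> k" "fresh x \<le> k"
  shows "sat e (A_fm c R n i k x) <-> AR R n (%j. PB (tval e (c j))) i (tval e x)"
  unfolding A_fm_def AR_def sat_disjs using assms by (auto simp: sat_conjs sat_P)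

lemma sat_H:
  assumes "\<forall>j. fresh (c j) \<le> k" "fresh x \<le> k"
  shows "sat e (H_fm c R n i k x) <-> HS R n (%j. PB (tval e (c j))) i (tval e x)"
  using assms
proof (induction i arbitrary: k x e rule: less_induct)
  case (less i)
  have c: "fresh (c j) \<le> k" "fresh (c j) \<le> Suc k" "fresh (c j) \<le> Suc (Suc k)" for j using less.prems(1) by (simp_all add: le_SucI)
  have H: "sat (e(k := y)) (H_fm c R n h (Suc k) (Var k)) <-> HS R n (%j. PB (tval e (c j))) h y" if "h < i" for h y
    by (subst less.IH[OF that]) (use c in simp_all)
  have conj: "sat d (conjs (map (%j. Neg (P_fm c j l t)) (filter (R h) [0..<m]))) <->
      (\<forall>j\<in>{..<m}. R h j --> \<not> PB (tval d (c j)) (tval d t))" if "\<forall>j. fresh (c j) \<le> l" "fresh t \<le> l" for d l t m h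
    unfolding sat_conjs using that by (auto simp: sat_P)
  have lt: "y \<sqsubseteq> z \<and> (y ~= z \<and> Q) <-> y \<sqsubset> z \<and> Q" for y z Q using M.less_le by blast
  show ?case
  proof (cases "i = 0")
    case True
    show ?thesis unfolding True
      by (subst H_fm.simps, subst HS.simps) (simp add: less.prems sat_BAll conj c M.less_le lessThan_Suc_atMost le_SucI del: upt_Suc; blast)
  next
    case False
    have z: "sat (e(k := y)) (BAll (Suc k) x (%z k'. Dis (Eq z x) (Dis (BEx k' (Var k) (%w k. Eq w z))
         (conjs (map (%j. Neg (P_fm c j k' z)) (filter (R i) [0..<Suc n])))))) <->
      (\<forall>z. y \<sqsubset> z \<and> z \<sqsubset> tval e x --> (\<forall>j\<in>{..n}. R i j --> \<not> PB (tval e (c j)) z))" for y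
    proof -
      have "y \<sqsubset> z <-> \<not> z \<sqsubseteq> y" for z using M.not_le by blast
      then show ?thesis using less.prems(2) c by (simp add: sat_BAll sat_BEx conj M.less_le[of _ "tval e x"] lessThan_Suc_atMost le_SucI del: upt_Suc; blast)
    qed
    have d: "sat (e(k := y)) (A_fm c R n i (Suc k) (Var k)) <-> AR R n (%j. PB (tval e (c j))) i y" for y
      by (subst sat_A_step) (use H c in simp_all)
    show ?thesis
      unfolding H_fm.simps[of c R n i] A_fm_def[symmetric] if_not_P[OF False] sat_BEx[OF less.prems(2)] sat_Con z d HS_pos[OF False]
      using less.prems(2) by (simp add: M.less_le conj_assoc)
  qed
qed

lemma sat_A: "\<forall>j. fresh (c j) \<le> k ==> fresh x \<le> k ==> sat e (A_fm c R n i k x) <-> AR R n (%j. PB (tval e (c j))) i (tval e x)"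
  using sat_A_step sat_H by blast

definition LMT :: "(nat => nat => bool) => nat => (nat => 'a => bool) => nat => bool" where
  "LMT R n P i <-> VIS R n P i \<and> (\<forall>j\<in>{..n}. R i j --> \<not> VIS R n P j)"

lemma sat_E:
  assumes "\<forall>j. fresh (c j) \<le> k"
  shows "sat e (E_fm c R n k i) <-> VIS R n (%j. PB (tval e (c j))) i"
proof -
  have "sat (e(k := y)) (A_fm c R n i (Suc k) (Var k)) <-> AR R n (%j. PB (tval e (c j))) i y" for y
    by (subst sat_A) (use assms in \<open>simp_all add: le_SucI\<close>)
  then show ?thesis by (cases "i = 0") (simp_all add: E_fm_def VIS_def sat_Ex)
qed

lemma sat_L: "\<forall>j. fresh (c j) \<le> k ==> sat e (L_fm c R n k i) <-> LMT R n (%j. PB (tval e (c j))) i"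
  unfolding L_fm_def LMT_def sat_Con sat_conjs by (auto simp: sat_E simp del: upt_Suc)

lemma pv_L_pat:
  assumes "e 0 = S (cf vr (Theta R n))" "pr (e 1) = num (e 0)" "j \<le> n"
  shows "pv e (L_pat j) = cf vr (Neg (L_sent R n j))"
proof -
  have "ct \<rho> (un (goedel_number (Theta R n))) = pr (e 1)" for \<rho>
    unfolding assms(2) ct_un goedel_number_def of_nat_code bs_fm_string assms(1) ..
  moreover have "vr(x := vr x) = vr" for x by simp
  moreover have "ct vr (un j) = ct \<rho> (un j)" for \<rho> unfolding ct_un ..
  moreover have "bs (tm_string (Var x)) = vr x" for x by (simp only: bs_tm_string ct.simps)
  ultimately show ?thesis using assms(1,3) by (simp add: L_pat_def Let_def L_sent_def bs_tm_string[of "un j"] del: tm_string.simps)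
qed

definition PL :: "(nat => nat => bool) => nat => nat => 'a => bool" where
  "PL R n j = PB (S (cf vr (Neg (L_sent R n j))))"

lemma sat_Theta:
  assumes "e 0 = S (cf vr (Theta R n))" "e 2 = M.of_nat i" "i \<le> n"
  shows "sat e (Theta R n) <-> LMT R n (PL R n) i"
proof -
  let ?c = "%j. S (cf vr (Neg (L_sent R n j)))"
  let ?F = "conjs [Num_fm, conjs (map (%j. pat_fm (L_pat j) (n + 4) (Var (3 + j))) [0..<Suc n]),
     disjs (map (%i. Con (Eq (Var 2) (un i)) (L_fm (%j. Var (3 + min j n)) R n (n + 4) i)) [0..<Suc n])]"
  have min: "L_sent R n (min j n) = L_sent R n j" for j by (simp add: L_sent_def)
  have F: "sat d ?F <-> d 1 = S (num (e 0)) \<and> (\<forall>j\<le>n. d (3 + j) = ?c j) \<and> LMT R n (PL R n) i"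
    if d: "d 0 = e 0" "d 2 = e 2" for d
  proof (cases "d 1 = S (num (e 0))")
    case True
    have d1: "d 1 ~= \<zero>" "pr (d 1) = num (d 0)" "d 0 ~= \<zero>" unfolding True d(1) assms(1) by simp_all
    have num: "sat d Num_fm" unfolding sat_Num using d1 by blast
    have pat: "sat d (pat_fm (L_pat j) (n + 4) (Var (3 + j))) <-> d (3 + j) = ?c j" if "j \<le> n" for j
    proof -
      have "sat d (pat_fm (L_pat j) (n + 4) (Var (3 + j))) <-> tval d (Var (3 + j)) ~= \<zero> \<and> pr (tval d (Var (3 + j))) = pv d (L_pat j)"
        by (rule sat_pat) (use that d1 in \<open>auto simp: L_pat_def Let_def simp del: tm_string.simps\<close>)
      moreover have "pv d (L_pat j) = cf vr (Neg (L_sent R n j))"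
        by (rule pv_L_pat) (use that d1 d assms in simp_all)
      ultimately show ?thesis by (simp only: code_eq tval.simps)
    qed
    have L: "sat d (L_fm (%j. Var (3 + min j n)) R n (n + 4) i') <-> LMT R n (PL R n) i'" if "\<forall>j\<le>n. d (3 + j) = ?c j" for i'
    proof -
      have "d (3 + min j n) = ?c j" for j using that[rule_format, of "min j n"] unfolding min by simp
      then have "(%j. PB (tval d (Var (3 + min j n)))) = PL R n" unfolding PL_def tval.simps by simp
      moreover have "\<forall>j. fresh (Var (3 + min j n)) \<le> n + 4" by simp
      ultimately show ?thesis using sat_L[of "%j. Var (3 + min j n)" "n + 4" d R n i'] by simp
    qed
    have i: "d 2 = M.of_nat i' <-> i' = i" for i' unfolding d(2) assms(2) of_nat_inj by blast
    have "(\<forall>j\<in>{0..<Suc n}. d (3 + j) = ?c j) <-> (\<forall>j\<le>n. d (3 + j) = ?c j)" by auto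
    then have 1: "sat d (conjs (map (%j. pat_fm (L_pat j) (n + 4) (Var (3 + j))) [0..<Suc n])) <-> (\<forall>j\<le>n. d (3 + j) = ?c j)"
      unfolding sat_conjs set_map set_upt ball_simps(9) using pat by auto
    show ?thesis
    proof (cases "\<forall>j\<le>n. d (3 + j) = ?c j")
      case a: True
      have "sat d (disjs (map (%i. Con (Eq (Var 2) (un i)) (L_fm (%j. Var (3 + min j n)) R n (n + 4) i)) [0..<Suc n])) <-> LMT R n (PL R n) i"
        unfolding sat_disjs set_map set_upt bex_simps(7) sat_Con L[OF a] sat.simps tval_un tval.simps i using assms(3) by auto
      then show ?thesis unfolding conjs.simps sat_Con 1 using num a True by blast
    qed (unfold conjs.simps sat_Con 1, blast)
  next
    case False
    then have "\<not> sat d Num_fm" unfolding sat_Num code_eq d(1) by blast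
    then show ?thesis unfolding conjs.simps sat_Con using False by blast
  qed
  let ?Q = "%a d. \<forall>x. x \<notin> {3..<3 + Suc n} --> d x = (e(1 := a)) x"
  have "sat e (Theta R n) <-> (\<exists>a d. ?Q a d \<and> sat d ?F)"
    unfolding Theta_def sat_Ex sat_exs by blast
  also have "\<dots> <-> LMT R n (PL R n) i"
  proof
    assume "\<exists>a d. ?Q a d \<and> sat d ?F"
    then obtain a d where d: "?Q a d" "sat d ?F" by blast
    have "d 0 = e 0" "d 2 = e 2" using d(1)[rule_format, of 0] d(1)[rule_format, of 2] by simp_all
    then show "LMT R n (PL R n) i" using F d(2) by blast
  next
    assume l: "LMT R n (PL R n) i"
    \<comment> \<open>Variable 1 and the block from 3 on get the only values that
      \<open>Num_fm\<close> and the patterns allow.\<close>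
    define d where "d x = (if x \<in> {3..<3 + Suc n} then ?c (x - 3) else (e(1 := S (num (e 0)))) x)" for x
    have "d 0 = e 0" "d 2 = e 2" "d 1 = S (num (e 0))" "\<forall>j\<le>n. d (3 + j) = ?c j" by (simp_all add: d_def)
    then have "sat d ?F" using F l by blast
    moreover have "?Q (S (num (e 0))) d" unfolding d_def by (intro allI impI) (simp only: if_False)
    ultimately show "\<exists>a d. ?Q a d \<and> sat d ?F" by blast
  qed
  finally show ?thesis .
qed

text \<open>The fixed point, as an equation about truth in every model: the function whose limit is
  meant on the right reads, through \<open>PL\<close>, proofs of the negations of these very
  sentences.\<close>

lemma sat_L_sent:
  assumes "i \<le> n"
  shows "sat e (L_sent R n i) <-> LMT R n (PL R n) i"
proof -
  let ?e = "e(2 := M.of_nat i, 0 := S (cf vr (Theta R n)))"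
  have "sat e (L_sent R n i) <-> sat ?e (Theta R n)"
    unfolding L_sent_def sat.simps tval_un tval.simps goedel_number_def of_nat_code bs_fm_string min_absorb1[OF assms]
      fun_upd_same by blast
  also have "\<dots> <-> LMT R n (PL R n) i" by (rule sat_Theta) (use assms in simp_all)
  finally show ?thesis .
qed

end

context arith_structure
begin

lemma sat_fm_subst: "tm_vars t = {} ==> sat e (fm_subst x t F) <-> sat (e(x := tval e t)) F"
proof (induction F arbitrary: e)
  case (Eq r s)
  have "tval e (tm_subst x t u) = tval (e(x := tval e t)) u" for u by (induction u) auto
  then show ?case by (simp only: fm_subst.simps sat.simps)
next
  case (All y F)
  show ?case
  proof (cases "y = x")
    case False
    have t: "tval (e(y := a)) t = tval e t" for a by (rule tval_cong) (use All.prems in simp)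
    show ?thesis using False by (simp only: fm_subst.simps if_False sat.simps All.IH[OF All.prems] t fun_upd_twist[OF False])
  qed (simp only: fm_subst.simps refl if_True sat.simps fun_upd_upd)
qed simp_all

end

lemma tm_vars_quot [simp]: "tm_vars (quot F) = {}"
proof -
  have "tm_vars (numeral_tm m) = {}" for m
    by (induction m rule: numeral_tm.induct) (subst numeral_tm.simps, simp)
  then show ?thesis by (simp add: quot_def)
qed

context pa_model
begin

lemma tval_quot: "tval e (quot F) = S (cf vr F)"
  by (simp only: quot_def tval_numeral goedel_number_def of_nat_code bs_fm_string)

lemma sat_box: "sat e (fm_subst 1 (quot F) Prv) <-> PRV (cf vr F)"
proof -
  have "sat (e(1 := S (cf vr F))) Prv <-> PRV (cf vr F)"
    unfolding Prv_def PRV_def by (rule sat_ExS) (simp add: sat_Prf)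
  then show ?thesis by (simp only: sat_fm_subst[OF tm_vars_quot] tval_quot)
qed

lemma PrE_sentence: "sentence F ==> PrE e F <-> PRV (cf vr F)"
  unfolding PrE_def by (subst cf_cong[of F _ vr]) (simp_all add: sentence_def)

lemma PB_PRV: "(\<exists>x. PB (S c) x) <-> PRV c"
proof
  assume "PRV c"
  then obtain x where "PRF x c" unfolding PRV_def by blast
  then have "PB (S c) (S x)" unfolding PB_def by (intro exI[of _ "S x"]) simp
  then show "\<exists>x. PB (S c) x" by blast
qed (auto simp: PB_def PRV_def)

lemma Dfn_PB: "dft c ==> dft t ==> Dfn (%e. PB (c e) (t e))"
  by (rule Dfn_formula2[of "P_fm (%_. Var 0) 0 2 (Var 1)" PB]) (simp add: sat_P)

end

section \<open>The limit sentences over a frame\<close>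

locale frame =
  fixes R :: "nat => nat => bool" and n :: nat
  assumes R_less: "R i j ==> i < j \<and> j \<le> n" and R_trans: "R i j ==> R j k ==> R i k"
    and R_root: "0 < j ==> j \<le> n ==> R 0 j"
begin

abbreviation "Ls \<equiv> L_sent R n"

abbreviation cq :: "nat => tm" where "cq j \<equiv> quot (Neg (Ls j))"

definition succs :: "nat => fm" where "succs i = disjs (map Ls (filter (R i) [0..<Suc n]))"

lemma sentence_succs: "sentence (succs i)"
proof -
  have "below 0 (succs i)" unfolding succs_def
    by (rule below_disjs) (use sentence_L in \<open>auto simp: below_def sentence_def simp del: upt_Suc\<close>)
  then show ?thesis by (simp add: below_def sentence_def)
qed

end

locale solovay_model = pa_model + frame
begin

sublocale solovay zero one add mult Dfn R n "PL R n"
proof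
  show "Dfn (%e. PL R n j (e 0))" for j unfolding PL_def by (rule Dfn_PB[of "%_. S (cf vr (Neg (Ls j)))"]) (intro dfn)+
  show "PL R n j y" if "PL R n j x" "x \<sqsubseteq> y" for j x y using that M.order_trans unfolding PL_def PB_def by blast
qed (use R_less R_trans in blast)+

abbreviation "T \<equiv> LMT R n (PL R n)"

lemma PL_PRV: "(\<exists>x. PL R n j x) <-> PRV (cf vr (Neg (Ls j)))"
  unfolding PL_def by (rule PB_PRV)

lemma T_exists: "\<exists>i\<le>n. T i"
proof -
  have "V 0" by (simp add: VIS_def)
  then obtain k where "V k" "\<forall>j. R k j --> \<not> V j" using V_limit by blast
  then show ?thesis using V_le by (auto simp: LMT_def)
qed

lemma T_unique: "T i ==> T j ==> i = j"
  unfolding LMT_def using V_chain[of i j] R_less by auto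

lemma T_consistent:
  assumes "T i" "R i j"
  shows "\<not> PRV (cf vr (Neg (Ls j)))"
proof
  assume "PRV (cf vr (Neg (Ls j)))"
  then obtain x where "PL R n j x" using PL_PRV by blast
  then obtain k where "R i k" "V k" using V_moves[of i j x] assms unfolding LMT_def by blast
  then show False using assms(1) R_less[of i k] unfolding LMT_def by auto
qed

lemma sat_Ls: "i \<le> n ==> sat e (Ls i) <-> T i"
  by (rule sat_L_sent)

lemma sat_succs: "sat e (succs i) <-> (\<exists>j. R i j \<and> T j)"
proof -
  have "j \<in> set (filter (R i) [0..<Suc n]) <-> R i j" for j using R_less by (auto simp: less_Suc_eq_le simp del: upt_Suc)
  then show ?thesis unfolding succs_def sat_disjs set_map bex_simps(7) using sat_Ls R_less by blast
qed

text \<open>With the codes quoted rather than computed by \<open>Theta\<close>, the statement that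
  \<open>i\<close> is visited is a bounded formula behind one existential quantifier, to which
  \<open>bdd_complete\<close> can be applied.\<close>

lemma sat_V: "sat e (E_fm cq R n 0 i) <-> V i"
proof -
  have "sat e (E_fm cq R n 0 i) <-> VIS R n (%j. PB (tval e (cq j))) i" by (rule sat_E) simp
  then show ?thesis unfolding tval_quot PL_def[symmetric] .
qed

lemma V_refutes: "V i ==> i ~= 0 ==> PRV (cf vr (Neg (Ls i)))"
  using V_P[of i] PL_PRV by blast

end

context frame
begin

text \<open>True in every model by \<open>V_limit\<close>, hence provable. It leads from the
  existential statement that \<open>i\<close> is visited to the limit sentences.\<close>

lemma PA_V: "PA_provable (Imp (E_fm cq R n 0 i) (Dis (Ls i) (succs i)))"
proof (rule PA_complete)
  fix zero one :: nat and add mult Dfn e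
  assume "pa_model zero one add mult Dfn"
  then interpret M: pa_model zero one add mult Dfn .
  interpret solovay_model zero one add mult Dfn R n ..
  show "M.sat e (Imp (E_fm cq R n 0 i) (Dis (Ls i) (succs i)))"
  proof (cases "V i")
    case True
    then obtain k where k: "k = i \<or> R i k" "V k" "\<forall>j. R k j --> \<not> V j" using V_limit by blast
    then have "T k" by (simp add: M.LMT_def)
    then show ?thesis using k V_le[OF True] by (auto simp: sat_Ls sat_succs)
  qed (simp add: sat_V)
qed

lemma sentence_V: "sentence (Imp (E_fm cq R n 0 i) (Dis (Ls i) (succs i)))"
proof -
  have "below (Suc 0) (A_fm cq R n i (Suc 0) (Var 0))" by (rule below_bdd, rule bdd_A) simp_all
  then have "free_vars (E_fm cq R n 0 i) = {}" by (auto simp: E_fm_def Ex_def below_def)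
  then show ?thesis using sentence_L sentence_succs by (simp add: sentence_def Dis_def)
qed

end

context solovay_model
begin

lemma T_proves:
  assumes "T i" "i ~= 0"
  shows "PRV (cf vr (succs i))"
proof -
  fix e
  have V: "V i" using assms(1) by (simp add: LMT_def)
  then have "sat e (E_fm cq R n 0 i)" by (simp add: sat_V)
  \<comment> \<open>The time \<open>y\<close> of the move may be nonstandard; the truth of the
    bounded formula gives its provability for the numeral of \<open>y\<close>.\<close>
  then obtain y where "sat (e(0 := y)) (A_fm cq R n i (Suc 0) (Var 0))" using assms(2) by (auto simp: E_fm_def sat_Ex simp del: fun_upd_apply)
  then have "PrE (e(0 := y)) (A_fm cq R n i (Suc 0) (Var 0))"
    using bdd_complete[OF bdd_A[of cq "Suc 0" "Var 0" R n i], of "e(0 := y)"] by (simp del: fun_upd_apply)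
  then have 1: "PrE e (E_fm cq R n 0 i)" unfolding E_fm_def using assms(2) PrE_Ex by (simp del: fun_upd_apply)
  have 2: "PrE e (Imp (E_fm cq R n 0 i) (Dis (Ls i) (succs i)))"
    by (rule PrE_PA[OF PA_V]) (use sentence_V in \<open>simp add: sentence_def\<close>)
  have 3: "PrE e (Neg (Ls i))" using V_refutes[OF V assms(2)] sentence_L by (simp add: PrE_sentence sentence_def)
  have "PrE e (succs i)"
    by (rule PrE_taut[of "[E_fm cq R n 0 i, Imp (E_fm cq R n 0 i) (Dis (Ls i) (succs i)), Neg (Ls i)]"])
      (use 1 2 3 in \<open>auto simp: Dis_def\<close>)
  then show ?thesis by (simp add: PrE_sentence sentence_succs)
qed

end

section \<open>Arithmetical interpretation of Kripke frames\<close>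

primrec forces :: "(nat => nat => bool) => (nat => nat => bool) => nat => mform => bool" where
  "forces R v i (MVar p) <-> v i p"
| "forces R v i MTop <-> True"
| "forces R v i MBot <-> False"
| "forces R v i (MNeg A) <-> \<not> forces R v i A"
| "forces R v i (MAnd A B) <-> forces R v i A \<and> forces R v i B"
| "forces R v i (MOr A B) <-> forces R v i A \<or> forces R v i B"
| "forces R v i (MImp A B) <-> (forces R v i A --> forces R v i B)"
| "forces R v i (MBox A) <-> (\<forall>j. R i j --> forces R v j A)"

primrec arith :: "(nat => fm) => mform => fm" where
  "arith g (MVar p) = g p"
| "arith g MTop = Eq Zero Zero"
| "arith g MBot = Eq Zero One"
| "arith g (MNeg A) = Neg (arith g A)"
| "arith g (MAnd A B) = Con (arith g A) (arith g B)"
| "arith g (MOr A B) = Dis (arith g A) (arith g B)"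
| "arith g (MImp A B) = Imp (arith g A) (arith g B)"
| "arith g (MBox A) = fm_subst 1 (quot (arith g A)) Prv"

lemma free_vars_box: "free_vars (fm_subst 1 (quot F) Prv) = {}"
proof -
  have t: "tm_vars (tm_subst x (quot F) s) = tm_vars s - {x}" for x s by (induction s) auto
  have "free_vars (fm_subst x (quot F) G) = free_vars G - {x}" for x G by (induction G) (auto simp: t)
  moreover have "below 2 Prf" unfolding Prf_def by (rule below_bdd, rule bdd_prf) simp_all
  then have "free_vars Prv \<subseteq> {1}" by (auto simp: Prv_def Ex_def below_def)
  ultimately show ?thesis by auto
qed

lemma arith_evaluation: "(\<And>p. sentence (g p)) ==> arithmetical_evaluation (arith g)"
proof -
  assume g: "\<And>p. sentence (g p)"
  have "sentence (arith g A)" for A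
    by (induction A) (use g free_vars_box in \<open>simp_all add: sentence_def Con_def Dis_def\<close>)
  then show ?thesis by (simp add: arithmetical_evaluation_def)
qed

context frame
begin

definition val_fm :: "(nat => nat => bool) => nat => fm" where
  "val_fm v p = disjs (map Ls (filter (%i. v i p) [1..<Suc n]))"

lemma sentence_val: "sentence (val_fm v p)"
proof -
  have "below 0 (val_fm v p)" unfolding val_fm_def
    by (rule below_disjs) (use sentence_L in \<open>auto simp: below_def sentence_def simp del: upt_Suc\<close>)
  then show ?thesis by (simp add: below_def sentence_def)
qed

end

context solovay_model
begin

lemma PRV_PA: "PA_provable (Imp F G) ==> PRV (cf vr F) ==> PRV (cf vr G)"
  using PRV_mp[of "cf vr F" "cf vr G"] PRV_provable[of "Imp F G"] by simp

text \<open>For Boolean connectives truth in the model is enough. The body of a box, however, is not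
  evaluated in the model but proved in it, so there the hypothesis is needed as a theorem of PA,
  which \<open>PRV_PA\<close> carries into the provability predicate.\<close>

lemma truth_step:
  assumes i: "T i" "0 < i" "i \<le> n"
    and IH: "\<And>B j e. R i j ==> \<phi> = MBox B ==> PA_provable (Imp (Ls j) (if forces R v j B then arith (val_fm v) B else Neg (arith (val_fm v) B)))"
    and IH_succs: "\<And>B. \<phi> = MBox B ==> forces R v i \<phi> ==> PA_provable (Imp (succs i) (arith (val_fm v) B))"
    and sub: "\<And>B C. \<phi> \<in> {MNeg B, MAnd B C, MOr B C, MImp B C} ==> (sat e (arith (val_fm v) B) <-> forces R v i B)"
    "\<And>B C. \<phi> \<in> {MAnd B C, MOr B C, MImp B C} ==> (sat e (arith (val_fm v) C) <-> forces R v i C)"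
  shows "sat e (arith (val_fm v) \<phi>) <-> forces R v i \<phi>"
proof (cases \<phi>)
  case (MVar p)
  have "sat e (val_fm v p) <-> (\<exists>j\<in>set (filter (%i. v i p) [1..<Suc n]). T j)"
    unfolding val_fm_def sat_disjs set_map bex_simps(7) using sat_Ls by auto
  also have "\<dots> <-> v i p"
  proof -
    have mem: "j \<in> set (filter (%i. v i p) [1..<Suc n]) <-> v j p \<and> 0 < j \<and> j \<le> n" for j
      by (auto simp: less_Suc_eq_le simp del: upt_Suc)
    show ?thesis unfolding Bex_def mem using i T_unique[OF i(1)] by blast
  qed
  finally show ?thesis by (simp add: MVar)
next
  case (MBox B)
  show ?thesis
  proof (cases "forces R v i \<phi>")
    case True
    then have "PRV (cf vr (arith (val_fm v) B))" using PRV_PA[OF IH_succs[OF MBox] T_proves[OF i(1)]] i(2) by simp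
    then show ?thesis using True unfolding MBox arith.simps sat_box by simp
  next
    case False
    then obtain j where j: "R i j" "\<not> forces R v j B" by (auto simp: MBox)
    let ?B = "arith (val_fm v) B"
    have "PA_provable (Imp ?B (Neg (Ls j)))"
      by (rule PA.taut_from[of "[Imp (Ls j) (Neg ?B)]"]) (use IH[OF j(1) MBox] j(2) in \<open>auto simp: PA.val_simps\<close>)
    then have "\<not> PRV (cf vr ?B)" using PRV_PA T_consistent[OF i(1) j(1)] by blast
    then show ?thesis using False unfolding MBox arith.simps sat_box by simp
  qed
qed (use sub in auto)

end

context frame
begin

text \<open>The claim is about provability in PA, since under a box it is used for the provability
  predicate of a model. Each step passes to an arbitrary model and returns by completeness. The root
  is left out because \<open>T_proves\<close> needs \<open>i ~= 0\<close>.\<close>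

theorem truth_lemma:
  assumes "0 < i" "i \<le> n"
  shows "PA_provable (Imp (Ls i) (if forces R v i \<phi> then arith (val_fm v) \<phi> else Neg (arith (val_fm v) \<phi>)))"
  using assms
proof (induction \<phi> arbitrary: i rule: measure_induct_rule[of size])
  case (less \<phi>)
  have succs: "PA_provable (Imp (succs i) (arith (val_fm v) B))" if A: "\<phi> = MBox B" and f: "forces R v i \<phi>" for B
  proof (rule PA_complete)
    fix zero one :: nat and add mult Dfn e
    assume m: "pa_model zero one add mult Dfn"
    then interpret M: pa_model zero one add mult Dfn .
    interpret solovay_model zero one add mult Dfn R n ..
    have "M.sat e (arith (val_fm v) B)" if j: "R i j" "T j" for j
    proof -
      have "PA_provable (Imp (Ls j) (arith (val_fm v) B))" using less.IH[of B j] A f j R_less[OF j(1)] by simp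
      then have "M.sat e (Imp (Ls j) (arith (val_fm v) B))" using M.sat_PA[OF M.axioms] by blast
      then show ?thesis using sat_Ls[of j e] R_less[OF j(1)] j(2) by simp
    qed
    then show "M.sat e (Imp (succs i) (arith (val_fm v) B))" by (auto simp: sat_succs)
  qed
  show ?case
  proof (rule PA_complete)
    fix zero one :: nat and add mult Dfn e
    assume "pa_model zero one add mult Dfn"
    then interpret M: pa_model zero one add mult Dfn .
    interpret solovay_model zero one add mult Dfn R n ..
    show "M.sat e (Imp (Ls i) (if forces R v i \<phi> then arith (val_fm v) \<phi> else Neg (arith (val_fm v) \<phi>)))"
    proof (cases "T i")
      case True
      have sub: "M.sat e (arith (val_fm v) B) <-> forces R v i B" if "size B < size \<phi>" for B
      proof -
        have "PA_provable (Imp (Ls i) (if forces R v i B then arith (val_fm v) B else Neg (arith (val_fm v) B)))"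
          by (rule less.IH[OF that less.prems])
        then have "M.sat e (Imp (Ls i) (if forces R v i B then arith (val_fm v) B else Neg (arith (val_fm v) B)))"
          using M.sat_PA[OF M.axioms] by blast
        then show ?thesis using sat_Ls[OF less.prems(2), of e] True by (auto split: if_splits)
      qed
      have "M.sat e (arith (val_fm v) \<phi>) <-> forces R v i \<phi>"
      proof (rule truth_step[OF True less.prems])
        show "PA_provable (Imp (Ls j) (if forces R v j B then arith (val_fm v) B else Neg (arith (val_fm v) B)))"
          if "R i j" "\<phi> = MBox B" for B j
          by (rule less.IH) (use that R_less[OF that(1)] in simp_all)
        show "PA_provable (Imp (succs i) (arith (val_fm v) B))" if "\<phi> = MBox B" "forces R v i \<phi>" for B
          using that by (rule succs)
      qed (auto intro!: sub)
      then show ?thesis by auto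
    qed (use less.prems in \<open>simp add: sat_Ls\<close>)
  qed
qed

end

text \<open>A proof of the translation would yield one of \<open>Neg (Ls i)\<close>. Let
  \<open>k\<close> be the limit in the standard model: \<open>k = 0\<close> contradicts
  \<open>T_consistent\<close> for the successor \<open>i\<close> of the root, and
  \<open>k > 0\<close> makes \<open>Ls k\<close> true although its negation is provable, against
  soundness.\<close>

lemma (in frame) arithmetical_countermodel:
  assumes i: "0 < i" "i \<le> n" "\<not> forces R v i \<phi>"
    and sound: "\<And>F. N.PRV (N.cf N.vr F) ==> PA_provable F"
  shows "\<not> PA_provable (arith (val_fm v) \<phi>)"
proof
  assume A: "PA_provable (arith (val_fm v) \<phi>)"
  interpret S: solovay_model "0::nat" "Suc 0" "(+)" "(*)" "%_. True" R n ..
  fix e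
  have true: "N.sat e F" if "PA_provable F" for F using N.sat_PA[OF N.axioms] that by blast
  have "PA_provable (Neg (Ls i))"
    by (rule PA.taut_from[of "[Imp (Ls i) (Neg (arith (val_fm v) \<phi>)), arith (val_fm v) \<phi>]"])
      (use truth_lemma[OF i(1,2), of v \<phi>] i(3) A in \<open>auto simp: PA.val_simps\<close>)
  then have P: "N.PRV (N.cf N.vr (Neg (Ls i)))" by (rule N.PRV_provable)
  obtain k where k: "k \<le> n" "S.T k" using S.T_exists by blast
  show False
  proof (cases "k = 0")
    case True
    then show False using S.T_consistent[OF k(2)] R_root[OF i(1,2)] P by blast
  next
    case False
    have "N.PRV (N.cf N.vr (Neg (Ls k)))" by (rule S.V_refutes) (use k(2) False in \<open>simp_all add: N.LMT_def\<close>)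
    then have "N.sat e (Neg (Ls k))" by (intro true sound)
    then show False using k S.sat_Ls[of k e] by simp
  qed
qed

section \<open>Soundness of provability in the standard model\<close>

context pa_model
begin

lemma mk_inj:
  assumes "mk (tagM j # as) = mk (tagM i # cs)" "\<forall>a\<in>set as. sh a" "i = j ==> length cs = length as"
  shows "i = j \<and> as = cs"
  using scan_node[OF mk_ENC assms(2) mk_ENC assms(3), where q = \<zero> and r = \<zero>] assms(1) by simp

lemma sh_ct: "sh (ct vr t)" and sh_cf: "sh (cf vr F)"
  using GT_ct[OF good_vr(1)] GF_cf[OF good_vr(1)] TMH_sh FMH_sh unfolding GT_def GF_def by blast+

lemma sh_vr: "sh (vr x)"
  using VAR_sh VAR_vr by blast

lemma tag_clash: "i ~= j ==> \<forall>a\<in>set as. sh a ==> mk (tagM i # as) ~= mk (tagM j # cs)"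
  using mk_inj[of i as j cs] by blast

lemma arg_inj: "sh a ==> mk [tagM i, a] = mk [tagM i, b] <-> a = b"
  "sh a ==> sh a' ==> mk [tagM i, a, a'] = mk [tagM i, b, b'] <-> a = b \<and> a' = b'"
  using mk_inj[of i "[a]" i "[b]"] mk_inj[of i "[a, a']" i "[b, b']"] by auto

lemma vr_clash: "j ~= 0 ==> vr x ~= mk (tagM j # as)" "j ~= 0 ==> mk (tagM j # as) ~= vr x"
  using tag_clash[of 0 j "[idx x]" as] IDX_sh[OF IDX_idx] unfolding vr_def by force+

lemma ct_inj: "ct vr s = ct vr t <-> s = t"
proof -
  have "ct vr s = ct vr t ==> s = t"
  proof (induction s arbitrary: t)
    case (Plus s1 s2)
    then show ?case by (cases t) (simp_all add: tag_clash vr_clash arg_inj sh_ct)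
  next
    case (Times s1 s2)
    then show ?case by (cases t) (simp_all add: tag_clash vr_clash arg_inj sh_ct)
  next
    case (Var x) then show ?case by (cases t) (simp_all add: vr_clash)
  next
    case Zero then show ?case by (cases t) (simp_all add: vr_clash tag_clash)
  next
    case One then show ?case by (cases t) (simp_all add: vr_clash tag_clash)
  qed
  then show ?thesis by blast
qed

lemma cf_inj: "cf vr F = cf vr G <-> F = G"
proof -
  have "cf vr F = cf vr G ==> F = G"
  proof (induction F arbitrary: G)
    case (Eq s t) then show ?case by (cases G) (simp_all add: tag_clash arg_inj sh_ct ct_inj)
  next
    case (Neg F) then show ?case by (cases G) (simp_all add: tag_clash arg_inj sh_cf)
  next
    case (Imp F1 F2) then show ?case by (cases G) (simp_all add: tag_clash arg_inj sh_cf)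
  next
    case (All x F) then show ?case by (cases G) (simp_all add: tag_clash arg_inj sh_cf sh_vr)
  qed
  then show ?thesis by blast
qed

lemma cf_Imp: "cf vr F = cImp a b ==> \<exists>A B. F = Imp A B \<and> a = cf vr A \<and> b = cf vr B"
  by (cases F) (auto simp: tag_clash arg_inj sh_cf sh_ct sh_vr)

lemma fac_mk: "fac x a ==> fac x (mk [t, a])" "fac x a \<or> fac x b ==> fac x (mk [t, a, b])"
  by (erule fac_trans, rule ENC_item[OF mk_ENC], simp, simp)
    (erule disjE; (erule fac_trans, rule ENC_item[OF mk_ENC], simp, simp))

lemma ct_fac: "x \<in> tm_vars t ==> fac (vr x) (ct vr t)"
  by (induction t) (auto intro!: fac_mk)

lemma cf_fac: "x \<in> fm_vars F ==> fac (vr x) (cf vr F)"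
  by (induction F) (auto intro!: fac_mk ct_fac)

lemma WF_fac: "WF z ==> fac a z ==> WF a"
  unfolding WF_def using fac_trans by blast

text \<open>Constituents of a standard string are standard and strictly shorter, because the front
  of the node is not part of them. This permits recursion on the length.\<close>

lemma ENC_part:
  assumes "ENC (bs w) ts" "a \<in> set ts"
  shows "\<exists>w'. a = bs w' \<and> length w' < length w"
proof -
  obtain s where s: "bs w = b0 @@ (s @@ b1) @@ seps (s @@ b1) ts" using assms(1) unfolding ENC_def by blast
  have "a \<in> set ts ==> fac a (seps r ts)" for r by (induction ts) (auto intro: fac_left fac_catI)
  then obtain p q where "bs w = (b0 @@ (s @@ b1) @@ p) @@ a @@ q" using assms(2) s unfolding fac_def by (metis cat_assoc)
  then obtain u w2 where u: "w = u @ w2" "b0 @@ (s @@ b1) @@ p = bs u" "a @@ q = bs w2" using bs_split by blast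
  obtain w' w3 where w': "w2 = w' @ w3" "a = bs w'" using bs_split[of w2 a q] u(3) by metis
  have "u ~= []" using u(2) by (cases u) auto
  then show ?thesis using u(1) w' by (intro exI[of _ w']) simp
qed

end

text \<open>Induction for arbitrary predicates makes every element a standard string, so that codes
  can be decoded and \<open>PRV\<close> can be read as actual provability.\<close>

locale full_model = pa_model +
  assumes full: "Dfn \<Phi>"
begin

lemma bs_surj: "\<exists>w. a = bs w"
proof (rule string_ind[OF full, of "%a. \<exists>w. a = bs w"])
  show "\<exists>w. \<zero> = bs w" by (rule exI[of _ "[]"]) simp
next
  fix a assume "\<exists>w. a = bs w"
  then obtain w where "a = bs w" by blast
  then have "a @@ b0 = bs (w @ [False])" "a @@ b1 = bs (w @ [True])" by simp_all
  then show "\<exists>w. a @@ b0 = bs w" "\<exists>w. a @@ b1 = bs w" by blast+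
qed

lemma VAR_real: "VAR x ==> \<exists>n. x = vr n"
proof -
  assume "VAR x"
  then obtain s where s: "ONE s" "ENC x [tagM 0, b0 @@ (s @@ b1) @@ b0]" unfolding VAR_def IDX_def by blast
  obtain w where w: "s = bs w" using bs_surj by blast
  have "ONE (bs w) ==> bs w = bs (ones (length w))"
  proof (induction w)
    case (Cons b w) then show ?case by (cases b) simp_all
  qed simp
  then have "b0 @@ (s @@ b1) @@ b0 = idx (length w)"
    using s(1) ONE_comm1[OF s(1)] by (simp add: w idx_def index_def)
  then show ?thesis using s(2) ENC_mk[of "[tagM 0, b0 @@ (s @@ b1) @@ b0]"] unfolding vr_def by auto
qed

text \<open>Here the condition \<open>WF\<close> on factors is enough: the constituents are shorter
  strings, and being factors they inherit it.\<close>

lemma TRM_real: "TRM a ==> \<exists>t. a = ct vr t"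
proof -
  have "TRM (bs w) ==> \<exists>t. bs w = ct vr t" for w
  proof (induction w rule: measure_induct_rule[of length])
    case (less w)
    have wf: "WF (bs w)" using less.prems by (simp add: TRM_def)
    have part: "\<exists>t. a = ct vr t" if e: "ENC (bs w) ts" "a \<in> set ts" "TMH a" for a ts
    proof -
      obtain w' where "a = bs w'" "length w' < length w" using ENC_part[OF e(1,2)] by blast
      moreover have "WF a" using WF_fac[OF wf ENC_item[OF e(1,2)]] .
      ultimately show ?thesis using less.IH[of w'] e(3) by (simp add: TRM_def)
    qed
    have binary: "\<exists>s t. a = ct vr s \<and> b = ct vr t" if e: "ENC (bs w) [tagM j, a, b]" "j = 3 \<or> j = 4" for j a b
    proof -
      have "TMH a" "TMH b" using wf e unfolding WF_def by (metis fac_refl)+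
      then show ?thesis using part[OF e(1), of a] part[OF e(1), of b] by auto
    qed
    have "TMH (bs w)" using less.prems by (simp add: TRM_def)
    then consider "VAR (bs w)" | "ENC (bs w) [tagM 1]" | "ENC (bs w) [tagM 2]" | a b where "ENC (bs w) [tagM 3, a, b]"
      | a b where "ENC (bs w) [tagM 4, a, b]" unfolding TMH_def by blast
    then show ?case
    proof cases
      case 1
      then obtain n where "bs w = vr n" using VAR_real by blast
      then show ?thesis by (intro exI[of _ "Var n"]) simp
    next
      case 2
      then show ?thesis by (intro exI[of _ Zero]) (simp add: ENC_mk)
    next
      case 3
      then show ?thesis by (intro exI[of _ One]) (simp add: ENC_mk)
    next
      case (4 a b)
      then obtain s t where "a = ct vr s" "b = ct vr t" using binary by blast
      then show ?thesis using 4 by (intro exI[of _ "Plus s t"]) (simp add: ENC_mk)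
    next
      case (5 a b)
      then obtain s t where "a = ct vr s" "b = ct vr t" using binary by blast
      then show ?thesis using 5 by (intro exI[of _ "Times s t"]) (simp add: ENC_mk)
    qed
  qed
  then show "TRM a ==> \<exists>t. a = ct vr t" using bs_surj[of a] by blast
qed

lemma FRM_real: "FRM a ==> \<exists>F. a = cf vr F"
proof -
  have "FRM (bs w) ==> \<exists>F. bs w = cf vr F" for w
  proof (induction w rule: measure_induct_rule[of length])
    case (less w)
    have wf: "WF (bs w)" using less.prems by (simp add: FRM_def)
    have part: "\<exists>F. a = cf vr F" if e: "ENC (bs w) ts" "a \<in> set ts" "FMH a" for a ts
    proof -
      obtain w' where "a = bs w'" "length w' < length w" using ENC_part[OF e(1,2)] by blast
      moreover have "WF a" using WF_fac[OF wf ENC_item[OF e(1,2)]] .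
      ultimately show ?thesis using less.IH[of w'] e(3) by (simp add: FRM_def)
    qed
    have tm: "\<exists>t. a = ct vr t" if e: "ENC (bs w) ts" "a \<in> set ts" "TMH a" for a ts
      using TRM_real[of a] WF_fac[OF wf ENC_item[OF e(1,2)]] e(3) by (simp add: TRM_def)
    have "FMH (bs w)" using less.prems by (simp add: FRM_def)
    then consider a where "ENC (bs w) [tagM 6, a]" | a b where "ENC (bs w) [tagM 5, a, b]"
      | a b where "ENC (bs w) [tagM 7, a, b]" | a b where "ENC (bs w) [tagM 8, a, b]" unfolding FMH_def by blast
    then show ?case
    proof cases
      case (1 a)
      then have "FMH a" using wf unfolding WF_def by (metis fac_refl)
      then obtain F where "a = cf vr F" using part[OF 1, of a] by auto
      then show ?thesis using 1 by (intro exI[of _ "Neg F"]) (simp add: ENC_mk)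
    next
      case (2 a b)
      then have "TMH a" "TMH b" using wf unfolding WF_def by (metis fac_refl)+
      then obtain s t where "a = ct vr s" "b = ct vr t" using tm[OF 2, of a] tm[OF 2, of b] by auto
      then show ?thesis using 2 by (intro exI[of _ "Eq s t"]) (simp add: ENC_mk)
    next
      case (3 a b)
      then have "FMH a" "FMH b" using wf unfolding WF_def by (metis fac_refl)+
      then obtain F G where "a = cf vr F" "b = cf vr G" using part[OF 3, of a] part[OF 3, of b] by auto
      then show ?thesis using 3 by (intro exI[of _ "Imp F G"]) (simp add: ENC_mk)
    next
      case (4 a b)
      then have "VAR a" "FMH b" using wf unfolding WF_def by (metis fac_refl)+
      then obtain n F where "a = vr n" "b = cf vr F" using VAR_real[of a] part[OF 4, of b] by auto
      then show ?thesis using 4 by (intro exI[of _ "All n F"]) (simp add: ENC_mk)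
    qed
  qed
  then show "FRM a ==> \<exists>F. a = cf vr F" using bs_surj[of a] by blast
qed

lemma LAX_real: "LAX u ==> \<exists>F. u = cf vr F \<and> logic_axiom F"
proof -
  have nf: "x \<notin> fm_vars F" if "\<not> fac (vr x) (cf vr F)" for x F using cf_fac that by blast
  have nt: "x \<notin> tm_vars t" if "\<not> fac (vr x) (ct vr t)" for x t using ct_fac that by blast
  have folds: "cImp (cf vr F) (cf vr G) = cf vr (Imp F G)" "cNeg (cf vr F) = cf vr (Neg F)" "cAll (vr x) (cf vr F) = cf vr (All x F)"
    "cEq (ct vr s) (ct vr t) = cf vr (Eq s t)" "cEq (vr x) (ct vr t) = cf vr (Eq (Var x) t)"
    "cPlus (ct vr s) (ct vr t) = ct vr (Plus s t)" "cTimes (ct vr s) (ct vr t) = ct vr (Times s t)" for F G x s t by simp_all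
  assume "LAX u"
  then show ?thesis unfolding LAX_def
    by (elim disjE exE conjE)
      (((drule FRM_real TRM_real VAR_real)+, elim exE, simp only: folds cf_inj simp_thms, rule logic_axiom.intros; rule nf nt, assumption)+)
qed

lemma PAX_real: "PAX u ==> \<exists>F. u = cf vr F \<and> PA_axiom F"
proof -
  assume "PAX u"
  then consider F where "F \<in> set Q_axioms" "u = bs (fm_string F)"
    | x y F where "VAR x" "VAR y" "FRM F" "x ~= y" "\<not> fac y F"
      "u = cImp (cAll x (cImp (cEq x cZero) F))
         (cImp (cAll x (cImp F (cAll y (cImp (cEq y (cPlus x cOne)) (cAll x (cImp (cEq x y) F))))))
           (cAll x F))" unfolding PAX_def by blast
  then show ?thesis
  proof cases
    case (1 F)
    then show ?thesis unfolding PA_axiom_def bs_fm_string by blast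
  next
    case (2 x y F)
    obtain m n G where m: "x = vr m" "y = vr n" "F = cf vr G" using VAR_real[OF 2(1)] VAR_real[OF 2(2)] FRM_real[OF 2(3)] by blast
    have "n \<notin> fm_vars G" using 2(5) cf_fac unfolding m by blast
    moreover have "m ~= n" using 2(4) unfolding m by blast
    moreover have "u = cf vr (induction_axiom m n G)" unfolding 2(6) m induction_axiom_def by simp
    ultimately show ?thesis unfolding PA_axiom_def by blast
  qed
qed

theorem PRV_sound:
  assumes "PRV (cf vr F)"
  shows "PA_provable F"
proof -
  have "\<exists>G. u = cf vr G \<and> PA_provable G" if "PR.DRV u" for u
  proof (rule PR.DRV_induct[OF that full])
    fix X u assume X: "\<And>w. X w ==> \<exists>G. w = cf vr G \<and> PA_provable G" and "STEP X u"
    then consider "LAX u" | "PAX u" | G H where "X G" "X H" "ENC H [tagM 7, G, u]" | G x where "VAR x" "X G" "ENC u [tagM 8, x, G]"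
      unfolding STEP_def by blast
    then show "\<exists>G. u = cf vr G \<and> PA_provable G"
    proof cases
      case 1
      then show ?thesis using LAX_real PA_ax by blast
    next
      case 2
      then show ?thesis using PAX_real PA_ax by blast
    next
      case (3 G H)
      obtain G' H' where G: "G = cf vr G'" "PA_provable G'" and H: "H = cf vr H'" "PA_provable H'" using X 3(1,2) by blast
      have "cf vr H' = cImp G u" using 3(3) H(1) by (simp add: ENC_mk)
      then obtain A B where AB: "H' = Imp A B" "G = cf vr A" "u = cf vr B" using cf_Imp by blast
      have "A = G'" using G(1) AB(2) cf_inj[of G' A] by simp
      then have "PA_provable B" using PA_MP[OF G(2), of B] H(2) AB(1) by simp
      then show ?thesis using AB(3) by blast
    next
      case (4 G x)
      obtain G' n where "G = cf vr G'" "PA_provable G'" "x = vr n" using X 4(2) VAR_real[OF 4(1)] by blast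
      then show ?thesis using 4(3) PA_Gen by (intro exI[of _ "All n G'"]) (simp add: ENC_mk)
    qed
  qed
  then obtain G where "cf vr F = cf vr G" "PA_provable G" using assms[unfolded PRV_DRV] by blast
  then show ?thesis by (simp add: cf_inj)
qed

end

interpretation N: full_model "0::nat" "Suc 0" "(+)" "(*)" "%_. True"
  by unfold_locales simp

section \<open>Kripke completeness of GL\<close>

interpretation GL: prop_calc GL MImp MNeg
proof
  fix F G H
  have m: "GL (MImp H G)" if "GL (MImp H (MImp F G))" "GL (MImp H F)" for F G H using GL.C2 GL.MP that by blast
  have w: "GL (MImp H F)" if "GL F" for F H using GL.C1 GL.MP that by blast
  have tr: "GL (MImp F H)" if "GL (MImp F G)" "GL (MImp G H)" for F G H using m[OF w[OF that(2)] that(1)] .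
  have sw: "GL (MImp G (MImp F H))" if "GL (MImp F (MImp G H))" for F G H
    using tr[OF GL.C1 GL.MP[OF that GL.C2]] .
  let ?X = "MImp (MNeg F) (MNeg G)"
  have "GL (MImp G (MImp ?X (MNeg (MNeg F))))" using tr[OF GL.C1 GL.C9] .
  then have "GL (MImp ?X (MImp G (MNeg (MNeg F))))" by (rule sw)
  moreover have "GL (MImp (MImp G (MNeg (MNeg F))) (MImp G F))" using GL.MP[OF w[OF GL.C10] GL.C2] .
  ultimately show "GL (MImp ?X (MImp G F))" by (rule tr)
qed (rule GL.C1 | rule GL.C2 | (erule (1) GL.MP))+

text \<open>Plays the part of a maximal consistent set; the connectives other than implication and
  negation are settled by the axioms, in \<open>theory_val_simps\<close>.\<close>

definition theory_val :: "(mform => bool) => bool" where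
  "theory_val v <-> GL.val v \<and> (\<forall>A. GL A --> v A)"

lemma theory_val_mp: "theory_val v ==> GL (MImp A B) ==> v A ==> v B"
  unfolding theory_val_def GL.val_def by blast

lemma theory_val_simps:
  assumes "theory_val v"
  shows "v (MNeg A) <-> \<not> v A" "v (MImp A B) <-> (v A --> v B)" "v (MAnd A B) <-> v A \<and> v B"
    "v (MOr A B) <-> v A \<or> v B" "v MTop" "\<not> v MBot"
proof -
  have v: "v (MNeg A) <-> \<not> v A" "v (MImp A B) <-> (v A --> v B)" and th: "GL A ==> v A" for A B
    using assms unfolding theory_val_def GL.val_def by blast+
  show "v (MNeg A) <-> \<not> v A" "v (MImp A B) <-> (v A --> v B)" by (rule v)+
  show "v MTop" by (rule th) (rule GL.C11)
  show bot: "\<not> v MBot" using th[OF GL.C12[of "MNeg MTop"]] \<open>v MTop\<close> v by simp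
  show "v (MAnd A B) <-> v A \<and> v B"
    using th[OF GL.C3[of A B]] th[OF GL.C4[of A B]] th[OF GL.C5[of A B]] v(2) by blast
  show "v (MOr A B) <-> v A \<or> v B"
    using th[OF GL.C6[of A B]] th[OF GL.C7[of B A]] th[OF GL.C8[of A MBot B]] v(2) bot by (simp; blast)
qed

lemma GL_taut: "(\<And>v. theory_val v ==> v A) ==> GL A"
proof (rule ccontr)
  assume v: "\<And>v. theory_val v ==> v A" and "\<not> GL A"
  then have "\<not> GL.der {} A" unfolding GL.der_def by auto
  then obtain v where "GL.val v" "\<And>G. GL.der {} G ==> v G" "\<not> v A" by (rule GL.val_exists) blast
  then show False using v[of v] GL.der_P unfolding theory_val_def by blast
qed

lemma box_mono: "GL (MImp A B) ==> GL (MImp (MBox A) (MBox B))"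
  using GL.Nec GL.K GL.MP by blast

text \<open>The standard derivation from Loeb's axiom, applied to the conjunction \<open>?D\<close>
  of \<open>MBox A\<close> and \<open>A\<close>: since \<open>MBox ?D\<close> implies
  \<open>MBox A\<close>, the formula \<open>A\<close> implies
  \<open>MImp (MBox ?D) ?D\<close>.\<close>

lemma GL_transitivity: "GL (MImp (MBox A) (MBox (MBox A)))"
proof -
  let ?D = "MAnd (MBox A) A"
  have "GL (MImp (MBox ?D) (MBox A))" by (rule box_mono) (rule GL.C4)
  then have "GL (MImp A (MImp (MBox ?D) ?D))" by (intro GL_taut) (auto simp: theory_val_simps dest: theory_val_mp)
  from box_mono[OF this] have 1: "GL (MImp (MBox A) (MBox (MImp (MBox ?D) ?D)))" .
  have 2: "GL (MImp (MBox (MImp (MBox ?D) ?D)) (MBox ?D))" by (rule GL.L)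
  have 3: "GL (MImp (MBox ?D) (MBox (MBox A)))" by (rule box_mono) (rule GL.C3)
  show ?thesis by (rule GL_taut) (use theory_val_mp[OF _ 1] theory_val_mp[OF _ 2] theory_val_mp[OF _ 3] theory_val_simps(2) in blast)
qed

text \<open>If there were no such \<open>u\<close>, then \<open>B\<close> would follow from
  \<open>MBox B\<close> and the formulas given by \<open>X\<close>; so \<open>v\<close> would
  satisfy \<open>MBox (MImp (MBox B) B)\<close> and, by Loeb's axiom, \<open>MBox B\<close>. That
  \<open>u\<close> satisfies \<open>MBox B\<close> while it refutes \<open>B\<close> makes the
  accessibility relation strict below.\<close>

lemma box_extension:
  assumes v: "theory_val v" "\<not> v (MBox B)" and X: "\<And>C. C \<in> X ==> v (MBox C)"
  obtains u where "theory_val u" "\<not> u B" "u (MBox B)" "\<And>C. C \<in> X ==> u C \<and> u (MBox C)"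
proof -
  let ?T = "insert (MBox B) (X \<union> MBox ` X)"
  have box: "v (MBox A)" if "GL (foldr MImp Gs A)" "set Gs \<subseteq> X \<union> MBox ` X" for Gs A
    using that
  proof (induction Gs arbitrary: A rule: rev_induct)
    case Nil
    then show ?case using GL.Nec v(1) by (simp add: theory_val_def)
  next
    case (snoc G Gs)
    have "v (MBox G)"
    proof (cases "G \<in> X")
      case False
      then obtain C where "G = MBox C" "C \<in> X" using snoc.prems(2) by auto
      then show ?thesis using X theory_val_mp[OF v(1) GL_transitivity] by blast
    qed (use X in blast)
    moreover have "v (MBox (MImp G A))" using snoc by simp
    ultimately show ?case using theory_val_mp[OF v(1) GL.K] theory_val_simps(2)[OF v(1)] by blast
  qed
  have "\<not> GL.der ?T B"
  proof
    assume "GL.der ?T B"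
    then have "GL.der (X \<union> MBox ` X) (MImp (MBox B) B)" by (rule GL.deduction)
    then have "v (MBox (MImp (MBox B) B))" using box unfolding GL.der_def by blast
    then show False using theory_val_mp[OF v(1) GL.L] v(2) by blast
  qed
  then obtain u where u: "GL.val u" "\<And>G. GL.der ?T G ==> u G" "\<not> u B" by (rule GL.val_exists) blast
  show thesis
  proof (rule that[of u])
    show "theory_val u" using u(1,2) GL.der_P unfolding theory_val_def by blast
    show "u (MBox B)" by (rule u(2)) (rule GL.der_in, simp)
    show "u C \<and> u (MBox C)" if "C \<in> X" for C by (intro conjI u(2) GL.der_in) (use that in auto)
  qed (rule u(3))
qed

section \<open>The finite canonical model\<close>

primrec subforms :: "mform => mform set" where
  "subforms (MVar p) = {MVar p}"
| "subforms MTop = {MTop}"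
| "subforms MBot = {MBot}"
| "subforms (MNeg A) = insert (MNeg A) (subforms A)"
| "subforms (MAnd A B) = insert (MAnd A B) (subforms A \<union> subforms B)"
| "subforms (MOr A B) = insert (MOr A B) (subforms A \<union> subforms B)"
| "subforms (MImp A B) = insert (MImp A B) (subforms A \<union> subforms B)"
| "subforms (MBox A) = insert (MBox A) (subforms A)"

lemma finite_subforms: "finite (subforms A)" and self_subforms [simp]: "A \<in> subforms A"
  by (induction A) auto

lemma subforms_trans: "B \<in> subforms A ==> C \<in> subforms B ==> C \<in> subforms A"
  by (induction A) auto

text \<open>Keeping the boxed formulas makes the relation transitive, and the gain of a new one
  makes it irreflexive.\<close>

definition above :: "mform set => mform set => bool" where
  "above w w' <-> (\<forall>B. MBox B \<in> w --> B \<in> w' \<and> MBox B \<in> w') \<and> (\<exists>B. MBox B \<in> w' - w)"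

theorem GL_countermodel:
  assumes "\<not> GL \<phi>"
  shows "\<exists>R n v i. frame R n \<and> 0 < i \<and> i \<le> n \<and> \<not> forces R v i \<phi>"
proof -
  define W where "W = {{B \<in> subforms \<phi>. v B} | v. theory_val v}"
  have "finite W" by (rule finite_subset[of _ "Pow (subforms \<phi>)"]) (auto simp: W_def finite_subforms)
  then obtain ys where ys: "set ys = W" "distinct ys" using finite_distinct_list by blast
  \<comment> \<open>Along \<open>above\<close> the set of boxed members grows strictly, so sorting
    by its size numbers the worlds in an order that extends the relation.\<close>
  define key :: "mform set => nat" where "key w = card {B. MBox B \<in> w}" for w
  define xs where "xs = sort_key key ys"
  define n where "n = length xs"
  \<comment> \<open>The world with the number \<open>i > 0\<close> is \<open>xs ! (i - 1)\<close>;
    the number 0 is left for the added root, which sees all others.\<close>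
  define R where "R i j <-> 0 < j \<and> j \<le> n \<and> (i = 0 \<or> i \<le> n \<and> above (xs ! (i - 1)) (xs ! (j - 1)))" for i j
  define val where "val i p <-> MVar p \<in> xs ! (i - 1)" for i p
  have W: "set xs = W" by (simp add: xs_def ys)
  have key: "key w < key w'" if "above w w'" "w' \<in> W" for w w'
  proof -
    have "finite (MBox -` w')" by (rule finite_vimageI[OF finite_subset[OF _ finite_subforms[of \<phi>]]]) (use that(2) in \<open>auto simp: W_def inj_on_def\<close>)
    then have "finite {B. MBox B \<in> w'}" by (simp add: vimage_def)
    moreover have "{B. MBox B \<in> w} \<subset> {B. MBox B \<in> w'}" using that(1) unfolding above_def by blast
    ultimately show ?thesis unfolding key_def by (rule psubset_card_mono)
  qed
  have in_W: "xs ! (i - 1) \<in> W" if "0 < i" "i \<le> n" for i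
    using that W nth_mem[of "i - 1" xs] unfolding n_def by auto
  have frame: "frame R n"
  proof
    show "i < j \<and> j \<le> n" if r: "R i j" for i j
    proof (cases "i = 0")
      case False
      have a: "above (xs ! (i - 1)) (xs ! (j - 1))" "0 < j" "j \<le> n" "i \<le> n" using r False by (auto simp: R_def)
      have "key (xs ! (i - 1)) < key (xs ! (j - 1))" by (rule key[OF a(1)]) (rule in_W[OF a(2,3)])
      moreover have "sorted (map key xs)" by (simp add: xs_def)
      then have "key (xs ! (j - 1)) \<le> key (xs ! (i - 1))" if "j - 1 \<le> i - 1"
        using sorted_nth_mono[of "map key xs" "j - 1" "i - 1"] that a False unfolding n_def by simp
      ultimately show ?thesis using a by linarith
    qed (use r in \<open>simp add: R_def\<close>)
    show "R i k" if "R i j" "R j k" for i j k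
      using that unfolding R_def above_def by (cases "i = 0") (simp, auto)
    show "R 0 j" if "0 < j" "j \<le> n" for j using that by (simp add: R_def)
  qed
  have W_val: "\<exists>v. theory_val v \<and> xs ! (i - 1) = {B \<in> subforms \<phi>. v B}" if "0 < i" "i \<le> n" for i
    using in_W[OF that] unfolding W_def by blast
  have truth: "forces R val i B <-> B \<in> xs ! (i - 1)" if "0 < i" "i \<le> n" "B \<in> subforms \<phi>" for i B
    using that
  proof (induction B arbitrary: i)
    case (MBox B)
    have B: "B \<in> subforms \<phi>" using subforms_trans[OF MBox.prems(3)] by simp
    obtain v where v: "theory_val v" "xs ! (i - 1) = {C \<in> subforms \<phi>. v C}" using W_val MBox.prems(1,2) by blast
    show ?case
    proof
      assume b: "MBox B \<in> xs ! (i - 1)"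
      have "forces R val j B" if "R i j" for j
      proof -
        have j: "0 < j" "j \<le> n" "above (xs ! (i - 1)) (xs ! (j - 1))" using that MBox.prems(1) by (auto simp: R_def)
        then show ?thesis using MBox.IH[OF j(1,2) B] b unfolding above_def by blast
      qed
      then show "forces R val i (MBox B)" by simp
    next
      assume f: "forces R val i (MBox B)"
      show "MBox B \<in> xs ! (i - 1)"
      proof (rule ccontr)
        assume nb: "MBox B \<notin> xs ! (i - 1)"
        then have nb': "\<not> v (MBox B)" using v(2) MBox.prems(3) by simp
        obtain u where u: "theory_val u" "\<not> u B" "u (MBox B)" "\<And>C. C \<in> {C. MBox C \<in> xs ! (i - 1)} ==> u C \<and> u (MBox C)"
          by (rule box_extension[OF v(1) nb', of "{C. MBox C \<in> xs ! (i - 1)}"]) (use v(2) in auto)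
        let ?w = "{C \<in> subforms \<phi>. u C}"
        have "?w \<in> set xs" using u(1) unfolding W W_def by blast
        then obtain m where m: "m < n" "xs ! m = ?w" unfolding n_def in_set_conv_nth by blast
        have "C \<in> subforms \<phi>" "MBox C \<in> subforms \<phi>" if "MBox C \<in> xs ! (i - 1)" for C
          using that v(2) subforms_trans[of "MBox C" \<phi> C] by auto
        then have "above (xs ! (i - 1)) ?w" unfolding above_def using u(3,4) nb MBox.prems(3) by blast
        then have "R i (Suc m)" unfolding R_def using m MBox.prems(2) by simp
        then have "forces R val (Suc m) B" using f by simp
        then show False using MBox.IH[of "Suc m"] m B u(2) by simp
      qed
    qed
  next
    case (MVar p)
    then show ?case by (simp add: val_def)
  next
    case MTop
    obtain v where v: "theory_val v" "xs ! (i - 1) = {C \<in> subforms \<phi>. v C}" using W_val MTop.prems(1,2) by blast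
    show ?case using MTop.prems v(2) theory_val_simps(5,6)[OF v(1)] by simp
  next
    case MBot
    obtain v where v: "theory_val v" "xs ! (i - 1) = {C \<in> subforms \<phi>. v C}" using W_val MBot.prems(1,2) by blast
    show ?case using MBot.prems v(2) theory_val_simps(5,6)[OF v(1)] by simp
  next
    case (MNeg B)
    have "B \<in> subforms \<phi>" using subforms_trans[OF MNeg.prems(3)] by simp
    moreover obtain v where v: "theory_val v" "xs ! (i - 1) = {C \<in> subforms \<phi>. v C}" using W_val MNeg.prems(1,2) by blast
    ultimately show ?case using MNeg v(2) theory_val_simps(1-4)[OF v(1)] by simp
  next
    case (MAnd B C)
    have "B \<in> subforms \<phi>" "C \<in> subforms \<phi>" using subforms_trans[OF MAnd.prems(3)] by simp_all
    moreover obtain v where v: "theory_val v" "xs ! (i - 1) = {C \<in> subforms \<phi>. v C}" using W_val MAnd.prems(1,2) by blast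
    ultimately show ?case using MAnd v(2) theory_val_simps(1-4)[OF v(1)] by simp
  next
    case (MOr B C)
    have "B \<in> subforms \<phi>" "C \<in> subforms \<phi>" using subforms_trans[OF MOr.prems(3)] by simp_all
    moreover obtain v where v: "theory_val v" "xs ! (i - 1) = {C \<in> subforms \<phi>. v C}" using W_val MOr.prems(1,2) by blast
    ultimately show ?case using MOr v(2) theory_val_simps(1-4)[OF v(1)] by simp
  next
    case (MImp B C)
    have "B \<in> subforms \<phi>" "C \<in> subforms \<phi>" using subforms_trans[OF MImp.prems(3)] by simp_all
    moreover obtain v where v: "theory_val v" "xs ! (i - 1) = {C \<in> subforms \<phi>. v C}" using W_val MImp.prems(1,2) by blast
    ultimately show ?case using MImp v(2) theory_val_simps(1-4)[OF v(1)] by simp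
  qed
  obtain v where v: "theory_val v" "\<not> v \<phi>" using GL_taut assms by blast
  then have "{B \<in> subforms \<phi>. v B} \<in> set xs" unfolding W W_def by blast
  then obtain m where m: "m < n" "xs ! m = {B \<in> subforms \<phi>. v B}" unfolding n_def in_set_conv_nth by blast
  then have "\<not> forces R val (Suc m) \<phi>" using truth[of "Suc m" \<phi>] v(2) by simp
  then show ?thesis using frame m(1) by (intro exI[of _ R] exI[of _ n] exI[of _ val] exI[of _ "Suc m"]) simp
qed

theorem theorem1:
  fixes \<phi> :: mform
  assumes "\<not> GL \<phi>"
  shows "\<exists>f. arithmetical_evaluation f \<and> \<not> PA_provable (f \<phi>)"
proof -
  obtain R n v i where "frame R n" and i: "0 < i" "i \<le> n" "\<not> forces R v i \<phi>" using GL_countermodel[OF assms] by blast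
  then interpret frame R n by simp
  have "\<not> PA_provable (arith (val_fm v) \<phi>)" by (rule arithmetical_countermodel[OF i]) (rule N.PRV_sound)
  moreover have "arithmetical_evaluation (arith (val_fm v))" by (rule arith_evaluation) (rule sentence_val)
  ultimately show ?thesis by blast
qed

end
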